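(* Let $\theta>0$, let $\sigma_1,\sigma_2:\mathbb{R}\to\mathbb{R}$ be globally Lipschitz continuous with $\sigma_i\ge 0$ on $\mathbb{R}$ and $\sigma_i(0)=0$ ($i=1,2$), and let $u_0,v_0\in L^1(\mathbb{R})\cap L^\infty(\mathbb{R})$ be nonrandom and nonnegative. Let $\xi$ be a space-time white noise on $\mathbb{R}_+\times\mathbb{R}$, and let $u$ and $v$ be the solutions, driven by the same noise $\xi$, to $$\frac{\partial}{\partial t}u_t(x)=\frac{\theta}{2}\frac{\partial^2}{\partial x^2}u_t(x)+\sigma_1(u_t(x))\,\xi(t,x),\qquad \frac{\partial}{\partial t}v_t(x)=\frac{\theta}{2}\frac{\partial^2}{\partial x^2}v_t(x)+\sigma_2(v_t(x))\,\xi(t,x)$$ for $t>0$, $x\in\mathbb{R}$, with initial functions $u_0$ and $v_0$ respectively. Then for all $t\ge 0$ and all $\beta>[\mathrm{Lip}(\sigma_1)\cdot\mathrm{Lip}(\sigma_2)]^2/(4\theta)$, $$\mathrm{Cov}\left(\|u_t\|_{L^1(\mathbb{R})},\|v_t\|_{L^1(\mathbb{R})}\right)\le\frac{2\sqrt{\beta\theta}\,\mathrm{Lip}(\sigma_1)\mathrm{Lip}(\sigma_2)}{2\sqrt{\beta\theta}-\mathrm{Lip}(\sigma_1)\mathrm{Lip}(\sigma_2)}\cdot e^{\beta t}\,\mathcal{E}_\beta(u_0,v_0).$$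
   Context: Space-time white noise $\xi$ is the generalized centered Gaussian random field with $\mathrm{Cov}[\xi(t,x),\xi(s,y)]=\delta_0(s-t)\delta_0(x-y)$ for $s,t\ge0$, $x,y\in\mathbb{R}$. Solution: for bounded measurable nonrandom $u_0$ and Lipschitz $\sigma$, the solution of $\partial_t u=\frac{\theta}{2}\partial_x^2u+\sigma(u)\xi$ started at $u_0$ is the mild (Walsh) solution, i.e. the unique (up to modification) predictable random field $u$, with respect to the filtration generated by $\xi$, such that $\sup_{t\in[0,T]}\sup_{x\in\mathbb{R}}\mathrm{E}(|u_t(x)|^2)<\infty$ for all $T<\infty$ and, almost surely, for all $t>0$ and $x\in\mathbb{R}$, $$u_t(x)=(p_t*u_0)(x)+\int_{(0,t)\times\mathbb{R}}p_{t-s}(x-y)\,\sigma(u_s(y))\,\xi(\mathrm{d}s\,\mathrm{d}y),$$ where the integral is a Walsh stochastic integral and $p_r(a)=(2\pi\theta r)^{-1/2}\exp(-a^2/(2\theta r))$ for $r>0$, $a\in\mathbb{R}$. The version of $u$ that is continuous on $(0,\infty)\times\mathbb{R}$ is used. $\mathrm{Lip}(\varphi):=\sup_{-\infty<a<b<\infty}|(\varphi(a)-\varphi(b))/(a-b)|$ is the optimal Lipschitz constant. For $\beta>0$: $r_\beta(x):=\frac{1}{2\sqrt{\beta\theta}}\exp(-|x|\sqrt{\beta/\theta})$ for $x\in\mathbb{R}$; $(\mathcal{R}_\beta f)(x):=(r_\beta*f)(x)$; and $\mathcal{E}_\beta(f,g):=\langle f,\mathcal{R}_\beta g\rangle_{L^2(\mathbb{R})}=\int_{\mathbb{R}}\int_{\mathbb{R}}f(x)\,r_\beta(x-y)\,g(y)\,\mathrm{d}x\,\mathrm{d}y$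 is the mutual $\beta$-energy between $f$ and $g$. *)

theory Defs
  imports "HOL-Probability.Probability"
begin

section \<open>Gaussian variables and space-time white noise\<close>

definition covariance :: "'a measure \<Rightarrow> ('a \<Rightarrow> real) \<Rightarrow> ('a \<Rightarrow> real) \<Rightarrow> real" where
  "covariance M X Y =
    (\<integral>\<omega>. (X \<omega> - (\<integral>\<omega>'. X \<omega>' \<partial>M)) * (Y \<omega> - (\<integral>\<omega>'. Y \<omega>' \<partial>M)) \<partial>M)"

text \<open>Constants count as (degenerate) Gaussian variables.\<close>

definition gaussian_rv :: "'a measure \<Rightarrow> ('a \<Rightarrow> real) \<Rightarrow> bool" where
  "gaussian_rv M X \<longleftrightarrow> X \<in> borel_measurable M \<and>
    ((\<exists>m s. 0 < s \<and> distributed M lborel X (\<lambda>x. ennreal (normal_density m s x))) \<or>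
     (\<exists>m. AE \<omega> in M. X \<omega> = m))"

text \<open>
  The generalized field is indexed by the test functions in \<open>L\<^sup>2\<close> of the half plane
  (time, space) in \<open>[0, \<infinity>) \<times> \<real>\<close>, represented by functions on the whole plane that vanish
  at negative times.
\<close>

definition noise_test :: "(real \<times> real \<Rightarrow> real) set" where
  "noise_test = {\<phi>. \<phi> \<in> borel_measurable lborel \<and> integrable lborel (\<lambda>z. (\<phi> z)\<^sup>2) \<and>
    (\<forall>z. z \<notin> {0..} \<times> UNIV \<longrightarrow> \<phi> z = 0)}"

text \<open>
  The covariance \<open>\<delta>\<^sub>0(s - t) \<delta>\<^sub>0(x - y)\<close> paired with test functions \<open>\<phi>\<close> and \<open>\<psi>\<close> is the
  integral of \<open>\<phi> \<psi>\<close>. The first clause says that the whole field is jointly Gaussian.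
\<close>

definition white_noise :: "'a measure \<Rightarrow> ((real \<times> real \<Rightarrow> real) \<Rightarrow> 'a \<Rightarrow> real) \<Rightarrow> bool" where
  "white_noise M \<xi> \<longleftrightarrow>
    (\<forall>(n::nat) (c :: nat \<Rightarrow> real) \<phi>. (\<forall>i<n. \<phi> i \<in> noise_test) \<longrightarrow>
       gaussian_rv M (\<lambda>\<omega>. \<Sum>i<n. c i * \<xi> (\<phi> i) \<omega>)) \<and>
    (\<forall>\<phi>\<in>noise_test. (\<integral>\<omega>. \<xi> \<phi> \<omega> \<partial>M) = 0) \<and>
    (\<forall>\<phi>\<in>noise_test. \<forall>\<psi>\<in>noise_test.
       covariance M (\<xi> \<phi>) (\<xi> \<psi>) = (\<integral>z. \<phi> z * \<psi> z \<partial>lborel))"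

section \<open>Filtration and predictable fields\<close>

text \<open>The filtration generated by the noise is augmented by the null sets.\<close>

definition noise_filtration ::
  "'a measure \<Rightarrow> ((real \<times> real \<Rightarrow> real) \<Rightarrow> 'a \<Rightarrow> real) \<Rightarrow> real \<Rightarrow> 'a measure" where
  "noise_filtration M \<xi> t = sigma (space M)
    ({\<xi> \<phi> -` B \<inter> space M | \<phi> B.
        \<phi> \<in> noise_test \<and> (\<forall>z. z \<notin> {0..t} \<times> UNIV \<longrightarrow> \<phi> z = 0) \<and> B \<in> sets borel}
     \<union> null_sets M)"

definition predictable_sigma ::
  "'a measure \<Rightarrow> ((real \<times> real \<Rightarrow> real) \<Rightarrow> 'a \<Rightarrow> real) \<Rightarrow> (real \<times> real \<times> 'a) measure" where
  "predictable_sigma M \<xi> = sigma ({0..} \<times> UNIV \<times> space M)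
    ({{a<..b} \<times> A \<times> G | a b A G.
        0 \<le> a \<and> a < b \<and> A \<in> sets borel \<and> G \<in> sets (noise_filtration M \<xi> a)} \<union>
     {{0} \<times> A \<times> G | A G. A \<in> sets borel \<and> G \<in> sets (noise_filtration M \<xi> 0)})"

text \<open>Random fields are written \<open>\<Phi> t x \<omega>\<close>; only times \<open>t \<ge> 0\<close> matter.\<close>

definition predictable ::
  "'a measure \<Rightarrow> ((real \<times> real \<Rightarrow> real) \<Rightarrow> 'a \<Rightarrow> real) \<Rightarrow> (real \<Rightarrow> real \<Rightarrow> 'a \<Rightarrow> real) \<Rightarrow> bool" where
  "predictable M \<xi> \<Phi> \<longleftrightarrow> (\<lambda>(t, x, \<omega>). \<Phi> t x \<omega>) \<in> borel_measurable (predictable_sigma M \<xi>)"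

lemma
  shows space_noise_filtration [simp]: "space (noise_filtration M \<xi> t) = space M"
    and sets_noise_filtration: "sets (noise_filtration M \<xi> t) = sigma_sets (space M)
      ({\<xi> \<phi> -` B \<inter> space M | \<phi> B.
        \<phi> \<in> noise_test \<and> (\<forall>z. z \<notin> {0..t} \<times> UNIV \<longrightarrow> \<phi> z = 0) \<and> B \<in> sets borel}
       \<union> null_sets M)"
proof -
  have "{\<xi> \<phi> -` B \<inter> space M | \<phi> B.
      \<phi> \<in> noise_test \<and> (\<forall>z. z \<notin> {0..t} \<times> UNIV \<longrightarrow> \<phi> z = 0) \<and> B \<in> sets borel}
      \<union> null_sets M \<subseteq> Pow (space M)"
    using sets.sets_into_space[of _ M] by auto
  then show "space (noise_filtration M \<xi> t) = space M"
    and "sets (noise_filtration M \<xi> t) = sigma_sets (space M)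
      ({\<xi> \<phi> -` B \<inter> space M | \<phi> B.
        \<phi> \<in> noise_test \<and> (\<forall>z. z \<notin> {0..t} \<times> UNIV \<longrightarrow> \<phi> z = 0) \<and> B \<in> sets borel}
       \<union> null_sets M)"
    unfolding noise_filtration_def by (simp_all add: space_measure_of sets_measure_of)
qed

lemma
  shows space_predictable_sigma [simp]:
      "space (predictable_sigma M \<xi>) = {0..} \<times> UNIV \<times> space M"
    and sets_predictable_sigma:
      "sets (predictable_sigma M \<xi>) = sigma_sets ({0..} \<times> UNIV \<times> space M)
        ({{a<..b} \<times> A \<times> G | a b A G.
            0 \<le> a \<and> a < b \<and> A \<in> sets borel \<and> G \<in> sets (noise_filtration M \<xi> a)} \<union>
         {{0} \<times> A \<times> G | A G. A \<in> sets borel \<and> G \<in> sets (noise_filtration M \<xi> 0)})"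
proof -
  have G: "G \<subseteq> space M" if "G \<in> sets (noise_filtration M \<xi> a)" for G a
    using sets.sets_into_space[OF that] by simp
  have "({{a<..b} \<times> A \<times> G | a b A G.
            0 \<le> a \<and> a < b \<and> A \<in> sets borel \<and> G \<in> sets (noise_filtration M \<xi> a)} \<union>
         {{0} \<times> A \<times> G | A G. A \<in> sets borel \<and> G \<in> sets (noise_filtration M \<xi> 0)})
      \<subseteq> Pow ({0::real..} \<times> (UNIV :: real set) \<times> space M)" (is "?A \<subseteq> _")
    using G by fastforce
  then show "space (predictable_sigma M \<xi>) = {0..} \<times> UNIV \<times> space M"
    and "sets (predictable_sigma M \<xi>) = sigma_sets ({0..} \<times> UNIV \<times> space M) ?A"
    unfolding predictable_sigma_def by (simp_all add: space_measure_of sets_measure_of)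
qed

section \<open>The Walsh stochastic integral\<close>

text \<open>
  A list of tuples \<open>(a, b, A, X)\<close> encodes the simple field
  \<open>\<Sum> X(\<omega>) 1\<^bsub>(a,b]\<^esub>(s) 1\<^bsub>A\<^esub>(y)\<close>, where \<open>X\<close> is bounded and measurable at time \<open>a\<close>.
\<close>

type_synonym 'a simple_data = "(real \<times> real \<times> real set \<times> ('a \<Rightarrow> real)) list"

definition simple_data ::
  "'a measure \<Rightarrow> ((real \<times> real \<Rightarrow> real) \<Rightarrow> 'a \<Rightarrow> real) \<Rightarrow> 'a simple_data \<Rightarrow> bool" where
  "simple_data M \<xi> L \<longleftrightarrow> (\<forall>(a, b, A, X) \<in> set L.
     0 \<le> a \<and> a < b \<and> A \<in> sets borel \<and> emeasure lborel A < \<infinity> \<and>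
     X \<in> borel_measurable (noise_filtration M \<xi> a) \<and> (\<exists>C. \<forall>\<omega>\<in>space M. \<bar>X \<omega>\<bar> \<le> C))"

definition simple_field :: "'a simple_data \<Rightarrow> real \<Rightarrow> real \<Rightarrow> 'a \<Rightarrow> real" where
  "simple_field L s y \<omega> = (\<Sum>(a, b, A, X)\<leftarrow>L. X \<omega> * indicator {a<..b} s * indicator A y)"

definition simple_integral_noise ::
  "((real \<times> real \<Rightarrow> real) \<Rightarrow> 'a \<Rightarrow> real) \<Rightarrow> 'a simple_data \<Rightarrow> 'a \<Rightarrow> real" where
  "simple_integral_noise \<xi> L \<omega> = (\<Sum>(a, b, A, X)\<leftarrow>L. X \<omega> * \<xi> (indicator ({a<..b} \<times> A)) \<omega>)"

text \<open>
  \<open>has_walsh_integral M \<xi> \<Phi> Z\<close>: the predictable field \<open>\<Phi>\<close> is a limit of simple fields in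
  \<open>L\<^sup>2((0,\<infinity>) \<times> \<real> \<times> \<Omega>)\<close> and \<open>Z\<close> is (a version of) the \<open>L\<^sup>2(\<Omega>)\<close> limit of their integrals.
\<close>

definition has_walsh_integral ::
  "'a measure \<Rightarrow> ((real \<times> real \<Rightarrow> real) \<Rightarrow> 'a \<Rightarrow> real) \<Rightarrow> (real \<Rightarrow> real \<Rightarrow> 'a \<Rightarrow> real)
    \<Rightarrow> ('a \<Rightarrow> real) \<Rightarrow> bool" where
  "has_walsh_integral M \<xi> \<Phi> Z \<longleftrightarrow> predictable M \<xi> \<Phi> \<and> Z \<in> borel_measurable M \<and>
    (\<exists>L. (\<forall>n. simple_data M \<xi> (L n)) \<and>
      ((\<lambda>n. \<integral>\<^sup>+\<omega>. (\<integral>\<^sup>+s\<in>{0<..}. (\<integral>\<^sup>+y. ennreal ((simple_field (L n) s y \<omega> - \<Phi> s y \<omega>)\<^sup>2) \<partial>lborel)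
          \<partial>lborel) \<partial>M) \<longlonglongrightarrow> 0) \<and>
      ((\<lambda>n. \<integral>\<^sup>+\<omega>. ennreal ((simple_integral_noise \<xi> (L n) \<omega> - Z \<omega>)\<^sup>2) \<partial>M) \<longlonglongrightarrow> 0))"

section \<open>Mild solutions\<close>

definition convol :: "(real \<Rightarrow> real) \<Rightarrow> (real \<Rightarrow> real) \<Rightarrow> real \<Rightarrow> real" where
  "convol f g x = (\<integral>y. f (x - y) * g y \<partial>lborel)"

definition heat_kernel :: "real \<Rightarrow> real \<Rightarrow> real \<Rightarrow> real" where
  "heat_kernel \<theta> r a = exp (- a\<^sup>2 / (2 * \<theta> * r)) / sqrt (2 * pi * \<theta> * r)"

text \<open>
  The initial function is an element of \<open>L\<^sup>\<infinity>\<close>, so it is attained at time 0 almost everywhere.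
  The stochastic integrals are only determined up to modification; \<open>I t x\<close> are versions for
  which the mild equation holds almost surely, simultaneously in \<open>t\<close> and \<open>x\<close>.
\<close>

definition mild_solution ::
  "'a measure \<Rightarrow> ((real \<times> real \<Rightarrow> real) \<Rightarrow> 'a \<Rightarrow> real) \<Rightarrow> real \<Rightarrow> (real \<Rightarrow> real) \<Rightarrow> (real \<Rightarrow> real)
    \<Rightarrow> (real \<Rightarrow> real \<Rightarrow> 'a \<Rightarrow> real) \<Rightarrow> bool" where
  "mild_solution M \<xi> \<theta> \<sigma> u\<^sub>0 u \<longleftrightarrow>
    predictable M \<xi> u \<and>
    (AE x in lborel. \<forall>\<omega>\<in>space M. u 0 x \<omega> = u\<^sub>0 x) \<and>
    (\<forall>T\<ge>0. (SUP t\<in>{0..T}. SUP x. \<integral>\<^sup>+\<omega>. ennreal (\<bar>u t x \<omega>\<bar>\<^sup>2) \<partial>M) < \<infinity>) \<and>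
    (\<exists>I. (\<forall>t>0. \<forall>x. has_walsh_integral M \<xi>
             (\<lambda>s y \<omega>. indicator {0<..<t} s * heat_kernel \<theta> (t - s) (x - y) * \<sigma> (u s y \<omega>)) (I t x)) \<and>
         (AE \<omega> in M. \<forall>t>0. \<forall>x. u t x \<omega> = convol (heat_kernel \<theta> t) u\<^sub>0 x + I t x \<omega>)) \<and>
    (AE \<omega> in M. continuous_on ({0<..} \<times> UNIV) (\<lambda>(t, x). u t x \<omega>))"

section \<open>Lipschitz constant, energy and norm\<close>

definition Lip :: "(real \<Rightarrow> real) \<Rightarrow> real" where
  "Lip \<phi> = (SUP (a, b) \<in> {(a, b). a < b}. \<bar>(\<phi> a - \<phi> b) / (a - b)\<bar>)"

definition r_kernel :: "real \<Rightarrow> real \<Rightarrow> real \<Rightarrow> real" where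
  "r_kernel \<theta> \<beta> x = exp (- \<bar>x\<bar> * sqrt (\<beta> / \<theta>)) / (2 * sqrt (\<beta> * \<theta>))"

definition R_op :: "real \<Rightarrow> real \<Rightarrow> (real \<Rightarrow> real) \<Rightarrow> real \<Rightarrow> real" where
  "R_op \<theta> \<beta> f = convol (r_kernel \<theta> \<beta>) f"

definition mutual_energy :: "real \<Rightarrow> real \<Rightarrow> (real \<Rightarrow> real) \<Rightarrow> (real \<Rightarrow> real) \<Rightarrow> real" where
  "mutual_energy \<theta> \<beta> f g = (\<integral>x. f x * R_op \<theta> \<beta> g x \<partial>lborel)"

definition L1_norm :: "(real \<Rightarrow> real) \<Rightarrow> real" where
  "L1_norm f = (\<integral>x. \<bar>f x\<bar> \<partial>lborel)"

end

theory Submission imports Defs "HOL-Real_Asymp.Real_Asymp"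
begin

text \<open>
  By the Walsh isometry, \<open>E[u\<^sub>t(x) v\<^sub>t(x')]\<close> is \<open>(P\<^sub>t u\<^sub>0)(x) (P\<^sub>t v\<^sub>0)(x')\<close> plus the integral of
  \<open>p\<^bsub>t-s\<^esub>(x - y) p\<^bsub>t-s\<^esub>(x' - y) E[\<sigma>\<^sub>1(u\<^sub>s(y)) \<sigma>\<^sub>2(v\<^sub>s(y))]\<close> over \<open>s < t\<close> and \<open>y\<close>. As \<open>u\<close> and \<open>v\<close> are
  nonnegative, integration over \<open>x\<close> and \<open>x'\<close> identifies the covariance of the masses with the integral of
  \<open>E[\<sigma>\<^sub>1(u\<^sub>s(y)) \<sigma>\<^sub>2(v\<^sub>s(y))]\<close>, which is at most \<open>Lip \<sigma>\<^sub>1 Lip \<sigma>\<^sub>2\<close> times the integral of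
  \<open>H(s) = \<integral> E[u\<^sub>s(y) v\<^sub>s(y)] dy\<close> over \<open>s < t\<close>. Integration over the diagonal \<open>x = x'\<close> gives a renewal inequality
  for \<open>H\<close> with kernel \<open>p\<^bsub>2r\<^esub>(0)\<close>; since \<open>r\<^sub>\<beta>\<close> is the Laplace transform of \<open>p\<^bsub>2r\<^esub>\<close> in \<open>r\<close>, the weight
  \<open>e\<^bsup>-\<beta>s\<^esup>\<close> turns it into the claimed bound.

  Nonnegativity comes from an explicit Euler scheme, driven by the noise averaged over space-time cells, which
  in each step multiplies the values by factors of mean one and applies the heat semigroup. The increments are so
  small that a factor is rarely negative, so in the limit \<open>E \<integral> |u\<^sub>t|\<close> is at most \<open>\<integral> u\<^sub>0\<close>. As this is also
  \<open>E \<integral> u\<^sub>t\<close>, the negative part vanishes.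
\<close>

section \<open>Independence of the past from the future noise\<close>

text \<open>Moments are mostly handled as extended nonnegative integrals, so that integrals can be
  exchanged freely. The obstacle is that a renewal inequality can be solved for its unknown only
  once the unknown is finite, while a mild solution comes with a bound uniform in space but with no
  integrability in space. Finiteness is won first, in \<open>energy_finite\<close>. The constant
  stems from 1 / (2 sqrt (\<beta> \<theta>)), the Laplace transform at \<beta> of p_{2r}(0) as a
  function of r. The lower bound on \<beta> says that Lip \<sigma>_1 Lip \<sigma>_2 times this
  number is less than 1; the quotient in the theorem is the resulting geometric series, times one
  more factor Lip \<sigma>_1 Lip \<sigma>_2 from the source term. In the scheme, cells have length 1
  / N and time steps N^-3: one step may increase the L^1 norm by a relative error of order N^-4, so
  the N^3 T steps up to time T contribute order 1 / N. The scheme is compared with the given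
  \<open>u\<close> directly, since both are Walsh integrals against the same noise. Independence of
  past and future noise has to be derived from Gaussian linear combinations and the
  covariance.\<close>

lemma (in prob_space) weighted_distribution_eqI:
  fixes a b Y :: "'a \<Rightarrow> real"
  assumes a: "integrable M a" "\<And>\<omega>. 0 \<le> a \<omega>" and b: "integrable M b" "\<And>\<omega>. 0 \<le> b \<omega>"
    and Y[measurable]: "Y \<in> borel_measurable M" and B: "B \<in> sets borel"
    and eq: "\<And>s q. (\<integral>\<omega>. a \<omega> * cos (s * Y \<omega> + q) \<partial>M) = (\<integral>\<omega>. b \<omega> * cos (s * Y \<omega> + q) \<partial>M)"
  shows "(\<integral>\<omega>. a \<omega> * indicator B (Y \<omega>) \<partial>M) = (\<integral>\<omega>. b \<omega> * indicator B (Y \<omega>) \<partial>M)"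
proof -
  define c where "c = (\<integral>\<omega>. a \<omega> \<partial>M)"
  have cb: "c = (\<integral>\<omega>. b \<omega> \<partial>M)" using eq[of 0 0] by (simp add: c_def)
  note [measurable] = borel_measurable_integrable[OF a(1)] borel_measurable_integrable[OF b(1)] B
  show ?thesis
  proof (cases "c = 0")
    case True
    have "AE \<omega> in M. a \<omega> = 0" "AE \<omega> in M. b \<omega> = 0"
      using True cb a b integral_nonneg_eq_0_iff_AE[OF a(1)] integral_nonneg_eq_0_iff_AE[OF b(1)]
      by (simp_all add: c_def)
    then have "(\<integral>\<omega>. a \<omega> * indicator B (Y \<omega>) \<partial>M) = (\<integral>\<omega>. 0 \<partial>M)" "(\<integral>\<omega>. b \<omega> * indicator B (Y \<omega>) \<partial>M) = (\<integral>\<omega>. 0 \<partial>M)"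
      by (intro integral_cong_AE; force)+
    then show ?thesis by simp
  next
    case False
    have c: "0 < c" using False a by (simp add: c_def less_le)
    \<comment> \<open>Normalised to total mass one, the weights become probability densities, and
      equality of the laws of \<open>Y\<close> under them is a matter of characteristic functions.
      The case \<open>c = 0\<close>, in which no normalisation is possible, has just been
      settled.\<close>
    define D where "D f = distr (density M (\<lambda>\<omega>. ennreal (f \<omega> / c))) borel Y" for f :: "'a \<Rightarrow> real"
    have D: "real_distribution (D f)" "\<And>s. char (D f) s =
        Complex ((\<integral>\<omega>. f \<omega> * cos (s * Y \<omega> + 0) \<partial>M) / c) ((\<integral>\<omega>. f \<omega> * cos (s * Y \<omega> + (- (pi/2))) \<partial>M) / c)"
      "measure (D f) B = (\<integral>\<omega>. f \<omega> * indicator B (Y \<omega>) \<partial>M) / c"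
      if f: "integrable M f" "\<And>\<omega>. 0 \<le> f \<omega>" and fc: "(\<integral>\<omega>. f \<omega> \<partial>M) = c" for f
    proof -
      note [measurable] = borel_measurable_integrable[OF f(1)]
      have "emeasure (density M (\<lambda>\<omega>. ennreal (f \<omega> / c))) (space M) = 1"
        using c f by (simp add: emeasure_density nn_integral_eq_integral fc cong: nn_integral_cong)
      then interpret d: prob_space "density M (\<lambda>\<omega>. ennreal (f \<omega> / c))"
        by (intro prob_spaceI) simp
      show "real_distribution (D f)"
        unfolding D_def by (intro real_distribution.intro real_distribution_axioms.intro d.prob_space_distr) auto
      show "measure (D f) B = (\<integral>\<omega>. f \<omega> * indicator B (Y \<omega>) \<partial>M) / c"
      proof -
        have "measure (D f) B = measure (density M (\<lambda>\<omega>. ennreal (f \<omega> / c))) (Y -` B \<inter> space M)"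
          by (simp add: D_def measure_distr)
        also have "\<dots> = (\<integral>\<omega>. indicator (Y -` B \<inter> space M) \<omega> \<partial>density M (\<lambda>\<omega>. ennreal (f \<omega> / c)))"
          by simp
        also have "\<dots> = (\<integral>\<omega>. (f \<omega> / c) * indicator (Y -` B \<inter> space M) \<omega> \<partial>M)"
          using c f by (subst integral_density) auto
        also have "\<dots> = (\<integral>\<omega>. f \<omega> * indicator B (Y \<omega>) / c \<partial>M)"
          by (intro Bochner_Integration.integral_cong) (auto simp: indicator_def)
        finally show ?thesis by simp
      qed
      fix s
      have int1: "integrable M (\<lambda>\<omega>. f \<omega> * cos (s * Y \<omega> + q))" for q
        by (rule Bochner_Integration.integrable_bound[OF f(1)]) (auto simp: abs_mult mult_left_le)
      have "char (D f) s = (\<integral>\<omega>. (f \<omega> / c) *\<^sub>R iexp (s * Y \<omega>) \<partial>M)"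
        unfolding char_def D_def using c f
        by (subst integral_distr, simp, simp, subst integral_density) auto
      \<comment> \<open>The phase -pi/2 turns the cosine into a sine, so the single family of
        hypotheses \<open>eq\<close> supplies both real and imaginary parts.\<close>
      also have "\<dots> = (\<integral>\<omega>. complex_of_real (f \<omega> * cos (s * Y \<omega> + 0) / c)
          + \<i> * complex_of_real (f \<omega> * cos (s * Y \<omega> + (- (pi/2))) / c) \<partial>M)"
        by (intro Bochner_Integration.integral_cong)
           (auto simp: complex_eq_iff exp_eq_polar cos_diff)
      also have "\<dots> = complex_of_real (\<integral>\<omega>. f \<omega> * cos (s * Y \<omega> + 0) / c \<partial>M)
          + \<i> * complex_of_real (\<integral>\<omega>. f \<omega> * cos (s * Y \<omega> + (- (pi/2))) / c \<partial>M)"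
        using int1[of 0] int1[of "-(pi/2)"]
        by (subst Bochner_Integration.integral_add) (auto simp del: of_real_divide of_real_mult)
      also have "\<dots> = Complex ((\<integral>\<omega>. f \<omega> * cos (s * Y \<omega> + 0) \<partial>M) / c) ((\<integral>\<omega>. f \<omega> * cos (s * Y \<omega> + (- (pi/2))) \<partial>M) / c)"
        by (simp add: complex_eq_iff)
      finally show "char (D f) s = Complex ((\<integral>\<omega>. f \<omega> * cos (s * Y \<omega> + 0) \<partial>M) / c) ((\<integral>\<omega>. f \<omega> * cos (s * Y \<omega> + (- (pi/2))) \<partial>M) / c)" .
    qed
    have "char (D a) = char (D b)"
      unfolding fun_eq_iff D(2)[OF a c_def[symmetric]] D(2)[OF b cb[symmetric]] eq by simp
    then have "D a = D b"
      using D(1)[OF a] D(1)[OF b] cb c_def by (intro Levy_uniqueness) auto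
    then show ?thesis
      using D(3)[OF a] D(3)[OF b] cb c_def c by auto
  qed
qed

text \<open>For a constant variable, mean zero forces the constant 0 and all formulas become
  trivial; otherwise they are those of a centred normal law. The cosine with a phase is the real
  part of a rotated characteristic function and is the form in which independence is tested; the
  fourth moment later controls how often an Euler factor is negative.\<close>

lemma gaussian_moments:
  assumes "prob_space M" "gaussian_rv M X" and m: "(\<integral>\<omega>. X \<omega> \<partial>M) = 0"
  shows "X \<in> borel_measurable M" "integrable M X" "integrable M (\<lambda>\<omega>. (X \<omega>)\<^sup>2)" "integrable M (\<lambda>\<omega>. X \<omega> ^ 4)"
    "(\<integral>\<omega>. X \<omega> ^ 4 \<partial>M) = 3 * (\<integral>\<omega>. (X \<omega>)\<^sup>2 \<partial>M)\<^sup>2"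
    "(\<integral>\<omega>. cos (X \<omega> + p) \<partial>M) = cos p * exp (- (\<integral>\<omega>. (X \<omega>)\<^sup>2 \<partial>M) / 2)"
proof -
  interpret prob_space M by fact
  show X[measurable]: "X \<in> borel_measurable M" using assms(2) by (simp add: gaussian_rv_def)
  from assms(2) consider (1) m s where "0 < s" "distributed M lborel X (\<lambda>x. ennreal (normal_density m s x))"
    | (2) m where "AE \<omega> in M. X \<omega> = m" unfolding gaussian_rv_def by auto
  then have "integrable M X \<and> integrable M (\<lambda>\<omega>. (X \<omega>)\<^sup>2) \<and> integrable M (\<lambda>\<omega>. X \<omega> ^ 4) \<and>
    (\<integral>\<omega>. X \<omega> ^ 4 \<partial>M) = 3 * (\<integral>\<omega>. (X \<omega>)\<^sup>2 \<partial>M)\<^sup>2 \<and>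
    (\<integral>\<omega>. cos (X \<omega> + p) \<partial>M) = cos p * exp (- (\<integral>\<omega>. (X \<omega>)\<^sup>2 \<partial>M) / 2)"
  proof cases
    case (2 n)
    have "(\<integral>\<omega>. X \<omega> \<partial>M) = (\<integral>\<omega>. n \<partial>M)" by (rule integral_cong_AE) (use 2 in auto)
    then have n: "n = 0" using m by (simp add: prob_space)
    have z: "AE \<omega> in M. X \<omega> = 0" using 2 n by simp
    have i: "integrable M (\<lambda>\<omega>. f (X \<omega>))" "(\<integral>\<omega>. f (X \<omega>) \<partial>M) = f 0"
      if [measurable]: "f \<in> borel_measurable borel" for f :: "real \<Rightarrow> real"
    proof -
      have "AE \<omega> in M. f (X \<omega>) = f 0" using z by eventually_elim simp
      then show "integrable M (\<lambda>\<omega>. f (X \<omega>))"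
        by (subst integrable_cong_AE[where g = "\<lambda>_. f 0"]) auto
      have "(\<integral>\<omega>. f (X \<omega>) \<partial>M) = (\<integral>\<omega>. f 0 \<partial>M)" by (rule integral_cong_AE) (use \<open>AE \<omega> in M. f (X \<omega>) = f 0\<close> in auto)
      then show "(\<integral>\<omega>. f (X \<omega>) \<partial>M) = f 0" by (simp add: prob_space)
    qed
    show ?thesis using i[of "\<lambda>x. x"] i[of "\<lambda>x. x\<^sup>2"] i[of "\<lambda>x. x^4"] i[of "\<lambda>x. cos (x + p)"] by simp
  next
    case (1 n s)
    have s[arith]: "0 < s" by fact
    have "n = 0" using normal_distributed_expectation[OF 1] m by simp
    then have d: "distributed M lborel X (\<lambda>x. ennreal (normal_density 0 s x))" using 1 by simp
    have di: "integrable M (\<lambda>\<omega>. f (X \<omega>))" "(\<integral>\<omega>. f (X \<omega>) \<partial>M) = (\<integral>x. normal_density 0 s x * f x \<partial>lborel)"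
      if "f \<in> borel_measurable borel" "integrable lborel (\<lambda>x. normal_density 0 s x * f x)" for f :: "real \<Rightarrow> real"
      using distributed_integrable[OF d, of f] distributed_integral[OF d, of f] that by auto
    have 2: "has_bochner_integral lborel (\<lambda>x. normal_density 0 s x * x\<^sup>2) (s\<^sup>2)"
      using normal_moment_even[of s 0 1] by (simp add: eval_nat_numeral)
    have 4: "has_bochner_integral lborel (\<lambda>x. normal_density 0 s x * x^4) (3 * (s\<^sup>2)\<^sup>2)"
      using normal_moment_even[of s 0 2] by (simp add: fact_numeral power_divide field_simps)
    have v: "integrable M (\<lambda>\<omega>. (X \<omega>)\<^sup>2)" "(\<integral>\<omega>. (X \<omega>)\<^sup>2 \<partial>M) = s\<^sup>2"
      using di[of "\<lambda>x. x\<^sup>2"] 2 by (auto simp: has_bochner_integral_iff)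
    have "distributed M lborel (\<lambda>x. (X x - 0) / s) std_normal_density"
      using d normal_standard_normal_convert[OF s] by simp
    then have "distr M lborel (\<lambda>x. X x / s) = std_normal_distribution"
      by (simp add: distributed_def)
    then have std: "distr M borel (\<lambda>x. X x / s) = std_normal_distribution"
      by (metis distr_cong sets_lborel)
    have "char std_normal_distribution s = (\<integral>\<omega>. iexp (s * (X \<omega> / s)) \<partial>M)"
      unfolding char_def std[symmetric] by (subst integral_distr) auto
    also have "\<dots> = (\<integral>\<omega>. iexp (X \<omega>) \<partial>M)" using s by simp
    finally have ch: "(\<integral>\<omega>. iexp (X \<omega>) \<partial>M) = complex_of_real (exp (- s\<^sup>2 / 2))"
      by (simp add: char_std_normal_distribution)
    have ii: "integrable M (\<lambda>\<omega>. iexp (X \<omega>))"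
      by (rule integrable_const_bound[where B=1]) auto
    have ii2: "integrable M (\<lambda>\<omega>. iexp (X \<omega>) * iexp p)" using ii by (rule integrable_mult_left)
    have "(\<integral>\<omega>. cos (X \<omega> + p) \<partial>M) = (\<integral>\<omega>. Re (iexp (X \<omega>) * iexp p) \<partial>M)"
      by (intro Bochner_Integration.integral_cong) (auto simp: exp_eq_polar cos_add)
    also have "\<dots> = Re (\<integral>\<omega>. iexp (X \<omega>) * iexp p \<partial>M)" by (rule integral_Re[OF ii2])
    also have "\<dots> = Re ((\<integral>\<omega>. iexp (X \<omega>) \<partial>M) * iexp p)" by simp
    also have "\<dots> = cos p * exp (- s\<^sup>2 / 2)" unfolding ch by (simp add: exp_eq_polar del: of_real_exp)
    finally have c: "(\<integral>\<omega>. cos (X \<omega> + p) \<partial>M) = cos p * exp (- s\<^sup>2 / 2)" .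
    have "integrable M (\<lambda>\<omega>. X \<omega> ^ 4)" "(\<integral>\<omega>. X \<omega> ^ 4 \<partial>M) = 3 * (s\<^sup>2)\<^sup>2"
      using di[of "\<lambda>x. x^4"] 4 by (auto simp: has_bochner_integral_iff)
    with c v show ?thesis using square_integrable_imp_integrable[OF X] v by auto
  qed
  then show "integrable M X" "integrable M (\<lambda>\<omega>. (X \<omega>)\<^sup>2)" "integrable M (\<lambda>\<omega>. X \<omega> ^ 4)"
    "(\<integral>\<omega>. X \<omega> ^ 4 \<partial>M) = 3 * (\<integral>\<omega>. (X \<omega>)\<^sup>2 \<partial>M)\<^sup>2"
    "(\<integral>\<omega>. cos (X \<omega> + p) \<partial>M) = cos p * exp (- (\<integral>\<omega>. (X \<omega>)\<^sup>2 \<partial>M) / 2)" by auto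
qed

section \<open>White noise as a Gaussian field\<close>

locale noise = prob_space M for M :: "'a measure" +
  fixes \<xi> :: "(real \<times> real \<Rightarrow> real) \<Rightarrow> 'a \<Rightarrow> real"
  assumes white_noise: "white_noise M \<xi>"
begin

lemma pair_sigma_finite_lborel: "pair_sigma_finite M (lborel :: real measure)"
  by (intro pair_sigma_finite.intro lborel.sigma_finite_measure_axioms sigma_finite_measure_axioms)

lemma noise_gaussian:
  assumes "\<And>i. i < (n::nat) \<Longrightarrow> \<phi> i \<in> noise_test"
  shows "gaussian_rv M (\<lambda>\<omega>. \<Sum>i<n. c i * \<xi> (\<phi> i) \<omega>)"
  using white_noise[unfolded white_noise_def, THEN conjunct1, rule_format, of n \<phi> c] assms by blast

lemma noise_gaussian1: assumes "\<phi> \<in> noise_test" shows "gaussian_rv M (\<xi> \<phi>)"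
  using noise_gaussian[of "Suc 0" "\<lambda>_. \<phi>" "\<lambda>_. 1"] assms by (simp add: lessThan_Suc del: sum_constant)

lemma noise_mean: "\<phi> \<in> noise_test \<Longrightarrow> (\<integral>\<omega>. \<xi> \<phi> \<omega> \<partial>M) = 0"
  using white_noise unfolding white_noise_def by blast

lemma noise_measurable[measurable (raw)]: "\<phi> \<in> noise_test \<Longrightarrow> \<xi> \<phi> \<in> borel_measurable M"
  using noise_gaussian1 by (simp add: gaussian_rv_def)

lemmas noise_moments = gaussian_moments[OF prob_space_axioms noise_gaussian1 noise_mean]

lemma integrable_mult_square:
  fixes f g :: "'b \<Rightarrow> real"
  assumes "f \<in> borel_measurable N" "g \<in> borel_measurable N"
    "integrable N (\<lambda>x. (f x)\<^sup>2)" "integrable N (\<lambda>x. (g x)\<^sup>2)"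
  shows "integrable N (\<lambda>x. f x * g x)"
proof (rule Bochner_Integration.integrable_bound)
  show "integrable N (\<lambda>x. (f x)\<^sup>2 + (g x)\<^sup>2)" using assms by simp
  have "\<bar>a * b\<bar> \<le> a\<^sup>2 + b\<^sup>2" for a b :: real
    using sum_squares_bound[of "\<bar>a\<bar>" "\<bar>b\<bar>"] abs_ge_zero[of "a * b"] unfolding abs_mult power2_abs by linarith
  then show "AE x in N. norm (f x * g x) \<le> norm ((f x)\<^sup>2 + (g x)\<^sup>2)" by auto
qed (use assms in measurable)

lemma noise_cov:
  assumes "\<phi> \<in> noise_test" "\<psi> \<in> noise_test"
  shows "integrable M (\<lambda>\<omega>. \<xi> \<phi> \<omega> * \<xi> \<psi> \<omega>)"
    "(\<integral>\<omega>. \<xi> \<phi> \<omega> * \<xi> \<psi> \<omega> \<partial>M) = (\<integral>z. \<phi> z * \<psi> z \<partial>lborel)"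
proof -
  show "integrable M (\<lambda>\<omega>. \<xi> \<phi> \<omega> * \<xi> \<psi> \<omega>)"
    using noise_moments assms by (intro integrable_mult_square) auto
  have "covariance M (\<xi> \<phi>) (\<xi> \<psi>) = (\<integral>z. \<phi> z * \<psi> z \<partial>lborel)"
    using white_noise assms unfolding white_noise_def by blast
  then show "(\<integral>\<omega>. \<xi> \<phi> \<omega> * \<xi> \<psi> \<omega> \<partial>M) = (\<integral>z. \<phi> z * \<psi> z \<partial>lborel)"
    using assms by (simp add: covariance_def noise_mean)
qed

text \<open>Together with \<open>noise_gaussian\<close> and \<open>gaussian_moments\<close> this
  determines the law of every linear combination of the field by the L^2 norm of the same
  combination of test functions, which is how joint Gaussianity enters.\<close>

lemma noise_lincomb:
  assumes \<phi>: "\<And>i. i < n \<Longrightarrow> \<phi> i \<in> noise_test"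
  shows "(\<integral>\<omega>. (\<Sum>i<n. c i * \<xi> (\<phi> i) \<omega>) \<partial>M) = 0"
    "(\<integral>\<omega>. (\<Sum>i<n. c i * \<xi> (\<phi> i) \<omega>)\<^sup>2 \<partial>M) = (\<integral>z. (\<Sum>i<n. c i * \<phi> i z)\<^sup>2 \<partial>lborel)"
proof -
  show "(\<integral>\<omega>. (\<Sum>i<n. c i * \<xi> (\<phi> i) \<omega>) \<partial>M) = 0"
    using assms noise_moments by (subst Bochner_Integration.integral_sum) (auto simp: noise_mean)
  have i: "integrable lborel (\<lambda>z. \<phi> i z * \<phi> j z)" if "i < n" "j < n" for i j
    using \<phi>[OF that(1)] \<phi>[OF that(2)] by (intro integrable_mult_square) (auto simp: noise_test_def)
  have "(\<integral>\<omega>. (\<Sum>i<n. c i * \<xi> (\<phi> i) \<omega>)\<^sup>2 \<partial>M) = (\<integral>\<omega>. (\<Sum>i<n. \<Sum>j<n. c i * c j * (\<xi> (\<phi> i) \<omega> * \<xi> (\<phi> j) \<omega>)) \<partial>M)"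
    by (simp add: power2_eq_square sum_product ac_simps)
  also have "\<dots> = (\<Sum>i<n. \<Sum>j<n. c i * c j * (\<integral>z. \<phi> i z * \<phi> j z \<partial>lborel))"
  proof -
    have ij: "integrable M (\<lambda>\<omega>. c i * c j * (\<xi> (\<phi> i) \<omega> * \<xi> (\<phi> j) \<omega>))"
      "(\<integral>\<omega>. c i * c j * (\<xi> (\<phi> i) \<omega> * \<xi> (\<phi> j) \<omega>) \<partial>M) = c i * c j * (\<integral>z. \<phi> i z * \<phi> j z \<partial>lborel)"
      if "i < n" "j < n" for i j using noise_cov[OF \<phi>[OF that(1)] \<phi>[OF that(2)]] by simp_all
    have "(\<integral>\<omega>. (\<Sum>i<n. \<Sum>j<n. c i * c j * (\<xi> (\<phi> i) \<omega> * \<xi> (\<phi> j) \<omega>)) \<partial>M) =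
      (\<Sum>i<n. \<integral>\<omega>. (\<Sum>j<n. c i * c j * (\<xi> (\<phi> i) \<omega> * \<xi> (\<phi> j) \<omega>)) \<partial>M)"
      by (intro Bochner_Integration.integral_sum Bochner_Integration.integrable_sum ij) auto
    also have "\<dots> = (\<Sum>i<n. \<Sum>j<n. \<integral>\<omega>. c i * c j * (\<xi> (\<phi> i) \<omega> * \<xi> (\<phi> j) \<omega>) \<partial>M)"
      by (intro sum.cong refl Bochner_Integration.integral_sum ij) auto
    also have "\<dots> = (\<Sum>i<n. \<Sum>j<n. c i * c j * (\<integral>z. \<phi> i z * \<phi> j z \<partial>lborel))"
      by (intro sum.cong refl ij) auto
    finally show ?thesis .
  qed
  also have "\<dots> = (\<integral>z. (\<Sum>i<n. \<Sum>j<n. c i * c j * (\<phi> i z * \<phi> j z)) \<partial>lborel)"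
  proof -
    have "(\<integral>z. (\<Sum>i<n. \<Sum>j<n. c i * c j * (\<phi> i z * \<phi> j z)) \<partial>lborel) =
      (\<Sum>i<n. \<integral>z. (\<Sum>j<n. c i * c j * (\<phi> i z * \<phi> j z)) \<partial>lborel)"
      by (intro Bochner_Integration.integral_sum Bochner_Integration.integrable_sum integrable_mult_right i) auto
    also have "\<dots> = (\<Sum>i<n. \<Sum>j<n. \<integral>z. c i * c j * (\<phi> i z * \<phi> j z) \<partial>lborel)"
      by (intro sum.cong refl Bochner_Integration.integral_sum integrable_mult_right i) auto
    finally show ?thesis by simp
  qed
  also have "\<dots> = (\<integral>z. (\<Sum>i<n. c i * \<phi> i z)\<^sup>2 \<partial>lborel)"
    by (simp add: power2_eq_square sum_product ac_simps)
  finally show "(\<integral>\<omega>. (\<Sum>i<n. c i * \<xi> (\<phi> i) \<omega>)\<^sup>2 \<partial>M) = (\<integral>z. (\<Sum>i<n. c i * \<phi> i z)\<^sup>2 \<partial>lborel)" .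
qed

text \<open>Additivity is not part of \<open>white_noise\<close>, but the defect is a Gaussian
  combination whose variance is the integral of a function that vanishes identically. The
  exceptional null set depends on the test functions.\<close>

lemma noise_add:
  assumes "\<phi> \<in> noise_test" "\<psi> \<in> noise_test" "\<eta> \<in> noise_test" "\<And>z. \<eta> z = \<phi> z + \<psi> z"
  shows "AE \<omega> in M. \<xi> \<eta> \<omega> = \<xi> \<phi> \<omega> + \<xi> \<psi> \<omega>"
proof -
  define f where "f i = (if i = 0 then \<eta> else if i = 1 then \<phi> else \<psi>)" for i :: nat
  define c :: "nat \<Rightarrow> real" where "c i = (if i = 0 then 1 else -1)" for i
  have f: "f i \<in> noise_test" for i using assms by (simp add: f_def)
  note g = noise_gaussian[of 3 f c, OF f] and l = noise_lincomb[of 3 f c, OF f]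
  note mm = gaussian_moments[OF prob_space_axioms g l(1)]
  have e: "(\<Sum>i<3. c i * f i z) = 0" "(\<Sum>i<3. c i * \<xi> (f i) \<omega>) = \<xi> \<eta> \<omega> - \<xi> \<phi> \<omega> - \<xi> \<psi> \<omega>" for z \<omega>
    using assms(4) by (simp_all add: eval_nat_numeral f_def c_def)
  have "AE \<omega> in M. (\<xi> \<eta> \<omega> - \<xi> \<phi> \<omega> - \<xi> \<psi> \<omega>)\<^sup>2 = 0"
    using l(2)[unfolded e] by (subst integral_nonneg_eq_0_iff_AE[OF mm(3)[unfolded e], symmetric]) auto
  then show ?thesis by eventually_elim simp
qed

definition past :: "real \<Rightarrow> (real \<times> real \<Rightarrow> real) set" where
  "past a = {\<phi> \<in> noise_test. \<forall>z. z \<notin> {0..a} \<times> UNIV \<longrightarrow> \<phi> z = 0}"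

definition future :: "real \<Rightarrow> (real \<times> real \<Rightarrow> real) set" where
  "future a = {\<phi> \<in> noise_test. \<forall>z. z \<notin> {a<..} \<times> UNIV \<longrightarrow> \<phi> z = 0}"

text \<open>This set is closed under adding a multiple of one more past variable
  (\<open>past_span_add\<close>). In the induction over finitely many past events, that absorbs the
  cosine testing each event into the Gaussian factor.\<close>

definition past_span :: "real \<Rightarrow> ('a \<Rightarrow> real) set" where
  "past_span a = {W. \<exists>n c \<phi>. (\<forall>i<(n::nat). \<phi> i \<in> past a) \<and> W = (\<lambda>\<omega>. \<Sum>i<n. c i * \<xi> (\<phi> i) \<omega>)}"

lemma past_span_add:
  assumes "W \<in> past_span a" "\<phi> \<in> past a"
  shows "(\<lambda>\<omega>. W \<omega> + s * \<xi> \<phi> \<omega>) \<in> past_span a"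
proof -
  obtain n c f where f: "\<forall>i<(n::nat). f i \<in> past a" and W: "W = (\<lambda>\<omega>. \<Sum>i<n. c i * \<xi> (f i) \<omega>)"
    using assms(1) unfolding past_span_def by blast
  show ?thesis unfolding past_span_def
    using assms(2) f
    by (intro CollectI exI[of _ "Suc n"] exI[of _ "c(n := s)"] exI[of _ "f(n := \<phi>)"]) (auto simp: W less_Suc_eq)
qed

lemma past_span_measurable: "W \<in> past_span a \<Longrightarrow> W \<in> borel_measurable M"
  by (auto simp: past_span_def past_def intro!: borel_measurable_sum borel_measurable_times noise_measurable)

text \<open>\<open>W\<close> and the future variable are jointly Gaussian and, since their test
  functions have disjoint supports, uncorrelated; hence the variance of
  \<open>W + r * \<xi> \<psi>\<close> splits. Product-to-sum formulas reduce the product of cosines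
  to cosines of such sums.\<close>

lemma past_span_cos:
  assumes "W \<in> past_span a" "\<psi> \<in> future a"
  shows "(\<integral>\<omega>. cos (W \<omega> + p) * cos (t * \<xi> \<psi> \<omega> + q) \<partial>M) =
    (\<integral>\<omega>. cos (W \<omega> + p) \<partial>M) * (\<integral>\<omega>. cos (t * \<xi> \<psi> \<omega> + q) \<partial>M)"
proof -
  obtain n c f where f': "\<forall>i<(n::nat). f i \<in> past a" and W: "W = (\<lambda>\<omega>. \<Sum>i<n. c i * \<xi> (f i) \<omega>)"
    using assms(1) unfolding past_span_def by blast
  then have f: "\<And>i. i < n \<Longrightarrow> f i \<in> past a" by blast
  have Wm[measurable]: "W \<in> borel_measurable M" using past_span_measurable assms by blast
  have fn: "\<And>i. i < n \<Longrightarrow> f i \<in> noise_test" and psi: "\<psi> \<in> noise_test"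
    using f assms by (auto simp: past_def future_def)
  note [measurable] = noise_measurable[OF psi]
  define v w where "v = (\<integral>\<omega>. (W \<omega>)\<^sup>2 \<partial>M)" and "w = (\<integral>\<omega>. (\<xi> \<psi> \<omega>)\<^sup>2 \<partial>M)"
  have Wint: "integrable M (\<lambda>\<omega>. (W \<omega>)\<^sup>2)"
    using gaussian_moments(3)[OF prob_space_axioms noise_gaussian noise_lincomb(1)] fn W by auto
  have fpsi: "f i z * \<psi> z = 0" if "i < n" for i z
    using f[OF that] assms(2) unfolding past_def future_def by (cases z; cases "fst z \<le> a") auto
  have WG: "integrable M (\<lambda>\<omega>. W \<omega> * \<xi> \<psi> \<omega>)" "(\<integral>\<omega>. W \<omega> * \<xi> \<psi> \<omega> \<partial>M) = 0"
    unfolding W sum_distrib_right using fn psi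
    by (auto simp: mult.assoc noise_cov fpsi)
  have cosW: "(\<integral>\<omega>. cos (W \<omega> + r * \<xi> \<psi> \<omega> + p) \<partial>M) = cos p * exp (- (v + r\<^sup>2 * w) / 2)" for r p
  proof -
    have e: "(\<lambda>\<omega>. W \<omega> + r * \<xi> \<psi> \<omega>) = (\<lambda>\<omega>. \<Sum>i<Suc n. (c(n := r)) i * \<xi> ((f(n := \<psi>)) i) \<omega>)"
      by (auto simp: W)
    have t: "(f(n := \<psi>)) i \<in> noise_test" if "i < Suc n" for i using that fn psi by (auto simp: less_Suc_eq)
    have "(\<integral>\<omega>. (W \<omega> + r * \<xi> \<psi> \<omega>)\<^sup>2 \<partial>M) = (\<integral>\<omega>. (W \<omega>)\<^sup>2 + 2 * r * (W \<omega> * \<xi> \<psi> \<omega>) + r\<^sup>2 * (\<xi> \<psi> \<omega>)\<^sup>2 \<partial>M)"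
      by (simp add: power2_eq_square algebra_simps)
    also have "\<dots> = v + r\<^sup>2 * w"
      using Wint WG noise_moments(3)[OF psi psi] by (simp add: v_def w_def)
    finally show ?thesis
      using gaussian_moments(6)[OF prob_space_axioms noise_gaussian[of "Suc n" "f(n := \<psi>)" "c(n := r)", OF t]
          noise_lincomb(1)[of "Suc n" "f(n := \<psi>)" "c(n := r)", OF t], of p]
      by (simp add: W)
  qed
  have cosG: "(\<integral>\<omega>. cos (t * \<xi> \<psi> \<omega> + q) \<partial>M) = cos q * exp (- (t\<^sup>2 * w) / 2)"
  proof -
    have g: "gaussian_rv M (\<lambda>\<omega>. t * \<xi> \<psi> \<omega>)"
      using noise_gaussian[of "Suc 0" "\<lambda>_. \<psi>" "\<lambda>_. t"] psi by (simp add: lessThan_Suc)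
    have "(\<integral>\<omega>. (t * \<xi> \<psi> \<omega>)\<^sup>2 \<partial>M) = t\<^sup>2 * w" by (simp add: power_mult_distrib w_def)
    then show ?thesis using gaussian_moments(6)[OF prob_space_axioms g, of q] noise_mean[OF psi] by simp
  qed
  have ib: "integrable M (\<lambda>\<omega>. cos (W \<omega> + r * \<xi> \<psi> \<omega> + p))" for r p
    by (rule integrable_const_bound[where B=1]) auto
  have "(\<integral>\<omega>. cos (W \<omega> + p) * cos (t * \<xi> \<psi> \<omega> + q) \<partial>M) =
    (\<integral>\<omega>. (cos (W \<omega> + t * \<xi> \<psi> \<omega> + (p + q)) + cos (W \<omega> + (- t) * \<xi> \<psi> \<omega> + (p - q))) / 2 \<partial>M)"
    by (intro Bochner_Integration.integral_cong) (auto simp: cos_times_cos algebra_simps)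
  also have "\<dots> = (cos (p + q) + cos (p - q)) / 2 * exp (- (v + t\<^sup>2 * w) / 2)"
    unfolding integral_divide_zero Bochner_Integration.integral_add[OF ib ib] cosW
    by (simp add: algebra_simps add_divide_distrib)
  also have "\<dots> = (cos p * exp (- v / 2)) * (cos q * exp (- (t\<^sup>2 * w) / 2))"
    by (simp add: cos_add cos_diff add_divide_distrib exp_add[symmetric] diff_divide_distrib)
  finally show ?thesis using cosW[of 0 p] cosG by simp
qed

definition past_events :: "real \<Rightarrow> 'a set set" where
  "past_events a = {\<xi> \<phi> -` B \<inter> space M | \<phi> B. \<phi> \<in> past a \<and> B \<in> sets borel} \<union> null_sets M"

lemma sets_filtration: "sets (noise_filtration M \<xi> a) = sigma_sets (space M) (past_events a)"
  unfolding sets_noise_filtration past_events_def past_def by (simp add: conj_assoc)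

lemma past_events_sets: "past_events a \<subseteq> sets M"
  by (auto simp: past_events_def past_def null_sets_def intro!: measurable_sets[OF noise_measurable])

lemma filtration_subalgebra: "sets (noise_filtration M \<xi> a) \<subseteq> sets M"
  unfolding sets_filtration using past_events_sets by (rule sets.sigma_sets_subset)

lemma filtration_mono: "a \<le> b \<Longrightarrow> sets (noise_filtration M \<xi> a) \<subseteq> sets (noise_filtration M \<xi> b)"
proof -
  assume "a \<le> b"
  then have "past a \<subseteq> past b" by (auto simp: past_def)
  then show ?thesis unfolding sets_filtration past_events_def by (intro sigma_sets_mono') blast
qed

text \<open>
  The law of \<open>\<xi> \<psi>\<close> is tested with the nonnegative functions \<open>1 + cos (t \<xi>(\<psi>) + q)\<close>, so that
  Levy's uniqueness theorem in dimension one applies to weighted laws of one past variable at a time.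
\<close>

lemma past_events_uncorrelated:
  fixes t q :: real
  assumes "\<psi> \<in> future a"
  defines "f \<equiv> \<lambda>\<omega>. 1 + cos (t * \<xi> \<psi> \<omega> + q)"
  assumes Es: "set Es \<subseteq> past_events a" and W: "W \<in> past_span a"
  shows "(\<integral>\<omega>. indicator (foldr (\<inter>) Es (space M)) \<omega> * f \<omega> * cos (W \<omega> + p) \<partial>M) =
    (\<integral>\<omega>. f \<omega> \<partial>M) * (\<integral>\<omega>. indicator (foldr (\<inter>) Es (space M)) \<omega> * cos (W \<omega> + p) \<partial>M)"
  using Es W
proof (induction Es arbitrary: W p)
  case Nil
  have psi: "\<psi> \<in> noise_test" using assms(1) by (simp add: future_def)
  note [measurable] = noise_measurable[OF psi] past_span_measurable[OF Nil(2)]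
  have i: "integrable M (\<lambda>\<omega>. cos (W \<omega> + p))" "integrable M (\<lambda>\<omega>. cos (t * \<xi> \<psi> \<omega> + q))"
    "integrable M (\<lambda>\<omega>. cos (W \<omega> + p) * cos (t * \<xi> \<psi> \<omega> + q))"
    by (rule integrable_const_bound[where B=1]; auto simp: abs_mult mult_le_one)+
  have "(\<integral>\<omega>. indicator (space M) \<omega> * f \<omega> * cos (W \<omega> + p) \<partial>M) =
     (\<integral>\<omega>. cos (W \<omega> + p) + cos (W \<omega> + p) * cos (t * \<xi> \<psi> \<omega> + q) \<partial>M)"
    by (intro Bochner_Integration.integral_cong) (auto simp: f_def algebra_simps)
  also have "\<dots> = (\<integral>\<omega>. f \<omega> \<partial>M) * (\<integral>\<omega>. cos (W \<omega> + p) \<partial>M)"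
    using i past_span_cos[OF Nil(2) assms(1)] by (simp add: f_def prob_space algebra_simps)
  also have "(\<integral>\<omega>. cos (W \<omega> + p) \<partial>M) = (\<integral>\<omega>. indicator (space M) \<omega> * cos (W \<omega> + p) \<partial>M)"
    by (intro Bochner_Integration.integral_cong) auto
  finally show ?case by simp
next
  case (Cons E Es)
  let ?D = "foldr (\<inter>) Es (space M)"
  have psi: "\<psi> \<in> noise_test" using assms(1) by (simp add: future_def)
  note [measurable] = noise_measurable[OF psi]
  have f01: "0 \<le> f \<omega>" "\<bar>f \<omega>\<bar> \<le> 2" for \<omega>
    using cos_ge_minus_one[of "t * \<xi> \<psi> \<omega> + q"] cos_le_one[of "t * \<xi> \<psi> \<omega> + q"] unfolding f_def by linarith+
  have fm[measurable]: "f \<in> borel_measurable M" by (simp add: f_def)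
  have Dm[measurable]: "?D \<in> sets M"
    using Cons.prems(1) past_events_sets[of a] by (induction Es) auto
  note IH = Cons.IH
  have IH: "(\<integral>\<omega>. indicator ?D \<omega> * f \<omega> * cos (W \<omega> + p) \<partial>M) = (\<integral>\<omega>. f \<omega> \<partial>M) * (\<integral>\<omega>. indicator ?D \<omega> * cos (W \<omega> + p) \<partial>M)"
    if "W \<in> past_span a" for W p
    using Cons that by simp
  define m where "m = (\<integral>\<omega>. f \<omega> \<partial>M)"
  have m: "0 \<le> m" using f01 by (simp add: m_def)
  have E: "E \<in> past_events a" using Cons.prems by simp
  have Em[measurable]: "E \<in> sets M" using E past_events_sets by blast
  show ?case
  proof (cases "E \<in> null_sets M")
    case True
    then have "AE \<omega> in M. \<omega> \<notin> E" by (rule AE_not_in)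
    then have z: "AE \<omega> in M. indicator (E \<inter> ?D) \<omega> = (0::real)" by eventually_elim simp
    note [measurable] = past_span_measurable[OF Cons.prems(2)]
    have "(\<integral>\<omega>. indicator (E \<inter> ?D) \<omega> * f \<omega> * cos (W \<omega> + p) \<partial>M) = (\<integral>\<omega>. 0 \<partial>M)"
      "(\<integral>\<omega>. indicator (E \<inter> ?D) \<omega> * cos (W \<omega> + p) \<partial>M) = (\<integral>\<omega>. 0 \<partial>M)"
      using z by (intro integral_cong_AE; force)+
    then show ?thesis by simp
  next
    case False
    then obtain \<phi> B where EB: "E = \<xi> \<phi> -` B \<inter> space M" and phi: "\<phi> \<in> past a" and B[measurable]: "B \<in> sets borel"
      using E by (auto simp: past_events_def)
    have [measurable]: "\<xi> \<phi> \<in> borel_measurable M" using phi by (simp add: past_def noise_measurable)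
    have bd: "integrable M (\<lambda>\<omega>. indicator ?D \<omega> * g \<omega>)"
      if "g \<in> borel_measurable M" "\<And>\<omega>. \<bar>g \<omega>\<bar> \<le> C" for g :: "'a \<Rightarrow> real" and C
      by (rule integrable_const_bound[where B="\<bar>C\<bar>"])
         (use that in \<open>auto simp: indicator_def intro: order_trans[OF _ abs_ge_self]\<close>)
    have fc: "\<bar>f \<omega> * cos x\<bar> \<le> 2" for \<omega> x
      using mult_mono[OF f01(2)[of \<omega>] abs_cos_le_one[of x]] by (simp add: abs_mult)
    have key: "(\<integral>\<omega>. indicator ?D \<omega> * (f \<omega> * w \<omega>) * indicator B (\<xi> \<phi> \<omega>) \<partial>M) =
       (\<integral>\<omega>. indicator ?D \<omega> * (m * w \<omega>) * indicator B (\<xi> \<phi> \<omega>) \<partial>M)"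
      if [measurable]: "w \<in> borel_measurable M" and w: "\<And>\<omega>. 0 \<le> w \<omega>" "\<And>\<omega>. \<bar>w \<omega>\<bar> \<le> 2" and
         ch: "\<And>s q. (\<integral>\<omega>. indicator ?D \<omega> * (f \<omega> * w \<omega>) * cos (s * \<xi> \<phi> \<omega> + q) \<partial>M) =
                  (\<integral>\<omega>. indicator ?D \<omega> * (m * w \<omega>) * cos (s * \<xi> \<phi> \<omega> + q) \<partial>M)" for w
    proof (rule weighted_distribution_eqI)
      have "\<bar>f \<omega> * w \<omega>\<bar> \<le> 2 * 2" for \<omega> unfolding abs_mult by (rule mult_mono) (use w f01 in auto)
      then show "integrable M (\<lambda>\<omega>. indicator ?D \<omega> * (f \<omega> * w \<omega>))" by (intro bd[of _ 4]) auto
      have "\<bar>m * w \<omega>\<bar> \<le> m * 2" for \<omega> unfolding abs_mult using m w(2)[of \<omega>] by (simp add: mult_left_mono)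
      then show "integrable M (\<lambda>\<omega>. indicator ?D \<omega> * (m * w \<omega>))" by (intro bd[of _ "m * 2"]) auto
    qed (use w m f01 ch in auto)
    \<comment> \<open>Product-to-sum formulas merge the cosine of \<open>s * \<xi> \<phi>\<close>
      with that of \<open>W\<close> into cosines of \<open>W + s * \<xi> \<phi>\<close> and
      \<open>W - s * \<xi> \<phi>\<close>. Both are again in \<open>past_span\<close>, so the
      induction hypothesis applies.\<close>
    have cosint: "(\<integral>\<omega>. indicator ?D \<omega> * (f \<omega> * (c + d * cos (W \<omega> + p))) * cos (s * \<xi> \<phi> \<omega> + q) \<partial>M) =
                  (\<integral>\<omega>. indicator ?D \<omega> * (m * (c + d * cos (W \<omega> + p))) * cos (s * \<xi> \<phi> \<omega> + q) \<partial>M)" for c d s q p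
    proof -
      note W[measurable] = past_span_measurable[OF Cons.prems(2)]
      have Z: "(\<lambda>\<omega>. 0) \<in> past_span a" unfolding past_span_def
        by (intro CollectI exI[of _ 0]) auto
      have sp: "(\<lambda>\<omega>. s * \<xi> \<phi> \<omega>) \<in> past_span a" "(\<lambda>\<omega>. W \<omega> + s * \<xi> \<phi> \<omega>) \<in> past_span a" "(\<lambda>\<omega>. W \<omega> + (-s) * \<xi> \<phi> \<omega>) \<in> past_span a"
        using past_span_add[OF Z phi, of s] past_span_add[OF Cons.prems(2) phi, of s] past_span_add[OF Cons.prems(2) phi, of "-s"] by simp_all
      note I = IH[OF sp(1), of q] IH[OF sp(2), of "p + q"] IH[OF sp(3), of "p - q"]
      have bf: "integrable M (\<lambda>\<omega>. indicator ?D \<omega> * f \<omega> * cos (g \<omega>))" if "g \<in> borel_measurable M" for g :: "'a \<Rightarrow> real"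
        using bd[of "\<lambda>\<omega>. f \<omega> * cos (g \<omega>)" 2] that fc by (auto simp: mult.assoc)
      have bg: "integrable M (\<lambda>\<omega>. indicator ?D \<omega> * cos (g \<omega>))" if "g \<in> borel_measurable M" for g :: "'a \<Rightarrow> real"
        using bd[of "\<lambda>\<omega>. cos (g \<omega>)" 1] that by simp
      have tr: "(c + d * cos (W \<omega> + p)) * cos (s * \<xi> \<phi> \<omega> + q) = c * cos (s * \<xi> \<phi> \<omega> + q) +
          d / 2 * cos (W \<omega> + s * \<xi> \<phi> \<omega> + (p + q)) + d / 2 * cos (W \<omega> + (-s) * \<xi> \<phi> \<omega> + (p - q))" for \<omega>
      proof -
        have *: "cos (W \<omega> + s * \<xi> \<phi> \<omega> + (p + q)) = cos ((W \<omega> + p) + (s * \<xi> \<phi> \<omega> + q))"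
          "cos (W \<omega> + (-s) * \<xi> \<phi> \<omega> + (p - q)) = cos ((W \<omega> + p) - (s * \<xi> \<phi> \<omega> + q))"
          by (simp_all add: algebra_simps)
        show ?thesis unfolding * cos_add[of "W \<omega> + p"] cos_diff[of "W \<omega> + p"] by (simp add: algebra_simps)
      qed
      have "(\<integral>\<omega>. indicator ?D \<omega> * (f \<omega> * (c + d * cos (W \<omega> + p))) * cos (s * \<xi> \<phi> \<omega> + q) \<partial>M) =
        (\<integral>\<omega>. c * (indicator ?D \<omega> * f \<omega> * cos (s * \<xi> \<phi> \<omega> + q)) +
          d / 2 * (indicator ?D \<omega> * f \<omega> * cos (W \<omega> + s * \<xi> \<phi> \<omega> + (p + q))) +
          d / 2 * (indicator ?D \<omega> * f \<omega> * cos (W \<omega> + (-s) * \<xi> \<phi> \<omega> + (p - q))) \<partial>M)"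
        by (intro Bochner_Integration.integral_cong refl) (simp only: mult.assoc tr, simp add: algebra_simps)
      also have "\<dots> = m * (\<integral>\<omega>. c * (indicator ?D \<omega> * cos (s * \<xi> \<phi> \<omega> + q)) +
          d / 2 * (indicator ?D \<omega> * cos (W \<omega> + s * \<xi> \<phi> \<omega> + (p + q))) +
          d / 2 * (indicator ?D \<omega> * cos (W \<omega> + (-s) * \<xi> \<phi> \<omega> + (p - q))) \<partial>M)"
      proof -
        have lin: "(\<integral>\<omega>. c * A \<omega> + d / 2 * B \<omega> + d / 2 * C \<omega> \<partial>M) = c * (\<integral>\<omega>. A \<omega> \<partial>M) + d / 2 * (\<integral>\<omega>. B \<omega> \<partial>M) + d / 2 * (\<integral>\<omega>. C \<omega> \<partial>M)"
          if "integrable M A" "integrable M B" "integrable M C" for A B C :: "'a \<Rightarrow> real" using that by simp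
        have A: "(\<lambda>\<omega>. s * \<xi> \<phi> \<omega> + q) \<in> borel_measurable M" "(\<lambda>\<omega>. W \<omega> + s * \<xi> \<phi> \<omega> + (p + q)) \<in> borel_measurable M"
          "(\<lambda>\<omega>. W \<omega> + - s * \<xi> \<phi> \<omega> + (p - q)) \<in> borel_measurable M" by measurable
        show ?thesis
          unfolding lin[OF bf bf bf, OF A] lin[OF bg bg bg, OF A] I m_def[symmetric] by (simp only: algebra_simps)
      qed
      also have "\<dots> = (\<integral>\<omega>. m * (c * (indicator ?D \<omega> * cos (s * \<xi> \<phi> \<omega> + q)) +
          d / 2 * (indicator ?D \<omega> * cos (W \<omega> + s * \<xi> \<phi> \<omega> + (p + q))) +
          d / 2 * (indicator ?D \<omega> * cos (W \<omega> + (-s) * \<xi> \<phi> \<omega> + (p - q)))) \<partial>M)" by simp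
      also have "\<dots> = (\<integral>\<omega>. indicator ?D \<omega> * (m * (c + d * cos (W \<omega> + p))) * cos (s * \<xi> \<phi> \<omega> + q) \<partial>M)"
        by (intro Bochner_Integration.integral_cong refl) (simp only: mult.assoc tr, simp add: algebra_simps)
      finally show ?thesis .
    qed
    note W[measurable] = past_span_measurable[OF Cons.prems(2)]
    have w01: "0 \<le> 1 + cos x" "\<bar>1 + cos x\<bar> \<le> 2" for x :: real
      using cos_ge_minus_one[of x] cos_le_one[of x] by linarith+
    \<comment> \<open>The weight in \<open>key\<close> must be nonnegative, so the cosine of
      \<open>W + p\<close> is reached as the difference of the weights
      \<open>1 + cos (W + p)\<close> and 1.\<close>
    have k1: "(\<integral>\<omega>. indicator ?D \<omega> * (f \<omega> * (1 + cos (W \<omega> + p))) * indicator B (\<xi> \<phi> \<omega>) \<partial>M) =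
       (\<integral>\<omega>. indicator ?D \<omega> * (m * (1 + cos (W \<omega> + p))) * indicator B (\<xi> \<phi> \<omega>) \<partial>M)"
      using cosint[of 1 1 p] w01 by (intro key) auto
    have k2: "(\<integral>\<omega>. indicator ?D \<omega> * (f \<omega> * 1) * indicator B (\<xi> \<phi> \<omega>) \<partial>M) =
       (\<integral>\<omega>. indicator ?D \<omega> * (m * 1) * indicator B (\<xi> \<phi> \<omega>) \<partial>M)"
      using cosint[of 1 0 0] by (intro key) auto
    have ie: "indicator (E \<inter> ?D) \<omega> = (indicator ?D \<omega> * indicator B (\<xi> \<phi> \<omega>) :: real)" if "\<omega> \<in> space M" for \<omega>
      using that by (auto simp: EB indicator_def)
    have bdB: "integrable M (\<lambda>\<omega>. indicator ?D \<omega> * g \<omega> * indicator B (\<xi> \<phi> \<omega>))"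
      if "g \<in> borel_measurable M" "\<And>\<omega>. \<bar>g \<omega>\<bar> \<le> C" for g :: "'a \<Rightarrow> real" and C
      by (rule integrable_const_bound[where B="\<bar>C\<bar>"])
         (use that in \<open>auto simp: indicator_def intro: order_trans[OF _ abs_ge_self]\<close>)
    have "(\<integral>\<omega>. indicator (E \<inter> ?D) \<omega> * f \<omega> * cos (W \<omega> + p) \<partial>M) =
      (\<integral>\<omega>. indicator ?D \<omega> * (f \<omega> * (1 + cos (W \<omega> + p))) * indicator B (\<xi> \<phi> \<omega>)
         - indicator ?D \<omega> * (f \<omega> * 1) * indicator B (\<xi> \<phi> \<omega>) \<partial>M)"
      by (intro Bochner_Integration.integral_cong refl) (simp add: ie algebra_simps)
    also have "\<dots> = (\<integral>\<omega>. indicator ?D \<omega> * (m * (1 + cos (W \<omega> + p))) * indicator B (\<xi> \<phi> \<omega>) \<partial>M)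
         - (\<integral>\<omega>. indicator ?D \<omega> * (m * 1) * indicator B (\<xi> \<phi> \<omega>) \<partial>M)"
    proof (subst Bochner_Integration.integral_diff)
      have "\<bar>f \<omega> * (1 + cos x)\<bar> \<le> 2 * 2" for \<omega> x unfolding abs_mult by (rule mult_mono) (use w01 f01 in auto)
      then show "integrable M (\<lambda>\<omega>. indicator ?D \<omega> * (f \<omega> * (1 + cos (W \<omega> + p))) * indicator B (\<xi> \<phi> \<omega>))"
        by (intro bdB[of _ 4]) auto
    qed (use k1 k2 bdB[of f 2] f01 in auto)
    also have "\<dots> = (\<integral>\<omega>. indicator ?D \<omega> * (m * (1 + cos (W \<omega> + p))) * indicator B (\<xi> \<phi> \<omega>)
         - indicator ?D \<omega> * (m * 1) * indicator B (\<xi> \<phi> \<omega>) \<partial>M)"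
    proof (subst Bochner_Integration.integral_diff)
      have "\<bar>m * (1 + cos x)\<bar> \<le> m * 2" for x unfolding abs_mult using m w01(2)[of x] by (simp add: mult_left_mono)
      then show "integrable M (\<lambda>\<omega>. indicator ?D \<omega> * (m * (1 + cos (W \<omega> + p))) * indicator B (\<xi> \<phi> \<omega>))"
        by (intro bdB[of _ "m * 2"]) auto
    qed (use bdB[of "\<lambda>_. m" m] m in auto)
    also have "\<dots> = (\<integral>\<omega>. m * (indicator (E \<inter> ?D) \<omega> * cos (W \<omega> + p)) \<partial>M)"
      by (intro Bochner_Integration.integral_cong refl) (simp add: ie algebra_simps)
    finally show ?thesis by (simp add: m_def)
  qed
qed

lemma foldr_Int_append: "foldr (\<inter>) (As @ Bs) S = foldr (\<inter>) As S \<inter> foldr (\<inter>) Bs (S :: 'b set)"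
  if "\<And>A. A \<in> set As \<union> set Bs \<Longrightarrow> A \<subseteq> S"
proof -
  have "foldr (\<inter>) Bs S \<subseteq> S" by (induction Bs) auto
  then show ?thesis by (induction As) auto
qed

text \<open>Finite intersections of generating events are an intersection-stable generator, and with
  the nonnegative weight \<open>f\<close> both sides are finite measures in \<open>A\<close>. The
  induction starts from \<open>past_events_uncorrelated\<close> with \<open>W = 0\<close> and phase
  0; the summand 1 in \<open>f\<close> is subtracted at the end.\<close>

lemma past_uncorrelated:
  assumes psi: "\<psi> \<in> future a" and A: "A \<in> sets (noise_filtration M \<xi> a)"
  shows "(\<integral>\<omega>. indicator A \<omega> * cos (t * \<xi> \<psi> \<omega> + q) \<partial>M) = prob A * (\<integral>\<omega>. cos (t * \<xi> \<psi> \<omega> + q) \<partial>M)"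
proof -
  define f where "f = (\<lambda>\<omega>. 1 + cos (t * \<xi> \<psi> \<omega> + q))"
  define P where "P = {foldr (\<inter>) Es (space M) | Es. set Es \<subseteq> past_events a}"
  have [measurable]: "\<xi> \<psi> \<in> borel_measurable M" using psi by (simp add: future_def noise_measurable)
  have fm[measurable]: "f \<in> borel_measurable M" by (simp add: f_def)
  have f01: "0 \<le> f \<omega>" "\<bar>f \<omega>\<bar> \<le> 2" for \<omega>
    using cos_ge_minus_one[of "t * \<xi> \<psi> \<omega> + q"] cos_le_one[of "t * \<xi> \<psi> \<omega> + q"] unfolding f_def by linarith+
  have fi: "integrable M f" by (rule integrable_const_bound[where B=2]) (use f01 in auto)
  have fiA: "integrable M (\<lambda>\<omega>. indicator A \<omega> * f \<omega>)" if "A \<in> sets M" for A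
    using integrable_real_mult_indicator[OF that fi] by (simp add: mult.commute)
  have sub: "past_events a \<subseteq> P" 
    unfolding P_def using past_events_sets[of a] sets.sets_into_space[of _ M]
    by (auto intro!: exI[of _ "[_]"])
  have Psets: "P \<subseteq> sigma_sets (space M) (past_events a)"
  proof -
    have pe: "past_events a \<subseteq> Pow (space M)"
      using past_events_sets[of a] sets.sets_into_space[of _ M] by blast
    interpret S: sigma_algebra "space M" "sigma_sets (space M) (past_events a)"
      using pe by (rule sigma_algebra_sigma_sets)
    have "foldr (\<inter>) Es (space M) \<in> sigma_sets (space M) (past_events a)" if "set Es \<subseteq> past_events a" for Es
      using that by (induction Es) auto
    then show ?thesis by (auto simp: P_def)
  qed
  have eq: "sigma_sets (space M) (past_events a) = sigma_sets (space M) P"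
    using sub Psets by (intro sigma_sets_eqI) auto
  have Pm: "P \<subseteq> sets M" using Psets filtration_subalgebra[of a] by (simp add: sets_filtration)
  have "Int_stable P"
  proof (rule Int_stableI)
    fix A B assume "A \<in> P" "B \<in> P"
    then obtain Es Fs where *: "A = foldr (\<inter>) Es (space M)" "set Es \<subseteq> past_events a"
      "B = foldr (\<inter>) Fs (space M)" "set Fs \<subseteq> past_events a" by (auto simp: P_def)
    have "A \<inter> B = foldr (\<inter>) (Es @ Fs) (space M)"
      unfolding * using * past_events_sets[of a] sets.sets_into_space[of _ M]
      by (intro foldr_Int_append[symmetric]) blast
    then show "A \<inter> B \<in> P" using * by (auto simp: P_def intro!: exI[of _ "Es @ Fs"])
  qed
  moreover have "P \<subseteq> Pow (space M)" using Pm sets.sets_into_space by blast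
  moreover have "A \<in> sigma_sets (space M) P" using A eq by (simp add: sets_filtration)
  ultimately have "(\<integral>\<omega>. indicator A \<omega> * f \<omega> \<partial>M) = prob A * (\<integral>\<omega>. f \<omega> \<partial>M)"
  proof (induction rule: sigma_sets_induct_disjoint)
    case (basic A)
    then obtain Es where Es: "A = foldr (\<inter>) Es (space M)" "set Es \<subseteq> past_events a" by (auto simp: P_def)
    have "(\<lambda>\<omega>. 0) \<in> past_span a" unfolding past_span_def by (intro CollectI exI[of _ 0]) auto
    note past_events_uncorrelated[OF psi Es(2) this, of t q 0]
    moreover have "A \<in> sets M" using basic Pm by blast
    ultimately show ?case by (simp add: f_def Es mult.commute)
  next
    case empty
    then show ?case by simp
  next
    case (compl A)
    then have [measurable]: "A \<in> sets M"
      using filtration_subalgebra[of a] by (auto simp: sets_filtration eq)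
    have "(\<integral>\<omega>. indicator (space M - A) \<omega> * f \<omega> \<partial>M) = (\<integral>\<omega>. f \<omega> - indicator A \<omega> * f \<omega> \<partial>M)"
      by (intro Bochner_Integration.integral_cong) (auto simp: indicator_def)
    also have "\<dots> = (\<integral>\<omega>. f \<omega> \<partial>M) - prob A * (\<integral>\<omega>. f \<omega> \<partial>M)"
      using compl fi fiA by simp
    finally show ?case by (simp add: prob_compl algebra_simps)
  next
    case (union A)
    then have [measurable]: "A i \<in> sets M" for i
      using filtration_subalgebra[of a] by (auto simp: sets_filtration eq)
    have "(\<lambda>i. (\<integral>\<omega>. indicator (A i) \<omega> *\<^sub>R f \<omega> \<partial>M)) sums (\<integral>\<omega>. indicator (\<Union>i. A i) \<omega> *\<^sub>R f \<omega> \<partial>M)"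
    proof -
      have "set_lebesgue_integral M (\<Union>i. A i) f = (\<Sum>i. set_lebesgue_integral M (A i) f)"
        "summable (\<lambda>i. set_lebesgue_integral M (A i) f)"
      proof -
        have si: "set_integrable M (\<Union>i. A i) f"
          using fiA[of "\<Union>i. A i"] by (simp add: set_integrable_def)
        show "set_lebesgue_integral M (\<Union>i. A i) f = (\<Sum>i. set_lebesgue_integral M (A i) f)"
          using union(1) by (intro lebesgue_integral_countable_add[OF _ _ si]) (auto simp: disjoint_family_on_def)
        have e: "set_lebesgue_integral M (A i) f = prob (A i) * (\<integral>\<omega>. f \<omega> \<partial>M)" for i
          using union(3)[of i] by (simp add: set_lebesgue_integral_def)
        have "(\<lambda>i. prob (A i)) sums prob (\<Union>i. A i)"
          using union(1) by (intro finite_measure_UNION) auto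
        then show "summable (\<lambda>i. set_lebesgue_integral M (A i) f)"
          unfolding e by (intro summable_mult2) (simp add: sums_iff)
      qed
      then show ?thesis by (simp add: set_lebesgue_integral_def sums_iff)
    qed
    moreover have "(\<lambda>i. prob (A i) * (\<integral>\<omega>. f \<omega> \<partial>M)) sums (prob (\<Union>i. A i) * (\<integral>\<omega>. f \<omega> \<partial>M))"
      using union(1) by (intro sums_mult2 finite_measure_UNION) auto
    ultimately show ?case using union(3) by (simp add: sums_unique2)
  qed
  moreover have Am[measurable]: "A \<in> sets M" using A filtration_subalgebra by blast
  moreover have "integrable M (\<lambda>\<omega>. indicator A \<omega> * cos (t * \<xi> \<psi> \<omega> + q))" "integrable M (\<lambda>\<omega>. cos (t * \<xi> \<psi> \<omega> + q))"
    by (rule integrable_const_bound[where B=1]; auto simp: indicator_def)+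
  moreover have "integrable M (\<lambda>\<omega>. indicator A \<omega> :: real)"
    by (rule integrable_const_bound[where B=1]) (auto simp: indicator_def)
  ultimately show ?thesis by (simp add: f_def distrib_left prob_space)
qed

text \<open>For a past event \<open>A\<close>, the weight \<open>indicator A\<close> and the
  constant weight \<open>prob A\<close> give the future variable the same cosine integrals, hence
  the same weighted law. That is independence.\<close>

lemma indep_past_future:
  assumes psi: "\<psi> \<in> future a" and X: "X \<in> borel_measurable (noise_filtration M \<xi> a)"
  shows "indep_var borel X borel (\<xi> \<psi>)"
proof -
  have gm[measurable]: "\<xi> \<psi> \<in> borel_measurable M" using psi by (simp add: future_def noise_measurable)
  have Xm[measurable]: "X \<in> borel_measurable M"
    using X by (rule measurable_from_subalg[rotated]) (simp add: subalgebra_def filtration_subalgebra)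
  have ind: "prob (A \<inter> (\<xi> \<psi> -` B \<inter> space M)) = prob A * prob (\<xi> \<psi> -` B \<inter> space M)"
    if A: "A \<in> sets (noise_filtration M \<xi> a)" and [measurable]: "B \<in> sets borel" for A B
  proof -
    have [measurable]: "A \<in> sets M" using A filtration_subalgebra by blast
    have "(\<integral>\<omega>. indicator A \<omega> * indicator B (\<xi> \<psi> \<omega>) \<partial>M) = (\<integral>\<omega>. prob A * indicator B (\<xi> \<psi> \<omega>) \<partial>M)"
    proof (rule weighted_distribution_eqI)
      show "integrable M (\<lambda>\<omega>. indicator A \<omega> :: real)"
        by (rule integrable_const_bound[where B=1]) (auto simp: indicator_def)
    qed (auto simp: past_uncorrelated[OF psi A])
    also have "(\<integral>\<omega>. indicator A \<omega> * indicator B (\<xi> \<psi> \<omega>) \<partial>M :: real) = (\<integral>\<omega>. indicator (A \<inter> (\<xi> \<psi> -` B \<inter> space M)) \<omega> \<partial>M)"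
      by (intro Bochner_Integration.integral_cong) (simp_all add: indicator_def)
    also have "(\<integral>\<omega>. prob A * indicator B (\<xi> \<psi> \<omega>) \<partial>M) = (\<integral>\<omega>. prob A * indicator (\<xi> \<psi> -` B \<inter> space M) \<omega> \<partial>M)"
      by (intro Bochner_Integration.integral_cong) (auto simp: indicator_def)
    finally show ?thesis by simp
  qed
  have sX: "sigma_sets (space M) {X -` A \<inter> space M |A. A \<in> sets borel} \<subseteq> sets (noise_filtration M \<xi> a)"
    using measurable_sets[OF X] by (intro sets.sigma_sets_subset[of _ "noise_filtration M \<xi> a", simplified]) auto
  have sG: "sigma_sets (space M) {\<xi> \<psi> -` A \<inter> space M |A. A \<in> sets borel} = {\<xi> \<psi> -` A \<inter> space M |A. A \<in> sets borel}"
    using sets_vimage_algebra2[of "\<xi> \<psi>" "space M" borel] unfolding sets_vimage_algebra by simp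
  show ?thesis
    unfolding indep_var_eq indep_sets2_eq using sX filtration_subalgebra[of a] ind unfolding sG by auto
qed

end

section \<open>Limits in the space of square integrable functions\<close>

text \<open>The parameter \<open>e\<close> lets the factor of the first square approach 1. With the
  fixed factor 2, an isometry would pass to the limit only up to a constant.\<close>

lemma square_add_le:
  fixes a b e :: real
  assumes "0 < e"
  shows "(a + b)\<^sup>2 \<le> (1 + e) * a\<^sup>2 + (1 + 1 / e) * b\<^sup>2"
proof -
  have "0 \<le> (sqrt e * a - b / sqrt e)\<^sup>2" by simp
  also have "\<dots> = e * a\<^sup>2 - 2 * a * b + b\<^sup>2 / e"
    using assms by (simp add: power2_diff power_mult_distrib power_divide)
  finally show ?thesis by (simp add: power2_sum algebra_simps)
qed

lemma nn_integral_square_add_le: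
  fixes f g :: "'b \<Rightarrow> real"
  assumes [measurable]: "f \<in> borel_measurable N" "g \<in> borel_measurable N" and e: "0 < e"
  shows "(\<integral>\<^sup>+x. ennreal ((f x + g x)\<^sup>2) \<partial>N) \<le>
    ennreal (1 + e) * (\<integral>\<^sup>+x. ennreal ((f x)\<^sup>2) \<partial>N) + ennreal (1 + 1 / e) * (\<integral>\<^sup>+x. ennreal ((g x)\<^sup>2) \<partial>N)"
proof -
  have "(\<integral>\<^sup>+x. ennreal ((f x + g x)\<^sup>2) \<partial>N) \<le> (\<integral>\<^sup>+x. ennreal (1 + e) * ennreal ((f x)\<^sup>2) + ennreal (1 + 1 / e) * ennreal ((g x)\<^sup>2) \<partial>N)"
    using square_add_le[OF e] e
    by (intro nn_integral_mono) (simp add: ennreal_mult[symmetric] ennreal_plus[symmetric] del: ennreal_plus)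
  then show ?thesis by (simp add: nn_integral_add nn_integral_cmult)
qed

lemma nn_integral_square_add_le2:
  fixes f g :: "'b \<Rightarrow> real"
  assumes [measurable]: "f \<in> borel_measurable N" "g \<in> borel_measurable N"
  shows "(\<integral>\<^sup>+x. ennreal ((f x + g x)\<^sup>2) \<partial>N) \<le>
    2 * (\<integral>\<^sup>+x. ennreal ((f x)\<^sup>2) \<partial>N) + 2 * (\<integral>\<^sup>+x. ennreal ((g x)\<^sup>2) \<partial>N)"
  using nn_integral_square_add_le[OF assms, of 1] by simp

lemma ennreal_le_of_le_multiples:
  fixes A B :: ennreal
  assumes "\<And>e::real. 0 < e \<Longrightarrow> A \<le> ennreal ((1 + e)\<^sup>2) * B"
  shows "A \<le> B"
proof (rule LIMSEQ_le_const)
  have "(\<lambda>n. ennreal ((1 + 1 / real (Suc n))\<^sup>2) * B) \<longlonglongrightarrow> ennreal ((1 + 0)\<^sup>2) * B"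
    by (intro tendsto_mult_ennreal tendsto_ennrealI tendsto_intros LIMSEQ_Suc[OF lim_1_over_n]) auto
  then show "(\<lambda>n. ennreal ((1 + 1 / real (Suc n))\<^sup>2) * B) \<longlonglongrightarrow> B" by simp
  show "\<exists>N. \<forall>n\<ge>N. A \<le> ennreal ((1 + 1 / real (Suc n))\<^sup>2) * B" by (auto intro!: assms)
qed

text \<open>Two triangle inequalities with parameter \<open>e\<close> cost the factor (1 + e)^2 and
  error terms that vanish as \<open>n\<close> grows; afterwards \<open>e\<close> tends to 0.\<close>

lemma nn_integral_square_limit_le:
  fixes f :: "'b \<Rightarrow> real" and g :: "'c \<Rightarrow> real"
  assumes [measurable]: "\<And>n. F n \<in> borel_measurable N" "f \<in> borel_measurable N"
    "\<And>n. G n \<in> borel_measurable K" "g \<in> borel_measurable K"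
    and eq: "\<And>n. (\<integral>\<^sup>+x. ennreal ((F n x)\<^sup>2) \<partial>N) \<le> (\<integral>\<^sup>+x. ennreal ((G n x)\<^sup>2) \<partial>K)"
    and F: "(\<lambda>n. \<integral>\<^sup>+x. ennreal ((F n x - f x)\<^sup>2) \<partial>N) \<longlonglongrightarrow> 0"
    and G: "(\<lambda>n. \<integral>\<^sup>+x. ennreal ((G n x - g x)\<^sup>2) \<partial>K) \<longlonglongrightarrow> 0"
  shows "(\<integral>\<^sup>+x. ennreal ((f x)\<^sup>2) \<partial>N) \<le> (\<integral>\<^sup>+x. ennreal ((g x)\<^sup>2) \<partial>K)"
proof (rule ennreal_le_of_le_multiples)
  fix e :: real assume e: "0 < e"
  let ?A = "\<integral>\<^sup>+x. ennreal ((f x)\<^sup>2) \<partial>N" and ?B = "\<integral>\<^sup>+x. ennreal ((g x)\<^sup>2) \<partial>K"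
  let ?d = "\<lambda>n. \<integral>\<^sup>+x. ennreal ((F n x - f x)\<^sup>2) \<partial>N" and ?e = "\<lambda>n. \<integral>\<^sup>+x. ennreal ((G n x - g x)\<^sup>2) \<partial>K"
  let ?c = "ennreal (1 + e)" and ?k = "ennreal (1 + 1 / e)"
  have "?A \<le> ?c * (?c * ?B + ?k * ?e n) + ?k * ?d n" for n
  proof -
    have "?A \<le> ?c * (\<integral>\<^sup>+x. ennreal ((F n x)\<^sup>2) \<partial>N) + ?k * ?d n"
      using nn_integral_square_add_le[OF _ _ e, of "F n" N "\<lambda>x. f x - F n x"]
      by (simp add: power2_commute[of "f _"])
    also have "\<dots> \<le> ?c * (\<integral>\<^sup>+x. ennreal ((G n x)\<^sup>2) \<partial>K) + ?k * ?d n"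
      by (intro add_mono mult_left_mono eq) auto
    also have "\<dots> \<le> ?c * (?c * ?B + ?k * ?e n) + ?k * ?d n"
      using nn_integral_square_add_le[OF _ _ e, of g K "\<lambda>x. G n x - g x"]
      by (intro add_mono mult_left_mono) auto
    finally show ?thesis .
  qed
  moreover have "(\<lambda>n. ?c * (?c * ?B + ?k * ?e n) + ?k * ?d n) \<longlonglongrightarrow> ?c * (?c * ?B + ?k * 0) + ?k * 0"
    by (intro tendsto_add tendsto_const ennreal_tendsto_cmult F G) auto
  ultimately have "?A \<le> ?c * (?c * ?B + ?k * 0) + ?k * 0"
    by (intro LIMSEQ_le_const) auto
  then show "?A \<le> ennreal ((1 + e)\<^sup>2) * ?B"
    using e by (simp add: power2_eq_square ennreal_mult mult.assoc)
qed

lemma nn_integral_square_limit_eq: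
  fixes f :: "'b \<Rightarrow> real" and g :: "'c \<Rightarrow> real"
  assumes "\<And>n. F n \<in> borel_measurable N" "f \<in> borel_measurable N"
    "\<And>n. G n \<in> borel_measurable K" "g \<in> borel_measurable K"
    and eq: "\<And>n. (\<integral>\<^sup>+x. ennreal ((F n x)\<^sup>2) \<partial>N) = (\<integral>\<^sup>+x. ennreal ((G n x)\<^sup>2) \<partial>K)"
    and "(\<lambda>n. \<integral>\<^sup>+x. ennreal ((F n x - f x)\<^sup>2) \<partial>N) \<longlonglongrightarrow> 0"
    and "(\<lambda>n. \<integral>\<^sup>+x. ennreal ((G n x - g x)\<^sup>2) \<partial>K) \<longlonglongrightarrow> 0"
  shows "(\<integral>\<^sup>+x. ennreal ((f x)\<^sup>2) \<partial>N) = (\<integral>\<^sup>+x. ennreal ((g x)\<^sup>2) \<partial>K)"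
  using assms by (intro antisym nn_integral_square_limit_le[of F N f G K g] nn_integral_square_limit_le[of G K g F N f]) auto

section \<open>The Walsh isometry\<close>

lemma indicator_rectangle_noise_test:
  assumes "0 \<le> a" "A \<in> sets borel" "emeasure lborel A < \<infinity>"
  shows "indicator ({a<..b} \<times> A) \<in> noise_test"
proof -
  have [measurable]: "{a<..b} \<times> A \<in> sets (borel :: (real \<times> real) measure)"
    using assms unfolding borel_prod[symmetric] by auto
  have "emeasure lborel ({a<..b} \<times> A) = emeasure (lborel \<Otimes>\<^sub>M lborel) ({a<..b} \<times> A)"
    by (simp add: lborel_prod)
  also have "\<dots> < \<infinity>"
    using assms emeasure_bounded_finite[of "{a<..b}"]
    by (subst lborel.emeasure_pair_measure_Times) (auto simp: ennreal_mult_less_top)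
  finally have "integrable lborel (indicator ({a<..b} \<times> A) :: real \<times> real \<Rightarrow> real)"
    by (intro integrable_real_indicator) auto
  moreover have "(\<lambda>z. (indicator ({a<..b} \<times> A) z)\<^sup>2) = (indicator ({a<..b} \<times> A) :: real \<times> real \<Rightarrow> real)"
    by (auto simp: indicator_def fun_eq_iff)
  ultimately show ?thesis
    using assms by (auto simp: noise_test_def indicator_def)
qed

context noise
begin

lemma filtration_measurable[measurable_dest]:
  "X \<in> borel_measurable (noise_filtration M \<xi> a) \<Longrightarrow> X \<in> borel_measurable M"
  by (erule measurable_from_subalg[rotated]) (simp add: subalgebra_def filtration_subalgebra)

lemma filtration_measurable_mono:
  "X \<in> borel_measurable (noise_filtration M \<xi> a) \<Longrightarrow> a \<le> b \<Longrightarrow> X \<in> borel_measurable (noise_filtration M \<xi> b)"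
  by (erule measurable_from_subalg[rotated]) (simp add: subalgebra_def filtration_mono)

lemma past_measurable:
  assumes "\<phi> \<in> past a" shows "\<xi> \<phi> \<in> borel_measurable (noise_filtration M \<xi> a)"
  using assms by (intro measurableI)
    (auto simp: sets_filtration past_events_def intro!: sigma_sets.Basic)

lemma past_future_expectation:
  assumes psi: "\<psi> \<in> future a" and Y: "Y \<in> borel_measurable (noise_filtration M \<xi> a)" "integrable M Y"
    and f: "f \<in> borel_measurable borel" "integrable M (\<lambda>\<omega>. f (\<xi> \<psi> \<omega>))"
  shows "integrable M (\<lambda>\<omega>. Y \<omega> * f (\<xi> \<psi> \<omega>))"
    "(\<integral>\<omega>. Y \<omega> * f (\<xi> \<psi> \<omega>) \<partial>M) = (\<integral>\<omega>. Y \<omega> \<partial>M) * (\<integral>\<omega>. f (\<xi> \<psi> \<omega>) \<partial>M :: real)"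
proof -
  have "indep_var borel ((\<lambda>x. x) \<circ> Y) borel (f \<circ> \<xi> \<psi>)"
    using indep_past_future[OF psi Y(1)] f(1) by (intro indep_var_compose) auto
  then have i: "indep_var borel Y borel (\<lambda>\<omega>. f (\<xi> \<psi> \<omega>))" by (simp add: comp_def)
  show "integrable M (\<lambda>\<omega>. Y \<omega> * f (\<xi> \<psi> \<omega>))" using indep_var_integrable[OF i Y(2) f(2)] .
  show "(\<integral>\<omega>. Y \<omega> * f (\<xi> \<psi> \<omega>) \<partial>M) = (\<integral>\<omega>. Y \<omega> \<partial>M) * (\<integral>\<omega>. f (\<xi> \<psi> \<omega>) \<partial>M)"
    using indep_var_lebesgue_integral[OF i Y(2) f(2)] .
qed

lemma future_noise_test: "\<psi> \<in> future a \<Longrightarrow> \<psi> \<in> noise_test"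
  by (simp add: future_def)

text \<open>Independence from the past is available for one future variable at a time. Polarisation
  with the sum \<open>?s\<close> reduces the product to three squares, as the field is additive up
  to a null set.\<close>

lemma past_future_product:
  assumes phi: "\<phi> \<in> future a" and psi: "\<psi> \<in> future a" and W: "W \<in> borel_measurable (noise_filtration M \<xi> a)" "integrable M W"
  shows "integrable M (\<lambda>\<omega>. W \<omega> * (\<xi> \<phi> \<omega> * \<xi> \<psi> \<omega>))"
    "(\<integral>\<omega>. W \<omega> * (\<xi> \<phi> \<omega> * \<xi> \<psi> \<omega>) \<partial>M) = (\<integral>\<omega>. W \<omega> \<partial>M) * (\<integral>z. \<phi> z * \<psi> z \<partial>lborel)"
proof -
  note t = future_noise_test[OF phi] future_noise_test[OF psi]
  note [measurable] = noise_measurable[OF t(1)] noise_measurable[OF t(2)] filtration_measurable[OF W(1)]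
  have p: "integrable lborel (\<lambda>z. \<phi> z * \<psi> z)"
    using t by (intro integrable_mult_square) (auto simp: noise_test_def)
  let ?s = "\<lambda>z. \<phi> z + \<psi> z"
  have e: "(?s z)\<^sup>2 = (\<phi> z)\<^sup>2 + 2 * (\<phi> z * \<psi> z) + (\<psi> z)\<^sup>2" for z by (simp add: power2_sum)
  have s: "?s \<in> future a"
    using phi psi p unfolding future_def noise_test_def mem_Collect_eq e
    by (auto intro!: borel_measurable_add)
  have AEs: "AE \<omega> in M. \<xi> ?s \<omega> = \<xi> \<phi> \<omega> + \<xi> \<psi> \<omega>"
    using t future_noise_test[OF s] by (intro noise_add) auto
  have sq: "integrable M (\<lambda>\<omega>. W \<omega> * (\<xi> \<eta> \<omega>)\<^sup>2)" "(\<integral>\<omega>. W \<omega> * (\<xi> \<eta> \<omega>)\<^sup>2 \<partial>M) = (\<integral>\<omega>. W \<omega> \<partial>M) * (\<integral>z. (\<eta> z)\<^sup>2 \<partial>lborel)"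
    if "\<eta> \<in> future a" for \<eta>
  proof -
    have n: "\<eta> \<in> noise_test" using that by (rule future_noise_test)
    show "integrable M (\<lambda>\<omega>. W \<omega> * (\<xi> \<eta> \<omega>)\<^sup>2)" "(\<integral>\<omega>. W \<omega> * (\<xi> \<eta> \<omega>)\<^sup>2 \<partial>M) = (\<integral>\<omega>. W \<omega> \<partial>M) * (\<integral>z. (\<eta> z)\<^sup>2 \<partial>lborel)"
      using past_future_expectation[OF that W, of "\<lambda>x. x\<^sup>2"] noise_moments(3)[OF n n] noise_cov(2)[OF n n]
      by (simp_all add: power2_eq_square)
  qed
  have AEp: "AE \<omega> in M. (W \<omega> * (\<xi> ?s \<omega>)\<^sup>2 - W \<omega> * (\<xi> \<phi> \<omega>)\<^sup>2 - W \<omega> * (\<xi> \<psi> \<omega>)\<^sup>2) / 2 = W \<omega> * (\<xi> \<phi> \<omega> * \<xi> \<psi> \<omega>)"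
    using AEs by eventually_elim (simp add: power2_eq_square algebra_simps)
  have m: "(\<lambda>\<omega>. W \<omega> * (\<xi> \<phi> \<omega> * \<xi> \<psi> \<omega>)) \<in> borel_measurable M" by measurable
  note [measurable] = noise_measurable[OF future_noise_test[OF s]]
  show "integrable M (\<lambda>\<omega>. W \<omega> * (\<xi> \<phi> \<omega> * \<xi> \<psi> \<omega>))"
    using sq(1)[OF s] sq(1)[OF phi] sq(1)[OF psi] by (intro integrable_cong_AE_imp[OF _ m AEp]) auto
  have "(\<integral>\<omega>. W \<omega> * (\<xi> \<phi> \<omega> * \<xi> \<psi> \<omega>) \<partial>M) = (\<integral>\<omega>. (W \<omega> * (\<xi> ?s \<omega>)\<^sup>2 - W \<omega> * (\<xi> \<phi> \<omega>)\<^sup>2 - W \<omega> * (\<xi> \<psi> \<omega>)\<^sup>2) / 2 \<partial>M)"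
    using AEp by (intro integral_cong_AE) auto
  also have "\<dots> = (\<integral>\<omega>. W \<omega> \<partial>M) * ((\<integral>z. (?s z)\<^sup>2 \<partial>lborel) - (\<integral>z. (\<phi> z)\<^sup>2 \<partial>lborel) - (\<integral>z. (\<psi> z)\<^sup>2 \<partial>lborel)) / 2"
    using sq[OF s] sq[OF phi] sq[OF psi] by (simp add: algebra_simps)
  also have "(\<integral>z. (?s z)\<^sup>2 \<partial>lborel) = (\<integral>z. (\<phi> z)\<^sup>2 \<partial>lborel) + 2 * (\<integral>z. \<phi> z * \<psi> z \<partial>lborel) + (\<integral>z. (\<psi> z)\<^sup>2 \<partial>lborel)"
    unfolding e using t p by (simp add: noise_test_def)
  finally show "(\<integral>\<omega>. W \<omega> * (\<xi> \<phi> \<omega> * \<xi> \<psi> \<omega>) \<partial>M) = (\<integral>\<omega>. W \<omega> \<partial>M) * (\<integral>z. \<phi> z * \<psi> z \<partial>lborel)" by simp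
qed

text \<open>The rectangle that starts first is cut at time \<open>a'\<close>. Its early part is,
  like \<open>X\<close> and \<open>X'\<close>, known at time \<open>a'\<close>, so its product with
  the centred later noise has mean zero. Its late part, empty if \<open>b \<le> a'\<close>, and the
  other rectangle both lie in the future of \<open>a'\<close>, where
  \<open>past_future_product\<close> applies.\<close>

lemma simple_cell_product:
  assumes "0 \<le> a" "a \<le> a'" "A \<in> sets borel" "emeasure lborel A < \<infinity>" "A' \<in> sets borel" "emeasure lborel A' < \<infinity>"
    and X: "X \<in> borel_measurable (noise_filtration M \<xi> a)" "\<And>\<omega>. \<omega> \<in> space M \<Longrightarrow> \<bar>X \<omega>\<bar> \<le> C"
    and X': "X' \<in> borel_measurable (noise_filtration M \<xi> a')" "\<And>\<omega>. \<omega> \<in> space M \<Longrightarrow> \<bar>X' \<omega>\<bar> \<le> C'"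
  shows "integrable M (\<lambda>\<omega>. (X \<omega> * \<xi> (indicator ({a<..b} \<times> A)) \<omega>) * (X' \<omega> * \<xi> (indicator ({a'<..b'} \<times> A')) \<omega>))"
    "(\<integral>\<omega>. (X \<omega> * \<xi> (indicator ({a<..b} \<times> A)) \<omega>) * (X' \<omega> * \<xi> (indicator ({a'<..b'} \<times> A')) \<omega>) \<partial>M) =
      (\<integral>\<omega>. X \<omega> * X' \<omega> \<partial>M) * (\<integral>z. indicator ({a<..b} \<times> A) z * indicator ({a'<..b'} \<times> A') z \<partial>lborel)"
proof -
  define c where "c = max a' 0"
  let ?I = "\<lambda>a b A. indicator ({a<..b} \<times> A) :: real \<times> real \<Rightarrow> real"
  have nn: "?I a b A \<in> noise_test" "?I a' b' A' \<in> noise_test" "?I a (min b a') A \<in> noise_test" "?I a' b A \<in> noise_test"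
    using assms by (auto intro!: indicator_rectangle_noise_test)
  have past: "?I a (min b a') A \<in> past a'" and fut: "?I a' b A \<in> future a'" "?I a' b' A' \<in> future a'"
    using nn assms(1) by (auto simp: past_def future_def indicator_def)
  note [measurable] = noise_measurable[OF nn(1)] noise_measurable[OF nn(2)] noise_measurable[OF nn(3)] noise_measurable[OF nn(4)]
    filtration_measurable[OF X(1)] filtration_measurable[OF X'(1)] filtration_measurable_mono[OF X(1) assms(2)] past_measurable[OF past] X'(1)
  have sum: "?I a b A z = ?I a (min b a') A z + ?I a' b A z" for z
    using assms(2) by (cases z) (auto simp: indicator_def)
  have AEs: "AE \<omega> in M. \<xi> (?I a b A) \<omega> = \<xi> (?I a (min b a') A) \<omega> + \<xi> (?I a' b A) \<omega>"
    using nn sum by (intro noise_add) auto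
  have Wb: "\<bar>X \<omega> * X' \<omega>\<bar> \<le> \<bar>C\<bar> * \<bar>C'\<bar>" if "\<omega> \<in> space M" for \<omega>
    using X(2)[OF that] X'(2)[OF that] unfolding abs_mult by (intro mult_mono) auto
  have Wi: "integrable M (\<lambda>\<omega>. X \<omega> * X' \<omega>)"
    by (rule integrable_const_bound[where B="\<bar>C\<bar> * \<bar>C'\<bar>"]) (use Wb in auto)
  let ?Y = "\<lambda>\<omega>. X \<omega> * X' \<omega> * \<xi> (?I a (min b a') A) \<omega>"
  have Yi: "integrable M ?Y"
  proof (rule Bochner_Integration.integrable_bound)
    show "integrable M (\<lambda>\<omega>. \<bar>C\<bar> * \<bar>C'\<bar> * \<xi> (?I a (min b a') A) \<omega>)" using noise_moments(2)[OF nn(3) nn(3)] by simp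
    show "AE \<omega> in M. norm (?Y \<omega>) \<le> norm (\<bar>C\<bar> * \<bar>C'\<bar> * \<xi> (?I a (min b a') A) \<omega>)"
      using Wb by (auto simp: abs_mult intro!: AE_I2 mult_right_mono)
  qed measurable
  have Ym: "?Y \<in> borel_measurable (noise_filtration M \<xi> a')" by measurable
  note i1 = past_future_expectation[OF fut(2) Ym Yi, of "\<lambda>x. x"]
  have i1: "integrable M (\<lambda>\<omega>. ?Y \<omega> * \<xi> (?I a' b' A') \<omega>)" "(\<integral>\<omega>. ?Y \<omega> * \<xi> (?I a' b' A') \<omega> \<partial>M) = 0"
    using i1 noise_moments(2)[OF nn(2) nn(2)] noise_mean[OF nn(2)] by auto
  have "(\<lambda>\<omega>. X \<omega> * X' \<omega>) \<in> borel_measurable (noise_filtration M \<xi> a')" by measurable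
  note i2 = past_future_product[OF fut this Wi]
  have AEp: "AE \<omega> in M. ?Y \<omega> * \<xi> (?I a' b' A') \<omega> + X \<omega> * X' \<omega> * (\<xi> (?I a' b A) \<omega> * \<xi> (?I a' b' A') \<omega>) =
    (X \<omega> * \<xi> (?I a b A) \<omega>) * (X' \<omega> * \<xi> (?I a' b' A') \<omega>)"
    using AEs by eventually_elim (simp add: algebra_simps)
  show "integrable M (\<lambda>\<omega>. (X \<omega> * \<xi> (?I a b A) \<omega>) * (X' \<omega> * \<xi> (?I a' b' A') \<omega>))"
    using i1 i2 by (intro integrable_cong_AE_imp[OF _ _ AEp]) auto
  have "(\<integral>\<omega>. (X \<omega> * \<xi> (?I a b A) \<omega>) * (X' \<omega> * \<xi> (?I a' b' A') \<omega>) \<partial>M) =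
     (\<integral>\<omega>. ?Y \<omega> * \<xi> (?I a' b' A') \<omega> + X \<omega> * X' \<omega> * (\<xi> (?I a' b A) \<omega> * \<xi> (?I a' b' A') \<omega>) \<partial>M)"
    using AEp by (intro integral_cong_AE) auto
  also have "\<dots> = (\<integral>\<omega>. X \<omega> * X' \<omega> \<partial>M) * (\<integral>z. ?I a' b A z * ?I a' b' A' z \<partial>lborel)"
    using i1 i2 by simp
  \<comment> \<open>The part cut off ends before the second rectangle begins and does not contribute
    to the overlap.\<close>
  also have "(\<lambda>z. ?I a' b A z * ?I a' b' A' z) = (\<lambda>z. ?I a b A z * ?I a' b' A' z)"
    using assms(2) by (auto simp: indicator_def fun_eq_iff)
  finally show "(\<integral>\<omega>. (X \<omega> * \<xi> (?I a b A) \<omega>) * (X' \<omega> * \<xi> (?I a' b' A') \<omega>) \<partial>M) =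
      (\<integral>\<omega>. X \<omega> * X' \<omega> \<partial>M) * (\<integral>z. ?I a b A z * ?I a' b' A' z \<partial>lborel)" .
qed

lemma simple_pair:
  assumes "0 \<le> a" "A \<in> sets borel" "emeasure lborel A < \<infinity>" "0 \<le> a'" "A' \<in> sets borel" "emeasure lborel A' < \<infinity>"
    and X: "X \<in> borel_measurable (noise_filtration M \<xi> a)" "\<And>\<omega>. \<omega> \<in> space M \<Longrightarrow> \<bar>X \<omega>\<bar> \<le> C"
    and X': "X' \<in> borel_measurable (noise_filtration M \<xi> a')" "\<And>\<omega>. \<omega> \<in> space M \<Longrightarrow> \<bar>X' \<omega>\<bar> \<le> C'"
  shows "integrable M (\<lambda>\<omega>. (X \<omega> * \<xi> (indicator ({a<..b} \<times> A)) \<omega>) * (X' \<omega> * \<xi> (indicator ({a'<..b'} \<times> A')) \<omega>)) \<and>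
    (\<integral>\<omega>. (X \<omega> * \<xi> (indicator ({a<..b} \<times> A)) \<omega>) * (X' \<omega> * \<xi> (indicator ({a'<..b'} \<times> A')) \<omega>) \<partial>M) =
      (\<integral>\<omega>. X \<omega> * X' \<omega> \<partial>M) * (\<integral>z. indicator ({a<..b} \<times> A) z * indicator ({a'<..b'} \<times> A') z \<partial>lborel)"
proof (cases "a \<le> a'")
  case True
  show ?thesis
    using simple_cell_product[OF assms(1) True assms(2,3,5,6) X X'] by blast
next
  case False
  then have "a' \<le> a" by simp
  note * = simple_cell_product[OF assms(4) this assms(5,6,2,3) X' X]
  show ?thesis using *[of b' b] by (simp add: mult.commute)
qed

lemma simple_term:
  assumes "0 \<le> a" "A \<in> sets borel" "emeasure lborel A < \<infinity>"
    and X: "X \<in> borel_measurable (noise_filtration M \<xi> a)" "integrable M X"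
  shows "integrable M (\<lambda>\<omega>. X \<omega> * \<xi> (indicator ({a<..b} \<times> A)) \<omega>)"
    "(\<integral>\<omega>. X \<omega> * \<xi> (indicator ({a<..b} \<times> A)) \<omega> \<partial>M) = 0"
proof -
  have n: "indicator ({a<..b} \<times> A) \<in> noise_test" using assms by (intro indicator_rectangle_noise_test)
  then have "indicator ({a<..b} \<times> A) \<in> future a" by (auto simp: future_def indicator_def)
  from past_future_expectation[OF this X, of "\<lambda>x. x"] noise_moments(2)[OF n n] noise_mean[OF n]
  show "integrable M (\<lambda>\<omega>. X \<omega> * \<xi> (indicator ({a<..b} \<times> A)) \<omega>)"
    "(\<integral>\<omega>. X \<omega> * \<xi> (indicator ({a<..b} \<times> A)) \<omega> \<partial>M) = 0" by auto
qed

definition spacetime :: "('a \<times> real \<times> real) measure" where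
  "spacetime = M \<Otimes>\<^sub>M (lborel \<Otimes>\<^sub>M lborel)"

text \<open>The indicator turns the iterated integral over \<open>{0<..}\<close> in
  \<open>has_walsh_integral\<close> into a square norm over the product space
  \<open>spacetime\<close>, whatever the field does at negative times.\<close>

definition field :: "(real \<Rightarrow> real \<Rightarrow> 'a \<Rightarrow> real) \<Rightarrow> 'a \<times> real \<times> real \<Rightarrow> real" where
  "field \<Phi> = (\<lambda>(\<omega>, s, y). indicator {0<..} s * \<Phi> s y \<omega>)"

lemma simple_field_nth:
  "simple_field L s y \<omega> = (\<Sum>i<length L. case L ! i of (a, b, A, X) \<Rightarrow> X \<omega> * indicator {a<..b} s * indicator A y)"
  unfolding simple_field_def by (subst sum_list_sum_nth) (simp add: atLeast0LessThan)

lemma simple_integral_noise_nth: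
  "simple_integral_noise \<xi> L \<omega> = (\<Sum>i<length L. case L ! i of (a, b, A, X) \<Rightarrow> X \<omega> * \<xi> (indicator ({a<..b} \<times> A)) \<omega>)"
  unfolding simple_integral_noise_def by (subst sum_list_sum_nth) (simp add: atLeast0LessThan)

lemma simple_dataD:
  assumes "simple_data M \<xi> L" "i < length L" "L ! i = (a, b, A, X)"
  shows "0 \<le> a" "a < b" "A \<in> sets borel" "emeasure lborel A < \<infinity>"
    "X \<in> borel_measurable (noise_filtration M \<xi> a)" "\<exists>C. \<forall>\<omega>\<in>space M. \<bar>X \<omega>\<bar> \<le> C"
  using assms nth_mem[OF assms(2)] unfolding simple_data_def by auto

lemma simple_integral_noise_measurable:
  assumes "simple_data M \<xi> L"
  shows "simple_integral_noise \<xi> L \<in> borel_measurable M"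
proof -
  have "(\<lambda>\<omega>. case L ! i of (a, b, A, X) \<Rightarrow> X \<omega> * \<xi> (indicator ({a<..b} \<times> A)) \<omega>) \<in> borel_measurable M"
    if i: "i < length L" for i
  proof -
    obtain a b A X where L: "L ! i = (a, b, A, X)" by (metis prod_cases4)
    note d = simple_dataD[OF assms i L]
    note [measurable] = noise_measurable[OF indicator_rectangle_noise_test[OF d(1,3,4)]] filtration_measurable[OF d(5)]
    show ?thesis by (simp add: L)
  qed
  then show ?thesis unfolding simple_integral_noise_nth[abs_def] by (intro borel_measurable_sum) auto
qed

lemma simple_integral_noise_mean:
  assumes "simple_data M \<xi> L"
  shows "integrable M (simple_integral_noise \<xi> L)" "(\<integral>\<omega>. simple_integral_noise \<xi> L \<omega> \<partial>M) = 0"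
proof -
  have i: "integrable M (\<lambda>\<omega>. case L ! i of (a, b, A, X) \<Rightarrow> X \<omega> * \<xi> (indicator ({a<..b} \<times> A)) \<omega>) \<and>
    (\<integral>\<omega>. (case L ! i of (a, b, A, X) \<Rightarrow> X \<omega> * \<xi> (indicator ({a<..b} \<times> A)) \<omega>) \<partial>M) = 0"
    if i: "i < length L" for i
  proof -
    obtain a b A X where L: "L ! i = (a, b, A, X)" by (metis prod_cases4)
    note d = simple_dataD[OF assms i L]
    obtain C where C: "\<And>\<omega>. \<omega> \<in> space M \<Longrightarrow> \<bar>X \<omega>\<bar> \<le> C" using d(6) by blast
    have "integrable M X"
      by (rule integrable_const_bound[where B=C]) (use C filtration_measurable[OF d(5)] in auto)
    from simple_term[OF d(1,3,4,5) this] show ?thesis by (simp add: L)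
  qed
  show "integrable M (simple_integral_noise \<xi> L)"
    unfolding simple_integral_noise_nth[abs_def] using i by (intro Bochner_Integration.integrable_sum) auto
  show "(\<integral>\<omega>. simple_integral_noise \<xi> L \<omega> \<partial>M) = 0"
    unfolding simple_integral_noise_nth[abs_def] using i
    by (subst Bochner_Integration.integral_sum) (auto simp del: prod.case_distrib)
qed

lemma spacetime_rectangle_measurable:
  fixes X :: "'a \<Rightarrow> real"
  assumes [measurable]: "A \<in> sets borel" "X \<in> borel_measurable M"
  shows "(\<lambda>(\<omega>, s, y). X \<omega> * indicator {a<..b} s * indicator A y) \<in> borel_measurable spacetime"
  unfolding spacetime_def by measurable

lemma simple_field_measurable:
  assumes "simple_data M \<xi> L"
  shows "field (simple_field L) \<in> borel_measurable spacetime"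
proof -
  have m: "(\<lambda>z. case L ! i of (a, b, A, X) \<Rightarrow> X (fst z) * indicator {a<..b} (fst (snd z)) * indicator A (snd (snd z))) \<in> borel_measurable spacetime"
    if i: "i < length L" for i
  proof -
    obtain a b A X where L: "L ! i = (a, b, A, X)" by (metis prod_cases4)
    note d = simple_dataD[OF assms i L]
    show ?thesis using spacetime_rectangle_measurable[OF d(3) filtration_measurable[OF d(5)], of a b]
      by (simp add: L case_prod_beta')
  qed
  have "(\<lambda>z. indicator {0<..} (fst (snd z)) :: real) \<in> borel_measurable spacetime"
    unfolding spacetime_def by measurable
  moreover have "field (simple_field L) = (\<lambda>z. indicator {0<..} (fst (snd z)) *
     (\<Sum>i<length L. case L ! i of (a, b, A, X) \<Rightarrow> X (fst z) * indicator {a<..b} (fst (snd z)) * indicator A (snd (snd z))))"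
    by (auto simp: field_def simple_field_nth)
  ultimately show ?thesis using m by (auto intro!: borel_measurable_times borel_measurable_sum)
qed

text \<open>The rectangles of a simple field may overlap or repeat, so there is no orthogonality to
  exploit. Both squares are expanded instead, and the double sums agree term by term by
  \<open>simple_pair\<close>.\<close>

lemma simple_isometry:
  assumes L: "simple_data M \<xi> L"
  shows "(\<integral>\<^sup>+\<omega>. ennreal ((simple_integral_noise \<xi> L \<omega>)\<^sup>2) \<partial>M) =
    (\<integral>\<^sup>+z. ennreal ((field (simple_field L) z)\<^sup>2) \<partial>spacetime)"
    and simple_square_integrable: "integrable M (\<lambda>\<omega>. (simple_integral_noise \<xi> L \<omega>)\<^sup>2)"
proof -
  let ?n = "length L"
  define a b A X where "a i = fst (L ! i)" and "b i = fst (snd (L ! i))" and "A i = fst (snd (snd (L ! i)))"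
    and "X i = snd (snd (snd (L ! i)))" for i
  have Li: "L ! i = (a i, b i, A i, X i)" for i by (simp add: a_def b_def A_def X_def)
  note d = simple_dataD[OF L _ Li]
  define T where "T i \<omega> = X i \<omega> * \<xi> (indicator ({a i<..b i} \<times> A i)) \<omega>" for i \<omega>
  define I where "I i = (indicator ({a i<..b i} \<times> A i) :: real \<times> real \<Rightarrow> real)" for i
  define F where "F i = (\<lambda>(\<omega>, z). X i \<omega> * I i z)" for i
  have S: "simple_integral_noise \<xi> L \<omega> = (\<Sum>i<?n. T i \<omega>)" for \<omega>
    by (simp add: simple_integral_noise_nth Li T_def)
  have F: "field (simple_field L) z = (\<Sum>i<?n. F i z)" for z
  proof -
    obtain \<omega> s y where z: "z = (\<omega>, s, y)" by (metis prod_cases3)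
    have "field (simple_field L) z = (\<Sum>i<?n. indicator {0<..} s * (X i \<omega> * indicator {a i<..b i} s * indicator (A i) y))"
      by (simp only: z field_def simple_field_nth Li sum_distrib_left prod.case)
    also have "\<dots> = (\<Sum>i<?n. F i z)"
    proof (rule sum.cong[OF refl])
      fix i assume "i \<in> {..<?n}"
      then have "0 \<le> a i" using d(1) by simp
      then show "indicator {0<..} s * (X i \<omega> * indicator {a i<..b i} s * indicator (A i) y) = F i z"
        by (auto simp: F_def I_def z indicator_def)
    qed
    finally show ?thesis .
  qed
  have pair: "integrable M (\<lambda>\<omega>. T i \<omega> * T j \<omega>)" "integrable spacetime (\<lambda>z. F i z * F j z)"
    "(\<integral>\<omega>. T i \<omega> * T j \<omega> \<partial>M) = (\<integral>z. F i z * F j z \<partial>spacetime)" if ij: "i < ?n" "j < ?n" for i j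
  proof -
    obtain C where C: "\<And>\<omega>. \<omega> \<in> space M \<Longrightarrow> \<bar>X i \<omega>\<bar> \<le> C" using d(6)[OF ij(1)] by blast
    obtain C' where C': "\<And>\<omega>. \<omega> \<in> space M \<Longrightarrow> \<bar>X j \<omega>\<bar> \<le> C'" using d(6)[OF ij(2)] by blast
    note p = simple_pair[OF d(1,3,4)[OF ij(1)] d(1,3,4)[OF ij(2)] d(5)[OF ij(1)] C d(5)[OF ij(2)] C', of "b i" "b j"]
    show "integrable M (\<lambda>\<omega>. T i \<omega> * T j \<omega>)" using p by (simp add: T_def)
    have n: "I i \<in> noise_test" "I j \<in> noise_test"
      using d ij by (auto simp: I_def intro!: indicator_rectangle_noise_test)
    have Ii: "integrable lborel (\<lambda>z. I i z * I j z)"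
      using n by (intro integrable_mult_square) (auto simp: noise_test_def)
    have Wb: "\<bar>X i \<omega> * X j \<omega>\<bar> \<le> \<bar>C\<bar> * \<bar>C'\<bar>" if "\<omega> \<in> space M" for \<omega>
      using C[OF that] C'[OF that] unfolding abs_mult by (intro mult_mono) auto
    have [measurable]: "X i \<in> borel_measurable M" "X j \<in> borel_measurable M"
      using d(5) ij filtration_measurable by auto
    have Wi: "integrable M (\<lambda>\<omega>. X i \<omega> * X j \<omega>)"
      by (rule integrable_const_bound[where B="\<bar>C\<bar> * \<bar>C'\<bar>"]) (use Wb in auto)
    interpret P: pair_sigma_finite M "lborel :: (real \<times> real) measure" ..
    have FF: "F i z * F j z = (case z of (\<omega>, z) \<Rightarrow> (X i \<omega> * X j \<omega>) * (I i z * I j z))" for z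
      by (cases z) (simp add: F_def)
    have st: "spacetime = M \<Otimes>\<^sub>M lborel" by (simp add: spacetime_def lborel_prod)
    show FFi: "integrable spacetime (\<lambda>z. F i z * F j z)"
      unfolding st FF
    proof (intro P.Fubini_integrable)
      have "integrable M (\<lambda>\<omega>. \<bar>X i \<omega> * X j \<omega>\<bar> * (\<integral>z. \<bar>I i z * I j z\<bar> \<partial>lborel))"
        using Wi by (intro integrable_mult_left integrable_abs)
      then show "integrable M (\<lambda>\<omega>. \<integral>z. norm (case (\<omega>, z) of (\<omega>, z) \<Rightarrow> (X i \<omega> * X j \<omega>) * (I i z * I j z)) \<partial>lborel)"
        by (simp add: abs_mult[of "X i _ * X j _"])
    qed (use Wi Ii in auto)
    have "(\<integral>z. F i z * F j z \<partial>spacetime) = (\<integral>\<omega>. \<integral>z. (X i \<omega> * X j \<omega>) * (I i z * I j z) \<partial>lborel \<partial>M)"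
      using FFi unfolding st FF by (subst P.integral_fst'[symmetric]) (auto simp: split_beta')
    also have "\<dots> = (\<integral>\<omega>. X i \<omega> * X j \<omega> \<partial>M) * (\<integral>z. I i z * I j z \<partial>lborel)" by simp
    finally show "(\<integral>\<omega>. T i \<omega> * T j \<omega> \<partial>M) = (\<integral>z. F i z * F j z \<partial>spacetime)"
      using p by (simp add: T_def I_def)
  qed
  have Tm: "integrable M (\<lambda>\<omega>. (\<Sum>i<?n. T i \<omega>)\<^sup>2)" "integrable spacetime (\<lambda>z. (\<Sum>i<?n. F i z)\<^sup>2)"
    using pair by (auto simp: power2_eq_square sum_product intro!: Bochner_Integration.integrable_sum)
  have "(\<integral>\<omega>. (\<Sum>i<?n. T i \<omega>)\<^sup>2 \<partial>M) = (\<Sum>i<?n. \<Sum>j<?n. \<integral>\<omega>. T i \<omega> * T j \<omega> \<partial>M)"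
    unfolding power2_eq_square sum_product using pair
    by (subst Bochner_Integration.integral_sum; (intro Bochner_Integration.integrable_sum sum.cong refl Bochner_Integration.integral_sum)?) auto
  also have "\<dots> = (\<Sum>i<?n. \<Sum>j<?n. \<integral>z. F i z * F j z \<partial>spacetime)"
    using pair(3) by (intro sum.cong refl) auto
  also have "\<dots> = (\<integral>z. (\<Sum>i<?n. F i z)\<^sup>2 \<partial>spacetime)"
    unfolding power2_eq_square sum_product using pair
    by (subst Bochner_Integration.integral_sum; (intro Bochner_Integration.integrable_sum sum.cong refl Bochner_Integration.integral_sum[symmetric])?) auto
  finally show "(\<integral>\<^sup>+\<omega>. ennreal ((simple_integral_noise \<xi> L \<omega>)\<^sup>2) \<partial>M) =
    (\<integral>\<^sup>+z. ennreal ((field (simple_field L) z)\<^sup>2) \<partial>spacetime)"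
    unfolding S F using Tm by (simp add: nn_integral_eq_integral)
  show "integrable M (\<lambda>\<omega>. (simple_integral_noise \<xi> L \<omega>)\<^sup>2)"
    unfolding S using Tm by simp
qed

text \<open>This is the bridge from \<open>predictable_sigma\<close> to a product measure on which
  Fubini applies. It is enough to pull back the generating boxes, and those at time 0 have the same
  product form as the others.\<close>

lemma predictable_clamp:
  assumes "predictable M \<xi> \<Phi>"
  shows "(\<lambda>(\<omega>, s, y). \<Phi> (max 0 s) y \<omega>) \<in> borel_measurable spacetime"
proof -
  have sp: "space spacetime = space M \<times> UNIV" by (simp add: spacetime_def space_pair_measure)
  have T: "(\<lambda>(\<omega>, s, y). (max 0 s, y, \<omega>)) \<in> measurable spacetime (predictable_sigma M \<xi>)"
    unfolding predictable_sigma_def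
  proof (rule measurable_measure_of)
    show "({{a<..b} \<times> A \<times> G |a b A G. 0 \<le> a \<and> a < b \<and> A \<in> sets borel \<and> G \<in> sets (noise_filtration M \<xi> a)} \<union>
      {{0} \<times> A \<times> G |A G. A \<in> sets borel \<and> G \<in> sets (noise_filtration M \<xi> 0)}) \<subseteq> Pow ({0..} \<times> UNIV \<times> space M)"
      using sets.sets_into_space[of _ "noise_filtration M \<xi> _"] by fastforce
    show "(\<lambda>(\<omega>, s, y). (max 0 s, y, \<omega>)) \<in> space spacetime \<rightarrow> {0..} \<times> UNIV \<times> space M"
      by (auto simp: sp)
    fix B :: "(real \<times> real \<times> 'a) set" assume "B \<in> {{a<..b} \<times> A \<times> G |a b A G. 0 \<le> a \<and> a < b \<and> A \<in> sets borel \<and> G \<in> sets (noise_filtration M \<xi> a)} \<union>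
      {{0} \<times> A \<times> G |A G. A \<in> sets borel \<and> G \<in> sets (noise_filtration M \<xi> 0)}"
    then obtain S A G c where B: "B = S \<times> A \<times> G" and [measurable]: "S \<in> sets borel" "A \<in> sets borel" and G: "G \<in> sets (noise_filtration M \<xi> c)"
      by (auto; blast intro: borel_closed)
    have [measurable]: "G \<in> sets M" using G filtration_subalgebra by blast
    have "(\<lambda>(\<omega>, s, y). (max 0 s, y, \<omega>)) -` B \<inter> space spacetime = G \<times> ((\<lambda>s. max 0 s) -` S \<inter> space borel) \<times> A"
      using sets.sets_into_space[of G M] by (auto simp: B sp)
    also have "\<dots> \<in> sets spacetime"
    proof -
      have "(\<lambda>s::real. max 0 s) \<in> borel_measurable borel" by measurable
      from measurable_sets[OF this, of S] show ?thesis
        unfolding spacetime_def by (intro pair_measureI) auto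
    qed
    finally show "(\<lambda>(\<omega>, s, y). (max 0 s, y, \<omega>)) -` B \<inter> space spacetime \<in> sets spacetime" .
  qed
  from measurable_compose[OF T assms[unfolded predictable_def]]
  show ?thesis by (simp add: case_prod_beta')
qed

lemma predictable_field:
  assumes "predictable M \<xi> \<Phi>"
  shows "field \<Phi> \<in> borel_measurable spacetime"
proof -
  have "(\<lambda>z. indicator {0<..} (fst (snd z)) :: real) \<in> borel_measurable spacetime"
    unfolding spacetime_def by measurable
  moreover have "field \<Phi> = (\<lambda>z. indicator {0<..} (fst (snd z)) * (case z of (\<omega>, s, y) \<Rightarrow> \<Phi> (max 0 s) y \<omega>))"
    by (auto simp: field_def indicator_def)
  ultimately show ?thesis using predictable_clamp[OF assms] by (auto intro!: borel_measurable_times)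
qed

lemma spacetime_integral:
  assumes [measurable]: "field \<Phi> \<in> borel_measurable spacetime"
  shows "(\<integral>\<^sup>+\<omega>. (\<integral>\<^sup>+s\<in>{0<..}. (\<integral>\<^sup>+y. ennreal ((\<Phi> s y \<omega>)\<^sup>2) \<partial>lborel) \<partial>lborel) \<partial>M) =
    (\<integral>\<^sup>+z. ennreal ((field \<Phi> z)\<^sup>2) \<partial>spacetime)"
proof -
  have sf: "sigma_finite_measure (lborel \<Otimes>\<^sub>M lborel :: (real \<times> real) measure)"
    unfolding lborel_prod by (rule lborel.sigma_finite_measure_axioms)
  have [measurable]: "field \<Phi> \<in> borel_measurable (M \<Otimes>\<^sub>M (lborel \<Otimes>\<^sub>M lborel))"
    using assms by (simp add: spacetime_def)
  have "(\<integral>\<^sup>+z. ennreal ((field \<Phi> z)\<^sup>2) \<partial>spacetime) =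
    (\<integral>\<^sup>+\<omega>. \<integral>\<^sup>+z. ennreal ((field \<Phi> (\<omega>, z))\<^sup>2) \<partial>(lborel \<Otimes>\<^sub>M lborel) \<partial>M)"
    unfolding spacetime_def by (rule sigma_finite_measure.nn_integral_fst[OF sf, symmetric]) measurable
  also have "\<dots> = (\<integral>\<^sup>+\<omega>. \<integral>\<^sup>+s. \<integral>\<^sup>+y. ennreal ((field \<Phi> (\<omega>, s, y))\<^sup>2) \<partial>lborel \<partial>lborel \<partial>M)"
    by (intro nn_integral_cong lborel.nn_integral_fst[symmetric]) measurable
  also have "\<dots> = (\<integral>\<^sup>+\<omega>. (\<integral>\<^sup>+s\<in>{0<..}. (\<integral>\<^sup>+y. ennreal ((\<Phi> s y \<omega>)\<^sup>2) \<partial>lborel) \<partial>lborel) \<partial>M)"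
    by (intro nn_integral_cong) (auto simp: field_def indicator_def)
  finally show ?thesis by simp
qed

lemma field_add: "field (\<lambda>s y \<omega>. \<Phi> s y \<omega> + c * \<Psi> s y \<omega>) = (\<lambda>z. field \<Phi> z + c * field \<Psi> z)"
  by (auto simp: field_def algebra_simps)

lemma field_diff: "field (\<lambda>s y \<omega>. \<Phi> s y \<omega> - \<Psi> s y \<omega>) = (\<lambda>z. field \<Phi> z - field \<Psi> z)"
  by (auto simp: field_def algebra_simps)

lemma has_walsh_integral_iff:
  "has_walsh_integral M \<xi> \<Phi> Z \<longleftrightarrow> predictable M \<xi> \<Phi> \<and> Z \<in> borel_measurable M \<and>
    (\<exists>L. (\<forall>n. simple_data M \<xi> (L n)) \<and>
      ((\<lambda>n. \<integral>\<^sup>+z. ennreal ((field (simple_field (L n)) z - field \<Phi> z)\<^sup>2) \<partial>spacetime) \<longlonglongrightarrow> 0) \<and>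
      ((\<lambda>n. \<integral>\<^sup>+\<omega>. ennreal ((simple_integral_noise \<xi> (L n) \<omega> - Z \<omega>)\<^sup>2) \<partial>M) \<longlonglongrightarrow> 0))"
proof -
  have "(\<integral>\<^sup>+\<omega>. (\<integral>\<^sup>+s\<in>{0<..}. (\<integral>\<^sup>+y. ennreal ((simple_field L s y \<omega> - \<Phi> s y \<omega>)\<^sup>2) \<partial>lborel) \<partial>lborel) \<partial>M) =
    (\<integral>\<^sup>+z. ennreal ((field (simple_field L) z - field \<Phi> z)\<^sup>2) \<partial>spacetime)"
    if "predictable M \<xi> \<Phi>" "simple_data M \<xi> L" for L
    using predictable_field[OF that(1)] simple_field_measurable[OF that(2)]
    by (subst spacetime_integral) (auto simp: field_diff intro!: borel_measurable_diff)
  then show ?thesis unfolding has_walsh_integral_def by (safe; force)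
qed

text \<open>The exact isometry survives the limit by \<open>nn_integral_square_limit_eq\<close>. The
  norm is finite because some simple integral has finite norm and lies at finite distance from
  \<open>Z\<close>. The mean stays zero because convergence in L^2 implies convergence in L^1 on a
  probability space.\<close>

lemma walsh_isometry:
  assumes "has_walsh_integral M \<xi> \<Phi> Z"
  shows "field \<Phi> \<in> borel_measurable spacetime" "Z \<in> borel_measurable M"
    "(\<integral>\<^sup>+\<omega>. ennreal ((Z \<omega>)\<^sup>2) \<partial>M) = (\<integral>\<^sup>+z. ennreal ((field \<Phi> z)\<^sup>2) \<partial>spacetime)"
    "(\<integral>\<^sup>+z. ennreal ((field \<Phi> z)\<^sup>2) \<partial>spacetime) < \<infinity>"
    "integrable M (\<lambda>\<omega>. (Z \<omega>)\<^sup>2)" "integrable M Z" "(\<integral>\<omega>. Z \<omega> \<partial>M) = 0"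
proof -
  obtain L where P: "predictable M \<xi> \<Phi>" and Z[measurable]: "Z \<in> borel_measurable M" and L: "\<And>n. simple_data M \<xi> (L n)"
    and F: "(\<lambda>n. \<integral>\<^sup>+z. ennreal ((field (simple_field (L n)) z - field \<Phi> z)\<^sup>2) \<partial>spacetime) \<longlonglongrightarrow> 0"
    and S: "(\<lambda>n. \<integral>\<^sup>+\<omega>. ennreal ((simple_integral_noise \<xi> (L n) \<omega> - Z \<omega>)\<^sup>2) \<partial>M) \<longlonglongrightarrow> 0"
    using assms unfolding has_walsh_integral_iff by blast
  note [measurable] = predictable_field[OF P] simple_field_measurable[OF L] simple_integral_noise_measurable[OF L]
  show "field \<Phi> \<in> borel_measurable spacetime" "Z \<in> borel_measurable M" by measurable
  show iso: "(\<integral>\<^sup>+\<omega>. ennreal ((Z \<omega>)\<^sup>2) \<partial>M) = (\<integral>\<^sup>+z. ennreal ((field \<Phi> z)\<^sup>2) \<partial>spacetime)"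
    by (rule nn_integral_square_limit_eq[OF _ _ _ _ simple_isometry(1)[OF L] S F]; measurable)
  have sfin: "(\<integral>\<^sup>+\<omega>. ennreal ((simple_integral_noise \<xi> (L n) \<omega>)\<^sup>2) \<partial>M) < \<infinity>" for n
  proof -
    let ?L = "L n"
    have "integrable M (\<lambda>\<omega>. (simple_integral_noise \<xi> ?L \<omega>)\<^sup>2)"
      using simple_square_integrable[OF L] .
    then show ?thesis by (simp add: nn_integral_eq_integral)
  qed
  have "\<forall>\<^sub>F n in sequentially. (\<integral>\<^sup>+\<omega>. ennreal ((simple_integral_noise \<xi> (L n) \<omega> - Z \<omega>)\<^sup>2) \<partial>M) < 1"
    using S by (rule order_tendstoD) simp
  then obtain n where n: "(\<integral>\<^sup>+\<omega>. ennreal ((simple_integral_noise \<xi> (L n) \<omega> - Z \<omega>)\<^sup>2) \<partial>M) < 1"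
    by (auto simp: eventually_sequentially)
  have "(\<integral>\<^sup>+\<omega>. ennreal ((Z \<omega>)\<^sup>2) \<partial>M) \<le> 2 * (\<integral>\<^sup>+\<omega>. ennreal ((simple_integral_noise \<xi> (L n) \<omega>)\<^sup>2) \<partial>M) +
      2 * (\<integral>\<^sup>+\<omega>. ennreal ((simple_integral_noise \<xi> (L n) \<omega> - Z \<omega>)\<^sup>2) \<partial>M)"
    using nn_integral_square_add_le2[of "simple_integral_noise \<xi> (L n)" M "\<lambda>\<omega>. Z \<omega> - simple_integral_noise \<xi> (L n) \<omega>"]
    by (simp add: power2_commute[of "Z _"])
  also have "\<dots> < \<infinity>" using sfin[of n] less_trans[OF n ennreal_one_less_top] by (simp add: ennreal_mult_less_top)
  finally have fin: "(\<integral>\<^sup>+\<omega>. ennreal ((Z \<omega>)\<^sup>2) \<partial>M) < \<infinity>" .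
  then show "(\<integral>\<^sup>+z. ennreal ((field \<Phi> z)\<^sup>2) \<partial>spacetime) < \<infinity>" using iso by simp
  show sq: "integrable M (\<lambda>\<omega>. (Z \<omega>)\<^sup>2)" using fin by (intro integrableI_bounded) auto
  show Zi: "integrable M Z" using sq by (rule square_integrable_imp_integrable[OF Z])
  \<comment> \<open>The inequality |x| \<le> e + x^2 / e trades the L^1 distance, which controls the
    mean, for the L^2 distance, which is known to vanish.\<close>
  have bound: "ennreal \<bar>\<integral>\<omega>. Z \<omega> \<partial>M\<bar> \<le> ennreal e + ennreal (1 / e) * (\<integral>\<^sup>+\<omega>. ennreal ((simple_integral_noise \<xi> (L n) \<omega> - Z \<omega>)\<^sup>2) \<partial>M)"
    if e: "0 < e" for e n
  proof -
    let ?S = "simple_integral_noise \<xi> (L n)"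
    have Si: "integrable M ?S" "(\<integral>\<omega>. ?S \<omega> \<partial>M) = 0" using simple_integral_noise_mean[OF L] by auto
    have "\<bar>\<integral>\<omega>. Z \<omega> \<partial>M\<bar> = \<bar>\<integral>\<omega>. ?S \<omega> - Z \<omega> \<partial>M\<bar>" using Si Zi by simp
    then have "ennreal \<bar>\<integral>\<omega>. Z \<omega> \<partial>M\<bar> \<le> (\<integral>\<^sup>+\<omega>. ennreal \<bar>?S \<omega> - Z \<omega>\<bar> \<partial>M)"
      using integral_norm_bound_ennreal[of M "\<lambda>\<omega>. ?S \<omega> - Z \<omega>"] Si Zi by auto
    also have "\<dots> \<le> (\<integral>\<^sup>+\<omega>. ennreal e + ennreal (1 / e) * ennreal ((?S \<omega> - Z \<omega>)\<^sup>2) \<partial>M)"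
    proof (intro nn_integral_mono)
      fix \<omega>
      let ?x = "\<bar>?S \<omega> - Z \<omega>\<bar>"
      have "e * x \<le> e\<^sup>2 + x\<^sup>2" if "0 \<le> x" for x
        using zero_le_power2[of "e - x"] mult_nonneg_nonneg[of e x] e that unfolding power2_diff by linarith
      from this[of ?x] have "e * ?x \<le> e\<^sup>2 + ?x\<^sup>2" by simp
      then have "?x \<le> e + 1 / e * ?x\<^sup>2" using e by (simp add: field_simps power2_eq_square)
      then show "ennreal ?x \<le> ennreal e + ennreal (1 / e) * ennreal ((?S \<omega> - Z \<omega>)\<^sup>2)"
        using e by (simp add: ennreal_mult[symmetric] ennreal_plus[symmetric] del: ennreal_plus)
    qed
    also have "\<dots> = ennreal e + ennreal (1 / e) * (\<integral>\<^sup>+\<omega>. ennreal ((?S \<omega> - Z \<omega>)\<^sup>2) \<partial>M)"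
      by (simp add: nn_integral_add nn_integral_cmult emeasure_space_1)
    finally show ?thesis .
  qed
  have small: "\<bar>\<integral>\<omega>. Z \<omega> \<partial>M\<bar> \<le> 0 + e" if e: "0 < e" for e
  proof -
    have "(\<lambda>n. ennreal e + ennreal (1 / e) * (\<integral>\<^sup>+\<omega>. ennreal ((simple_integral_noise \<xi> (L n) \<omega> - Z \<omega>)\<^sup>2) \<partial>M)) \<longlonglongrightarrow> ennreal e + ennreal (1 / e) * 0"
      by (intro tendsto_add tendsto_const ennreal_tendsto_cmult S) auto
    then have "ennreal \<bar>\<integral>\<omega>. Z \<omega> \<partial>M\<bar> \<le> ennreal e + ennreal (1 / e) * 0"
      using bound[OF e] by (intro LIMSEQ_le_const) auto
    then show ?thesis using e by simp
  qed
  have "\<bar>\<integral>\<omega>. Z \<omega> \<partial>M\<bar> \<le> 0" by (rule field_le_epsilon[OF small])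
  then show "(\<integral>\<omega>. Z \<omega> \<partial>M) = 0" by simp
qed

lemma simple_field_append_scale:
  "simple_field (L @ map (\<lambda>(a, b, A, X). (a, b, A, \<lambda>\<omega>. c * X \<omega>)) K) s y \<omega> = simple_field L s y \<omega> + c * simple_field K s y \<omega>"
  by (simp add: simple_field_def sum_list_const_mult[symmetric] comp_def case_prod_beta' mult.assoc)

lemma simple_integral_noise_append_scale:
  "simple_integral_noise \<xi> (L @ map (\<lambda>(a, b, A, X). (a, b, A, \<lambda>\<omega>. c * X \<omega>)) K) \<omega> =
    simple_integral_noise \<xi> L \<omega> + c * simple_integral_noise \<xi> K \<omega>"
  by (simp add: simple_integral_noise_def sum_list_const_mult[symmetric] comp_def case_prod_beta' mult.assoc)

lemma simple_data_append_scale: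
  assumes "simple_data M \<xi> L" "simple_data M \<xi> K"
  shows "simple_data M \<xi> (L @ map (\<lambda>(a, b, A, X). (a, b, A, \<lambda>\<omega>. c * X \<omega>)) K)"
proof -
  have "\<exists>C. \<forall>\<omega>\<in>space M. \<bar>c * X \<omega>\<bar> \<le> C" if "\<forall>\<omega>\<in>space M. \<bar>X \<omega>\<bar> \<le> C" for X :: "'a \<Rightarrow> real" and C
    using that by (intro exI[of _ "\<bar>c\<bar> * C"]) (auto simp: abs_mult mult_left_mono)
  then show ?thesis using assms unfolding simple_data_def by (fastforce intro: borel_measurable_times)
qed

text \<open>The approximating lists are concatenated. The scalar is used with 1 for polarisation and
  finite sums, and with -1 to compare the Euler scheme with the solution.\<close>

lemma has_walsh_integral_add:
  assumes "has_walsh_integral M \<xi> \<Phi> Z" "has_walsh_integral M \<xi> \<Psi> Y"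
  shows "has_walsh_integral M \<xi> (\<lambda>s y \<omega>. \<Phi> s y \<omega> + c * \<Psi> s y \<omega>) (\<lambda>\<omega>. Z \<omega> + c * Y \<omega>)"
proof -
  obtain L where P: "predictable M \<xi> \<Phi>" and Z[measurable]: "Z \<in> borel_measurable M" and L: "\<And>n. simple_data M \<xi> (L n)"
    and F: "(\<lambda>n. \<integral>\<^sup>+z. ennreal ((field (simple_field (L n)) z - field \<Phi> z)\<^sup>2) \<partial>spacetime) \<longlonglongrightarrow> 0"
    and S: "(\<lambda>n. \<integral>\<^sup>+\<omega>. ennreal ((simple_integral_noise \<xi> (L n) \<omega> - Z \<omega>)\<^sup>2) \<partial>M) \<longlonglongrightarrow> 0"
    using assms(1) unfolding has_walsh_integral_iff by blast
  obtain K where P': "predictable M \<xi> \<Psi>" and Y[measurable]: "Y \<in> borel_measurable M" and K: "\<And>n. simple_data M \<xi> (K n)"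
    and F': "(\<lambda>n. \<integral>\<^sup>+z. ennreal ((field (simple_field (K n)) z - field \<Psi> z)\<^sup>2) \<partial>spacetime) \<longlonglongrightarrow> 0"
    and S': "(\<lambda>n. \<integral>\<^sup>+\<omega>. ennreal ((simple_integral_noise \<xi> (K n) \<omega> - Y \<omega>)\<^sup>2) \<partial>M) \<longlonglongrightarrow> 0"
    using assms(2) unfolding has_walsh_integral_iff by blast
  note [measurable] = predictable_field[OF P] simple_field_measurable[OF L] simple_integral_noise_measurable[OF L]
    predictable_field[OF P'] simple_field_measurable[OF K] simple_integral_noise_measurable[OF K]
  define J where "J n = L n @ map (\<lambda>(a, b, A, X). (a, b, A, \<lambda>\<omega>. c * X \<omega>)) (K n)" for n
  have lim: "(\<lambda>n. \<integral>\<^sup>+x. ennreal ((f n x + c * g n x)\<^sup>2) \<partial>N) \<longlonglongrightarrow> 0"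
    if [measurable]: "\<And>n. f n \<in> borel_measurable N" "\<And>n. g n \<in> borel_measurable N"
      and f: "(\<lambda>n. \<integral>\<^sup>+x. ennreal ((f n x)\<^sup>2) \<partial>N) \<longlonglongrightarrow> 0" and g: "(\<lambda>n. \<integral>\<^sup>+x. ennreal ((g n x)\<^sup>2) \<partial>N) \<longlonglongrightarrow> 0"
    for f g :: "nat \<Rightarrow> 'b \<Rightarrow> real" and N
  proof (rule tendsto_sandwich)
    show "\<forall>\<^sub>F n in sequentially. (0::ennreal) \<le> (\<integral>\<^sup>+x. ennreal ((f n x + c * g n x)\<^sup>2) \<partial>N)" by simp
    have "(\<integral>\<^sup>+x. ennreal ((c * g n x)\<^sup>2) \<partial>N) = ennreal (c\<^sup>2) * (\<integral>\<^sup>+x. ennreal ((g n x)\<^sup>2) \<partial>N)" for n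
      by (simp add: power_mult_distrib ennreal_mult nn_integral_cmult)
    then show "\<forall>\<^sub>F n in sequentially. (\<integral>\<^sup>+x. ennreal ((f n x + c * g n x)\<^sup>2) \<partial>N) \<le>
      2 * (\<integral>\<^sup>+x. ennreal ((f n x)\<^sup>2) \<partial>N) + 2 * (ennreal (c\<^sup>2) * (\<integral>\<^sup>+x. ennreal ((g n x)\<^sup>2) \<partial>N))"
      using nn_integral_square_add_le2[of "f _" N "\<lambda>x. c * g _ x"] by (intro always_eventually allI) simp
    have "(\<lambda>n. 2 * (\<integral>\<^sup>+x. ennreal ((f n x)\<^sup>2) \<partial>N) + 2 * (ennreal (c\<^sup>2) * (\<integral>\<^sup>+x. ennreal ((g n x)\<^sup>2) \<partial>N)))
      \<longlonglongrightarrow> 2 * 0 + 2 * (ennreal (c\<^sup>2) * 0)"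
      by (intro tendsto_add ennreal_tendsto_cmult f g) auto
    then show "(\<lambda>n. 2 * (\<integral>\<^sup>+x. ennreal ((f n x)\<^sup>2) \<partial>N) + 2 * (ennreal (c\<^sup>2) * (\<integral>\<^sup>+x. ennreal ((g n x)\<^sup>2) \<partial>N)))
      \<longlonglongrightarrow> 0" by simp
  qed simp
  have Jf: "field (simple_field (J n)) z - (field \<Phi> z + c * field \<Psi> z) =
    (field (simple_field (L n)) z - field \<Phi> z) + c * (field (simple_field (K n)) z - field \<Psi> z)" for n z
    unfolding J_def by (cases z) (simp add: field_def simple_field_append_scale algebra_simps)
  have Js: "simple_integral_noise \<xi> (J n) \<omega> - (Z \<omega> + c * Y \<omega>) =
    (simple_integral_noise \<xi> (L n) \<omega> - Z \<omega>) + c * (simple_integral_noise \<xi> (K n) \<omega> - Y \<omega>)" for n \<omega>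
    unfolding J_def by (simp add: simple_integral_noise_append_scale algebra_simps)
  have "predictable M \<xi> (\<lambda>s y \<omega>. \<Phi> s y \<omega> + c * \<Psi> s y \<omega>)"
    using P P' unfolding predictable_def by (auto simp: split_beta' intro!: borel_measurable_add borel_measurable_times)
  moreover have "simple_data M \<xi> (J n)" for n unfolding J_def by (rule simple_data_append_scale[OF L K])
  ultimately show ?thesis
    unfolding has_walsh_integral_iff field_add
    by (intro conjI exI[of _ J] allI; (unfold Jf Js)?; (intro lim F S F' S')?) auto
qed

text \<open>Polarisation: the isometry for \<open>Z + Y\<close>, less those for \<open>Z\<close> and
  \<open>Y\<close>, leaves twice the mixed terms.\<close>

lemma walsh_covariance:
  assumes Z: "has_walsh_integral M \<xi> \<Phi> Z" and Y: "has_walsh_integral M \<xi> \<Psi> Y"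
  shows "integrable M (\<lambda>\<omega>. Z \<omega> * Y \<omega>)" "integrable spacetime (\<lambda>z. field \<Phi> z * field \<Psi> z)"
    "(\<integral>\<omega>. Z \<omega> * Y \<omega> \<partial>M) = (\<integral>z. field \<Phi> z * field \<Psi> z \<partial>spacetime)"
proof -
  note w = walsh_isometry[OF Z] walsh_isometry[OF Y]
  note [measurable] = w(1,2,8,9)
  show ZY: "integrable M (\<lambda>\<omega>. Z \<omega> * Y \<omega>)" using w by (intro integrable_mult_square) auto
  have sq: "integrable spacetime (\<lambda>z. (field \<Theta> z)\<^sup>2)" "(\<integral>z. (field \<Theta> z)\<^sup>2 \<partial>spacetime) = (\<integral>\<omega>. (W \<omega>)\<^sup>2 \<partial>M)"
    if "has_walsh_integral M \<xi> \<Theta> W" for \<Theta> W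
  proof -
    note ww = walsh_isometry[OF that]
    note [measurable] = ww(1,2)
    show i: "integrable spacetime (\<lambda>z. (field \<Theta> z)\<^sup>2)" using ww(4) by (intro integrableI_bounded) auto
    have "ennreal (\<integral>z. (field \<Theta> z)\<^sup>2 \<partial>spacetime) = ennreal (\<integral>\<omega>. (W \<omega>)\<^sup>2 \<partial>M)"
      using ww(3) i ww(5) by (simp add: nn_integral_eq_integral)
    then show "(\<integral>z. (field \<Theta> z)\<^sup>2 \<partial>spacetime) = (\<integral>\<omega>. (W \<omega>)\<^sup>2 \<partial>M)" by simp
  qed
  show FF: "integrable spacetime (\<lambda>z. field \<Phi> z * field \<Psi> z)"
    using sq[OF Z] sq[OF Y] by (intro integrable_mult_square) auto
  have p2: "(a + 1 * b)\<^sup>2 = a\<^sup>2 + 2 * (a * b) + b\<^sup>2" for a b :: real by (simp add: power2_sum)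
  show "(\<integral>\<omega>. Z \<omega> * Y \<omega> \<partial>M) = (\<integral>z. field \<Phi> z * field \<Psi> z \<partial>spacetime)"
    using sq(2)[OF has_walsh_integral_add[OF Z Y, of 1]] sq[OF Z] sq[OF Y] w ZY FF
    unfolding field_add p2 by simp
qed

end

section \<open>The heat kernel\<close>

text \<open>Jensen's inequality for a weight of mass at most one, obtained from Cauchy-Schwarz by
  splitting \<open>w\<close> into two square roots. If the integrand on the left is not integrable,
  its Bochner integral is 0 and there is nothing to show.\<close>

lemma weighted_square_le:
  fixes w f :: "'b \<Rightarrow> real"
  assumes [measurable]: "w \<in> borel_measurable N" "f \<in> borel_measurable N"
    and w: "\<And>x. 0 \<le> w x" "(\<integral>\<^sup>+x. ennreal (w x) \<partial>N) \<le> 1"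
  shows "ennreal ((\<integral>x. w x * f x \<partial>N)\<^sup>2) \<le> (\<integral>\<^sup>+x. ennreal (w x * (f x)\<^sup>2) \<partial>N)"
proof (cases "integrable N (\<lambda>x. w x * f x)")
  case True
  have "ennreal ((\<integral>x. w x * f x \<partial>N)\<^sup>2) = (ennreal \<bar>\<integral>x. w x * f x \<partial>N\<bar>)\<^sup>2"
    by (simp add: ennreal_power)
  also have "\<dots> \<le> (\<integral>\<^sup>+x. ennreal \<bar>w x * f x\<bar> \<partial>N)\<^sup>2"
    using integral_norm_bound_ennreal[OF True] by (intro power_mono) auto
  also have "(\<integral>\<^sup>+x. ennreal \<bar>w x * f x\<bar> \<partial>N) = (\<integral>\<^sup>+x. ennreal (sqrt (w x)) * ennreal (sqrt (w x) * \<bar>f x\<bar>) \<partial>N)"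
    using w by (intro nn_integral_cong) (simp add: ennreal_mult[symmetric] abs_mult mult.assoc[symmetric])
  also have "\<dots>\<^sup>2 \<le> (\<integral>\<^sup>+x. (ennreal (sqrt (w x)))\<^sup>2 \<partial>N) * (\<integral>\<^sup>+x. (ennreal (sqrt (w x) * \<bar>f x\<bar>))\<^sup>2 \<partial>N)"
    by (intro Cauchy_Schwarz_nn_integral) auto
  also have "\<dots> = (\<integral>\<^sup>+x. ennreal (w x) \<partial>N) * (\<integral>\<^sup>+x. ennreal (w x * (f x)\<^sup>2) \<partial>N)"
    using w by (simp add: ennreal_power power_mult_distrib)
  also have "\<dots> \<le> 1 * (\<integral>\<^sup>+x. ennreal (w x * (f x)\<^sup>2) \<partial>N)" using w by (intro mult_right_mono) auto
  finally show ?thesis by simp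
qed (simp add: not_integrable_integral_eq)

text \<open>The error function up to normalisation: an abstract antiderivative is antisymmetrised to
  fix the constant of integration, and its limits come from the Gaussian integral over the
  half-line. It provides the closed antiderivative in \<open>heat_laplace\<close>.\<close>

lemma gaussian_primitive:
  obtains E :: "real \<Rightarrow> real" where "\<And>z. DERIV E z :> exp (- z\<^sup>2)" "(E \<longlongrightarrow> sqrt pi / 2) at_top" "(E \<longlongrightarrow> - (sqrt pi / 2)) at_bot" "\<And>z. E (- z) = - E z"
proof -
  have "\<exists>F. \<forall>x::real. -\<infinity> < ereal x \<longrightarrow> ereal x < \<infinity> \<longrightarrow> (F has_vector_derivative exp (- x\<^sup>2)) (at x)"
    by (rule einterval_antiderivative) (auto intro!: continuous_intros)
  then obtain F where "\<forall>x::real. (F has_vector_derivative exp (- x\<^sup>2)) (at x)" by auto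
  then have F: "DERIV F x :> exp (- x\<^sup>2)" for x
    unfolding has_real_derivative_iff_has_vector_derivative by blast
  define E where "E z = (F z - F (- z)) / 2" for z
  have E: "DERIV E z :> exp (- z\<^sup>2)" for z
  proof -
    have "DERIV (\<lambda>z. F (- z)) z :> - exp (- z\<^sup>2)"
      using DERIV_chain2[OF F[of "- z"] DERIV_minus[OF DERIV_ident]] by simp
    then have "DERIV (\<lambda>z. F z - F (- z)) z :> exp (- z\<^sup>2) - - exp (- z\<^sup>2)"
      by (intro DERIV_diff F)
    from DERIV_cdivide[OF this, of 2] show ?thesis unfolding E_def by simp
  qed
  have odd: "E (- z) = - E z" for z by (simp add: E_def field_simps)
  have top: "(E \<longlongrightarrow> sqrt pi / 2) at_top"
  proof -
    let ?f = "\<lambda>x::real. indicator {0..} x *\<^sub>R exp (- x\<^sup>2)"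
    have i: "integrable lborel ?f" "(\<integral>x. ?f x \<partial>lborel) = sqrt pi / 2"
      using gaussian_moment_0 by (auto simp: has_bochner_integral_iff)
    have "((\<lambda>y. \<integral> x. indicator {.. y} x *\<^sub>R ?f x \<partial>lborel) \<longlongrightarrow> sqrt pi / 2) at_top"
      using tendsto_integral_at_top[OF _ i(1)] unfolding i(2) by simp
    moreover have "\<forall>\<^sub>F y in at_top. (\<integral> x. indicator {.. y} x *\<^sub>R ?f x \<partial>lborel) = E y"
    proof (rule eventually_at_top_linorderI[of 0])
      fix y :: real assume y: "0 \<le> y"
      have "(\<integral> x. indicator {.. y} x *\<^sub>R ?f x \<partial>lborel) = (\<integral> x. exp (- x\<^sup>2) * indicator {0..y} x \<partial>lborel)"
        by (intro Bochner_Integration.integral_cong) (auto simp: indicator_def)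
      also have "\<dots> = E y - E 0"
        using y E by (intro integral_FTC_Icc_nonneg) auto
      finally show "(\<integral> x. indicator {.. y} x *\<^sub>R ?f x \<partial>lborel) = E y" by (simp add: E_def)
    qed
    ultimately show ?thesis by (rule Lim_transform_eventually)
  qed
  have "((\<lambda>z. - E (- z)) \<longlongrightarrow> - (sqrt pi / 2)) at_bot"
    by (intro tendsto_minus filterlim_compose[OF top] filterlim_uminus_at_top_at_bot)
  then have "(E \<longlongrightarrow> - (sqrt pi / 2)) at_bot" by (simp add: odd)
  from that[OF E top this odd] show thesis .
qed

locale heat =
  fixes \<theta> :: real
  assumes \<theta>: "0 < \<theta>"
begin

abbreviation "p \<equiv> heat_kernel \<theta>"

lemma heat_normal: "0 < r \<Longrightarrow> p r a = normal_density 0 (sqrt (\<theta> * r)) a"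
  using \<theta> by (simp add: heat_kernel_def normal_density_def real_sqrt_pow2 mult_ac)

lemma heat_nonneg: "0 \<le> r \<Longrightarrow> 0 \<le> p r a"
  using \<theta> by (simp add: heat_kernel_def)

lemma heat_pos: "0 < r \<Longrightarrow> 0 < p r a"
  using \<theta> by (simp add: heat_kernel_def)

lemma heat_minus [simp]: "p r (- a) = p r a" and heat_commute: "p r (x - y) = p r (y - x)"
  by (simp_all add: heat_kernel_def power2_commute)

lemma heat_le: "0 < r \<Longrightarrow> p r a \<le> p r 0"
  using \<theta> by (simp add: heat_kernel_def divide_right_mono)

lemma heat_measurable[measurable]: "(\<lambda>(r, a). p r a) \<in> borel_measurable (borel \<Otimes>\<^sub>M borel)"
  unfolding heat_kernel_def by measurable

lemma heat_measurable2[measurable (raw)]: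
  "f \<in> borel_measurable N \<Longrightarrow> g \<in> borel_measurable N \<Longrightarrow> (\<lambda>x. p (f x) (g x)) \<in> borel_measurable N"
  using measurable_compose[OF measurable_Pair heat_measurable, of f N g] by simp

lemma heat_antimono: "0 < r \<Longrightarrow> r \<le> s \<Longrightarrow> p s 0 \<le> p r 0"
  using \<theta> by (simp add: heat_kernel_def frac_le)

lemma heat_scale: "0 < r \<Longrightarrow> p r 0 = sqrt 2 * p (2 * r) 0"
  using \<theta> by (simp add: heat_kernel_def real_sqrt_mult field_simps)

lemma heat_mass0: "0 < r \<Longrightarrow> (\<integral>\<^sup>+a. ennreal (p r a) \<partial>lborel) = 1"
  using \<theta> by (simp add: heat_normal nn_integral_eq_integral)

lemma heat_mass:
  assumes "0 < r"
  shows "(\<integral>\<^sup>+x. ennreal (p r (x - y)) \<partial>lborel) = 1" "(\<integral>\<^sup>+y. ennreal (p r (x - y)) \<partial>lborel) = 1"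
proof -
  show *: "(\<integral>\<^sup>+x. ennreal (p r (x - y)) \<partial>lborel) = 1" for y
    using nn_integral_real_affine[of "\<lambda>a. ennreal (p r a)" 1 "- y"] heat_mass0[OF assms] by simp
  show "(\<integral>\<^sup>+y. ennreal (p r (x - y)) \<partial>lborel) = 1"
    using *[of x] by (subst heat_commute)
qed

lemma heat_semigroup:
  assumes "0 < a" "0 < b"
  shows "(\<integral>\<^sup>+y. ennreal (p a (x - y) * p b (y - z)) \<partial>lborel) = ennreal (p (a + b) (x - z))"
proof -
  have "(\<integral>\<^sup>+y. ennreal (p a (x - y) * p b (y - z)) \<partial>lborel) = (\<integral>\<^sup>+y. ennreal (p a (x - z - y) * p b y) \<partial>lborel)"
    using nn_integral_real_affine[of "\<lambda>y. ennreal (p a (x - y) * p b (y - z))" 1 z] by (simp add: diff_diff_eq)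
  also have "\<dots> = ennreal (p (a + b) (x - z))"
    using fun_cong[OF conv_normal_density_zero_mean[of "sqrt (\<theta> * a)" "sqrt (\<theta> * b)"], of "x - z"] assms \<theta>
    by (simp add: heat_normal distrib_left)
  finally show ?thesis .
qed

lemma heat_square:
  assumes "0 < r"
  shows "(\<integral>\<^sup>+x. ennreal ((p r (x - y))\<^sup>2) \<partial>lborel) = ennreal (p (2 * r) 0)"
    "(\<integral>\<^sup>+y. ennreal ((p r (x - y))\<^sup>2) \<partial>lborel) = ennreal (p (2 * r) 0)"
proof -
  show *: "(\<integral>\<^sup>+y. ennreal ((p r (x - y))\<^sup>2) \<partial>lborel) = ennreal (p (2 * r) 0)" for x
  proof -
    have "p r (x - y) * p r (y - x) = (p r (x - y))\<^sup>2" for y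
      by (simp add: heat_commute[of r y x] power2_eq_square)
    then show ?thesis using heat_semigroup[OF assms assms, of x x] by simp
  qed
  show "(\<integral>\<^sup>+x. ennreal ((p r (x - y))\<^sup>2) \<partial>lborel) = ennreal (p (2 * r) 0)"
    using *[of y] by (subst heat_commute)
qed

text \<open>After the substitution s = sqrt t the integrand is a multiple of exp (-(a^2 s^2 + b^2 /
  s^2)). Completing the square in both ways gives exp (2ab) exp (-(as + b/s)^2) and exp (-2ab) exp
  (-(as - b/s)^2). \<open>H\<close> adds the two corresponding error functions, so that the terms b
  / s^2 from the inner derivatives cancel.\<close>

lemma heat_laplace:
  assumes \<beta>: "0 < \<beta>"
  shows "(\<integral>\<^sup>+t\<in>{0<..}. ennreal (exp (- \<beta> * t) * p (2 * t) x) \<partial>lborel) = ennreal (r_kernel \<theta> \<beta> x)"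
proof -
  obtain E :: "real \<Rightarrow> real" where E: "\<And>z. DERIV E z :> exp (- z\<^sup>2)" "(E \<longlongrightarrow> sqrt pi / 2) at_top" "(E \<longlongrightarrow> - (sqrt pi / 2)) at_bot"
      "\<And>z. E (- z) = - E z" by (rule gaussian_primitive) blast
  have E0: "E 0 = 0" using E(4)[of 0] by simp
  have Econt: "isCont E z" for z using E(1) by (rule DERIV_isCont)
  define a b where "a = sqrt \<beta>" and "b = \<bar>x\<bar> / (2 * sqrt \<theta>)"
  have a: "0 < a" "a\<^sup>2 = \<beta>" and b: "0 \<le> b" "b\<^sup>2 = x\<^sup>2 / (4 * \<theta>)"
    using \<beta> \<theta> by (auto simp: a_def b_def power_divide power_mult_distrib)
  define c where "c = 1 / (2 * sqrt (pi * \<theta>))"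
  have c: "0 < c" using \<theta> by (simp add: c_def)
  define H where "H s = exp (2 * a * b) * E (a * s + b / s) + exp (- (2 * a * b)) * E (a * s - b / s)" for s
  define f where "f t = exp (- \<beta> * t) * p (2 * t) x" for t
  have feq: "f t = c * (exp (- (a\<^sup>2 * t + b\<^sup>2 / t)) / sqrt t)" if t: "0 < t" for t
  proof -
    have "sqrt (2 * pi * \<theta> * (2 * t)) = 2 * sqrt (pi * \<theta>) * sqrt t"
    proof -
      have "2 * pi * \<theta> * (2 * t) = 2\<^sup>2 * (pi * \<theta> * t)" by simp
      then show ?thesis by (simp add: real_sqrt_mult)
    qed
    then show ?thesis
      using t \<theta> by (simp add: f_def heat_kernel_def a b c_def exp_add[symmetric] field_simps)
  qed
  have DH: "DERIV H s :> 2 * a * exp (- (a\<^sup>2 * s\<^sup>2 + b\<^sup>2 / s\<^sup>2))" if s: "0 < s" for s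
  proof -
    have e: "exp (2 * a * b) * exp (- (a * s + b / s)\<^sup>2) = exp (- (a\<^sup>2 * s\<^sup>2 + b\<^sup>2 / s\<^sup>2))"
      "exp (- (2 * a * b)) * exp (- (a * s - b / s)\<^sup>2) = exp (- (a\<^sup>2 * s\<^sup>2 + b\<^sup>2 / s\<^sup>2))"
      using s by (auto simp: exp_add[symmetric] power2_sum power2_diff power_mult_distrib power_divide)
    have "DERIV H s :> exp (2 * a * b) * (exp (- (a * s + b / s)\<^sup>2) * (a - b / s\<^sup>2))
        + exp (- (2 * a * b)) * (exp (- (a * s - b / s)\<^sup>2) * (a + b / s\<^sup>2))"
      unfolding H_def using s
      by (auto intro!: derivative_eq_intros DERIV_chain'[OF _ E(1)] simp: power2_eq_square)
    then show ?thesis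
      unfolding mult.assoc[symmetric] e by (simp add: algebra_simps)
  qed
  let ?F = "\<lambda>t. c / a * H (sqrt t)"
  have int: "set_integrable lborel (einterval 0 \<infinity>) f"
      "(LBINT t=0..\<infinity>. f t) = c / a * (sqrt pi / 2 * (exp (2 * a * b) + exp (- (2 * a * b)))) - c / a * (sqrt pi / 2 * (exp (2 * a * b) - exp (- (2 * a * b))))"
  proof -
    have D: "DERIV ?F t :> f t" if t: "0 < t" for t
    proof -
      have "DERIV (\<lambda>t. H (sqrt t)) t :> 2 * a * exp (- (a\<^sup>2 * (sqrt t)\<^sup>2 + b\<^sup>2 / (sqrt t)\<^sup>2)) * (inverse (sqrt t) / 2)"
        using t by (intro DERIV_chain2[OF DH DERIV_real_sqrt]) auto
      from DERIV_cmult[OF this, of "c / a"] show ?thesis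
        using t a by (simp add: feq field_simps)
    qed
    have C: "isCont f t" if t: "0 < t" for t
      unfolding f_def heat_kernel_def using t \<theta> by (auto intro!: continuous_intros)
    have sq: "filterlim sqrt at_top at_top" by (rule sqrt_at_top)
    have top: "(?F \<longlongrightarrow> c / a * (exp (2 * a * b) * (sqrt pi / 2) + exp (- (2 * a * b)) * (sqrt pi / 2))) at_top"
    proof -
      have "filterlim (\<lambda>s. a * s + b / s) at_top at_top"
        using a b by real_asymp
      moreover have "filterlim (\<lambda>s. a * s - b / s) at_top at_top"
        using a b by real_asymp
      ultimately have "(H \<longlongrightarrow> exp (2 * a * b) * (sqrt pi / 2) + exp (- (2 * a * b)) * (sqrt pi / 2)) at_top"
        unfolding H_def by (intro tendsto_intros filterlim_compose[OF E(2)])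
      then show ?thesis by (intro tendsto_mult tendsto_const filterlim_compose[OF _ sq])
    qed
    have zero: "(?F \<longlongrightarrow> c / a * (sqrt pi / 2 * (exp (2 * a * b) - exp (- (2 * a * b))))) (at_right 0)"
    proof -
      have sr: "filterlim sqrt (at_right 0) (at_right (0::real))"
        by (auto simp: filterlim_at eventually_at_filter intro!: tendsto_eq_intros)
      have "(H \<longlongrightarrow> sqrt pi / 2 * (exp (2 * a * b) - exp (- (2 * a * b)))) (at_right 0)"
      \<comment> \<open>For \<open>b = 0\<close> both arguments of \<open>E\<close> tend to 0, where
        \<open>E\<close> vanishes; for \<open>b > 0\<close> they diverge to opposite infinities. The
        same formula covers both cases.\<close>
      proof (cases "b = 0")
        case True
        have "((\<lambda>s. E (a * s)) \<longlongrightarrow> E (a * 0)) (at_right 0)"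
          by (intro isCont_tendsto_compose[OF Econt] tendsto_intros)
        then have "((\<lambda>s. E (a * s) + E (a * s)) \<longlongrightarrow> 0 + 0) (at_right 0)" 
          by (intro tendsto_add) (simp_all add: E0)
        then show ?thesis using True by (simp add: H_def[abs_def])
      next
        case False
        then have b': "0 < b" using b by simp
        have "filterlim (\<lambda>s. a * s + b / s) at_top (at_right 0)" using a b' by real_asymp
        moreover have "filterlim (\<lambda>s. a * s - b / s) at_bot (at_right 0)" using a b' by real_asymp
        ultimately have "(H \<longlongrightarrow> exp (2 * a * b) * (sqrt pi / 2) + exp (- (2 * a * b)) * (- (sqrt pi / 2))) (at_right 0)"
          unfolding H_def by (intro tendsto_intros filterlim_compose[OF E(2)] filterlim_compose[OF E(3)])
        then show ?thesis by (simp add: algebra_simps)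
      qed
      then show ?thesis by (intro tendsto_mult tendsto_const filterlim_compose[OF _ sr])
    qed
    have A: "((?F \<circ> real_of_ereal) \<longlongrightarrow> c / a * (sqrt pi / 2 * (exp (2 * a * b) - exp (- (2 * a * b))))) (at_right 0)"
      using zero by (simp add: zero_ereal_def ereal_tendsto_simps del: ereal_eq_0)
    have B: "((?F \<circ> real_of_ereal) \<longlongrightarrow> c / a * (sqrt pi / 2 * (exp (2 * a * b) + exp (- (2 * a * b))))) (at_left \<infinity>)"
      using top by (simp add: ereal_tendsto_simps algebra_simps)
    have pos: "AE t in lborel. 0 < ereal t \<longrightarrow> ereal t < \<infinity> \<longrightarrow> 0 \<le> f t"
      by (intro AE_I2) (auto simp: f_def heat_nonneg)
    show "set_integrable lborel (einterval 0 \<infinity>) f"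
      by (rule interval_integral_FTC_nonneg(1)[OF _ D C pos A B]) auto
    show "(LBINT t=0..\<infinity>. f t) = c / a * (sqrt pi / 2 * (exp (2 * a * b) + exp (- (2 * a * b)))) - c / a * (sqrt pi / 2 * (exp (2 * a * b) - exp (- (2 * a * b))))"
      by (rule interval_integral_FTC_nonneg(2)[OF _ D C pos A B]) auto
  qed
  have ei: "einterval 0 \<infinity> = {0<..}" by (auto simp: einterval_def zero_ereal_def)
  have fi: "integrable lborel (\<lambda>t. indicator {0<..} t * f t)"
    using int(1) by (simp add: set_integrable_def ei)
  have "(\<integral>\<^sup>+t\<in>{0<..}. ennreal (f t) \<partial>lborel) = (\<integral>\<^sup>+t. ennreal (indicator {0<..} t * f t) \<partial>lborel)"
    by (intro nn_integral_cong) (auto simp: indicator_def)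
  also have "\<dots> = ennreal (\<integral>t. indicator {0<..} t * f t \<partial>lborel)"
    by (rule nn_integral_eq_integral[OF fi]) (auto simp: f_def indicator_def heat_nonneg)
  also have "(\<integral>t. indicator {0<..} t * f t \<partial>lborel) = (LBINT t=0..\<infinity>. f t)"
    by (simp add: interval_lebesgue_integral_def ei set_lebesgue_integral_def)
  \<comment> \<open>Of the boundary values only the part with exp (-2ab) survives the subtraction,
    and 2ab = |x| sqrt (\<beta> / \<theta>).\<close>
  also have "\<dots> = c / a * sqrt pi * exp (- (2 * a * b))" unfolding int(2) by (simp add: algebra_simps)
  also have "\<dots> = r_kernel \<theta> \<beta> x"
    using \<theta> \<beta> by (simp add: c_def a_def b_def r_kernel_def real_sqrt_mult real_sqrt_divide field_simps)
  finally show ?thesis by (simp add: f_def)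
qed

lemma heat_laplace0:
  "0 < \<beta> \<Longrightarrow> (\<integral>\<^sup>+t\<in>{0<..}. ennreal (exp (- \<beta> * t) * p (2 * t) 0) \<partial>lborel) = ennreal (1 / (2 * sqrt (\<beta> * \<theta>)))"
  using heat_laplace[of \<beta> 0] by (simp add: r_kernel_def)

definition heat_op :: "real \<Rightarrow> (real \<Rightarrow> real) \<Rightarrow> real \<Rightarrow> real" where
  "heat_op r f = convol (p r) f"

lemma heat_op_measurable[measurable]:
  assumes [measurable]: "f \<in> borel_measurable borel"
  shows "(\<lambda>(r, x). heat_op r f x) \<in> borel_measurable (borel \<Otimes>\<^sub>M borel)" "heat_op r f \<in> borel_measurable borel"
  unfolding heat_op_def convol_def by measurable

lemma heat_op_measurable2[measurable (raw)]:
  assumes [measurable]: "f \<in> borel_measurable borel" "g \<in> borel_measurable N" "h \<in> borel_measurable N"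
  shows "(\<lambda>x. heat_op (g x) f (h x)) \<in> borel_measurable N"
  unfolding heat_op_def convol_def by measurable

lemma heat_op_L1:
  assumes r: "0 < r" and [measurable]: "f \<in> borel_measurable borel"
  shows "(\<integral>\<^sup>+x. ennreal \<bar>heat_op r f x\<bar> \<partial>lborel) \<le> (\<integral>\<^sup>+x. ennreal \<bar>f x\<bar> \<partial>lborel)"
proof -
  have "(\<integral>\<^sup>+x. ennreal \<bar>heat_op r f x\<bar> \<partial>lborel) \<le> (\<integral>\<^sup>+x. \<integral>\<^sup>+y. ennreal (p r (x - y)) * ennreal \<bar>f y\<bar> \<partial>lborel \<partial>lborel)"
  proof (intro nn_integral_mono)
    fix x
    have "ennreal \<bar>heat_op r f x\<bar> \<le> (\<integral>\<^sup>+y. ennreal \<bar>p r (x - y) * f y\<bar> \<partial>lborel)"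
      using integral_norm_bound_ennreal[of lborel "\<lambda>y. p r (x - y) * f y"]
      by (cases "integrable lborel (\<lambda>y. p r (x - y) * f y)") (auto simp: heat_op_def convol_def not_integrable_integral_eq)
    also have "\<dots> = (\<integral>\<^sup>+y. ennreal (p r (x - y)) * ennreal \<bar>f y\<bar> \<partial>lborel)"
      using r by (intro nn_integral_cong) (simp add: ennreal_mult[symmetric] abs_mult heat_nonneg)
    finally show "ennreal \<bar>heat_op r f x\<bar> \<le> (\<integral>\<^sup>+y. ennreal (p r (x - y)) * ennreal \<bar>f y\<bar> \<partial>lborel)" .
  qed
  also have "\<dots> = (\<integral>\<^sup>+y. \<integral>\<^sup>+x. ennreal (p r (x - y)) * ennreal \<bar>f y\<bar> \<partial>lborel \<partial>lborel)"
    by (rule lborel_pair.Fubini') measurable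
  also have "\<dots> = (\<integral>\<^sup>+x. ennreal \<bar>f x\<bar> \<partial>lborel)"
    using r by (simp add: nn_integral_multc heat_mass)
  finally show ?thesis .
qed

lemma heat_op_L2:
  assumes r: "0 < r" and [measurable]: "f \<in> borel_measurable borel"
  shows "(\<integral>\<^sup>+x. ennreal ((heat_op r f x)\<^sup>2) \<partial>lborel) \<le> (\<integral>\<^sup>+x. ennreal ((f x)\<^sup>2) \<partial>lborel)"
proof -
  have "(\<integral>\<^sup>+x. ennreal ((heat_op r f x)\<^sup>2) \<partial>lborel) \<le> (\<integral>\<^sup>+x. \<integral>\<^sup>+y. ennreal (p r (x - y)) * ennreal ((f y)\<^sup>2) \<partial>lborel \<partial>lborel)"
    unfolding heat_op_def convol_def using r
    by (intro nn_integral_mono order_trans[OF weighted_square_le]) (auto simp: heat_nonneg heat_mass ennreal_mult)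
  also have "\<dots> = (\<integral>\<^sup>+y. \<integral>\<^sup>+x. ennreal (p r (x - y)) * ennreal ((f y)\<^sup>2) \<partial>lborel \<partial>lborel)"
    by (rule lborel_pair.Fubini') measurable
  also have "\<dots> = (\<integral>\<^sup>+x. ennreal ((f x)\<^sup>2) \<partial>lborel)"
    using r by (simp add: nn_integral_multc heat_mass)
  finally show ?thesis .
qed

lemma heat_op_integrable_kernel:
  assumes "0 < r" "integrable lborel f"
  shows "integrable lborel (\<lambda>y. p r (x - y) * f y)"
proof (rule Bochner_Integration.integrable_bound)
  show "integrable lborel (\<lambda>y. p r 0 * f y)" using assms by simp
  show "AE y in lborel. norm (p r (x - y) * f y) \<le> norm (p r 0 * f y)"
    using assms heat_le by (auto simp: abs_mult heat_nonneg intro!: mult_right_mono)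
  show "(\<lambda>y. p r (x - y) * f y) \<in> borel_measurable lborel" using borel_measurable_integrable[OF assms(2)] by measurable
qed

lemma heat_op_semigroup:
  assumes a: "0 < a" and b: "0 < b" and f: "integrable lborel f"
  shows "heat_op a (heat_op b f) x = heat_op (a + b) f x"
proof -
  note [measurable] = borel_measurable_integrable[OF f]
  have int: "integrable (lborel \<Otimes>\<^sub>M lborel) (\<lambda>(y, z). p a (x - y) * (p b (y - z) * f z))"
  proof (rule integrableI_bounded)
    show "(\<lambda>(y, z). p a (x - y) * (p b (y - z) * f z)) \<in> borel_measurable (lborel \<Otimes>\<^sub>M lborel)" by measurable
    have "(\<integral>\<^sup>+w. ennreal (norm (case w of (y, z) \<Rightarrow> p a (x - y) * (p b (y - z) * f z))) \<partial>(lborel \<Otimes>\<^sub>M lborel)) =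
      (\<integral>\<^sup>+z. \<integral>\<^sup>+y. ennreal (norm (p a (x - y) * (p b (y - z) * f z))) \<partial>lborel \<partial>lborel)"
      by (subst lborel_pair.nn_integral_snd[symmetric]) (auto simp: split_beta')
    also have "\<dots> = (\<integral>\<^sup>+z. ennreal (p (a + b) (x - z)) * ennreal \<bar>f z\<bar> \<partial>lborel)"
    proof (intro nn_integral_cong)
      fix z
      have "(\<integral>\<^sup>+y. ennreal (norm (p a (x - y) * (p b (y - z) * f z))) \<partial>lborel) =
        (\<integral>\<^sup>+y. ennreal (p a (x - y) * p b (y - z)) * ennreal \<bar>f z\<bar> \<partial>lborel)"
        using a b by (intro nn_integral_cong) (simp add: ennreal_mult[symmetric] abs_mult heat_nonneg mult.assoc)
      then show "(\<integral>\<^sup>+y. ennreal (norm (p a (x - y) * (p b (y - z) * f z))) \<partial>lborel) = ennreal (p (a + b) (x - z)) * ennreal \<bar>f z\<bar>"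
        using heat_semigroup[OF a b] by (simp add: nn_integral_multc)
    qed
    also have "\<dots> \<le> (\<integral>\<^sup>+z. ennreal (p (a + b) 0) * ennreal \<bar>f z\<bar> \<partial>lborel)"
      using a b by (intro nn_integral_mono mult_right_mono ennreal_leI heat_le) auto
    also have "\<dots> < \<infinity>"
      using f by (simp add: nn_integral_cmult ennreal_mult_less_top integrable_iff_bounded)
    finally show "(\<integral>\<^sup>+w. ennreal (norm (case w of (y, z) \<Rightarrow> p a (x - y) * (p b (y - z) * f z))) \<partial>(lborel \<Otimes>\<^sub>M lborel)) < \<infinity>" .
  qed
  have "heat_op a (heat_op b f) x = (\<integral>y. \<integral>z. p a (x - y) * (p b (y - z) * f z) \<partial>lborel \<partial>lborel)"
    by (simp add: heat_op_def convol_def)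
  also have "\<dots> = (\<integral>z. \<integral>y. p a (x - y) * (p b (y - z) * f z) \<partial>lborel \<partial>lborel)"
    by (rule lborel_pair.Fubini_integral[OF int, symmetric])
  also have "\<dots> = (\<integral>z. p (a + b) (x - z) * f z \<partial>lborel)"
  proof (intro Bochner_Integration.integral_cong refl)
    fix z
    have "(\<integral>y. p a (x - y) * p b (y - z) \<partial>lborel) = p (a + b) (x - z)"
      using heat_semigroup[OF a b] a b by (intro integral_eq_nn_integral[THEN trans]) (auto simp: heat_nonneg)
    then show "(\<integral>y. p a (x - y) * (p b (y - z) * f z) \<partial>lborel) = p (a + b) (x - z) * f z"
      by (simp add: mult.assoc[symmetric])
  qed
  finally show ?thesis by (simp add: heat_op_def convol_def)
qed

lemma heat_op_nn:
  assumes "0 < r" "integrable lborel f" "AE x in lborel. 0 \<le> f x"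
  shows "ennreal (heat_op r f x) = (\<integral>\<^sup>+y. ennreal (p r (x - y) * f y) \<partial>lborel)" "0 \<le> heat_op r f x"
    "(\<integral>\<^sup>+x. ennreal (heat_op r f x) \<partial>lborel) = (\<integral>\<^sup>+x. ennreal (f x) \<partial>lborel)"
proof -
  note [measurable] = borel_measurable_integrable[OF assms(2)]
  have nn: "AE y in lborel. 0 \<le> p r (x - y) * f y" for x
    using assms(3) by eventually_elim (simp add: heat_nonneg assms(1) less_imp_le)
  show e: "ennreal (heat_op r f x) = (\<integral>\<^sup>+y. ennreal (p r (x - y) * f y) \<partial>lborel)" for x
    unfolding heat_op_def convol_def
    using heat_op_integrable_kernel[OF assms(1,2)] nn by (intro nn_integral_eq_integral[symmetric]) auto
  show "0 \<le> heat_op r f x" unfolding heat_op_def convol_def using nn by (rule integral_nonneg_AE)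
  have "(\<integral>\<^sup>+x. ennreal (heat_op r f x) \<partial>lborel) = (\<integral>\<^sup>+x. \<integral>\<^sup>+y. ennreal (p r (x - y)) * ennreal (f y) \<partial>lborel \<partial>lborel)"
    unfolding e using assms(1) by (simp add: ennreal_mult' heat_nonneg)
  also have "\<dots> = (\<integral>\<^sup>+y. \<integral>\<^sup>+x. ennreal (p r (x - y)) * ennreal (f y) \<partial>lborel \<partial>lborel)"
    by (rule lborel_pair.Fubini') measurable
  also have "\<dots> = (\<integral>\<^sup>+x. ennreal (f x) \<partial>lborel)"
    using assms(1) by (simp add: nn_integral_multc heat_mass)
  finally show "(\<integral>\<^sup>+x. ennreal (heat_op r f x) \<partial>lborel) = (\<integral>\<^sup>+x. ennreal (f x) \<partial>lborel)" .
qed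

lemma heat_tendsto:
  assumes "r \<longlonglongrightarrow> s" "0 < s" "a \<longlonglongrightarrow> b"
  shows "(\<lambda>n. p (r n) (a n)) \<longlonglongrightarrow> p s b"
  unfolding heat_kernel_def using assms \<theta> by (intro tendsto_intros) auto

text \<open>Approximation from later times: \<open>s \<le> r n\<close> makes \<open>p s 0\<close> a
  common bound for the kernels. The scheme evaluates the heat flow at the right end of a time step,
  which is of this kind.\<close>

lemma heat_op_tendsto:
  assumes r: "r \<longlonglongrightarrow> s" "0 < s" "\<And>n. s \<le> r n" and f: "integrable lborel f"
  shows "(\<lambda>n. heat_op (r n) f x) \<longlonglongrightarrow> heat_op s f x"
  unfolding heat_op_def convol_def
proof (rule integral_dominated_convergence)
  note [measurable] = borel_measurable_integrable[OF f]
  show "(\<lambda>y. p s (x - y) * f y) \<in> borel_measurable lborel" "\<And>n. (\<lambda>y. p (r n) (x - y) * f y) \<in> borel_measurable lborel" by measurable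
  show "integrable lborel (\<lambda>y. p s 0 * \<bar>f y\<bar>)" using f by simp
  show "AE y in lborel. (\<lambda>n. p (r n) (x - y) * f y) \<longlonglongrightarrow> p s (x - y) * f y"
    using r by (intro AE_I2 tendsto_mult heat_tendsto tendsto_const)
  fix n
  have "0 < r n" using r(2,3) by (rule less_le_trans)
  then have "p (r n) (x - y) \<le> p s 0" for y
    using heat_le[of "r n" "x - y"] heat_antimono[OF r(2) r(3)[of n]] \<open>0 < r n\<close> by (meson order_trans)
  then show "AE y in lborel. norm (p (r n) (x - y) * f y) \<le> p s 0 * \<bar>f y\<bar>"
    using \<open>0 < r n\<close> by (auto simp: abs_mult heat_nonneg intro!: mult_right_mono)
qed

end

section \<open>Convolution inequalities in time\<close>

lemma pred_mem_greaterThanLessThan [measurable (raw)]: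
  fixes f g h :: "'b \<Rightarrow> real"
  assumes [measurable]: "f \<in> borel_measurable N" "g \<in> borel_measurable N" "h \<in> borel_measurable N"
  shows "Measurable.pred N (\<lambda>x. h x \<in> {f x<..<g x})"
  unfolding greaterThanLessThan_iff by measurable

text \<open>The weight factorises as exp (-c t) = exp (-c (t - s)) exp (-c s). After the exchange of
  integrals, t - s is allowed to run over the whole half-line.\<close>

lemma time_convolution_bound:
  fixes k g :: "real \<Rightarrow> ennreal" and T c :: real
  assumes [measurable]: "k \<in> borel_measurable borel" "g \<in> borel_measurable borel"
  shows "(\<integral>\<^sup>+t\<in>{0<..<T}. ennreal (exp (- c * t)) * (\<integral>\<^sup>+s\<in>{0<..<t}. k (t - s) * g s \<partial>lborel) \<partial>lborel) \<le>
    (\<integral>\<^sup>+r\<in>{0<..}. ennreal (exp (- c * r)) * k r \<partial>lborel) * (\<integral>\<^sup>+s\<in>{0<..<T}. ennreal (exp (- c * s)) * g s \<partial>lborel)"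
    (is "?L \<le> ?K * ?G")
proof -
  have "?L = (\<integral>\<^sup>+t. \<integral>\<^sup>+s. ennreal (exp (- c * t)) * k (t - s) * g s * indicator {0<..<t} s * indicator {0<..<T} t \<partial>lborel \<partial>lborel)"
  proof (intro nn_integral_cong)
    fix t
    have "(\<integral>\<^sup>+s. ennreal (exp (- c * t)) * k (t - s) * g s * indicator {0<..<t} s * indicator {0<..<T} t \<partial>lborel) =
      (\<integral>\<^sup>+s. ennreal (exp (- c * t)) * (k (t - s) * g s * indicator {0<..<t} s) \<partial>lborel) * indicator {0<..<T} t"
      by (subst nn_integral_multc[symmetric]) (auto simp: mult.assoc)
    also have "\<dots> = ennreal (exp (- c * t)) * (\<integral>\<^sup>+s\<in>{0<..<t}. k (t - s) * g s \<partial>lborel) * indicator {0<..<T} t"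
      by (subst nn_integral_cmult) auto
    finally show "ennreal (exp (- c * t)) * (\<integral>\<^sup>+s\<in>{0<..<t}. k (t - s) * g s \<partial>lborel) * indicator {0<..<T} t =
      (\<integral>\<^sup>+s. ennreal (exp (- c * t)) * k (t - s) * g s * indicator {0<..<t} s * indicator {0<..<T} t \<partial>lborel)" by simp
  qed
  also have "\<dots> = (\<integral>\<^sup>+s. \<integral>\<^sup>+t. ennreal (exp (- c * t)) * k (t - s) * g s * indicator {0<..<t} s * indicator {0<..<T} t \<partial>lborel \<partial>lborel)"
    by (rule lborel_pair.Fubini') measurable
  also have "\<dots> \<le> (\<integral>\<^sup>+s. ?K * (ennreal (exp (- c * s)) * g s * indicator {0<..<T} s) \<partial>lborel)"
  proof (intro nn_integral_mono)
    fix s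
    have "(\<integral>\<^sup>+t. ennreal (exp (- c * t)) * k (t - s) * g s * indicator {0<..<t} s * indicator {0<..<T} t \<partial>lborel) \<le>
      (\<integral>\<^sup>+t. (ennreal (exp (- c * (t - s))) * k (t - s) * indicator {0<..} (t - s)) * (ennreal (exp (- c * s)) * g s * indicator {0<..<T} s) \<partial>lborel)"
    proof (intro nn_integral_mono)
      fix t
      have "ennreal (exp (- c * t)) = ennreal (exp (- c * (t - s))) * ennreal (exp (- c * s))"
        by (simp add: ennreal_mult[symmetric] exp_add[symmetric] algebra_simps)
      then show "ennreal (exp (- c * t)) * k (t - s) * g s * indicator {0<..<t} s * indicator {0<..<T} t \<le>
        (ennreal (exp (- c * (t - s))) * k (t - s) * indicator {0<..} (t - s)) * (ennreal (exp (- c * s)) * g s * indicator {0<..<T} s)"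
        by (auto simp: indicator_def mult_ac)
    qed
    also have "\<dots> = (\<integral>\<^sup>+t. ennreal (exp (- c * (t - s))) * k (t - s) * indicator {0<..} (t - s) \<partial>lborel) * (ennreal (exp (- c * s)) * g s * indicator {0<..<T} s)"
      by (rule nn_integral_multc) measurable
    also have "(\<integral>\<^sup>+t. ennreal (exp (- c * (t - s))) * k (t - s) * indicator {0<..} (t - s) \<partial>lborel) = ?K"
      by (subst nn_integral_real_affine[where c = 1 and t = s]) auto
    finally show "(\<integral>\<^sup>+t. ennreal (exp (- c * t)) * k (t - s) * g s * indicator {0<..<t} s * indicator {0<..<T} t \<partial>lborel)
      \<le> ?K * (ennreal (exp (- c * s)) * g s * indicator {0<..<T} s)" .
  qed
  also have "\<dots> = ?K * ?G" by (rule nn_integral_cmult) measurable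
  finally show ?thesis .
qed

context heat
begin

lemma space_convolution:
  assumes "0 < r" and [measurable]: "g \<in> borel_measurable borel"
  shows "(\<integral>\<^sup>+x. \<integral>\<^sup>+y. ennreal ((p r (x - y))\<^sup>2) * g y \<partial>lborel \<partial>lborel) = ennreal (p (2 * r) 0) * (\<integral>\<^sup>+y. g y \<partial>lborel)"
proof -
  have "(\<integral>\<^sup>+x. \<integral>\<^sup>+y. ennreal ((p r (x - y))\<^sup>2) * g y \<partial>lborel \<partial>lborel) = (\<integral>\<^sup>+y. \<integral>\<^sup>+x. ennreal ((p r (x - y))\<^sup>2) * g y \<partial>lborel \<partial>lborel)"
    by (rule lborel_pair.Fubini') measurable
  then show ?thesis using assms(1) by (simp add: nn_integral_multc nn_integral_cmult heat_square)
qed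

text \<open>The operator by which the Walsh isometry turns the second moment of \<sigma>(u) into
  that of the stochastic integral at (t, x).\<close>

definition square_conv :: "(real \<Rightarrow> real \<Rightarrow> ennreal) \<Rightarrow> real \<Rightarrow> real \<Rightarrow> ennreal" where
  "square_conv f t x = (\<integral>\<^sup>+s\<in>{0<..<t}. (\<integral>\<^sup>+y. ennreal ((p (t - s) (x - y))\<^sup>2) * f s y \<partial>lborel) \<partial>lborel)"

lemma square_conv_measurable[measurable (raw)]:
  assumes [measurable]: "case_prod f \<in> borel_measurable (borel \<Otimes>\<^sub>M borel)" "g \<in> borel_measurable N" "h \<in> borel_measurable N"
  shows "(\<lambda>z. square_conv f (g z) (h z)) \<in> borel_measurable N"
proof -
  have "(\<lambda>z. square_conv f (fst z) (snd z)) \<in> borel_measurable (borel \<Otimes>\<^sub>M borel)"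
    unfolding square_conv_def by measurable
  from measurable_compose[OF measurable_Pair[OF assms(2,3)] this] show ?thesis by simp
qed

lemma square_conv_space:
  assumes [measurable]: "case_prod f \<in> borel_measurable (borel \<Otimes>\<^sub>M borel)"
  shows "(\<integral>\<^sup>+x. square_conv f t x \<partial>lborel) = (\<integral>\<^sup>+s\<in>{0<..<t}. ennreal (p (2 * (t - s)) 0) * (\<integral>\<^sup>+y. f s y \<partial>lborel) \<partial>lborel)"
proof -
  have "(\<integral>\<^sup>+x. square_conv f t x \<partial>lborel) =
     (\<integral>\<^sup>+s. \<integral>\<^sup>+x. (\<integral>\<^sup>+y. ennreal ((p (t - s) (x - y))\<^sup>2) * f s y \<partial>lborel) * indicator {0<..<t} s \<partial>lborel \<partial>lborel)"
    unfolding square_conv_def by (rule lborel_pair.Fubini') measurable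
  also have "\<dots> = (\<integral>\<^sup>+s\<in>{0<..<t}. ennreal (p (2 * (t - s)) 0) * (\<integral>\<^sup>+y. f s y \<partial>lborel) \<partial>lborel)"
  proof (intro nn_integral_cong)
    fix s
    have "(\<integral>\<^sup>+x. (\<integral>\<^sup>+y. ennreal ((p (t - s) (x - y))\<^sup>2) * f s y \<partial>lborel) * indicator {0<..<t} s \<partial>lborel) =
      (\<integral>\<^sup>+x. (\<integral>\<^sup>+y. ennreal ((p (t - s) (x - y))\<^sup>2) * f s y \<partial>lborel) \<partial>lborel) * indicator {0<..<t} s"
      by (rule nn_integral_multc) measurable
    then show "(\<integral>\<^sup>+x. (\<integral>\<^sup>+y. ennreal ((p (t - s) (x - y))\<^sup>2) * f s y \<partial>lborel) * indicator {0<..<t} s \<partial>lborel) =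
      ennreal (p (2 * (t - s)) 0) * (\<integral>\<^sup>+y. f s y \<partial>lborel) * indicator {0<..<t} s"
      using space_convolution[of "t - s" "f s"] by (auto simp: indicator_def)
  qed
  finally show ?thesis .
qed

text \<open>Integration over x collapses the squared kernel to p_{2(t-s)}(0), and the constant is
  the Laplace transform of p_{2r}(0) at \<open>c\<close>. It becomes arbitrarily small for large
  \<open>c\<close>.\<close>

lemma square_conv_weighted:
  assumes c: "0 < c" and [measurable]: "case_prod f \<in> borel_measurable (borel \<Otimes>\<^sub>M borel)"
  shows "(\<integral>\<^sup>+t\<in>{0<..<T}. ennreal (exp (- c * t)) * (\<integral>\<^sup>+x. square_conv f t x \<partial>lborel) \<partial>lborel) \<le>
    ennreal (1 / (2 * sqrt (c * \<theta>))) * (\<integral>\<^sup>+s\<in>{0<..<T}. ennreal (exp (- c * s)) * (\<integral>\<^sup>+y. f s y \<partial>lborel) \<partial>lborel)"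
proof -
  have "(\<integral>\<^sup>+r\<in>{0<..}. ennreal (exp (- c * r)) * ennreal (p (2 * r) 0) \<partial>lborel) = ennreal (1 / (2 * sqrt (c * \<theta>)))"
    unfolding heat_laplace0[OF c, symmetric]
    by (intro nn_integral_cong) (auto simp: indicator_def ennreal_mult heat_nonneg)
  then show ?thesis unfolding square_conv_space[OF assms(2)]
    using time_convolution_bound[of "\<lambda>r. ennreal (p (2 * r) 0)" "\<lambda>s. \<integral>\<^sup>+y. f s y \<partial>lborel" c T] by simp
qed

lemma square_conv_mono:
  assumes "\<And>s y. 0 < s \<Longrightarrow> s < t \<Longrightarrow> f s y \<le> g s y"
  shows "square_conv f t x \<le> square_conv g t x"
  unfolding square_conv_def using assms
  by (intro nn_integral_mono) (auto simp: indicator_def intro!: nn_integral_mono mult_left_mono)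

lemma square_conv_add:
  assumes [measurable]: "case_prod f \<in> borel_measurable (borel \<Otimes>\<^sub>M borel)" "case_prod g \<in> borel_measurable (borel \<Otimes>\<^sub>M borel)"
  shows "square_conv (\<lambda>s y. f s y + g s y) t x = square_conv f t x + square_conv g t x"
proof -
  have "(\<integral>\<^sup>+y. ennreal ((p (t - s) (x - y))\<^sup>2) * (f s y + g s y) \<partial>lborel) =
    (\<integral>\<^sup>+y. ennreal ((p (t - s) (x - y))\<^sup>2) * f s y \<partial>lborel) + (\<integral>\<^sup>+y. ennreal ((p (t - s) (x - y))\<^sup>2) * g s y \<partial>lborel)" for s
    unfolding distrib_left by (rule nn_integral_add) measurable
  then show ?thesis unfolding square_conv_def by (simp add: distrib_right nn_integral_add)
qed

lemma square_conv_cmult: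
  assumes [measurable]: "case_prod f \<in> borel_measurable (borel \<Otimes>\<^sub>M borel)"
  shows "square_conv (\<lambda>s y. C * f s y) t x = C * square_conv f t x"
proof -
  have "(\<integral>\<^sup>+y. ennreal ((p (t - s) (x - y))\<^sup>2) * (C * f s y) \<partial>lborel) =
    C * (\<integral>\<^sup>+y. ennreal ((p (t - s) (x - y))\<^sup>2) * f s y \<partial>lborel)" for s
    unfolding mult.left_commute[of _ C] by (rule nn_integral_cmult) measurable
  then show ?thesis unfolding square_conv_def by (simp add: mult.assoc nn_integral_cmult)
qed

text \<open>Up to an inequality, an exponential in time is an eigenfunction whose eigenvalue is the
  same Laplace transform. This measures the remainder when the renewal inequality is
  iterated.\<close>

lemma square_conv_exp:
  assumes c: "0 < c"
  shows "square_conv (\<lambda>s y. K * ennreal (exp (c * s))) t x \<le> ennreal (1 / (2 * sqrt (c * \<theta>))) * (K * ennreal (exp (c * t)))"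
proof -
  have "square_conv (\<lambda>s y. K * ennreal (exp (c * s))) t x = (\<integral>\<^sup>+s\<in>{0<..<t}. ennreal (p (2 * (t - s)) 0) * (K * ennreal (exp (c * s))) \<partial>lborel)"
    unfolding square_conv_def
    by (intro nn_integral_cong) (auto simp: indicator_def nn_integral_multc heat_square)
  also have "\<dots> \<le> (\<integral>\<^sup>+s. ennreal (exp (- c * (t - s)) * p (2 * (t - s)) 0) * indicator {0<..} (t - s) * (K * ennreal (exp (c * t))) \<partial>lborel)"
  proof (intro nn_integral_mono)
    fix s
    have "ennreal (exp (c * s)) = ennreal (exp (- c * (t - s))) * ennreal (exp (c * t))"
      by (simp add: ennreal_mult[symmetric] exp_add[symmetric] algebra_simps)
    then show "ennreal (p (2 * (t - s)) 0) * (K * ennreal (exp (c * s))) * indicator {0<..<t} s \<le>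
      ennreal (exp (- c * (t - s)) * p (2 * (t - s)) 0) * indicator {0<..} (t - s) * (K * ennreal (exp (c * t)))"
      by (auto simp: indicator_def ennreal_mult heat_nonneg mult_ac)
  qed
  also have "\<dots> = (\<integral>\<^sup>+s. ennreal (exp (- c * (t - s)) * p (2 * (t - s)) 0) * indicator {0<..} (t - s) \<partial>lborel) * (K * ennreal (exp (c * t)))"
    by (rule nn_integral_multc) measurable
  also have "(\<integral>\<^sup>+s. ennreal (exp (- c * (t - s)) * p (2 * (t - s)) 0) * indicator {0<..} (t - s) \<partial>lborel) = ennreal (1 / (2 * sqrt (c * \<theta>)))"
    unfolding heat_laplace0[OF c, symmetric]
    by (subst nn_integral_real_affine[where c = "-1" and t = t]) auto
  finally show ?thesis .
qed

text \<open>
  The contraction argument needs \<open>m\<close> to be integrable in space, which is what has to be shown; so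
  the inequality is iterated, and the remainder is controlled by the bound on \<open>m\<close>.
\<close>

lemma renewal_integrable:
  assumes [measurable]: "case_prod m \<in> borel_measurable (borel \<Otimes>\<^sub>M borel)" "case_prod a \<in> borel_measurable (borel \<Otimes>\<^sub>M borel)"
    and B: "B < \<infinity>" "\<And>t x. 0 < t \<Longrightarrow> t < T \<Longrightarrow> m t x \<le> B"
    and m: "\<And>t x. 0 < t \<Longrightarrow> t < T \<Longrightarrow> m t x \<le> a t x + ennreal C * square_conv m t x"
    and c: "0 < c" and C: "0 \<le> C" "C / (2 * sqrt (c * \<theta>)) \<le> 1 / 2"
  shows "(\<integral>\<^sup>+t\<in>{0<..<T}. ennreal (exp (- c * t)) * (\<integral>\<^sup>+x. m t x \<partial>lborel) \<partial>lborel) \<le>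
    2 * (\<integral>\<^sup>+t\<in>{0<..<T}. ennreal (exp (- c * t)) * (\<integral>\<^sup>+x. a t x \<partial>lborel) \<partial>lborel)"
proof -
  define N where "N f = (\<integral>\<^sup>+t\<in>{0<..<T}. ennreal (exp (- c * t)) * (\<integral>\<^sup>+x. f t x \<partial>lborel) \<partial>lborel)" for f :: "real \<Rightarrow> real \<Rightarrow> ennreal"
  \<comment> \<open>Picard iterates of the renewal equation with inhomogeneity \<open>a\<close>,
    started at zero.\<close>
  define f where "f j = rec_nat (\<lambda>t x. 0) (\<lambda>_ f t x. a t x + ennreal C * square_conv f t x) j" for j
  have f0: "f 0 = (\<lambda>t x. 0)" and fS: "f (Suc j) = (\<lambda>t x. a t x + ennreal C * square_conv (f j) t x)" for j
    by (simp_all add: f_def)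
  have fm[measurable]: "case_prod (f j) \<in> borel_measurable (borel \<Otimes>\<^sub>M borel)" for j
  proof (induction j)
    case (Suc j)
    note [measurable] = Suc
    show ?case unfolding fS by measurable
  qed (simp add: f0)
  have half: "ennreal C * ennreal (1 / (2 * sqrt (c * \<theta>))) \<le> ennreal (1 / 2)"
  proof -
    have "ennreal C * ennreal (1 / (2 * sqrt (c * \<theta>))) = ennreal (C * (1 / (2 * sqrt (c * \<theta>))))"
      by (rule ennreal_mult[symmetric]) (use C c \<theta> in auto)
    also have "\<dots> \<le> ennreal (1 / 2)" by (rule ennreal_leI) (use C in simp)
    finally show ?thesis .
  qed
  \<comment> \<open>After \<open>j\<close> iterations the remainder carries the bound
    \<open>B\<close>; each application of the operator costs a factor 1/2 relative to the growing
    weight exp (c t).\<close>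
  have mf: "m t x \<le> f j t x + ennreal ((1 / 2) ^ j) * B * ennreal (exp (c * t))" if "0 < t" "t < T" for j t x
    using that
  proof (induction j arbitrary: t x)
    case 0
    have "B * 1 \<le> B * ennreal (exp (c * t))" using 0 c by (intro mult_left_mono) auto
    then show ?case using B(2)[OF 0, of x] by (simp add: f0)
  next
    case (Suc j)
    let ?K = "ennreal ((1 / 2) ^ j) * B"
    have "square_conv m t x \<le> square_conv (\<lambda>s y. f j s y + ?K * ennreal (exp (c * s))) t x"
      using Suc by (intro square_conv_mono) auto
    also have "\<dots> = square_conv (f j) t x + square_conv (\<lambda>s y. ?K * ennreal (exp (c * s))) t x"
      by (rule square_conv_add) measurable
    also have "\<dots> \<le> square_conv (f j) t x + ennreal (1 / (2 * sqrt (c * \<theta>))) * (?K * ennreal (exp (c * t)))"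
      using square_conv_exp[OF c] by (intro add_mono) auto
    finally have "m t x \<le> a t x + ennreal C * (square_conv (f j) t x + ennreal (1 / (2 * sqrt (c * \<theta>))) * (?K * ennreal (exp (c * t))))"
      using m[OF Suc.prems, of x] by (meson add_left_mono mult_left_mono order_trans zero_le)
    also have "\<dots> = f (Suc j) t x + (ennreal C * ennreal (1 / (2 * sqrt (c * \<theta>)))) * (?K * ennreal (exp (c * t)))"
      by (simp add: fS distrib_left add.assoc mult.assoc)
    also have "\<dots> \<le> f (Suc j) t x + ennreal (1 / 2) * (?K * ennreal (exp (c * t)))"
      using half by (intro add_mono mult_right_mono) auto
    also have "ennreal (1 / 2) * (?K * ennreal (exp (c * t))) = ennreal ((1 / 2) ^ Suc j) * B * ennreal (exp (c * t))"
      by (simp only: power_Suc) (subst ennreal_mult, simp_all add: mult.assoc)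
    finally show ?case .
  qed
  \<comment> \<open>The value 2 N a solves z = N a + z / 2, so the induction reproduces it.\<close>
  have Nf: "N (f j) \<le> 2 * N a" for j
  proof (induction j)
    case (Suc j)
    have "N (f (Suc j)) = N a + ennreal C * N (square_conv (f j))"
    proof -
      have "N (f (Suc j)) = (\<integral>\<^sup>+t. ennreal (exp (- c * t)) * (\<integral>\<^sup>+x. a t x \<partial>lborel) * indicator {0<..<T} t
         + ennreal C * (ennreal (exp (- c * t)) * (\<integral>\<^sup>+x. square_conv (f j) t x \<partial>lborel) * indicator {0<..<T} t) \<partial>lborel)"
        unfolding N_def fS by (intro nn_integral_cong) (simp add: nn_integral_add nn_integral_cmult algebra_simps)
      also have "\<dots> = N a + ennreal C * N (square_conv (f j))"
        unfolding N_def by (simp add: nn_integral_add nn_integral_cmult)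
      finally show ?thesis .
    qed
    also have "N (square_conv (f j)) \<le> ennreal (1 / (2 * sqrt (c * \<theta>))) * N (f j)"
      unfolding N_def by (rule square_conv_weighted[OF c fm])
    also have "N a + ennreal C * (ennreal (1 / (2 * sqrt (c * \<theta>))) * N (f j)) \<le> N a + ennreal (1 / 2) * (2 * N a)"
      using mult_mono[OF half Suc] by (intro add_mono order_refl) (simp add: mult.assoc)
    also have "ennreal (1 / 2) * (2 * N a) = N a"
    proof -
      have "ennreal (1 / 2) * 2 = ennreal (1 / 2 * 2)" by (subst ennreal_mult) auto
      then show ?thesis by (simp add: mult.assoc[symmetric])
    qed
    also have "N a + N a = 2 * N a" by (simp add: mult_2)
    finally show ?case by (meson add_left_mono mult_left_mono order_trans zero_le)
  qed (simp add: N_def f0)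
  have incf: "f j t x \<le> f (Suc j) t x" for j t x
  proof (induction j arbitrary: t x)
    case (Suc j)
    show ?case unfolding fS[of "Suc j"] using Suc
      by (subst fS) (intro add_mono mult_left_mono square_conv_mono, auto)
  qed (simp add: f0)
  have lim: "m t x \<le> (SUP j. f j t x)" if t: "0 < t" "t < T" for t x
  proof -
    let ?e = "\<lambda>j. ennreal ((1 / 2) ^ j) * B * ennreal (exp (c * t))"
    have "(\<lambda>j. ennreal ((1 / 2) ^ j) * (B * ennreal (exp (c * t)))) \<longlonglongrightarrow> ennreal 0 * (B * ennreal (exp (c * t)))"
      using B(1) by (intro tendsto_mult_ennreal tendsto_ennrealI tendsto_const LIMSEQ_power_zero) (auto simp: ennreal_mult_eq_top_iff)
    then have "(\<lambda>j. (SUP j. f j t x) + ?e j) \<longlonglongrightarrow> (SUP j. f j t x) + 0"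
      by (intro tendsto_add tendsto_const) (simp add: mult.assoc)
    moreover have "m t x \<le> (SUP j. f j t x) + ?e j" for j
      by (rule order_trans[OF mf[OF t, of x j]]) (intro add_right_mono SUP_upper, simp)
    ultimately show ?thesis by (intro LIMSEQ_le_const[of _ "(SUP j. f j t x)"]) auto
  qed
  have inc: "incseq (\<lambda>j x. f j t x * w)" for t and w :: ennreal
    using incf by (intro incseq_SucI le_funI mult_right_mono) auto
  let ?w = "\<lambda>t. ennreal (exp (- c * t)) * indicator {0<..<T} t"
  have N: "N g = (\<integral>\<^sup>+t. \<integral>\<^sup>+x. g t x * ?w t \<partial>lborel \<partial>lborel)"
    if [measurable]: "case_prod g \<in> borel_measurable (borel \<Otimes>\<^sub>M borel)" for g
    unfolding N_def by (intro nn_integral_cong) (simp add: nn_integral_multc mult_ac)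
  have "N m \<le> (\<integral>\<^sup>+t. \<integral>\<^sup>+x. (SUP j. f j t x * ?w t) \<partial>lborel \<partial>lborel)"
    unfolding N[OF assms(1)]
  proof (intro nn_integral_mono)
    fix t x
    have "m t x * ?w t \<le> (SUP j. f j t x) * ?w t"
      using lim[of t x] by (cases "t \<in> {0<..<T}") (auto intro: mult_right_mono)
    then show "m t x * ?w t \<le> (SUP j. f j t x * ?w t)"
      by (simp add: SUP_mult_right_ennreal)
  qed
  also have "\<dots> = (\<integral>\<^sup>+t. (SUP j. \<integral>\<^sup>+x. f j t x * ?w t \<partial>lborel) \<partial>lborel)"
    by (intro nn_integral_cong nn_integral_monotone_convergence_SUP inc) measurable
  also have "\<dots> = (SUP j. \<integral>\<^sup>+t. \<integral>\<^sup>+x. f j t x * ?w t \<partial>lborel \<partial>lborel)"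
    using incf by (intro nn_integral_monotone_convergence_SUP incseq_SucI le_funI nn_integral_mono mult_right_mono) auto
  also have "\<dots> = (SUP j. N (f j))" by (simp add: N)
  also have "\<dots> \<le> 2 * N a" using Nf by (intro SUP_least)
  finally show ?thesis by (simp add: N_def)
qed

lemma exists_contraction_rate:
  assumes "0 \<le> C" obtains c where "0 < c" "C / (2 * sqrt (c * \<theta>)) \<le> 1 / 2"
proof -
  \<comment> \<open>This makes sqrt (c \<theta>) equal to C + 1, and the quotient equal to C / (2 (C
    + 1)).\<close>
  define c where "c = (C + 1)\<^sup>2 / \<theta>"
  have "sqrt (c * \<theta>) = C + 1" using \<theta> assms by (simp add: c_def)
  then have "0 < c \<and> C / (2 * sqrt (c * \<theta>)) \<le> 1 / 2" using \<theta> assms by (auto simp: c_def field_simps)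
  then show thesis using that by blast
qed

end

section \<open>Second moments of mild solutions\<close>

locale solution = noise M \<xi> + heat \<theta>
  for M :: "'a measure" and \<xi> :: "(real \<times> real \<Rightarrow> real) \<Rightarrow> 'a \<Rightarrow> real" and \<theta> :: real +
  fixes \<sigma> u\<^sub>0 :: "real \<Rightarrow> real" and u :: "real \<Rightarrow> real \<Rightarrow> 'a \<Rightarrow> real" and L :: real
  assumes Lip: "\<And>a b. \<bar>\<sigma> a - \<sigma> b\<bar> \<le> L * \<bar>a - b\<bar>" and L: "0 \<le> L" and \<sigma>0: "\<sigma> 0 = 0"
    and u\<^sub>0: "integrable lborel u\<^sub>0" "\<exists>C. AE x in lborel. \<bar>u\<^sub>0 x\<bar> \<le> C" "AE x in lborel. 0 \<le> u\<^sub>0 x"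
    and mild: "mild_solution M \<xi> \<theta> \<sigma> u\<^sub>0 u"
begin

lemma sigma_bound: "\<bar>\<sigma> a\<bar> \<le> L * \<bar>a\<bar>"
  using Lip[of a 0] by (simp add: \<sigma>0)

lemma sigma_square_bound: "(\<sigma> a)\<^sup>2 \<le> L\<^sup>2 * a\<^sup>2"
  using power_mono[OF sigma_bound[of a], of 2] by (simp add: power_mult_distrib)

lemma sigma_continuous: "continuous_on UNIV \<sigma>"
proof -
  have "L-lipschitz_on UNIV \<sigma>" using Lip L by (intro lipschitz_onI) (auto simp: dist_real_def)
  then show ?thesis by (rule lipschitz_on_continuous_on)
qed

lemma sigma_measurable[measurable]: "\<sigma> \<in> borel_measurable borel"
  using sigma_continuous by (rule borel_measurable_continuous_onI)

lemma u0_measurable[measurable]: "u\<^sub>0 \<in> borel_measurable borel"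
  using u\<^sub>0(1) by (auto dest: borel_measurable_integrable)

lemma u0_square: "(\<integral>\<^sup>+x. ennreal ((u\<^sub>0 x)\<^sup>2) \<partial>lborel) < \<infinity>"
proof -
  obtain C where C: "AE x in lborel. \<bar>u\<^sub>0 x\<bar> \<le> C" using u\<^sub>0(2) by blast
  have "(\<integral>\<^sup>+x. ennreal ((u\<^sub>0 x)\<^sup>2) \<partial>lborel) \<le> (\<integral>\<^sup>+x. ennreal \<bar>C\<bar> * ennreal \<bar>u\<^sub>0 x\<bar> \<partial>lborel)"
    using C
  proof (intro nn_integral_mono_AE, eventually_elim)
    fix x assume "\<bar>u\<^sub>0 x\<bar> \<le> C"
    then have "\<bar>u\<^sub>0 x\<bar> * \<bar>u\<^sub>0 x\<bar> \<le> \<bar>C\<bar> * \<bar>u\<^sub>0 x\<bar>" by (intro mult_right_mono) auto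
    then show "ennreal ((u\<^sub>0 x)\<^sup>2) \<le> ennreal \<bar>C\<bar> * ennreal \<bar>u\<^sub>0 x\<bar>"
      by (simp add: ennreal_mult[symmetric] power2_eq_square ennreal_leI)
  qed
  also have "\<dots> < \<infinity>"
    using u\<^sub>0(1) by (simp add: nn_integral_cmult ennreal_mult_less_top integrable_iff_bounded)
  finally show ?thesis .
qed

text \<open>The predictable \<open>\<sigma>\<close>-algebra only sees times \<open>t \<ge> 0\<close>; clamping makes the field measurable on the whole plane.\<close>

definition uc :: "real \<Rightarrow> real \<Rightarrow> 'a \<Rightarrow> real" where
  "uc t x \<omega> = u (max 0 t) x \<omega>"

lemma uc_eq: "0 \<le> t \<Longrightarrow> uc t x \<omega> = u t x \<omega>"
  by (simp add: uc_def max_def)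

lemma uc_measurable[measurable (raw)]:
  assumes f: "f \<in> measurable N M" and [measurable]: "g \<in> borel_measurable N" "h \<in> borel_measurable N"
  shows "(\<lambda>x. uc (g x) (h x) (f x)) \<in> borel_measurable N"
proof -
  have "predictable M \<xi> u" using mild by (simp add: mild_solution_def)
  note c = predictable_clamp[OF this]
  have "(\<lambda>x. (f x, g x, h x)) \<in> measurable N spacetime"
    unfolding spacetime_def using f by measurable
  from measurable_compose[OF this c] show ?thesis by (simp add: uc_def)
qed

definition walsh_kernel :: "real \<Rightarrow> real \<Rightarrow> real \<Rightarrow> real \<Rightarrow> 'a \<Rightarrow> real" where
  "walsh_kernel t x = (\<lambda>s y \<omega>. indicator {0<..<t} s * p (t - s) (x - y) * \<sigma> (u s y \<omega>))"

lemma field_walsh_kernel: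
  "field (walsh_kernel t x) = (\<lambda>(\<omega>, s, y). indicator {0<..<t} s * p (t - s) (x - y) * \<sigma> (uc s y \<omega>))"
  by (auto simp: field_def walsh_kernel_def indicator_def uc_eq)

lemma mild_representation:
  obtains I where "\<And>t x. 0 < t \<Longrightarrow> has_walsh_integral M \<xi> (walsh_kernel t x) (I t x)"
    "AE \<omega> in M. \<forall>t>0. \<forall>x. u t x \<omega> = heat_op t u\<^sub>0 x + I t x \<omega>"
  using mild that unfolding mild_solution_def walsh_kernel_def heat_op_def by blast

lemma spacetime_swap:
  assumes g: "g \<in> borel_measurable spacetime"
  shows "(\<integral>\<^sup>+z. g z \<partial>spacetime) = (\<integral>\<^sup>+s. \<integral>\<^sup>+y. \<integral>\<^sup>+\<omega>. g (\<omega>, s, y) \<partial>M \<partial>lborel \<partial>lborel)"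
proof -
  have sf: "sigma_finite_measure (lborel \<Otimes>\<^sub>M lborel :: (real \<times> real) measure)"
    unfolding lborel_prod by (rule lborel.sigma_finite_measure_axioms)
  interpret Q: pair_sigma_finite M "lborel \<Otimes>\<^sub>M lborel :: (real \<times> real) measure"
    by (intro pair_sigma_finite.intro sf) (rule sigma_finite_measure_axioms)
  note [measurable] = g[unfolded spacetime_def]
  have "(\<integral>\<^sup>+z. g z \<partial>spacetime) = (\<integral>\<^sup>+z. \<integral>\<^sup>+\<omega>. g (\<omega>, z) \<partial>M \<partial>(lborel \<Otimes>\<^sub>M lborel))"
    unfolding spacetime_def by (rule Q.nn_integral_snd[symmetric]) measurable
  also have "\<dots> = (\<integral>\<^sup>+s. \<integral>\<^sup>+y. \<integral>\<^sup>+\<omega>. g (\<omega>, s, y) \<partial>M \<partial>lborel \<partial>lborel)"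
    by (rule lborel.nn_integral_fst[symmetric]) measurable
  finally show ?thesis .
qed

text \<open>The stochastic integral is centred, so its mixed term with the deterministic heat flow
  drops out, and the isometry supplies the rest.\<close>

lemma second_moment:
  assumes t: "0 < t"
  shows "(\<integral>\<^sup>+\<omega>. ennreal ((uc t x \<omega>)\<^sup>2) \<partial>M) =
    ennreal ((heat_op t u\<^sub>0 x)\<^sup>2) + square_conv (\<lambda>s y. \<integral>\<^sup>+\<omega>. ennreal ((\<sigma> (uc s y \<omega>))\<^sup>2) \<partial>M) t x"
proof -
  obtain I where I: "\<And>t x. 0 < t \<Longrightarrow> has_walsh_integral M \<xi> (walsh_kernel t x) (I t x)"
    "AE \<omega> in M. \<forall>t>0. \<forall>x. u t x \<omega> = heat_op t u\<^sub>0 x + I t x \<omega>" by (rule mild_representation) blast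
  note w = walsh_isometry[OF I(1)[OF t, of x]]
  let ?Z = "I t x" and ?a = "heat_op t u\<^sub>0 x"
  have "(\<integral>\<^sup>+\<omega>. ennreal ((uc t x \<omega>)\<^sup>2) \<partial>M) = (\<integral>\<^sup>+\<omega>. ennreal ((?a + ?Z \<omega>)\<^sup>2) \<partial>M)"
    using I(2) by (intro nn_integral_cong_AE, eventually_elim) (use t in \<open>simp add: uc_eq\<close>)
  also have "\<dots> = ennreal (\<integral>\<omega>. ?a\<^sup>2 + 2 * ?a * ?Z \<omega> + (?Z \<omega>)\<^sup>2 \<partial>M)"
  proof -
    have e: "(?a + ?Z \<omega>)\<^sup>2 = ?a\<^sup>2 + 2 * ?a * ?Z \<omega> + (?Z \<omega>)\<^sup>2" for \<omega> by (simp add: power2_sum)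
    have "integrable M (\<lambda>\<omega>. ?a\<^sup>2 + 2 * ?a * ?Z \<omega> + (?Z \<omega>)\<^sup>2)" using w(5,6) by simp
    then show ?thesis unfolding e[symmetric] by (rule nn_integral_eq_integral) simp
  qed
  also have "(\<integral>\<omega>. ?a\<^sup>2 + 2 * ?a * ?Z \<omega> + (?Z \<omega>)\<^sup>2 \<partial>M) = ?a\<^sup>2 + (\<integral>\<omega>. (?Z \<omega>)\<^sup>2 \<partial>M)"
    using w by (simp add: prob_space)
  also have "ennreal (?a\<^sup>2 + (\<integral>\<omega>. (?Z \<omega>)\<^sup>2 \<partial>M)) = ennreal (?a\<^sup>2) + (\<integral>\<^sup>+\<omega>. ennreal ((?Z \<omega>)\<^sup>2) \<partial>M)"
    using w by (simp add: nn_integral_eq_integral)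
  also have "(\<integral>\<^sup>+\<omega>. ennreal ((?Z \<omega>)\<^sup>2) \<partial>M) = (\<integral>\<^sup>+s. \<integral>\<^sup>+y. \<integral>\<^sup>+\<omega>. ennreal ((field (walsh_kernel t x) (\<omega>, s, y))\<^sup>2) \<partial>M \<partial>lborel \<partial>lborel)"
    unfolding w(3) using w(1) by (intro spacetime_swap) auto
  also have "\<dots> = (\<integral>\<^sup>+s. \<integral>\<^sup>+y. ennreal ((p (t - s) (x - y))\<^sup>2) * (\<integral>\<^sup>+\<omega>. ennreal ((\<sigma> (uc s y \<omega>))\<^sup>2) \<partial>M) * indicator {0<..<t} s \<partial>lborel \<partial>lborel)"
  proof (intro nn_integral_cong)
    fix s y
    have "(\<integral>\<^sup>+\<omega>. ennreal ((field (walsh_kernel t x) (\<omega>, s, y))\<^sup>2) \<partial>M) =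
      (\<integral>\<^sup>+\<omega>. ennreal ((p (t - s) (x - y))\<^sup>2) * indicator {0<..<t} s * ennreal ((\<sigma> (uc s y \<omega>))\<^sup>2) \<partial>M)"
      by (intro nn_integral_cong) (auto simp: field_walsh_kernel indicator_def power_mult_distrib ennreal_mult)
    then show "(\<integral>\<^sup>+\<omega>. ennreal ((field (walsh_kernel t x) (\<omega>, s, y))\<^sup>2) \<partial>M) =
      ennreal ((p (t - s) (x - y))\<^sup>2) * (\<integral>\<^sup>+\<omega>. ennreal ((\<sigma> (uc s y \<omega>))\<^sup>2) \<partial>M) * indicator {0<..<t} s"
      by (subst (asm) nn_integral_cmult) (auto simp: mult_ac)
  qed
  also have "\<dots> = square_conv (\<lambda>s y. \<integral>\<^sup>+\<omega>. ennreal ((\<sigma> (uc s y \<omega>))\<^sup>2) \<partial>M) t x"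
    unfolding square_conv_def by (intro nn_integral_cong nn_integral_multc) measurable
  finally show ?thesis .
qed

lemma second_moment_bounded:
  "\<exists>B::ennreal. B < \<infinity> \<and> (\<forall>t x. 0 < t \<longrightarrow> t < T \<longrightarrow> (\<integral>\<^sup>+\<omega>. ennreal ((uc t x \<omega>)\<^sup>2) \<partial>M) \<le> B)"
proof -
  let ?B = "\<lambda>T. SUP t\<in>{0..T}. SUP x. \<integral>\<^sup>+\<omega>. ennreal (\<bar>u t x \<omega>\<bar>\<^sup>2) \<partial>M"
  have "?B (max 0 T) < \<infinity>" using mild unfolding mild_solution_def by auto
  moreover have "(\<integral>\<^sup>+\<omega>. ennreal ((uc t x \<omega>)\<^sup>2) \<partial>M) \<le> ?B (max 0 T)" if "0 < t" "t < T" for t x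
    using that by (intro SUP_upper2[of t] SUP_upper2[of x]) (auto simp: uc_eq)
  ultimately show ?thesis by blast
qed

text \<open>By \<open>second_moment\<close> and \<sigma>(a)^2 \<le> L^2 a^2 the second moment
  satisfies a renewal inequality, and the uniform bound contained in \<open>mild_solution\<close>
  starts the iteration of \<open>renewal_integrable\<close>. Before time T the weight is at least
  exp (-c T) and can be removed.\<close>

lemma energy_finite: "(\<integral>\<^sup>+t\<in>{0<..<T}. (\<integral>\<^sup>+x. \<integral>\<^sup>+\<omega>. ennreal ((uc t x \<omega>)\<^sup>2) \<partial>M \<partial>lborel) \<partial>lborel) < \<infinity>"
proof -
  let ?m = "\<lambda>t x. \<integral>\<^sup>+\<omega>. ennreal ((uc t x \<omega>)\<^sup>2) \<partial>M" and ?a = "\<lambda>t x. ennreal ((heat_op t u\<^sub>0 x)\<^sup>2)"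
  obtain c where c: "0 < c" "L\<^sup>2 / (2 * sqrt (c * \<theta>)) \<le> 1 / 2" by (rule exists_contraction_rate[of "L\<^sup>2"]) auto
  obtain B where B: "B < \<infinity>" "\<And>t x. 0 < t \<Longrightarrow> t < T \<Longrightarrow> ?m t x \<le> B" using second_moment_bounded[of T] by blast
  have m: "?m t x \<le> ?a t x + ennreal (L\<^sup>2) * square_conv ?m t x" if "0 < t" for t x
  proof -
    have "square_conv (\<lambda>s y. \<integral>\<^sup>+\<omega>. ennreal ((\<sigma> (uc s y \<omega>))\<^sup>2) \<partial>M) t x \<le> square_conv (\<lambda>s y. ennreal (L\<^sup>2) * ?m s y) t x"
      using sigma_square_bound
      by (intro square_conv_mono) (simp add: nn_integral_cmult[symmetric] ennreal_mult[symmetric] nn_integral_mono)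
    also have "\<dots> = ennreal (L\<^sup>2) * square_conv ?m t x"
      by (rule square_conv_cmult) measurable
    finally show ?thesis unfolding second_moment[OF that] by (intro add_left_mono)
  qed
  have "(\<integral>\<^sup>+t\<in>{0<..<T}. ennreal (exp (- c * t)) * (\<integral>\<^sup>+x. ?m t x \<partial>lborel) \<partial>lborel) \<le>
    2 * (\<integral>\<^sup>+t\<in>{0<..<T}. ennreal (exp (- c * t)) * (\<integral>\<^sup>+x. ?a t x \<partial>lborel) \<partial>lborel)"
    using B m c by (intro renewal_integrable[where B=B and C="L\<^sup>2"]) auto
  also have "\<dots> \<le> 2 * (\<integral>\<^sup>+t\<in>{0<..<T}. (\<integral>\<^sup>+x. ennreal ((u\<^sub>0 x)\<^sup>2) \<partial>lborel) \<partial>lborel)"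
  proof (intro mult_left_mono nn_integral_mono)
    fix t
    have "ennreal (exp (- c * t)) * (\<integral>\<^sup>+x. ?a t x \<partial>lborel) \<le> 1 * (\<integral>\<^sup>+x. ennreal ((u\<^sub>0 x)\<^sup>2) \<partial>lborel)" if "0 < t"
      using heat_op_L2[OF that u0_measurable] c that by (intro mult_mono) (auto simp: ennreal_le_1)
    then show "ennreal (exp (- c * t)) * (\<integral>\<^sup>+x. ?a t x \<partial>lborel) * indicator {0<..<T} t \<le> (\<integral>\<^sup>+x. ennreal ((u\<^sub>0 x)\<^sup>2) \<partial>lborel) * indicator {0<..<T} t"
      by (auto simp: indicator_def)
  qed auto
  also have "\<dots> < \<infinity>"
    using u0_square emeasure_bounded_finite[of "{0<..<T}"] by (simp add: nn_integral_cmult ennreal_mult_less_top)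
  finally have fin: "(\<integral>\<^sup>+t\<in>{0<..<T}. ennreal (exp (- c * t)) * (\<integral>\<^sup>+x. ?m t x \<partial>lborel) \<partial>lborel) < \<infinity>" .
  have "(\<integral>\<^sup>+t\<in>{0<..<T}. (\<integral>\<^sup>+x. ?m t x \<partial>lborel) \<partial>lborel) \<le>
    (\<integral>\<^sup>+t. ennreal (exp (c * T)) * (ennreal (exp (- c * t)) * (\<integral>\<^sup>+x. ?m t x \<partial>lborel) * indicator {0<..<T} t) \<partial>lborel)"
  proof (intro nn_integral_mono)
    fix t
    have "1 * (\<integral>\<^sup>+x. ?m t x \<partial>lborel) \<le> ennreal (exp (c * T) * exp (- c * t)) * (\<integral>\<^sup>+x. ?m t x \<partial>lborel)" if "t < T"
      using that c by (intro mult_right_mono) (auto simp: exp_add[symmetric] ennreal_1[symmetric] simp del: ennreal_1 intro!: ennreal_leI)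
    then show "(\<integral>\<^sup>+x. ?m t x \<partial>lborel) * indicator {0<..<T} t \<le> ennreal (exp (c * T)) * (ennreal (exp (- c * t)) * (\<integral>\<^sup>+x. ?m t x \<partial>lborel) * indicator {0<..<T} t)"
      by (auto simp: indicator_def ennreal_mult mult.assoc)
  qed
  also have "\<dots> < \<infinity>" using fin by (subst nn_integral_cmult) (auto simp: ennreal_mult_less_top)
  finally show ?thesis .
qed

end

section \<open>Step fields\<close>

context noise
begin

lemma walsh_shift_square:
  assumes "has_walsh_integral M \<xi> \<Phi> Z"
  shows "(\<integral>\<^sup>+\<omega>. ennreal ((a + Z \<omega>)\<^sup>2) \<partial>M) = ennreal (a\<^sup>2) + (\<integral>\<^sup>+z. ennreal ((field \<Phi> z)\<^sup>2) \<partial>spacetime)"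
proof -
  note w = walsh_isometry[OF assms]
  have e: "(a + Z \<omega>)\<^sup>2 = a\<^sup>2 + 2 * a * Z \<omega> + (Z \<omega>)\<^sup>2" for \<omega> by (simp add: power2_sum)
  have i: "integrable M (\<lambda>\<omega>. a\<^sup>2 + 2 * a * Z \<omega> + (Z \<omega>)\<^sup>2)" using w(5,6) by simp
  then have "(\<integral>\<^sup>+\<omega>. ennreal ((a + Z \<omega>)\<^sup>2) \<partial>M) = ennreal (\<integral>\<omega>. a\<^sup>2 + 2 * a * Z \<omega> + (Z \<omega>)\<^sup>2 \<partial>M)"
    unfolding e[symmetric] by (rule nn_integral_eq_integral) simp
  also have "(\<integral>\<omega>. a\<^sup>2 + 2 * a * Z \<omega> + (Z \<omega>)\<^sup>2 \<partial>M) = a\<^sup>2 + (\<integral>\<omega>. (Z \<omega>)\<^sup>2 \<partial>M)"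
    using w(5-7) by (simp add: prob_space)
  also have "ennreal (a\<^sup>2 + (\<integral>\<omega>. (Z \<omega>)\<^sup>2 \<partial>M)) = ennreal (a\<^sup>2) + (\<integral>\<^sup>+\<omega>. ennreal ((Z \<omega>)\<^sup>2) \<partial>M)"
    using w(5) by (simp add: nn_integral_eq_integral)
  finally show ?thesis by (simp add: w(3))
qed

lemma has_walsh_integral_zero: "has_walsh_integral M \<xi> (\<lambda>s y \<omega>. 0) (\<lambda>\<omega>. 0)"
  unfolding has_walsh_integral_iff
  by (intro conjI exI[of _ "\<lambda>_. []"]) (auto simp: predictable_def simple_data_def field_def simple_field_def simple_integral_noise_def split_beta')

lemma predictable_rectangle:
  assumes a: "0 \<le> a" "a < b" and A: "A \<in> sets borel" and X: "X \<in> borel_measurable (noise_filtration M \<xi> a)"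
  shows "predictable M \<xi> (\<lambda>s y \<omega>. X \<omega> * indicator {a<..b} s * indicator A y)"
  unfolding predictable_def
proof (rule measurableI)
  have gen: "{a<..b} \<times> A \<times> G \<in> sets (predictable_sigma M \<xi>)" if "G \<in> sets (noise_filtration M \<xi> a)" for G
    unfolding sets_predictable_sigma using a A that by (intro sigma_sets.Basic) blast
  fix B :: "real set" assume B: "B \<in> sets borel"
  let ?E = "{a<..b} \<times> A \<times> (X -` B \<inter> space M)" and ?E' = "{a<..b} \<times> A \<times> space M"
  have "?E \<in> sets (predictable_sigma M \<xi>)" using measurable_sets[OF X B] by (intro gen) simp
  moreover have "?E' \<in> sets (predictable_sigma M \<xi>)"
    using gen[OF sets.top] by simp
  moreover have "(\<lambda>(s, y, \<omega>). X \<omega> * indicator {a<..b} s * indicator A y) -` B \<inter> space (predictable_sigma M \<xi>) =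
    ?E \<union> (if 0 \<in> B then space (predictable_sigma M \<xi>) - ?E' else {})"
  proof (intro set_eqI)
    fix z :: "real \<times> real \<times> 'a"
    obtain s y \<omega> where z: "z = (s, y, \<omega>)" by (metis prod_cases3)
    show "z \<in> (\<lambda>(s, y, \<omega>). X \<omega> * indicator {a<..b} s * indicator A y) -` B \<inter> space (predictable_sigma M \<xi>) \<longleftrightarrow>
      z \<in> ?E \<union> (if 0 \<in> B then space (predictable_sigma M \<xi>) - ?E' else {})"
      using a by (cases "s \<in> {a<..b} \<and> y \<in> A") (auto simp: z)
  qed
  ultimately show "(\<lambda>(s, y, \<omega>). X \<omega> * indicator {a<..b} s * indicator A y) -` B \<inter> space (predictable_sigma M \<xi>) \<in> sets (predictable_sigma M \<xi>)"
    by (cases "0 \<in> B") (simp_all only: if_True if_False sets.Un sets.compl_sets Un_empty_right)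
qed simp

lemma field_rectangle:
  assumes "0 \<le> a"
  shows "field (\<lambda>s y \<omega>. X \<omega> * indicator {a<..b} s * indicator A y) = (\<lambda>(\<omega>, s, y). X \<omega> * indicator {a<..b} s * indicator A y)"
  using assms by (auto simp: field_def indicator_def)

text \<open>Simple data must be bounded, but here the coefficient is only square integrable. It is
  truncated at level n; both approximation errors then equal the squared L^2 error of the truncation
  times the area of the rectangle, on the noise side by independence.\<close>

lemma has_walsh_integral_rectangle:
  assumes a: "0 \<le> a" "a < b" and A: "A \<in> sets borel" "emeasure lborel A < \<infinity>"
    and X: "X \<in> borel_measurable (noise_filtration M \<xi> a)" "integrable M (\<lambda>\<omega>. (X \<omega>)\<^sup>2)"
  shows "has_walsh_integral M \<xi> (\<lambda>s y \<omega>. X \<omega> * indicator {a<..b} s * indicator A y) (\<lambda>\<omega>. X \<omega> * \<xi> (indicator ({a<..b} \<times> A)) \<omega>)"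
proof -
  define Y where "Y n \<omega> = max (- real n) (min (real n) (X \<omega>))" for n \<omega>
  let ?\<psi> = "indicator ({a<..b} \<times> A) :: real \<times> real \<Rightarrow> real"
  have psi: "?\<psi> \<in> noise_test" using a A by (intro indicator_rectangle_noise_test)
  then have fut: "?\<psi> \<in> future a" by (auto simp: future_def indicator_def)
  have Ym: "Y n \<in> borel_measurable (noise_filtration M \<xi> a)" for n using X(1) unfolding Y_def by measurable
  note [measurable] = filtration_measurable[OF X(1)] filtration_measurable[OF Ym] noise_measurable[OF psi] A(1)
  define V where "V = (\<integral>z. (?\<psi> z)\<^sup>2 \<partial>lborel)"
  have dec: "(Y n \<omega> - X \<omega>)\<^sup>2 \<le> (X \<omega>)\<^sup>2" for n \<omega>
    unfolding Y_def abs_le_square_iff[symmetric] by (auto simp: max_def min_def)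
  have ptw: "(\<lambda>n. (Y n \<omega> - X \<omega>)\<^sup>2) \<longlonglongrightarrow> 0" for \<omega>
  proof (rule tendsto_eventually)
    obtain n0 where n0: "\<bar>X \<omega>\<bar> \<le> real n0" using real_arch_simple by blast
    show "\<forall>\<^sub>F n in sequentially. (Y n \<omega> - X \<omega>)\<^sup>2 = 0"
      by (rule eventually_sequentiallyI[of n0]) (use n0 in \<open>auto simp: Y_def\<close>)
  qed
  have Di: "integrable M (\<lambda>\<omega>. (Y n \<omega> - X \<omega>)\<^sup>2)" for n
    by (rule Bochner_Integration.integrable_bound[OF X(2)]) (use dec in auto)
  have "(\<lambda>n. \<integral>\<omega>. (Y n \<omega> - X \<omega>)\<^sup>2 \<partial>M) \<longlonglongrightarrow> (\<integral>\<omega>. 0 \<partial>M)"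
    by (rule integral_dominated_convergence[OF _ _ X(2)]) (use dec ptw in auto)
  then have lim: "(\<lambda>n. ennreal (\<integral>\<omega>. (Y n \<omega> - X \<omega>)\<^sup>2 \<partial>M)) \<longlonglongrightarrow> 0"
    using tendsto_ennrealI by fastforce
  let ?L = "\<lambda>n. [(a, b, A, Y n)]"
  have V0: "0 \<le> V" by (simp add: V_def)
  have "simple_data M \<xi> (?L n)" for n
    using a A Ym by (auto simp: simple_data_def Y_def intro!: exI[of _ "real n"])
  moreover have "(\<integral>\<^sup>+z. ennreal ((field (simple_field (?L n)) z - field (\<lambda>s y \<omega>. X \<omega> * indicator {a<..b} s * indicator A y) z)\<^sup>2) \<partial>spacetime) =
    ennreal (\<integral>\<omega>. (Y n \<omega> - X \<omega>)\<^sup>2 \<partial>M) * ennreal V" for n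
  proof -
    have s: "simple_field (?L n) = (\<lambda>s y \<omega>. Y n \<omega> * indicator {a<..b} s * indicator A y)" by (simp add: simple_field_def[abs_def])
    have "(\<integral>\<^sup>+z. ennreal ((field (simple_field (?L n)) z - field (\<lambda>s y \<omega>. X \<omega> * indicator {a<..b} s * indicator A y) z)\<^sup>2) \<partial>spacetime) =
      (\<integral>\<^sup>+z. (case z of (\<omega>, z) \<Rightarrow> ennreal ((Y n \<omega> - X \<omega>)\<^sup>2) * ennreal ((?\<psi> z)\<^sup>2)) \<partial>(M \<Otimes>\<^sub>M lborel))"
      unfolding s field_rectangle[OF a(1)] spacetime_def lborel_prod
      by (intro nn_integral_cong) (auto simp: indicator_def)
    also have "\<dots> = (\<integral>\<^sup>+\<omega>. \<integral>\<^sup>+z. ennreal ((Y n \<omega> - X \<omega>)\<^sup>2) * ennreal ((?\<psi> z)\<^sup>2) \<partial>lborel \<partial>M)"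
      using psi by (subst lborel.nn_integral_fst[symmetric]) (auto simp: noise_test_def split_beta')
    also have "\<dots> = (\<integral>\<^sup>+\<omega>. ennreal ((Y n \<omega> - X \<omega>)\<^sup>2) \<partial>M) * (\<integral>\<^sup>+z. ennreal ((?\<psi> z)\<^sup>2) \<partial>lborel)"
    proof -
      have [measurable]: "?\<psi> \<in> borel_measurable lborel" using psi by (simp add: noise_test_def)
      have "(\<integral>\<^sup>+z. ennreal ((Y n \<omega> - X \<omega>)\<^sup>2) * ennreal ((?\<psi> z)\<^sup>2) \<partial>lborel) =
        ennreal ((Y n \<omega> - X \<omega>)\<^sup>2) * (\<integral>\<^sup>+z. ennreal ((?\<psi> z)\<^sup>2) \<partial>lborel)" for \<omega>
        by (rule nn_integral_cmult) measurable
      then show ?thesis by (simp only:) (rule nn_integral_multc, measurable)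
    qed
    also have "(\<integral>\<^sup>+z. ennreal ((?\<psi> z)\<^sup>2) \<partial>lborel) = ennreal V"
      using psi unfolding V_def by (intro nn_integral_eq_integral) (auto simp: noise_test_def)
    finally show ?thesis using Di by (simp add: nn_integral_eq_integral)
  qed
  moreover have "(\<integral>\<^sup>+\<omega>. ennreal ((simple_integral_noise \<xi> (?L n) \<omega> - X \<omega> * \<xi> ?\<psi> \<omega>)\<^sup>2) \<partial>M) = ennreal (\<integral>\<omega>. (Y n \<omega> - X \<omega>)\<^sup>2 \<partial>M) * ennreal V" for n
  proof -
    have D: "(\<lambda>\<omega>. (Y n \<omega> - X \<omega>)\<^sup>2) \<in> borel_measurable (noise_filtration M \<xi> a)" using Ym X(1) by measurable
    note pf = past_future_expectation[OF fut D Di, of "\<lambda>x. x\<^sup>2"]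
    have pf: "integrable M (\<lambda>\<omega>. (Y n \<omega> - X \<omega>)\<^sup>2 * (\<xi> ?\<psi> \<omega>)\<^sup>2)"
      "(\<integral>\<omega>. (Y n \<omega> - X \<omega>)\<^sup>2 * (\<xi> ?\<psi> \<omega>)\<^sup>2 \<partial>M) = (\<integral>\<omega>. (Y n \<omega> - X \<omega>)\<^sup>2 \<partial>M) * V"
      using pf noise_moments(3)[OF psi psi] noise_cov(2)[OF psi psi] by (simp_all add: V_def power2_eq_square)
    have "(\<integral>\<^sup>+\<omega>. ennreal ((simple_integral_noise \<xi> (?L n) \<omega> - X \<omega> * \<xi> ?\<psi> \<omega>)\<^sup>2) \<partial>M) = (\<integral>\<^sup>+\<omega>. ennreal ((Y n \<omega> - X \<omega>)\<^sup>2 * (\<xi> ?\<psi> \<omega>)\<^sup>2) \<partial>M)"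
      by (simp add: simple_integral_noise_def left_diff_distrib[symmetric] power_mult_distrib)
    also have "\<dots> = ennreal ((\<integral>\<omega>. (Y n \<omega> - X \<omega>)\<^sup>2 \<partial>M) * V)"
      using pf by (subst nn_integral_eq_integral) auto
    finally show ?thesis using V0 by (simp add: ennreal_mult)
  qed
  moreover have "(\<lambda>n. ennreal (\<integral>\<omega>. (Y n \<omega> - X \<omega>)\<^sup>2 \<partial>M) * ennreal V) \<longlonglongrightarrow> 0 * ennreal V"
    by (intro tendsto_mult_ennreal lim tendsto_const) auto
  ultimately show ?thesis
    unfolding has_walsh_integral_iff using predictable_rectangle[OF a A(1) X(1)]
    by (intro conjI exI[of _ ?L]) auto
qed

lemma has_walsh_integral_step:
  assumes "finite K" and "\<And>k. k \<in> K \<Longrightarrow> 0 \<le> a k \<and> a k < b k \<and> A k \<in> sets borel \<and> emeasure lborel (A k) < \<infinity> \<and>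
     X k \<in> borel_measurable (noise_filtration M \<xi> (a k)) \<and> integrable M (\<lambda>\<omega>. (X k \<omega>)\<^sup>2)"
  shows "has_walsh_integral M \<xi> (\<lambda>s y \<omega>. \<Sum>k\<in>K. X k \<omega> * indicator {a k<..b k} s * indicator (A k) y)
    (\<lambda>\<omega>. \<Sum>k\<in>K. X k \<omega> * \<xi> (indicator ({a k<..b k} \<times> A k)) \<omega>)"
  using assms
proof (induction K rule: finite_induct)
  case empty
  then show ?case using has_walsh_integral_zero by simp
next
  case (insert k K)
  have "has_walsh_integral M \<xi> (\<lambda>s y \<omega>. X k \<omega> * indicator {a k<..b k} s * indicator (A k) y) (\<lambda>\<omega>. X k \<omega> * \<xi> (indicator ({a k<..b k} \<times> A k)) \<omega>)"
    using insert.prems[of k] by (intro has_walsh_integral_rectangle) auto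
  from has_walsh_integral_add[OF this insert.IH[OF insert.prems[OF insertI2]], of 1]
  show ?case by (simp only: sum.insert[OF insert.hyps(1,2)] mult_1)
qed

end

section \<open>Averages over cells\<close>

text \<open>For \<open>j < 2 * N\<^sup>2\<close> the cells tile (-N, N] by intervals of length 1 /
  N, so the window grows while the mesh shrinks.\<close>

definition cell :: "nat \<Rightarrow> nat \<Rightarrow> real set" where
  "cell N j = {real j / real N - real N<..real (Suc j) / real N - real N}"

definition cell_mean :: "nat \<Rightarrow> nat \<Rightarrow> (real \<Rightarrow> real) \<Rightarrow> real" where
  "cell_mean N j f = (\<integral>y. real N * indicator (cell N j) y * f y \<partial>lborel)"

text \<open>On L^2 this is the orthogonal projection onto functions that are constant on the cells
  and vanish outside the window.\<close>

definition cell_proj :: "nat \<Rightarrow> (real \<Rightarrow> real) \<Rightarrow> real \<Rightarrow> real" where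
  "cell_proj N f y = (\<Sum>j<2 * N\<^sup>2. indicator (cell N j) y * cell_mean N j f)"

lemma cell_sets[measurable, simp]: "cell N j \<in> sets borel"
  by (simp add: cell_def)

lemma cell_emeasure: "0 < N \<Longrightarrow> emeasure lborel (cell N j) = ennreal (1 / real N)"
  unfolding cell_def by (subst emeasure_lborel_Ioc) (auto simp: divide_right_mono diff_divide_distrib[symmetric] add_divide_distrib)

lemma cell_iff:
  assumes "0 < N"
  shows "y \<in> cell N j \<longleftrightarrow> int j = \<lceil>(y + real N) * real N\<rceil> - 1"
  using assms unfolding cell_def
  by (subst eq_diff_eq, subst eq_commute, subst ceiling_eq_iff) (auto simp: field_simps)

lemma cell_unique: "0 < N \<Longrightarrow> y \<in> cell N i \<Longrightarrow> y \<in> cell N j \<Longrightarrow> i = j"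
  by (simp add: cell_iff)

lemma cell_mass: "0 < N \<Longrightarrow> (\<integral>\<^sup>+y. ennreal (real N * indicator (cell N j) y) \<partial>lborel) = 1"
  by (simp add: ennreal_mult ennreal_indicator nn_integral_cmult cell_emeasure ennreal_mult[symmetric])

lemma sum_cell:
  fixes c :: "nat \<Rightarrow> 'b::semiring_1"
  assumes "0 < N" "j < n" "y \<in> cell N j"
  shows "(\<Sum>i<n. indicator (cell N i) y * c i) = c j"
proof -
  have "(\<Sum>i<n. indicator (cell N i) y * c i) = (\<Sum>i<n. if i = j then c i else 0)"
    using assms cell_unique[OF assms(1)] by (intro sum.cong) (auto simp: indicator_def)
  then show ?thesis using assms(2) by simp
qed

lemma cell_proj_eq: "0 < N \<Longrightarrow> j < 2 * N\<^sup>2 \<Longrightarrow> y \<in> cell N j \<Longrightarrow> cell_proj N f y = cell_mean N j f"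
  unfolding cell_proj_def by (rule sum_cell)

lemma cell_proj_outside: "(\<And>j. j < 2 * N\<^sup>2 \<Longrightarrow> y \<notin> cell N j) \<Longrightarrow> cell_proj N f y = 0"
  unfolding cell_proj_def by (intro sum.neutral) auto

lemma cell_mean_measurable[measurable (raw)]:
  assumes [measurable]: "case_prod f \<in> borel_measurable (K \<Otimes>\<^sub>M borel)"
  shows "(\<lambda>x. cell_mean N j (f x)) \<in> borel_measurable K"
  unfolding cell_mean_def by measurable

lemma cell_proj_measurable[measurable (raw)]:
  assumes [measurable]: "case_prod f \<in> borel_measurable (K \<Otimes>\<^sub>M borel)" "g \<in> borel_measurable K"
  shows "(\<lambda>x. cell_proj N (f x) (g x)) \<in> borel_measurable K"
  unfolding cell_proj_def by measurable

lemma cell_mean_square: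
  assumes "0 < N" and [measurable]: "f \<in> borel_measurable borel"
  shows "ennreal ((cell_mean N j f)\<^sup>2) \<le> ennreal (real N) * (\<integral>\<^sup>+y\<in>cell N j. ennreal ((f y)\<^sup>2) \<partial>lborel)"
proof -
  have "ennreal ((cell_mean N j f)\<^sup>2) \<le> (\<integral>\<^sup>+y. ennreal (real N * indicator (cell N j) y * (f y)\<^sup>2) \<partial>lborel)"
    unfolding cell_mean_def using cell_mass[OF assms(1), of j] by (intro weighted_square_le) auto
  also have "\<dots> = (\<integral>\<^sup>+y. ennreal (real N) * (ennreal ((f y)\<^sup>2) * indicator (cell N j) y) \<partial>lborel)"
    by (intro nn_integral_cong) (auto simp: indicator_def ennreal_mult)
  also have "\<dots> = ennreal (real N) * (\<integral>\<^sup>+y\<in>cell N j. ennreal ((f y)\<^sup>2) \<partial>lborel)"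
    by (rule nn_integral_cmult) measurable
  finally show ?thesis .
qed

text \<open>Jensen's inequality on each cell, and disjointness of the cells.\<close>

lemma cell_proj_square:
  assumes N: "0 < N" and [measurable]: "f \<in> borel_measurable borel"
  shows "(\<integral>\<^sup>+y. ennreal ((cell_proj N f y)\<^sup>2) \<partial>lborel) \<le> (\<integral>\<^sup>+y. ennreal ((f y)\<^sup>2) \<partial>lborel)"
proof -
  let ?n = "2 * N\<^sup>2"
  have "(\<integral>\<^sup>+y. ennreal ((cell_proj N f y)\<^sup>2) \<partial>lborel) = (\<integral>\<^sup>+y. (\<Sum>j<?n. indicator (cell N j) y * ennreal ((cell_mean N j f)\<^sup>2)) \<partial>lborel)"
  proof (intro nn_integral_cong)
    fix y
    show "ennreal ((cell_proj N f y)\<^sup>2) = (\<Sum>j<?n. indicator (cell N j) y * ennreal ((cell_mean N j f)\<^sup>2))"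
    proof (cases "\<exists>j<?n. y \<in> cell N j")
      case True
      then obtain j where j: "j < ?n" "y \<in> cell N j" by blast
      show ?thesis unfolding cell_proj_eq[OF N j] sum_cell[OF N j] ..
    next
      case False
      then show ?thesis by (subst cell_proj_outside) (auto intro!: sum.neutral[symmetric])
    qed
  qed
  also have "\<dots> = (\<Sum>j<?n. ennreal (1 / real N) * ennreal ((cell_mean N j f)\<^sup>2))"
  proof -
    have "(\<integral>\<^sup>+y. (\<Sum>j<?n. indicator (cell N j) y * ennreal ((cell_mean N j f)\<^sup>2)) \<partial>lborel) =
      (\<Sum>j<?n. \<integral>\<^sup>+y. indicator (cell N j) y * ennreal ((cell_mean N j f)\<^sup>2) \<partial>lborel)"
      by (rule nn_integral_sum) measurable
    also have "\<dots> = (\<Sum>j<?n. ennreal (1 / real N) * ennreal ((cell_mean N j f)\<^sup>2))"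
      by (intro sum.cong refl) (simp add: nn_integral_multc cell_emeasure[OF N])
    finally show ?thesis .
  qed
  also have "\<dots> \<le> (\<Sum>j<?n. \<integral>\<^sup>+y\<in>cell N j. ennreal ((f y)\<^sup>2) \<partial>lborel)"
  proof (intro sum_mono)
    fix j
    have "ennreal (1 / real N) * ennreal ((cell_mean N j f)\<^sup>2) \<le> ennreal (1 / real N) * (ennreal (real N) * (\<integral>\<^sup>+y\<in>cell N j. ennreal ((f y)\<^sup>2) \<partial>lborel))"
      using cell_mean_square[OF N] by (intro mult_left_mono) auto
    also have "\<dots> = (\<integral>\<^sup>+y\<in>cell N j. ennreal ((f y)\<^sup>2) \<partial>lborel)"
      using N by (simp add: mult.assoc[symmetric] ennreal_mult[symmetric])
    finally show "ennreal (1 / real N) * ennreal ((cell_mean N j f)\<^sup>2) \<le> (\<integral>\<^sup>+y\<in>cell N j. ennreal ((f y)\<^sup>2) \<partial>lborel)" .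
  qed
  also have "\<dots> = (\<integral>\<^sup>+y. (\<Sum>j<?n. ennreal ((f y)\<^sup>2) * indicator (cell N j) y) \<partial>lborel)"
    by (rule nn_integral_sum[symmetric]) measurable
  also have "\<dots> \<le> (\<integral>\<^sup>+y. ennreal ((f y)\<^sup>2) \<partial>lborel)"
  proof (intro nn_integral_mono)
    fix y
    show "(\<Sum>j<?n. ennreal ((f y)\<^sup>2) * indicator (cell N j) y) \<le> ennreal ((f y)\<^sup>2)"
    proof (cases "\<exists>j<?n. y \<in> cell N j")
      case True
      then obtain j where j: "j < ?n" "y \<in> cell N j" by blast
      show ?thesis unfolding mult.commute[of "ennreal _"] sum_cell[OF N j] ..
    next
      case False
      then have "(\<Sum>j<?n. ennreal ((f y)\<^sup>2) * indicator (cell N j) y) = 0" by (intro sum.neutral) auto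
      then show ?thesis by (rule ord_eq_le_trans) simp
    qed
  qed
  finally show ?thesis .
qed

lemma cell_proj_diff:
  assumes "\<And>j. integrable lborel (\<lambda>y. indicator (cell N j) y * f y)" "\<And>j. integrable lborel (\<lambda>y. indicator (cell N j) y * g y)"
  shows "cell_proj N (\<lambda>y. f y - g y) y = cell_proj N f y - cell_proj N g y"
proof -
  have "cell_mean N j (\<lambda>y. f y - g y) = cell_mean N j f - cell_mean N j g" for j
    unfolding cell_mean_def using assms[of j] by (simp add: right_diff_distrib mult.assoc)
  then show ?thesis by (simp add: cell_proj_def right_diff_distrib sum_subtractf)
qed

text \<open>The mean is taken over a whole cell around y, so \<open>f n\<close> must be close to
  \<open>l\<close> at all nearby points at once; hence the limit along the product filter.\<close>

lemma cell_proj_tendsto: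
  fixes f :: "nat \<Rightarrow> real \<Rightarrow> real"
  assumes [measurable]: "\<And>n. f n \<in> borel_measurable borel"
    and lim: "((\<lambda>(n, y'). f n y') \<longlongrightarrow> l) (sequentially \<times>\<^sub>F nhds y)"
  shows "(\<lambda>n. cell_proj n (f n) y) \<longlonglongrightarrow> l"
proof (rule LIMSEQ_I)
  fix e :: real assume e: "0 < e"
  have "\<forall>\<^sub>F z in sequentially \<times>\<^sub>F nhds y. dist (case z of (n, y') \<Rightarrow> f n y') l < e / 2"
    using lim e by (intro tendstoD) auto
  then obtain P Q where PQ: "eventually P sequentially" "eventually Q (nhds y)" "\<And>n y'. P n \<Longrightarrow> Q y' \<Longrightarrow> \<bar>f n y' - l\<bar> < e / 2"
    unfolding eventually_prod_filter by (auto simp: dist_real_def)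
  obtain d where d: "0 < d" "\<And>y'. dist y' y < d \<Longrightarrow> Q y'" using PQ(2) unfolding eventually_nhds_metric by blast
  obtain n1 where n1: "\<And>n. n1 \<le> n \<Longrightarrow> P n" using PQ(1) unfolding eventually_sequentially by blast
  \<comment> \<open>From \<open>n2\<close> on, the cells are shorter than \<open>d\<close>; from
    \<open>n3\<close> on, y lies in the window covered by the cells.\<close>
  obtain n2 :: nat where n2: "1 / d < real n2" using reals_Archimedean2 by blast
  obtain n3 :: nat where n3: "\<bar>y\<bar> < real n3" using reals_Archimedean2 by blast
  show "\<exists>no. \<forall>n\<ge>no. norm (cell_proj n (f n) y - l) < e"
  proof (intro exI allI impI)
    fix n assume n: "max 1 (max n1 (max n2 n3)) \<le> n"
    then have n': "0 < n" "P n" "1 / d < real n" "\<bar>y\<bar> < real n" using n1 n2 n3 by auto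
    define j where "j = nat (\<lceil>(y + real n) * real n\<rceil> - 1)"
    have pos: "0 < (y + real n) * real n" using n' by auto
    then have j: "y \<in> cell n j" unfolding cell_iff[OF n'(1)] j_def by (auto simp: one_le_ceiling)
    have "real j < (y + real n) * real n"
      using pos unfolding j_def by linarith
    also have "\<dots> < (2 * real n) * real n" using n' by (intro mult_strict_right_mono) auto
    finally have "real j < real (2 * n\<^sup>2)" by (simp add: power2_eq_square)
    then have jn: "j < 2 * n\<^sup>2" by linarith
    have near: "\<bar>f n y' - l\<bar> < e / 2" if "y' \<in> cell n j" for y'
    proof (rule PQ(3)[OF n'(2)], rule d(2))
      have "\<bar>y' - y\<bar> < 1 / real n" using that j by (auto simp: cell_def add_divide_distrib abs_less_iff)
      also have "\<dots> < d" using n'(3) d(1) n'(1) by (simp add: field_simps)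
      finally show "dist y' y < d" by (simp add: dist_real_def)
    qed
    let ?w = "\<lambda>y. real n * indicator (cell n j) y"
    have wi: "integrable lborel ?w" "(\<integral>y. ?w y \<partial>lborel) = 1"
    proof -
      have "has_bochner_integral lborel ?w 1"
        using cell_mass[OF n'(1)] by (intro has_bochner_integral_nn_integral) auto
      then show "integrable lborel ?w" "(\<integral>y. ?w y \<partial>lborel) = 1" by (auto simp: has_bochner_integral_iff)
    qed
    have nb: "\<bar>?w y * (f n y - l)\<bar> \<le> ?w y * (e / 2)" for y
      using mult_left_mono[OF less_imp_le[OF near], of y "real n"] by (cases "y \<in> cell n j") (simp_all add: abs_mult)
    have fi: "integrable lborel (\<lambda>y. ?w y * (f n y - l))"
      by (rule Bochner_Integration.integrable_bound[OF integrable_mult_left[OF wi(1), of "e / 2"]])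
         (use nb e in \<open>auto intro: order_trans[OF _ abs_ge_self]\<close>)
    have "cell_proj n (f n) y - l = (\<integral>y. ?w y * f n y \<partial>lborel) - (\<integral>y. ?w y * l \<partial>lborel)"
      using wi unfolding cell_proj_eq[OF n'(1) jn j] cell_mean_def by simp
    also have "\<dots> = (\<integral>y. ?w y * (f n y - l) \<partial>lborel)"
    proof -
      have "integrable lborel (\<lambda>y. ?w y * (f n y - l) + ?w y * l)" by (intro Bochner_Integration.integrable_add fi integrable_mult_left wi)
      then have "integrable lborel (\<lambda>y. ?w y * f n y)" by (simp add: algebra_simps)
      then show ?thesis using wi by (simp add: right_diff_distrib)
    qed
    finally have "\<bar>cell_proj n (f n) y - l\<bar> \<le> (\<integral>y. \<bar>?w y * (f n y - l)\<bar> \<partial>lborel)" by simp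
    also have "\<dots> \<le> (\<integral>y. ?w y * (e / 2) \<partial>lborel)"
      by (intro integral_mono integrable_abs fi integrable_mult_left wi nb)
    also have "\<dots> = e / 2" using wi by simp
    finally show "norm (cell_proj n (f n) y - l) < e" using e by simp
  qed
qed

section \<open>An explicit Euler scheme\<close>

context heat
begin

lemma heat_op_integrable:
  assumes r: "0 < r" and f: "integrable lborel f"
  shows "integrable lborel (heat_op r f)"
proof (rule integrableI_bounded)
  have [measurable]: "f \<in> borel_measurable borel" using f by (auto dest: borel_measurable_integrable)
  show "heat_op r f \<in> borel_measurable lborel" by measurable
  show "(\<integral>\<^sup>+x. ennreal (norm (heat_op r f x)) \<partial>lborel) < \<infinity>"
    using heat_op_L1[OF r, of f] f by (auto simp: integrable_iff_bounded intro: order_le_less_trans)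
qed

lemma heat_op_add:
  assumes "0 < r" "integrable lborel f" "integrable lborel g"
  shows "heat_op r (\<lambda>y. f y + g y) x = heat_op r f x + heat_op r g x"
  using heat_op_integrable_kernel[OF assms(1,2)] heat_op_integrable_kernel[OF assms(1,3)]
  by (simp add: heat_op_def convol_def distrib_left)

end

context solution
begin

text \<open>The noise of one step, averaged over a cell of length 1 / N, has variance N^-2 and
  fourth moment 3 N^-4. About T N^3 steps are made up to time T, and the fourth moments then add up
  to order 1 / N. This is why the time step is so much shorter than the cells.\<close>

definition step :: "nat \<Rightarrow> real" where
  "step N = 1 / real N ^ 3"

lemma step_pos: "0 < N \<Longrightarrow> 0 < step N"
  by (simp add: step_def)

definition cell_noise :: "nat \<Rightarrow> nat \<Rightarrow> nat \<Rightarrow> 'a \<Rightarrow> real" where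
  "cell_noise N k j = \<xi> (indicator ({real k * step N<..real (Suc k) * step N} \<times> cell N j))"

text \<open>The factor N averages over a cell in space, but there is no division by the time step:
  the value is an increment in time.\<close>

definition noise_density :: "nat \<Rightarrow> nat \<Rightarrow> real \<Rightarrow> 'a \<Rightarrow> real" where
  "noise_density N k y \<omega> = (\<Sum>j<2 * N\<^sup>2. indicator (cell N j) y * (real N * cell_noise N k j \<omega>))"

text \<open>The noise acts first, with \<sigma> taken at the old value, which is independent of the
  noise of the step; the heat semigroup smooths afterwards. The initial value is smoothed as well,
  so index k belongs to heat flow over k + 1 steps.\<close>

primrec scheme :: "nat \<Rightarrow> nat \<Rightarrow> real \<Rightarrow> 'a \<Rightarrow> real" where
  "scheme N 0 = (\<lambda>x \<omega>. heat_op (step N) u\<^sub>0 x)"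
| "scheme N (Suc k) = (\<lambda>x \<omega>. heat_op (step N) (\<lambda>y. scheme N k y \<omega> + \<sigma> (scheme N k y \<omega>) * noise_density N k y \<omega>) x)"

abbreviation filt :: "nat \<Rightarrow> nat \<Rightarrow> 'a measure" where
  "filt N k \<equiv> noise_filtration M \<xi> (real k * step N)"

lemma rectangle_test:
  assumes "0 < N"
  shows "indicator ({real k * step N<..real (Suc k) * step N} \<times> cell N j) \<in> noise_test"
  using assms step_pos[OF assms] by (intro indicator_rectangle_noise_test) (auto simp: cell_emeasure)

lemma rectangle_future:
  assumes "0 < N"
  shows "indicator ({real k * step N<..real (Suc k) * step N} \<times> cell N j) \<in> future (real k * step N)"
  using rectangle_test[OF assms, of k j] by (auto simp: future_def indicator_def)

lemma rectangle_past:
  assumes "0 < N"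
  shows "indicator ({real k * step N<..real (Suc k) * step N} \<times> cell N j) \<in> past (real (Suc k) * step N)"
proof -
  have "0 \<le> real k * step N" using step_pos[OF assms] by simp
  then show ?thesis using rectangle_test[OF assms, of k j] by (auto simp: past_def indicator_def)
qed

lemma cell_noise_measurable: "0 < N \<Longrightarrow> cell_noise N k j \<in> borel_measurable (filt N (Suc k))"
  unfolding cell_noise_def by (rule past_measurable[OF rectangle_past])

text \<open>The variance is the area N^-3 N^-1 of the rectangle; the fourth moment is three times
  its square.\<close>

lemma cell_noise_moments:
  assumes N: "0 < N"
  shows "integrable M (cell_noise N k j)" "(\<integral>\<omega>. cell_noise N k j \<omega> \<partial>M) = 0"
    "integrable M (\<lambda>\<omega>. (cell_noise N k j \<omega>)\<^sup>2)" "(\<integral>\<omega>. (cell_noise N k j \<omega>)\<^sup>2 \<partial>M) = 1 / real N ^ 4"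
    "integrable M (\<lambda>\<omega>. cell_noise N k j \<omega> ^ 4)" "(\<integral>\<omega>. cell_noise N k j \<omega> ^ 4 \<partial>M) = 3 / real N ^ 8"
proof -
  note n = rectangle_test[OF N, of k j]
  note m = noise_moments[OF n n]
  show "integrable M (cell_noise N k j)" "integrable M (\<lambda>\<omega>. (cell_noise N k j \<omega>)\<^sup>2)" "integrable M (\<lambda>\<omega>. cell_noise N k j \<omega> ^ 4)"
    using m by (simp_all add: cell_noise_def)
  show "(\<integral>\<omega>. cell_noise N k j \<omega> \<partial>M) = 0" using noise_mean[OF n] by (simp add: cell_noise_def)
  let ?R = "{real k * step N<..real (Suc k) * step N} \<times> cell N j"
  have R[measurable]: "?R \<in> sets (borel \<Otimes>\<^sub>M borel)" by measurable
  have "emeasure lborel ?R = emeasure (lborel \<Otimes>\<^sub>M lborel) ?R" by (simp add: lborel_prod)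
  also have "\<dots> = ennreal (step N) * ennreal (1 / real N)"
  proof -
    have "real k * step N \<le> real (Suc k) * step N" using step_pos[OF N] by (intro mult_right_mono) auto
    moreover have "real (Suc k) * step N - real k * step N = step N" by (simp add: algebra_simps)
    ultimately have "emeasure lborel {real k * step N<..real (Suc k) * step N} = ennreal (step N)"
      by (subst emeasure_lborel_Ioc) (simp_all only:)
    then show ?thesis by (subst lborel.emeasure_pair_measure_Times) (simp_all only: cell_emeasure[OF N], simp_all)
  qed
  also have "\<dots> = ennreal (1 / real N ^ 4)"
    using N by (simp add: step_def ennreal_mult[symmetric] power4_eq_xxxx power3_eq_cube)
  finally have "measure lborel ?R = 1 / real N ^ 4" by (simp add: measure_def)
  moreover have "(\<integral>\<omega>. (cell_noise N k j \<omega>)\<^sup>2 \<partial>M) = (\<integral>z. indicator ?R z \<partial>lborel)"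
    unfolding power2_eq_square cell_noise_def noise_cov(2)[OF n n] 
    by (intro Bochner_Integration.integral_cong) (auto simp: indicator_def)
  ultimately show v: "(\<integral>\<omega>. (cell_noise N k j \<omega>)\<^sup>2 \<partial>M) = 1 / real N ^ 4" by simp
  show "(\<integral>\<omega>. cell_noise N k j \<omega> ^ 4 \<partial>M) = 3 / real N ^ 8"
    using m(5) v by (simp add: cell_noise_def power_divide power_mult[symmetric])
qed

lemma borel_filt_mono:
  assumes N: "0 < N" and "i \<le> k" and X: "X \<in> borel_measurable (borel \<Otimes>\<^sub>M filt N i)"
  shows "X \<in> borel_measurable (borel \<Otimes>\<^sub>M filt N k)"
proof -
  have "real i * step N \<le> real k * step N" using assms step_pos[OF N] by (intro mult_right_mono) auto
  then have "(\<lambda>\<omega>. \<omega>) \<in> measurable (filt N k) (filt N i)"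
    using sets.sets_into_space[of _ "filt N i"] filtration_mono[of "real i * step N" "real k * step N"]
    by (intro measurableI) (auto simp: Int_absorb2 subset_iff)
  then have "(\<lambda>z. (fst z, snd z)) \<in> measurable (borel \<Otimes>\<^sub>M filt N k) (borel \<Otimes>\<^sub>M filt N i)"
    by (intro measurable_Pair measurable_fst measurable_compose[OF measurable_snd])
  from measurable_compose[OF this X] show ?thesis by simp
qed

lemma noise_density_filt:
  assumes N: "0 < N"
  shows "(\<lambda>z. noise_density N k (fst z) (snd z)) \<in> borel_measurable (borel \<Otimes>\<^sub>M filt N (Suc k))"
proof -
  note [measurable] = cell_noise_measurable[OF N, of k]
  show ?thesis unfolding noise_density_def by measurable
qed

lemma scheme_filt:
  assumes N: "0 < N"
  shows "(\<lambda>z. scheme N k (fst z) (snd z)) \<in> borel_measurable (borel \<Otimes>\<^sub>M filt N k)"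
proof (induction k)
  case (Suc k)
  have S: "(\<lambda>z. scheme N k (f z) (g z)) \<in> borel_measurable K" "(\<lambda>z. noise_density N k (f z) (g z)) \<in> borel_measurable K"
    if fg: "f \<in> borel_measurable K" "g \<in> measurable K (filt N (Suc k))" for f g K
  proof -
    have k: "k \<le> Suc k" by simp
    show "(\<lambda>z. scheme N k (f z) (g z)) \<in> borel_measurable K"
      using measurable_compose[OF measurable_Pair[OF fg] borel_filt_mono[OF N k Suc]] by (simp only: fst_conv snd_conv)
    show "(\<lambda>z. noise_density N k (f z) (g z)) \<in> borel_measurable K"
      using measurable_compose[OF measurable_Pair[OF fg] noise_density_filt[OF N]] by (simp only: fst_conv snd_conv)
  qed
  note [measurable (raw)] = S
  show ?case unfolding scheme.simps heat_op_def convol_def by measurable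
qed simp

lemma scheme_measurable[measurable (raw)]:
  assumes N: "0 < N" and f: "f \<in> borel_measurable K" and g: "g \<in> measurable K M"
  shows "(\<lambda>z. scheme N k (f z) (g z)) \<in> borel_measurable K" "(\<lambda>z. noise_density N k (f z) (g z)) \<in> borel_measurable K"
proof -
  have "g \<in> measurable K (filt N k)" for k
    using g filtration_subalgebra by (intro measurableI) (auto dest: measurable_space measurable_sets)
  note g' = this
  show "(\<lambda>z. scheme N k (f z) (g z)) \<in> borel_measurable K" "(\<lambda>z. noise_density N k (f z) (g z)) \<in> borel_measurable K"
    using measurable_compose[OF measurable_Pair[OF f g'] scheme_filt[OF N, of k]]
      measurable_compose[OF measurable_Pair[OF f g'] noise_density_filt[OF N, of k]] by auto
qed

lemma scheme_adapted: "0 < N \<Longrightarrow> (\<lambda>\<omega>. scheme N k x \<omega>) \<in> borel_measurable (filt N k)"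
  using measurable_compose[OF measurable_Pair[OF measurable_const measurable_ident_sets[OF refl]] scheme_filt[of N k], of x] by simp

lemma noise_density_bounded: "\<exists>C. \<forall>y. \<bar>noise_density N k y \<omega>\<bar> \<le> C"
proof (intro exI allI)
  fix y
  have "\<bar>noise_density N k y \<omega>\<bar> \<le> (\<Sum>j<2 * N\<^sup>2. \<bar>indicator (cell N j) y * (real N * cell_noise N k j \<omega>)\<bar>)"
    unfolding noise_density_def by (rule sum_abs)
  also have "\<dots> \<le> (\<Sum>j<2 * N\<^sup>2. \<bar>real N * cell_noise N k j \<omega>\<bar>)"
    by (intro sum_mono) (auto simp: indicator_def)
  finally show "\<bar>noise_density N k y \<omega>\<bar> \<le> (\<Sum>j<2 * N\<^sup>2. \<bar>real N * cell_noise N k j \<omega>\<bar>)" .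
qed

lemma sigma_noise_integrable:
  assumes N: "0 < N" and \<omega>: "\<omega> \<in> space M" and f: "integrable lborel f"
  shows "integrable lborel (\<lambda>y. \<sigma> (f y) * noise_density N k y \<omega>)"
proof -
  obtain C where C: "\<And>y. \<bar>noise_density N k y \<omega>\<bar> \<le> C" using noise_density_bounded by blast
  have [measurable]: "f \<in> borel_measurable borel" using f by (auto dest: borel_measurable_integrable)
  have [measurable]: "(\<lambda>y. noise_density N k y \<omega>) \<in> borel_measurable borel"
    using scheme_measurable(2)[OF N measurable_ident_sets[OF refl] measurable_const[OF \<omega>]] by simp
  show ?thesis
  proof (rule Bochner_Integration.integrable_bound)
    show "integrable lborel (\<lambda>y. (L * \<bar>f y\<bar>) * C)" using f by simp
    have "\<bar>\<sigma> (f y) * noise_density N k y \<omega>\<bar> \<le> (L * \<bar>f y\<bar>) * C" for y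
      unfolding abs_mult using L by (intro mult_mono sigma_bound C) auto
    then show "AE y in lborel. norm (\<sigma> (f y) * noise_density N k y \<omega>) \<le> norm ((L * \<bar>f y\<bar>) * C)"
      by (auto intro: order_trans[OF _ abs_ge_self])
  qed measurable
qed

lemma scheme_integrable:
  assumes N: "0 < N" and \<omega>: "\<omega> \<in> space M"
  shows "integrable lborel (\<lambda>y. scheme N k y \<omega>)"
proof (induction k)
  case 0
  show ?case using heat_op_integrable[OF step_pos[OF N] u\<^sub>0(1)] by simp
next
  case (Suc k)
  show ?case unfolding scheme.simps
    using Suc sigma_noise_integrable[OF N \<omega> Suc] by (intro heat_op_integrable step_pos[OF N] Bochner_Integration.integrable_add)
qed

text \<open>Each step applies the semigroup to everything accumulated so far, so the induction must
  carry an additional smoothing time \<open>r\<close>. It has to be positive: by division by zero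
  the kernel at time 0 vanishes, and \<open>heat_op 0\<close> is not the identity.\<close>

lemma scheme_mild_smoothed:
  assumes N: "0 < N" and \<omega>: "\<omega> \<in> space M" and r: "0 < r"
  shows "heat_op r (\<lambda>y. scheme N k y \<omega>) x = heat_op (r + real (Suc k) * step N) u\<^sub>0 x +
    (\<Sum>i<k. heat_op (r + real (k - i) * step N) (\<lambda>y. \<sigma> (scheme N i y \<omega>) * noise_density N i y \<omega>) x)"
  using r
proof (induction k arbitrary: r)
  case 0
  have "heat_op r (\<lambda>y. scheme N 0 y \<omega>) x = heat_op r (heat_op (step N) u\<^sub>0) x" by (simp add: eta_contract_eq)
  also have "\<dots> = heat_op (r + step N) u\<^sub>0 x" by (rule heat_op_semigroup[OF 0 step_pos[OF N] u\<^sub>0(1)])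
  finally show ?case by simp
next
  case (Suc k)
  let ?d = "step N" and ?g = "\<lambda>i y. \<sigma> (scheme N i y \<omega>) * noise_density N i y \<omega>"
  have d: "0 < ?d" by (rule step_pos[OF N])
  note i = scheme_integrable[OF N \<omega>, of k] sigma_noise_integrable[OF N \<omega> scheme_integrable[OF N \<omega>, of k], of k]
  have "heat_op r (\<lambda>y. scheme N (Suc k) y \<omega>) x = heat_op r (heat_op ?d (\<lambda>y. scheme N k y \<omega> + ?g k y)) x" by simp
  also have "\<dots> = heat_op (r + ?d) (\<lambda>y. scheme N k y \<omega> + ?g k y) x"
    by (rule heat_op_semigroup[OF Suc.prems d Bochner_Integration.integrable_add[OF i]])
  also have "\<dots> = heat_op (r + ?d) (\<lambda>y. scheme N k y \<omega>) x + heat_op (r + ?d) (?g k) x"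
    using Suc.prems d by (intro heat_op_add i) auto
  also have "heat_op (r + ?d) (\<lambda>y. scheme N k y \<omega>) x = heat_op (r + ?d + real (Suc k) * ?d) u\<^sub>0 x +
    (\<Sum>i<k. heat_op (r + ?d + real (k - i) * ?d) (?g i) x)"
    using Suc.prems d by (intro Suc.IH) auto
  also have "r + ?d + real (Suc k) * ?d = r + real (Suc (Suc k)) * ?d" by (simp add: algebra_simps)
  also have "(\<Sum>i<k. heat_op (r + ?d + real (k - i) * ?d) (?g i) x) = (\<Sum>i<k. heat_op (r + real (Suc k - i) * ?d) (?g i) x)"
    by (intro sum.cong refl) (simp add: Suc_diff_le algebra_simps of_nat_diff)
  finally show ?case by simp
qed

text \<open>Duhamel's formula for the scheme, with the smoothing of the last step in the role of
  \<open>r\<close>. Splitting the noise into cells brings it to the form of a stochastic integral of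
  a step field.\<close>

lemma scheme_mild:
  assumes N: "0 < N" and \<omega>: "\<omega> \<in> space M"
  shows "scheme N k x \<omega> = heat_op (real (Suc k) * step N) u\<^sub>0 x +
    (\<Sum>i<k. \<Sum>j<2 * N\<^sup>2. cell_mean N j (\<lambda>y. p (real (k - i) * step N) (x - y) * \<sigma> (scheme N i y \<omega>)) * cell_noise N i j \<omega>)"
proof -
  let ?d = "step N" and ?g = "\<lambda>i y. \<sigma> (scheme N i y \<omega>) * noise_density N i y \<omega>"
  have d: "0 < ?d" by (rule step_pos[OF N])
  have "scheme N k x \<omega> = heat_op (real (Suc k) * ?d) u\<^sub>0 x + (\<Sum>i<k. heat_op (real (k - i) * ?d) (?g i) x)"
  proof (cases k)
    case (Suc k')
    note i = scheme_integrable[OF N \<omega>, of k'] sigma_noise_integrable[OF N \<omega> scheme_integrable[OF N \<omega>, of k'], of k']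
    have "scheme N k x \<omega> = heat_op ?d (\<lambda>y. scheme N k' y \<omega>) x + heat_op ?d (?g k') x"
      unfolding Suc scheme.simps by (rule heat_op_add[OF d i])
    also have "heat_op ?d (\<lambda>y. scheme N k' y \<omega>) x = heat_op (?d + real (Suc k') * ?d) u\<^sub>0 x + (\<Sum>i<k'. heat_op (?d + real (k' - i) * ?d) (?g i) x)"
      by (rule scheme_mild_smoothed[OF N \<omega> d])
    also have "?d + real (Suc k') * ?d = real (Suc k) * ?d" by (simp add: Suc algebra_simps)
    also have "(\<Sum>i<k'. heat_op (?d + real (k' - i) * ?d) (?g i) x) = (\<Sum>i<k'. heat_op (real (k - i) * ?d) (?g i) x)"
      by (intro sum.cong refl) (simp add: Suc Suc_diff_le algebra_simps of_nat_diff)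
    finally show ?thesis by (simp add: Suc)
  qed simp
  also have "(\<Sum>i<k. heat_op (real (k - i) * ?d) (?g i) x) =
    (\<Sum>i<k. \<Sum>j<2 * N\<^sup>2. cell_mean N j (\<lambda>y. p (real (k - i) * ?d) (x - y) * \<sigma> (scheme N i y \<omega>)) * cell_noise N i j \<omega>)"
  proof (intro sum.cong refl)
    fix i assume i: "i \<in> {..<k}"
    let ?r = "real (k - i) * ?d"
    have r: "0 < ?r" using i d by simp
    note U = scheme_integrable[OF N \<omega>, of i]
    have [measurable]: "(\<lambda>y. scheme N i y \<omega>) \<in> borel_measurable borel" using U by (auto dest: borel_measurable_integrable)
    have "integrable lborel (\<lambda>y. \<sigma> (scheme N i y \<omega>))"
      by (rule Bochner_Integration.integrable_bound[OF integrable_mult_right[OF integrable_abs[OF U], of L]])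
         (use sigma_bound L in \<open>auto simp: abs_mult\<close>)
    then have pi: "integrable lborel (\<lambda>y. p ?r (x - y) * \<sigma> (scheme N i y \<omega>))" by (rule heat_op_integrable_kernel[OF r])
    have ci: "integrable lborel (\<lambda>y. real N * indicator (cell N j) y * (p ?r (x - y) * \<sigma> (scheme N i y \<omega>)) * cell_noise N i j \<omega>)" for j
      using integrable_mult_left[OF integrable_mult_right[OF integrable_real_mult_indicator[OF _ pi, of "cell N j"], of "real N"], of "cell_noise N i j \<omega>"]
      by (simp add: mult_ac)
    have "heat_op ?r (?g i) x = (\<integral>y. (\<Sum>j<2 * N\<^sup>2. real N * indicator (cell N j) y * (p ?r (x - y) * \<sigma> (scheme N i y \<omega>)) * cell_noise N i j \<omega>) \<partial>lborel)"
      unfolding heat_op_def convol_def noise_density_def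
      by (intro Bochner_Integration.integral_cong refl) (simp only: sum_distrib_left mult_ac)
    also have "\<dots> = (\<Sum>j<2 * N\<^sup>2. cell_mean N j (\<lambda>y. p ?r (x - y) * \<sigma> (scheme N i y \<omega>)) * cell_noise N i j \<omega>)"
      unfolding cell_mean_def using ci by (subst Bochner_Integration.integral_sum) auto
    finally show "heat_op ?r (?g i) x = (\<Sum>j<2 * N\<^sup>2. cell_mean N j (\<lambda>y. p ?r (x - y) * \<sigma> (scheme N i y \<omega>)) * cell_noise N i j \<omega>)" .
  qed
  finally show ?thesis .
qed

lemma noise_density_cell:
  assumes "0 < N" "j < 2 * N\<^sup>2" "y \<in> cell N j"
  shows "noise_density N k y \<omega> = real N * cell_noise N k j \<omega>"
  unfolding noise_density_def by (rule sum_cell[OF assms])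

lemma noise_density_outside: "(\<And>j. j < 2 * N\<^sup>2 \<Longrightarrow> y \<notin> cell N j) \<Longrightarrow> noise_density N k y \<omega> = 0"
  unfolding noise_density_def by (intro sum.neutral) auto

text \<open>
  The factor \<open>1 + (\<sigma> X / X) B\<close> has mean one, and it is negative only if \<open>L \<bar>B\<bar> > 1\<close>. So its absolute
  value has mean at most \<open>1 + 2 L\<^sup>4 E B\<^sup>4\<close>; the fourth moment is of smaller order than the time step.
\<close>

lemma abs_euler_step_le:
  "\<bar>X + \<sigma> X * B\<bar> \<le> \<bar>X\<bar> + sgn X * \<sigma> X * B + 2 * L ^ 4 * (\<bar>X\<bar> * B ^ 4)"
proof (cases "X = 0")
  case False
  define c where "c = \<sigma> X / X"
  have c: "\<bar>c\<bar> \<le> L" using sigma_bound[of X] False by (simp add: c_def field_simps)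
  let ?z = "c * B"
  have z: "\<bar>1 + z\<bar> \<le> 1 + z + 2 * z ^ 4" for z :: real
  proof (cases "0 \<le> 1 + z")
    case neg: False
    then have "1 \<le> - z" by simp
    then have "- z \<le> (- z) ^ 4" using power_increasing[of 1 4 "- z"] by simp
    then show ?thesis using neg by simp
  qed simp
  have "c ^ 4 \<le> L ^ 4" using power_mono[OF c, of 4] by simp
  then have z4: "?z ^ 4 \<le> L ^ 4 * B ^ 4" by (simp add: power_mult_distrib mult_right_mono)
  have "\<bar>X + \<sigma> X * B\<bar> = \<bar>X\<bar> * \<bar>1 + ?z\<bar>" using False by (simp add: abs_mult[symmetric] c_def field_simps)
  also have "\<dots> \<le> \<bar>X\<bar> * (1 + ?z + 2 * (L ^ 4 * B ^ 4))"
    using z[of ?z] z4 by (intro mult_left_mono) auto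
  also have "\<dots> = \<bar>X\<bar> + sgn X * \<sigma> X * B + 2 * L ^ 4 * (\<bar>X\<bar> * B ^ 4)"
    using False by (simp add: c_def abs_sgn[of X] algebra_simps)
  finally show ?thesis .
qed (simp add: \<sigma>0)

text \<open>The present value is independent of the centred noise of the step, so the linear term of
  \<open>abs_euler_step_le\<close> has mean zero. The increment \<open>?B\<close> has fourth moment
  N^4 3 / N^8 = 3 / N^4, and the factor 2 L^4 in front of it yields the constant.\<close>

lemma euler_step_L1:
  assumes N: "0 < N"
  shows "(\<integral>\<^sup>+\<omega>. ennreal \<bar>scheme N k y \<omega> + \<sigma> (scheme N k y \<omega>) * noise_density N k y \<omega>\<bar> \<partial>M) \<le>
    ennreal (1 + 6 * L ^ 4 / real N ^ 4) * (\<integral>\<^sup>+\<omega>. ennreal \<bar>scheme N k y \<omega>\<bar> \<partial>M)"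
proof -
  let ?X = "\<lambda>\<omega>. scheme N k y \<omega>" and ?q = "1 + 6 * L ^ 4 / real N ^ 4"
  have q1: "1 \<le> ?q" using L by simp
  have le: "(\<integral>\<^sup>+\<omega>. ennreal \<bar>?X \<omega>\<bar> \<partial>M) \<le> ennreal ?q * (\<integral>\<^sup>+\<omega>. ennreal \<bar>?X \<omega>\<bar> \<partial>M)"
    using mult_right_mono[of 1 "ennreal ?q" "\<integral>\<^sup>+\<omega>. ennreal \<bar>?X \<omega>\<bar> \<partial>M"] q1 by simp
  have [measurable]: "?X \<in> borel_measurable M" using filtration_measurable[OF scheme_adapted[OF N]] .
  show ?thesis
  proof (cases "\<exists>j<2 * N\<^sup>2. y \<in> cell N j")
    case False
    then show ?thesis using le by (subst noise_density_outside) auto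
  next
    case True
    then obtain j where j: "j < 2 * N\<^sup>2" "y \<in> cell N j" by blast
    show ?thesis
    proof (cases "(\<integral>\<^sup>+\<omega>. ennreal \<bar>?X \<omega>\<bar> \<partial>M) < \<infinity>")
      case False
      then have "(\<integral>\<^sup>+\<omega>. ennreal \<bar>?X \<omega>\<bar> \<partial>M) = \<infinity>" by (simp add: less_top[symmetric])
      then show ?thesis using q1 by (simp add: ennreal_mult_top)
    next
      case True
      then have Xi: "integrable M ?X" by (intro integrableI_bounded) auto
      let ?B = "\<lambda>\<omega>. real N * cell_noise N k j \<omega>"
      note mo = cell_noise_moments[OF N, of k j]
      have s: "integrable M (\<lambda>\<omega>. sgn (?X \<omega>) * \<sigma> (?X \<omega>))"
        by (rule Bochner_Integration.integrable_bound[OF integrable_mult_right[OF integrable_abs[OF Xi], of L]])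
           (use sigma_bound L in \<open>auto simp: abs_mult abs_sgn_eq\<close>)
      have sm: "(\<lambda>\<omega>. sgn (?X \<omega>) * \<sigma> (?X \<omega>)) \<in> borel_measurable (filt N k)" "(\<lambda>\<omega>. \<bar>?X \<omega>\<bar>) \<in> borel_measurable (filt N k)"
        using scheme_adapted[OF N] by measurable
      have i1: "integrable M (\<lambda>\<omega>. sgn (?X \<omega>) * \<sigma> (?X \<omega>) * ?B \<omega>)" "(\<integral>\<omega>. sgn (?X \<omega>) * \<sigma> (?X \<omega>) * ?B \<omega> \<partial>M) = 0"
        using past_future_expectation[OF rectangle_future[OF N] sm(1) s, of "\<lambda>x. real N * x" j] mo by (simp_all add: cell_noise_def)
      have i4: "integrable M (\<lambda>\<omega>. \<bar>?X \<omega>\<bar> * ?B \<omega> ^ 4)" "(\<integral>\<omega>. \<bar>?X \<omega>\<bar> * ?B \<omega> ^ 4 \<partial>M) = (\<integral>\<omega>. \<bar>?X \<omega>\<bar> \<partial>M) * (3 / real N ^ 4)"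
      proof -
        have n: "real N ^ 8 = real N ^ 4 * real N ^ 4" by (simp add: power_add[symmetric])
        have q: "q * (E * (3 / (q * q))) = E * (3 / q)" if "q \<noteq> 0" for q E :: real using that by (simp add: divide_simps)
        have e: "\<bar>?X \<omega>\<bar> * ?B \<omega> ^ 4 = real N ^ 4 * (\<bar>?X \<omega>\<bar> * cell_noise N k j \<omega> ^ 4)" for \<omega>
          by (simp add: power_mult_distrib)
        have "integrable M (\<lambda>\<omega>. \<bar>?X \<omega>\<bar> * cell_noise N k j \<omega> ^ 4)"
          "(\<integral>\<omega>. \<bar>?X \<omega>\<bar> * cell_noise N k j \<omega> ^ 4 \<partial>M) = (\<integral>\<omega>. \<bar>?X \<omega>\<bar> \<partial>M) * (3 / real N ^ 8)"
          using past_future_expectation[OF rectangle_future[OF N] sm(2) integrable_abs[OF Xi], of "\<lambda>x. x ^ 4" j] mo(5,6)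
          by (simp_all add: cell_noise_def)
        then show "integrable M (\<lambda>\<omega>. \<bar>?X \<omega>\<bar> * ?B \<omega> ^ 4)" "(\<integral>\<omega>. \<bar>?X \<omega>\<bar> * ?B \<omega> ^ 4 \<partial>M) = (\<integral>\<omega>. \<bar>?X \<omega>\<bar> \<partial>M) * (3 / real N ^ 4)"
          unfolding e n using q[of "real N ^ 4"] N by simp_all
      qed
      let ?R = "\<lambda>\<omega>. \<bar>?X \<omega>\<bar> + sgn (?X \<omega>) * \<sigma> (?X \<omega>) * ?B \<omega> + 2 * L ^ 4 * (\<bar>?X \<omega>\<bar> * ?B \<omega> ^ 4)"
      have Ri: "integrable M ?R" using Xi i1 i4 by simp
      have R: "\<bar>?X \<omega> + \<sigma> (?X \<omega>) * ?B \<omega>\<bar> \<le> ?R \<omega>" for \<omega> by (rule abs_euler_step_le)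
      have "(\<integral>\<^sup>+\<omega>. ennreal \<bar>?X \<omega> + \<sigma> (?X \<omega>) * noise_density N k y \<omega>\<bar> \<partial>M) \<le> (\<integral>\<^sup>+\<omega>. ennreal (?R \<omega>) \<partial>M)"
        unfolding noise_density_cell[OF N j] using R by (intro nn_integral_mono ennreal_leI)
      also have "\<dots> = ennreal (\<integral>\<omega>. ?R \<omega> \<partial>M)"
        using R by (intro nn_integral_eq_integral[OF Ri] AE_I2) (meson abs_ge_zero order_trans)
      also have "(\<integral>\<omega>. ?R \<omega> \<partial>M) = ?q * (\<integral>\<omega>. \<bar>?X \<omega>\<bar> \<partial>M)" using Xi i1 i4 by (simp add: algebra_simps)
      also have "ennreal \<dots> = ennreal ?q * (\<integral>\<^sup>+\<omega>. ennreal \<bar>?X \<omega>\<bar> \<partial>M)"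
        using Xi q1 by (simp add: ennreal_mult nn_integral_eq_integral)
      finally show ?thesis .
    qed
  qed
qed

lemma scheme_L1:
  assumes N: "0 < N"
  shows "(\<integral>\<^sup>+x. \<integral>\<^sup>+\<omega>. ennreal \<bar>scheme N k x \<omega>\<bar> \<partial>M \<partial>lborel) \<le> ennreal ((1 + 6 * L ^ 4 / real N ^ 4) ^ k) * (\<integral>\<^sup>+x. ennreal \<bar>u\<^sub>0 x\<bar> \<partial>lborel)"
proof (induction k)
  case 0
  then show ?case using heat_op_L1[OF step_pos[OF N] u0_measurable] by (simp add: emeasure_space_1)
next
  case (Suc k)
  interpret P: pair_sigma_finite M "lborel :: real measure" by (rule pair_sigma_finite_lborel)
  note [measurable (raw)] = scheme_measurable[OF N]
  let ?W = "\<lambda>y \<omega>. scheme N k y \<omega> + \<sigma> (scheme N k y \<omega>) * noise_density N k y \<omega>" and ?q = "1 + 6 * L ^ 4 / real N ^ 4"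
  have "(\<integral>\<^sup>+x. \<integral>\<^sup>+\<omega>. ennreal \<bar>scheme N (Suc k) x \<omega>\<bar> \<partial>M \<partial>lborel) = (\<integral>\<^sup>+\<omega>. \<integral>\<^sup>+x. ennreal \<bar>scheme N (Suc k) x \<omega>\<bar> \<partial>lborel \<partial>M)"
    by (rule P.Fubini') measurable
  also have "\<dots> \<le> (\<integral>\<^sup>+\<omega>. \<integral>\<^sup>+y. ennreal \<bar>?W y \<omega>\<bar> \<partial>lborel \<partial>M)"
    unfolding scheme.simps by (intro nn_integral_mono heat_op_L1 step_pos N) measurable
  also have "\<dots> = (\<integral>\<^sup>+y. \<integral>\<^sup>+\<omega>. ennreal \<bar>?W y \<omega>\<bar> \<partial>M \<partial>lborel)"
    by (rule P.Fubini'[symmetric]) measurable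
  also have "\<dots> \<le> (\<integral>\<^sup>+y. ennreal ?q * (\<integral>\<^sup>+\<omega>. ennreal \<bar>scheme N k y \<omega>\<bar> \<partial>M) \<partial>lborel)"
    by (intro nn_integral_mono euler_step_L1 N)
  also have "\<dots> = ennreal ?q * (\<integral>\<^sup>+y. \<integral>\<^sup>+\<omega>. ennreal \<bar>scheme N k y \<omega>\<bar> \<partial>M \<partial>lborel)"
    by (rule nn_integral_cmult) measurable
  also have "\<dots> \<le> ennreal ?q * (ennreal (?q ^ k) * (\<integral>\<^sup>+x. ennreal \<bar>u\<^sub>0 x\<bar> \<partial>lborel))"
    using Suc by (intro mult_left_mono) auto
  also have "\<dots> = ennreal (?q ^ Suc k) * (\<integral>\<^sup>+x. ennreal \<bar>u\<^sub>0 x\<bar> \<partial>lborel)"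
    using L by (simp add: ennreal_mult mult.assoc)
  finally show ?case .
qed

text \<open>A crude bound that degrades with every step; only finiteness for fixed N and k is
  wanted. It makes the coefficients of the step fields square integrable and the discretisation
  error finite.\<close>

lemma scheme_L2:
  assumes N: "0 < N"
  shows "(\<integral>\<^sup>+x. \<integral>\<^sup>+\<omega>. ennreal ((scheme N k x \<omega>)\<^sup>2) \<partial>M \<partial>lborel) < \<infinity>"
proof (induction k)
  case 0
  have "(\<integral>\<^sup>+x. \<integral>\<^sup>+\<omega>. ennreal ((scheme N 0 x \<omega>)\<^sup>2) \<partial>M \<partial>lborel) \<le> (\<integral>\<^sup>+x. ennreal ((u\<^sub>0 x)\<^sup>2) \<partial>lborel)"
    using heat_op_L2[OF step_pos[OF N] u0_measurable] by (simp add: emeasure_space_1)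
  then show ?case using u0_square by (rule order_le_less_trans)
next
  case (Suc k)
  interpret P: pair_sigma_finite M "lborel :: real measure" by (rule pair_sigma_finite_lborel)
  note [measurable (raw)] = scheme_measurable[OF N]
  let ?W = "\<lambda>y \<omega>. scheme N k y \<omega> + \<sigma> (scheme N k y \<omega>) * noise_density N k y \<omega>"
  let ?C = "ennreal (2 + 2 * (L\<^sup>2 / real N ^ 2))"
  have W: "(\<integral>\<^sup>+\<omega>. ennreal ((?W y \<omega>)\<^sup>2) \<partial>M) \<le> ?C * (\<integral>\<^sup>+\<omega>. ennreal ((scheme N k y \<omega>)\<^sup>2) \<partial>M)" for y
  proof -
    let ?X = "\<lambda>\<omega>. scheme N k y \<omega>"
    have [measurable]: "?X \<in> borel_measurable M" "(\<lambda>\<omega>. noise_density N k y \<omega>) \<in> borel_measurable M" by measurable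
    have C1: "2 \<le> ?C" using ennreal_leI[of 2 "2 + 2 * (L\<^sup>2 / real N ^ 2)"] by simp
    show ?thesis
    proof (cases "\<exists>j<2 * N\<^sup>2. y \<in> cell N j")
      case False
      then have z: "noise_density N k y \<omega> = 0" for \<omega> by (intro noise_density_outside) auto
      have "1 * (\<integral>\<^sup>+\<omega>. ennreal ((scheme N k y \<omega>)\<^sup>2) \<partial>M) \<le> ?C * (\<integral>\<^sup>+\<omega>. ennreal ((scheme N k y \<omega>)\<^sup>2) \<partial>M)"
        using C1 by (intro mult_right_mono) (auto intro: order_trans[of _ 2])
      then show ?thesis by (simp add: z)
    next
      case True
      then obtain j where j: "j < 2 * N\<^sup>2" "y \<in> cell N j" by blast
      show ?thesis
      proof (cases "(\<integral>\<^sup>+\<omega>. ennreal ((?X \<omega>)\<^sup>2) \<partial>M) < \<infinity>")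
        case False
        then have "(\<integral>\<^sup>+\<omega>. ennreal ((?X \<omega>)\<^sup>2) \<partial>M) = \<infinity>" by (simp add: less_top[symmetric])
        then show ?thesis using C1 by (auto simp: ennreal_mult_top)
      next
        case True
        then have Xi: "integrable M (\<lambda>\<omega>. (?X \<omega>)\<^sup>2)" by (intro integrableI_bounded) auto
        note mo = cell_noise_moments[OF N, of k j]
        have sm: "(\<lambda>\<omega>. (?X \<omega>)\<^sup>2) \<in> borel_measurable (filt N k)" using scheme_adapted[OF N] by measurable
        have i2: "integrable M (\<lambda>\<omega>. (?X \<omega>)\<^sup>2 * (cell_noise N k j \<omega>)\<^sup>2)"
          "(\<integral>\<omega>. (?X \<omega>)\<^sup>2 * (cell_noise N k j \<omega>)\<^sup>2 \<partial>M) = (\<integral>\<omega>. (?X \<omega>)\<^sup>2 \<partial>M) * (1 / real N ^ 4)"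
          using past_future_expectation[OF rectangle_future[OF N] sm Xi, of "\<lambda>x. x\<^sup>2" j] mo by (simp_all add: cell_noise_def)
        have "(\<integral>\<^sup>+\<omega>. ennreal ((?W y \<omega>)\<^sup>2) \<partial>M) \<le>
          2 * (\<integral>\<^sup>+\<omega>. ennreal ((?X \<omega>)\<^sup>2) \<partial>M) + 2 * (\<integral>\<^sup>+\<omega>. ennreal ((\<sigma> (?X \<omega>) * noise_density N k y \<omega>)\<^sup>2) \<partial>M)"
          by (rule nn_integral_square_add_le2) measurable
        also have "(\<integral>\<^sup>+\<omega>. ennreal ((\<sigma> (?X \<omega>) * noise_density N k y \<omega>)\<^sup>2) \<partial>M) \<le>
          (\<integral>\<^sup>+\<omega>. ennreal (L\<^sup>2 * real N ^ 2 * ((?X \<omega>)\<^sup>2 * (cell_noise N k j \<omega>)\<^sup>2)) \<partial>M)"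
        proof (intro nn_integral_mono ennreal_leI)
          fix \<omega>
          have "(\<sigma> (?X \<omega>))\<^sup>2 * (real N * cell_noise N k j \<omega>)\<^sup>2 \<le> (L\<^sup>2 * (?X \<omega>)\<^sup>2) * (real N * cell_noise N k j \<omega>)\<^sup>2"
            by (intro mult_right_mono sigma_square_bound) auto
          then show "(\<sigma> (?X \<omega>) * noise_density N k y \<omega>)\<^sup>2 \<le> L\<^sup>2 * real N ^ 2 * ((?X \<omega>)\<^sup>2 * (cell_noise N k j \<omega>)\<^sup>2)"
            by (simp add: noise_density_cell[OF N j] power_mult_distrib mult_ac)
        qed
        also have "\<dots> = ennreal (L\<^sup>2 * real N ^ 2 * ((\<integral>\<omega>. (?X \<omega>)\<^sup>2 \<partial>M) * (1 / real N ^ 4)))"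
          unfolding i2(2)[symmetric] using i2(1) by (subst nn_integral_eq_integral) auto
        also have "\<dots> = ennreal (L\<^sup>2 / real N ^ 2) * (\<integral>\<^sup>+\<omega>. ennreal ((?X \<omega>)\<^sup>2) \<partial>M)"
          using Xi N by (simp add: nn_integral_eq_integral ennreal_mult[symmetric] field_simps power2_eq_square power4_eq_xxxx)
        finally have "(\<integral>\<^sup>+\<omega>. ennreal ((?W y \<omega>)\<^sup>2) \<partial>M) \<le> 2 * (\<integral>\<^sup>+\<omega>. ennreal ((?X \<omega>)\<^sup>2) \<partial>M) + 2 * (ennreal (L\<^sup>2 / real N ^ 2) * (\<integral>\<^sup>+\<omega>. ennreal ((?X \<omega>)\<^sup>2) \<partial>M))"
          by (simp add: add_left_mono mult_left_mono)
        also have "\<dots> = ?C * (\<integral>\<^sup>+\<omega>. ennreal ((?X \<omega>)\<^sup>2) \<partial>M)"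
        proof -
          have "ennreal (2 + 2 * a) = 2 + 2 * ennreal a" if "0 \<le> a" for a using that by (simp add: ennreal_mult)
          from this[of "L\<^sup>2 / real N ^ 2"] show ?thesis by (simp only: distrib_right mult.assoc zero_le_divide_iff zero_le_power2 simp_thms)
        qed
        finally show ?thesis .
      qed
    qed
  qed
  have "(\<integral>\<^sup>+x. \<integral>\<^sup>+\<omega>. ennreal ((scheme N (Suc k) x \<omega>)\<^sup>2) \<partial>M \<partial>lborel) = (\<integral>\<^sup>+\<omega>. \<integral>\<^sup>+x. ennreal ((scheme N (Suc k) x \<omega>)\<^sup>2) \<partial>lborel \<partial>M)"
    by (rule P.Fubini') measurable
  also have "\<dots> \<le> (\<integral>\<^sup>+\<omega>. \<integral>\<^sup>+y. ennreal ((?W y \<omega>)\<^sup>2) \<partial>lborel \<partial>M)"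
    unfolding scheme.simps by (intro nn_integral_mono heat_op_L2 step_pos N) measurable
  also have "\<dots> = (\<integral>\<^sup>+y. \<integral>\<^sup>+\<omega>. ennreal ((?W y \<omega>)\<^sup>2) \<partial>M \<partial>lborel)"
    by (rule P.Fubini'[symmetric]) measurable
  also have "\<dots> \<le> (\<integral>\<^sup>+y. ?C * (\<integral>\<^sup>+\<omega>. ennreal ((scheme N k y \<omega>)\<^sup>2) \<partial>M) \<partial>lborel)"
    by (intro nn_integral_mono W)
  also have "\<dots> = ?C * (\<integral>\<^sup>+y. \<integral>\<^sup>+\<omega>. ennreal ((scheme N k y \<omega>)\<^sup>2) \<partial>M \<partial>lborel)"
    by (rule nn_integral_cmult) measurable
  also have "\<dots> < \<infinity>" using Suc by (simp add: ennreal_mult_less_top)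
  finally show ?case .
qed

end

section \<open>Convergence of the scheme\<close>

text \<open>The parallelogram identity expresses the norm of f - g by those of f, g and f + g, and
  Fatou's lemma bounds the norm of f + g from below. Convergence of upper bounds for the norms thus
  takes the place of a pointwise majorant.\<close>

lemma square_integrals_tendsto_zero:
  fixes f :: "nat \<Rightarrow> 'b \<Rightarrow> real"
  assumes [measurable]: "\<And>n. f n \<in> borel_measurable K" "g \<in> borel_measurable K"
    and lim: "\<And>x. x \<in> space K \<Longrightarrow> (\<lambda>n. f n x) \<longlonglongrightarrow> g x"
    and b: "\<And>n. (\<integral>\<^sup>+x. ennreal ((f n x)\<^sup>2) \<partial>K) \<le> b n" "b \<longlonglongrightarrow> (\<integral>\<^sup>+x. ennreal ((g x)\<^sup>2) \<partial>K)"
    and fin: "(\<integral>\<^sup>+x. ennreal ((g x)\<^sup>2) \<partial>K) < \<infinity>"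
  shows "(\<lambda>n. \<integral>\<^sup>+x. ennreal ((f n x - g x)\<^sup>2) \<partial>K) \<longlonglongrightarrow> 0"
proof -
  define B where "B = enn2real (\<integral>\<^sup>+x. ennreal ((g x)\<^sup>2) \<partial>K)"
  have B: "(\<integral>\<^sup>+x. ennreal ((g x)\<^sup>2) \<partial>K) = ennreal B" "0 \<le> B" using fin by (auto simp: B_def less_top)
  have sum: "(\<integral>\<^sup>+x. ennreal ((f n x - g x)\<^sup>2) \<partial>K) + (\<integral>\<^sup>+x. ennreal ((f n x + g x)\<^sup>2) \<partial>K) \<le> 2 * b n + 2 * ennreal B" for n
  proof -
    have "(\<integral>\<^sup>+x. ennreal ((f n x - g x)\<^sup>2) \<partial>K) + (\<integral>\<^sup>+x. ennreal ((f n x + g x)\<^sup>2) \<partial>K) =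
      (\<integral>\<^sup>+x. ennreal ((f n x - g x)\<^sup>2) + ennreal ((f n x + g x)\<^sup>2) \<partial>K)"
      by (rule nn_integral_add[symmetric]) measurable
    also have "\<dots> = (\<integral>\<^sup>+x. 2 * ennreal ((f n x)\<^sup>2) + 2 * ennreal ((g x)\<^sup>2) \<partial>K)"
    proof (intro nn_integral_cong)
      fix x
      have "ennreal ((f n x - g x)\<^sup>2) + ennreal ((f n x + g x)\<^sup>2) = ennreal (2 * (f n x)\<^sup>2 + 2 * (g x)\<^sup>2)"
        by (simp only: ennreal_plus[symmetric] zero_le_power2) (simp add: power2_sum power2_diff)
      then show "ennreal ((f n x - g x)\<^sup>2) + ennreal ((f n x + g x)\<^sup>2) = 2 * ennreal ((f n x)\<^sup>2) + 2 * ennreal ((g x)\<^sup>2)"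
        by (simp add: ennreal_mult)
    qed
    also have "\<dots> = 2 * (\<integral>\<^sup>+x. ennreal ((f n x)\<^sup>2) \<partial>K) + 2 * ennreal B"
      by (simp add: nn_integral_add nn_integral_cmult B)
    also have "\<dots> \<le> 2 * b n + 2 * ennreal B" using b(1)[of n] by (intro add_right_mono mult_left_mono) auto
    finally show ?thesis .
  qed
  have fatou: "ennreal (4 * B) \<le> liminf (\<lambda>n. \<integral>\<^sup>+x. ennreal ((f n x + g x)\<^sup>2) \<partial>K)"
  proof -
    have "ennreal (4 * B) = (\<integral>\<^sup>+x. ennreal ((2 * g x)\<^sup>2) \<partial>K)"
      by (simp add: power_mult_distrib ennreal_mult B nn_integral_cmult)
    also have "\<dots> = (\<integral>\<^sup>+x. liminf (\<lambda>n. ennreal ((f n x + g x)\<^sup>2)) \<partial>K)"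
    proof (intro nn_integral_cong lim_imp_Liminf[symmetric])
      fix x assume "x \<in> space K"
      then have "(\<lambda>n. ennreal ((f n x + g x)\<^sup>2)) \<longlonglongrightarrow> ennreal ((g x + g x)\<^sup>2)"
        by (intro tendsto_ennrealI tendsto_intros lim)
      then show "(\<lambda>n. ennreal ((f n x + g x)\<^sup>2)) \<longlonglongrightarrow> ennreal ((2 * g x)\<^sup>2)" by simp
    qed simp
    also have "\<dots> \<le> liminf (\<lambda>n. \<integral>\<^sup>+x. ennreal ((f n x + g x)\<^sup>2) \<partial>K)"
      by (rule nn_integral_liminf) measurable
    finally show ?thesis .
  qed
  show ?thesis
    proof (rule order_tendstoI)
      fix e :: ennreal assume "0 < e"
      then obtain d :: real where d: "0 < d" "ennreal d < e"
      proof -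
        obtain q where q: "0 < q" "q < e" using dense[OF \<open>0 < e\<close>] by blast
        then have "q < \<top>" using less_top by (metis order_less_trans top.not_eq_extremum)
        then show thesis using q that[of "enn2real q"] by (simp add: enn2real_positive_iff)
      qed
      \<comment> \<open>The two margins combine to (4B + d/2) - (4B - d/2) = d.\<close>
      have "\<forall>\<^sub>F n in sequentially. b n < ennreal (B + d / 4)"
        using b(2) d B by (intro order_tendstoD) (auto simp: ennreal_less_iff)
      \<comment> \<open>The second disjunct covers small \<open>B\<close>: there
        \<open>ennreal\<close> truncates the negative number to 0 and the strict inequality may
        fail.\<close>
      moreover have "\<forall>\<^sub>F n in sequentially. ennreal (4 * B - d / 2) < (\<integral>\<^sup>+x. ennreal ((f n x + g x)\<^sup>2) \<partial>K) \<or> 4 * B - d / 2 < 0"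
      proof (cases "4 * B - d / 2 < 0")
        case False
        then have "ennreal (4 * B - d / 2) < liminf (\<lambda>n. \<integral>\<^sup>+x. ennreal ((f n x + g x)\<^sup>2) \<partial>K)"
          using d fatou by (intro less_le_trans[OF _ fatou]) (auto simp: ennreal_less_iff)
        from less_LiminfD[OF this] show ?thesis by (auto elim: eventually_mono)
      qed simp
      ultimately show "\<forall>\<^sub>F n in sequentially. (\<integral>\<^sup>+x. ennreal ((f n x - g x)\<^sup>2) \<partial>K) < e"
      proof eventually_elim
        case (elim n)
        let ?a = "\<integral>\<^sup>+x. ennreal ((f n x - g x)\<^sup>2) \<partial>K" and ?c = "\<integral>\<^sup>+x. ennreal ((f n x + g x)\<^sup>2) \<partial>K"
        have "2 * b n + 2 * ennreal B \<le> 2 * ennreal (B + d / 4) + 2 * ennreal B"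
          using elim(1) by (intro add_right_mono mult_left_mono) auto
        also have "\<dots> = ennreal (4 * B + d / 2)"
        proof -
          have e2: "2 * ennreal a = ennreal (2 * a)" if "0 \<le> a" for a using that by (simp add: ennreal_mult)
          have "2 * ennreal (B + d / 4) + 2 * ennreal B = ennreal (2 * (B + d / 4)) + ennreal (2 * B)"
            using d B(2) by (intro arg_cong2[where f="(+)"] e2) auto
          also have "\<dots> = ennreal (2 * (B + d / 4) + 2 * B)" using d B(2) by (intro ennreal_plus[symmetric]) auto
          also have "2 * (B + d / 4) + 2 * B = 4 * B + d / 2" by simp
          finally show ?thesis .
        qed
        finally have ac: "?a + ?c \<le> ennreal (4 * B + d / 2)" using sum[of n] by (rule order_trans[rotated])
        then have "?a < \<top>" "?c < \<top>" by (auto simp: less_top[symmetric] top_unique)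
        define a c where "a = enn2real ?a" and "c = enn2real ?c"
        have a: "?a = ennreal a" "0 \<le> a" and c: "?c = ennreal c" "0 \<le> c"
          using \<open>?a < \<top>\<close> \<open>?c < \<top>\<close> by (simp_all add: a_def c_def)
        have "a + c \<le> 4 * B + d / 2"
          using ac a c d B(2) by (simp add: ennreal_plus[symmetric] del: ennreal_plus)
        moreover have "4 * B - d / 2 \<le> c"
          using elim(2) c by (cases "4 * B - d / 2 < 0") (auto simp: ennreal_less_iff not_less)
        ultimately have "a \<le> d" by simp
        then show ?case using a d by (auto intro: order_le_less_trans ennreal_leI)
      qed
    qed simp
qed

section \<open>A modification with continuous paths, and the time grid\<close>

context solution
begin

text \<open>The set of discontinuous paths need not be measurable itself; a measurable null set
  containing it is chosen.\<close>

definition bad :: "'a set" where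
  "bad = (SOME A. A \<in> null_sets M \<and> (\<forall>\<omega>\<in>space M - A. continuous_on ({0<..} \<times> UNIV) (\<lambda>(t, x). u t x \<omega>)))"

lemma bad: "bad \<in> null_sets M" "\<And>\<omega>. \<omega> \<in> space M \<Longrightarrow> \<omega> \<notin> bad \<Longrightarrow> continuous_on ({0<..} \<times> UNIV) (\<lambda>(t, x). u t x \<omega>)"
proof -
  have "AE \<omega> in M. continuous_on ({0<..} \<times> UNIV) (\<lambda>(t, x). u t x \<omega>)" using mild by (simp add: mild_solution_def)
  then obtain A where "{\<omega> \<in> space M. \<not> continuous_on ({0<..} \<times> UNIV) (\<lambda>(t, x). u t x \<omega>)} \<subseteq> A" "A \<in> null_sets M"
    by (auto elim!: AE_E simp: null_sets_def)
  then have "\<exists>A. A \<in> null_sets M \<and> (\<forall>\<omega>\<in>space M - A. continuous_on ({0<..} \<times> UNIV) (\<lambda>(t, x). u t x \<omega>))" by blast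
  from someI_ex[OF this, folded bad_def]
  show "bad \<in> null_sets M" "\<And>\<omega>. \<omega> \<in> space M \<Longrightarrow> \<omega> \<notin> bad \<Longrightarrow> continuous_on ({0<..} \<times> UNIV) (\<lambda>(t, x). u t x \<omega>)" by auto
qed

text \<open>With the value 0 on \<open>bad\<close> every path is continuous in space at positive
  times, and the field stays jointly measurable. Statements about single paths then hold without
  exceptional sets.\<close>

definition ug :: "real \<Rightarrow> real \<Rightarrow> 'a \<Rightarrow> real" where
  "ug t x \<omega> = (if \<omega> \<in> bad then 0 else uc t x \<omega>)"

lemma ug_measurable[measurable (raw)]:
  assumes [measurable]: "f \<in> measurable N M" "g \<in> borel_measurable N" "h \<in> borel_measurable N"
  shows "(\<lambda>x. ug (g x) (h x) (f x)) \<in> borel_measurable N"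
proof -
  have [measurable]: "bad \<in> sets M" using bad(1) by auto
  show ?thesis unfolding ug_def by measurable
qed

lemma AE_ug: "AE \<omega> in M. \<forall>t x. ug t x \<omega> = uc t x \<omega>"
  using AE_not_in[OF bad(1)] by eventually_elim (simp add: ug_def)

lemma ug_continuous:
  assumes \<omega>: "\<omega> \<in> space M" and t: "0 < t"
  shows "isCont (\<lambda>x. ug t x \<omega>) x"
proof (cases "\<omega> \<in> bad")
  case False
  have "continuous_on UNIV (\<lambda>x. (\<lambda>(t, x). u t x \<omega>) (t, x))"
    by (rule continuous_on_compose2[OF bad(2)[OF \<omega> False]]) (use t in \<open>auto intro!: continuous_intros\<close>)
  then show ?thesis using t False by (simp add: ug_def uc_eq continuous_on_eq_continuous_at)
qed (simp add: ug_def)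

text \<open>The time intervals are open on the left to fit the rectangles of
  \<open>cell_noise\<close>; hence the ceiling minus one.\<close>

definition slot :: "nat \<Rightarrow> real \<Rightarrow> nat" where
  "slot N t = nat (\<lceil>t / step N\<rceil> - 1)"

abbreviation grid :: "nat \<Rightarrow> real \<Rightarrow> real" where
  "grid N t \<equiv> real (slot N t) * step N"

lemma slot_measurable[measurable]: "slot N \<in> measurable borel (count_space UNIV)"
  unfolding slot_def by measurable

lemma slot_borel_measurable[measurable (raw)]: "g \<in> borel_measurable K \<Longrightarrow> (\<lambda>x. slot N (g x)) \<in> borel_measurable K"
proof -
  have "slot N \<in> borel_measurable borel"
    using measurable_compose[OF slot_measurable, of "\<lambda>k. k" borel] by simp
  then show "g \<in> borel_measurable K \<Longrightarrow> (\<lambda>x. slot N (g x)) \<in> borel_measurable K" by (rule measurable_compose[rotated])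
qed

lemma slot_iff:
  assumes N: "0 < N" and t: "0 < t"
  shows "slot N t = k \<longleftrightarrow> t \<in> {real k * step N<..real (Suc k) * step N}"
proof -
  have d: "0 < step N" by (rule step_pos[OF N])
  have "0 < \<lceil>t / step N\<rceil>" using t d by simp
  then have "slot N t = k \<longleftrightarrow> \<lceil>t / step N\<rceil> = int k + 1" unfolding slot_def by linarith
  also have "\<dots> \<longleftrightarrow> t \<in> {real k * step N<..real (Suc k) * step N}"
    using d by (auto simp: ceiling_eq_iff field_simps)
  finally show ?thesis .
qed

lemma grid_bounds:
  assumes "0 < N" "0 < t"
  shows "grid N t < t" "t \<le> grid N t + step N"
  using slot_iff[OF assms, of "slot N t"] by (auto simp: algebra_simps)

lemma slot_mono: "0 < N \<Longrightarrow> s \<le> t \<Longrightarrow> slot N s \<le> slot N t"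
  using step_pos[of N] unfolding slot_def by (intro nat_mono diff_mono ceiling_mono divide_right_mono) auto

lemma step_tendsto: "step \<longlonglongrightarrow> 0"
  unfolding step_def by real_asymp

lemma grid_tendsto:
  assumes "0 < t" shows "(\<lambda>N. grid N t) \<longlonglongrightarrow> t"
proof (rule tendsto_sandwich)
  show "\<forall>\<^sub>F N in sequentially. t - step N \<le> grid N t" "\<forall>\<^sub>F N in sequentially. grid N t \<le> t"
    using grid_bounds[OF _ assms] by (auto intro!: eventually_sequentiallyI[of 1] simp: algebra_simps less_imp_le)
  show "(\<lambda>N. t - step N) \<longlonglongrightarrow> t" using tendsto_diff[OF tendsto_const step_tendsto, of t] by simp
qed simp

text \<open>Times in different slots have grid points at least one step apart, while rounding
  changes t - s by less than one step; so the grid difference loses at most a factor 2. The kernel p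
  (2 r) 0 at the grid difference r is therefore bounded by p (t - s) 0, uniformly in N.\<close>

lemma grid_diff:
  assumes N: "0 < N" and "0 < s" "0 < t" and lt: "slot N s < slot N t"
  shows "s < t" "0 < grid N t - grid N s" "t - s \<le> 2 * (grid N t - grid N s)"
    "grid N t - grid N s = real (slot N t - slot N s) * step N"
proof -
  have d: "0 < step N" by (rule step_pos[OF N])
  have "step N \<le> (real (slot N t) - real (slot N s)) * step N"
    using lt d by (simp add: mult_le_cancel_right1)
  then have *: "step N \<le> grid N t - grid N s" by (simp add: left_diff_distrib)
  then show "0 < grid N t - grid N s" using d by linarith
  show "s < t" using slot_mono[OF N, of t s] lt by (meson not_less)
  show "t - s \<le> 2 * (grid N t - grid N s)"
  proof -
    have "t - s \<le> 2 * (a - b)" if "step N \<le> a - b" "t \<le> a + step N" "b < s" for a b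
    proof -
      have "t - s \<le> (a + step N) - b" using that by (intro diff_mono) auto
      also have "\<dots> \<le> (a + (a - b)) - b" using that(1) by (intro diff_mono add_mono) auto
      finally show ?thesis by simp
    qed
    then show ?thesis using * grid_bounds[OF N \<open>0 < t\<close>] grid_bounds[OF N \<open>0 < s\<close>] by blast
  qed
  show "grid N t - grid N s = real (slot N t - slot N s) * step N"
    using lt by (simp add: of_nat_diff left_diff_distrib)
qed

definition limit_field :: "real \<Rightarrow> real \<Rightarrow> 'a \<times> real \<times> real \<Rightarrow> real" where
  "limit_field t x = (\<lambda>(\<omega>, s, y). indicator {0<..<t} s * (p (t - s) (x - y) * \<sigma> (ug s y \<omega>)))"

text \<open>With \<open>v = scheme_at N\<close> this is the integrand of the scheme; with
  \<open>v = ug\<close> it is the same discretisation applied to the solution, the intermediate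
  point of the error analysis. The condition on slots says that the noise of the current slot has
  not yet entered the scheme.\<close>

definition discrete_field :: "nat \<Rightarrow> (real \<Rightarrow> real \<Rightarrow> 'a \<Rightarrow> real) \<Rightarrow> real \<Rightarrow> real \<Rightarrow> 'a \<times> real \<times> real \<Rightarrow> real" where
  "discrete_field N v t x = (\<lambda>(\<omega>, s, y). if 0 < s \<and> slot N s < slot N t
     then cell_proj N (\<lambda>y'. p (grid N t - grid N s) (x - y') * \<sigma> (v s y' \<omega>)) y else 0)"

definition scheme_at :: "nat \<Rightarrow> real \<Rightarrow> real \<Rightarrow> 'a \<Rightarrow> real" where
  "scheme_at N t = scheme N (slot N t)"

lemma scheme_at_measurable[measurable (raw)]:
  assumes N: "0 < N" and f[measurable]: "f \<in> measurable K M" and [measurable]: "g \<in> borel_measurable K" "h \<in> borel_measurable K"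
  shows "(\<lambda>x. scheme_at N (g x) (h x) (f x)) \<in> borel_measurable K"
  unfolding scheme_at_def
proof (rule measurable_compose_countable[where g = "\<lambda>x. slot N (g x)"])
  show "(\<lambda>x. scheme N i (h x) (f x)) \<in> borel_measurable K" for i by (rule scheme_measurable(1)[OF N _ f]) measurable
qed measurable

lemma discrete_field_measurable:
  fixes K :: "'k measure"
  assumes v: "\<And>f g h. f \<in> measurable (K \<Otimes>\<^sub>M (borel :: real measure)) M \<Longrightarrow> g \<in> borel_measurable (K \<Otimes>\<^sub>M borel) \<Longrightarrow> h \<in> borel_measurable (K \<Otimes>\<^sub>M borel) \<Longrightarrow>
      (\<lambda>x. v (g x) (h x) (f x)) \<in> borel_measurable (K \<Otimes>\<^sub>M borel)"
    and [measurable]: "t \<in> borel_measurable K" "x \<in> borel_measurable K" "f \<in> measurable K M" "s \<in> borel_measurable K" "y \<in> borel_measurable K"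
  shows "(\<lambda>k. discrete_field N v (t k) (x k) (f k, s k, y k)) \<in> borel_measurable K"
proof -
  have [measurable]: "(\<lambda>z. v (s (fst z)) (snd z) (f (fst z))) \<in> borel_measurable (K \<Otimes>\<^sub>M (borel :: real measure))"
    by (rule v) measurable
  have "(\<lambda>(k, y'). p (grid N (t k) - grid N (s k)) (x k - y') * \<sigma> (v (s k) y' (f k))) \<in> borel_measurable (K \<Otimes>\<^sub>M borel)"
    unfolding split_beta' by measurable
  then have [measurable]: "(\<lambda>k. cell_proj N (\<lambda>y'. p (grid N (t k) - grid N (s k)) (x k - y') * \<sigma> (v (s k) y' (f k))) (y k)) \<in> borel_measurable K"
    by (rule cell_proj_measurable) fact
  show ?thesis unfolding discrete_field_def prod.case by measurable
qed

lemma discrete_field_spacetime: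
  assumes v: "\<And>(K :: (('a \<times> real \<times> real) \<times> real) measure) f g h. f \<in> measurable K M \<Longrightarrow> g \<in> borel_measurable K \<Longrightarrow> h \<in> borel_measurable K \<Longrightarrow> (\<lambda>x. v (g x) (h x) (f x)) \<in> borel_measurable K"
  shows "discrete_field N v t x \<in> borel_measurable spacetime"
proof -
  have "(\<lambda>z. discrete_field N v t x (fst z, fst (snd z), snd (snd z))) \<in> borel_measurable spacetime"
    by (rule discrete_field_measurable; (rule v)?) (auto simp: spacetime_def)
  then show ?thesis by simp
qed

text \<open>The coefficient of a cell is known at the beginning of its time step and is square
  integrable by \<open>scheme_L2\<close>. Hence the noise sum in \<open>scheme_mild\<close> is the
  Walsh integral of a step field, and on each slot this field is the projected kernel
  integrand.\<close>

lemma scheme_walsh: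
  assumes N: "0 < N" and t: "0 < t"
  obtains S where "has_walsh_integral M \<xi> S (\<lambda>\<omega>. \<Sum>i<slot N t. \<Sum>j<2 * N\<^sup>2. cell_mean N j (\<lambda>y. p (real (slot N t - i) * step N) (x - y) * \<sigma> (scheme N i y \<omega>)) * cell_noise N i j \<omega>)"
    "field S = discrete_field N (scheme_at N) t x"
proof -
  let ?k = "slot N t" and ?n = "2 * N\<^sup>2" and ?d = "step N"
  have d: "0 < ?d" by (rule step_pos[OF N])
  define X where "X i j \<omega> = cell_mean N j (\<lambda>y. p (real (?k - i) * ?d) (x - y) * \<sigma> (scheme N i y \<omega>))" for i j \<omega>
  let ?K = "{..<?k} \<times> {..<?n}"
  have Xm: "X i j \<in> borel_measurable (filt N i)" for i j
  proof -
    have S: "(\<lambda>z. scheme N i (f z) (g z)) \<in> borel_measurable K"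
      if fg: "f \<in> borel_measurable K" "g \<in> measurable K (filt N i)" for f g K
      using measurable_compose[OF measurable_Pair[OF fg] scheme_filt[OF N]] by (simp only: fst_conv snd_conv)
    note [measurable (raw)] = S
    show ?thesis unfolding X_def by measurable
  qed
  note [measurable (raw)] = scheme_measurable[OF N]
  have Xsq: "integrable M (\<lambda>\<omega>. (X i j \<omega>)\<^sup>2)" if i: "i < ?k" for i j
  proof (rule integrableI_bounded)
    show "(\<lambda>\<omega>. (X i j \<omega>)\<^sup>2) \<in> borel_measurable M" using filtration_measurable[OF Xm] by measurable
    let ?r = "real (?k - i) * ?d" and ?C = "real N * ((p (real (?k - i) * ?d) 0)\<^sup>2 * L\<^sup>2)"
    have r: "0 < ?r" using i d by simp
    interpret P: pair_sigma_finite M "lborel :: real measure" by (rule pair_sigma_finite_lborel)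
    have "(\<integral>\<^sup>+\<omega>. ennreal (norm ((X i j \<omega>)\<^sup>2)) \<partial>M) \<le> (\<integral>\<^sup>+\<omega>. \<integral>\<^sup>+y. ennreal ?C * ennreal ((scheme N i y \<omega>)\<^sup>2) \<partial>lborel \<partial>M)"
    proof (intro nn_integral_mono)
      fix \<omega> assume \<omega>: "\<omega> \<in> space M"
      have [measurable]: "(\<lambda>y. scheme N i y \<omega>) \<in> borel_measurable borel"
        using scheme_integrable[OF N \<omega>] by (auto dest: borel_measurable_integrable)
      have "ennreal (norm ((X i j \<omega>)\<^sup>2)) \<le> ennreal (real N) * (\<integral>\<^sup>+y\<in>cell N j. ennreal ((p ?r (x - y) * \<sigma> (scheme N i y \<omega>))\<^sup>2) \<partial>lborel)"
        unfolding X_def real_norm_def abs_power2 by (rule cell_mean_square[OF N]) measurable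
      also have "\<dots> \<le> ennreal (real N) * (\<integral>\<^sup>+y. ennreal ((p ?r 0)\<^sup>2 * L\<^sup>2) * ennreal ((scheme N i y \<omega>)\<^sup>2) \<partial>lborel)"
      proof (intro mult_left_mono nn_integral_mono)
        fix y
        have "(p ?r (x - y))\<^sup>2 * (\<sigma> (scheme N i y \<omega>))\<^sup>2 \<le> (p ?r 0)\<^sup>2 * (L\<^sup>2 * (scheme N i y \<omega>)\<^sup>2)"
          by (intro mult_mono power_mono heat_le[OF r] sigma_square_bound heat_nonneg[OF less_imp_le[OF r]]) simp_all
        then have "ennreal ((p ?r (x - y) * \<sigma> (scheme N i y \<omega>))\<^sup>2) \<le> ennreal ((p ?r 0)\<^sup>2 * L\<^sup>2) * ennreal ((scheme N i y \<omega>)\<^sup>2)"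
          by (subst ennreal_mult[symmetric]) (auto simp: power_mult_distrib mult.assoc intro!: ennreal_leI)
        then show "ennreal ((p ?r (x - y) * \<sigma> (scheme N i y \<omega>))\<^sup>2) * indicator (cell N j) y \<le> ennreal ((p ?r 0)\<^sup>2 * L\<^sup>2) * ennreal ((scheme N i y \<omega>)\<^sup>2)"
          by (auto simp: indicator_def)
      qed simp
      also have "\<dots> = (\<integral>\<^sup>+y. ennreal ?C * ennreal ((scheme N i y \<omega>)\<^sup>2) \<partial>lborel)"
        by (subst (1 2) nn_integral_cmult) (auto simp: ennreal_mult mult.assoc)
      finally show "ennreal (norm ((X i j \<omega>)\<^sup>2)) \<le> (\<integral>\<^sup>+y. ennreal ?C * ennreal ((scheme N i y \<omega>)\<^sup>2) \<partial>lborel)" .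
    qed
    also have "\<dots> = (\<integral>\<^sup>+y. \<integral>\<^sup>+\<omega>. ennreal ?C * ennreal ((scheme N i y \<omega>)\<^sup>2) \<partial>M \<partial>lborel)"
      by (rule P.Fubini'[symmetric]) measurable
    also have "\<dots> = ennreal ?C * (\<integral>\<^sup>+y. \<integral>\<^sup>+\<omega>. ennreal ((scheme N i y \<omega>)\<^sup>2) \<partial>M \<partial>lborel)"
      by (simp add: nn_integral_cmult)
    also have "\<dots> < \<infinity>" using scheme_L2[OF N, of i] by (simp add: ennreal_mult_less_top)
    finally show "(\<integral>\<^sup>+\<omega>. ennreal (norm ((X i j \<omega>)\<^sup>2)) \<partial>M) < \<infinity>" .
  qed
  let ?S = "\<lambda>s y \<omega>. \<Sum>k\<in>?K. X (fst k) (snd k) \<omega> * indicator {real (fst k) * ?d<..real (Suc (fst k)) * ?d} s * indicator (cell N (snd k)) y"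
  have "has_walsh_integral M \<xi> ?S (\<lambda>\<omega>. \<Sum>k\<in>?K. X (fst k) (snd k) \<omega> * \<xi> (indicator ({real (fst k) * ?d<..real (Suc (fst k)) * ?d} \<times> cell N (snd k))) \<omega>)"
    using d Xm Xsq by (intro has_walsh_integral_step) (auto simp: cell_emeasure[OF N])
  moreover have "(\<Sum>k\<in>?K. X (fst k) (snd k) \<omega> * \<xi> (indicator ({real (fst k) * ?d<..real (Suc (fst k)) * ?d} \<times> cell N (snd k))) \<omega>) =
    (\<Sum>i<?k. \<Sum>j<?n. X i j \<omega> * cell_noise N i j \<omega>)" for \<omega>
    unfolding sum.cartesian_product cell_noise_def split_beta' ..
  moreover have "field ?S z = discrete_field N (scheme_at N) t x z" for z
  proof -
    obtain \<omega> s y where z: "z = (\<omega>, s, y)" by (metis prod_cases3)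
    show ?thesis
    proof (cases "0 < s")
      case False
      then show ?thesis by (simp add: z field_def discrete_field_def)
    next
      case s: True
      have "field ?S z = (\<Sum>i<?k. \<Sum>j<?n. X i j \<omega> * indicator {real i * ?d<..real (Suc i) * ?d} s * indicator (cell N j) y)"
        using s by (simp only: z field_def prod.case)
          (subst sum.cartesian_product[of "\<lambda>i j. X i j \<omega> * indicator {real i * ?d<..real (Suc i) * ?d} s * indicator (cell N j) y"], simp only: split_beta' indicator_simps greaterThan_iff mult_1)
      also have "\<dots> = (\<Sum>i<?k. if i = slot N s then \<Sum>j<?n. indicator (cell N j) y * X i j \<omega> else 0)"
      proof (intro sum.cong refl)
        fix i
        have "s \<in> {real i * ?d<..real (Suc i) * ?d} \<longleftrightarrow> i = slot N s" using slot_iff[OF N s, of i] by auto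
        then have ind: "indicator {real i * ?d<..real (Suc i) * ?d} s = (if i = slot N s then 1 else 0 :: real)"
          by (simp only: indicator_def of_bool_def)
        show "(\<Sum>j<?n. X i j \<omega> * indicator {real i * ?d<..real (Suc i) * ?d} s * indicator (cell N j) y) =
          (if i = slot N s then \<Sum>j<?n. indicator (cell N j) y * X i j \<omega> else 0)"
        proof (cases "i = slot N s")
          case True
          show ?thesis unfolding if_P[OF True] ind by (intro sum.cong refl) simp
        next
          case False
          show ?thesis unfolding if_not_P[OF False] ind by simp
        qed
      qed
      also have "\<dots> = (if slot N s < ?k then \<Sum>j<?n. indicator (cell N j) y * X (slot N s) j \<omega> else 0)"
        by simp
      also have "\<dots> = discrete_field N (scheme_at N) t x z"
        using s t grid_diff(4)[OF N s t] by (simp add: z discrete_field_def cell_proj_def X_def scheme_at_def)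
      finally show ?thesis .
    qed
  qed
  ultimately show thesis
    using that[of ?S] by (simp add: X_def ext)
qed

text \<open>Scheme and solution are driven by the same noise, so their difference is a deterministic
  term plus the Walsh integral of the difference of the integrands. The shifted time
  \<open>grid N t + step N\<close> reflects the additional smoothing of the initial value.\<close>

lemma scheme_error:
  assumes N: "0 < N" and t: "0 < t"
  shows "(\<integral>\<^sup>+\<omega>. ennreal ((scheme_at N t x \<omega> - ug t x \<omega>)\<^sup>2) \<partial>M) =
    ennreal ((heat_op (grid N t + step N) u\<^sub>0 x - heat_op t u\<^sub>0 x)\<^sup>2) +
    (\<integral>\<^sup>+z. ennreal ((discrete_field N (scheme_at N) t x z - limit_field t x z)\<^sup>2) \<partial>spacetime)"
proof -
  obtain I where I: "\<And>t x. 0 < t \<Longrightarrow> has_walsh_integral M \<xi> (walsh_kernel t x) (I t x)"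
    "AE \<omega> in M. \<forall>t>0. \<forall>x. u t x \<omega> = heat_op t u\<^sub>0 x + I t x \<omega>" by (rule mild_representation) blast
  let ?Z = "\<lambda>\<omega>. \<Sum>i<slot N t. \<Sum>j<2 * N\<^sup>2. cell_mean N j (\<lambda>y. p (real (slot N t - i) * step N) (x - y) * \<sigma> (scheme N i y \<omega>)) * cell_noise N i j \<omega>"
  obtain S where S: "has_walsh_integral M \<xi> S ?Z" "field S = discrete_field N (scheme_at N) t x"
    by (rule scheme_walsh[OF N t])
  let ?a = "heat_op (grid N t + step N) u\<^sub>0 x - heat_op t u\<^sub>0 x"
  have W: "has_walsh_integral M \<xi> (\<lambda>s y \<omega>. S s y \<omega> + (-1) * walsh_kernel t x s y \<omega>) (\<lambda>\<omega>. ?Z \<omega> + (-1) * I t x \<omega>)"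
    by (rule has_walsh_integral_add[OF S(1) I(1)[OF t]])
  have g: "real (Suc (slot N t)) * step N = grid N t + step N" by (simp add: algebra_simps)
  have "(\<integral>\<^sup>+\<omega>. ennreal ((scheme_at N t x \<omega> - ug t x \<omega>)\<^sup>2) \<partial>M) = (\<integral>\<^sup>+\<omega>. ennreal ((?a + (?Z \<omega> + (-1) * I t x \<omega>))\<^sup>2) \<partial>M)"
  proof -
    have "AE \<omega> in M. scheme_at N t x \<omega> - ug t x \<omega> = ?a + (?Z \<omega> + (-1) * I t x \<omega>)"
      using I(2) AE_ug AE_space[of M]
    proof eventually_elim
      case (elim \<omega>)
      then show ?case using t unfolding scheme_at_def scheme_mild[OF N elim(3), of "slot N t" x] g by (simp add: uc_eq)
    qed
    then show ?thesis by (intro nn_integral_cong_AE, eventually_elim) simp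
  qed
  also have "\<dots> = ennreal (?a\<^sup>2) + (\<integral>\<^sup>+z. ennreal ((discrete_field N (scheme_at N) t x z - field (walsh_kernel t x) z)\<^sup>2) \<partial>spacetime)"
    unfolding walsh_shift_square[OF W] field_add S(2) by simp
  also have "(\<integral>\<^sup>+z. ennreal ((discrete_field N (scheme_at N) t x z - field (walsh_kernel t x) z)\<^sup>2) \<partial>spacetime) =
    (\<integral>\<^sup>+z. ennreal ((discrete_field N (scheme_at N) t x z - limit_field t x z)\<^sup>2) \<partial>spacetime)"
  proof -
    note [measurable (raw)] = scheme_at_measurable[OF N]
    have [measurable]: "discrete_field N (scheme_at N) t x \<in> borel_measurable spacetime" by (rule discrete_field_spacetime) measurable
    have [measurable]: "limit_field t x \<in> borel_measurable spacetime" "field (walsh_kernel t x) \<in> borel_measurable spacetime"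
      unfolding limit_field_def field_walsh_kernel spacetime_def split_beta' by measurable
    show ?thesis
    proof -
      have m: "(\<lambda>z. ennreal ((discrete_field N (scheme_at N) t x z - field (walsh_kernel t x) z)\<^sup>2)) \<in> borel_measurable spacetime"
        "(\<lambda>z. ennreal ((discrete_field N (scheme_at N) t x z - limit_field t x z)\<^sup>2)) \<in> borel_measurable spacetime" by measurable
      show ?thesis
        unfolding spacetime_swap[OF m(1)] spacetime_swap[OF m(2)]
      proof (rule nn_integral_cong, rule nn_integral_cong)
        fix s y
        show "(\<integral>\<^sup>+\<omega>. ennreal ((discrete_field N (scheme_at N) t x (\<omega>, s, y) - field (walsh_kernel t x) (\<omega>, s, y))\<^sup>2) \<partial>M) =
          (\<integral>\<^sup>+\<omega>. ennreal ((discrete_field N (scheme_at N) t x (\<omega>, s, y) - limit_field t x (\<omega>, s, y))\<^sup>2) \<partial>M)"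
          using AE_ug by (intro nn_integral_cong_AE, eventually_elim) (simp add: limit_field_def field_walsh_kernel mult.assoc)
      qed
    qed
  qed
  finally show ?thesis .
qed

lemma spacetime_swap2:
  assumes [measurable]: "g \<in> borel_measurable spacetime"
  shows "(\<integral>\<^sup>+z. g z \<partial>spacetime) = (\<integral>\<^sup>+s. \<integral>\<^sup>+\<omega>. \<integral>\<^sup>+y. g (\<omega>, s, y) \<partial>lborel \<partial>M \<partial>lborel)"
proof -
  interpret P: pair_sigma_finite M "lborel :: real measure" by (rule pair_sigma_finite_lborel)
  have [measurable]: "g \<in> borel_measurable (M \<Otimes>\<^sub>M (lborel \<Otimes>\<^sub>M lborel))" using assms by (simp add: spacetime_def)
  show ?thesis unfolding spacetime_swap[OF assms]
    by (intro nn_integral_cong P.Fubini') measurable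
qed

text \<open>The two space variables become innermost, so that the estimates in space can be made for
  a fixed time and a fixed path.\<close>

lemma field_space_integral:
  fixes f :: "real \<Rightarrow> 'a \<times> real \<times> real \<Rightarrow> ennreal"
  assumes f[measurable]: "case_prod f \<in> borel_measurable (borel \<Otimes>\<^sub>M spacetime)"
  shows "(\<integral>\<^sup>+x. \<integral>\<^sup>+z. f x z \<partial>spacetime \<partial>lborel) = (\<integral>\<^sup>+s. \<integral>\<^sup>+\<omega>. \<integral>\<^sup>+x. \<integral>\<^sup>+y. f x (\<omega>, s, y) \<partial>lborel \<partial>lborel \<partial>M \<partial>lborel)"
proof -
  interpret P: pair_sigma_finite M "lborel :: real measure" by (rule pair_sigma_finite_lborel)
  have [measurable]: "case_prod f \<in> borel_measurable (borel \<Otimes>\<^sub>M (M \<Otimes>\<^sub>M (lborel \<Otimes>\<^sub>M lborel)))"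
    using f by (simp add: spacetime_def)
  have "(\<integral>\<^sup>+x. \<integral>\<^sup>+z. f x z \<partial>spacetime \<partial>lborel) = (\<integral>\<^sup>+x. \<integral>\<^sup>+s. \<integral>\<^sup>+\<omega>. \<integral>\<^sup>+y. f x (\<omega>, s, y) \<partial>lborel \<partial>M \<partial>lborel \<partial>lborel)"
    by (intro nn_integral_cong spacetime_swap2) measurable
  also have "\<dots> = (\<integral>\<^sup>+s. \<integral>\<^sup>+x. \<integral>\<^sup>+\<omega>. \<integral>\<^sup>+y. f x (\<omega>, s, y) \<partial>lborel \<partial>M \<partial>lborel \<partial>lborel)"
    by (rule lborel_pair.Fubini') measurable
  also have "\<dots> = (\<integral>\<^sup>+s. \<integral>\<^sup>+\<omega>. \<integral>\<^sup>+x. \<integral>\<^sup>+y. f x (\<omega>, s, y) \<partial>lborel \<partial>lborel \<partial>M \<partial>lborel)"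
  proof (rule nn_integral_cong)
    fix s
    show "(\<integral>\<^sup>+x. \<integral>\<^sup>+\<omega>. \<integral>\<^sup>+y. f x (\<omega>, s, y) \<partial>lborel \<partial>M \<partial>lborel) = (\<integral>\<^sup>+\<omega>. \<integral>\<^sup>+x. \<integral>\<^sup>+y. f x (\<omega>, s, y) \<partial>lborel \<partial>lborel \<partial>M)"
      by (rule P.Fubini') measurable
  qed
  finally show ?thesis .
qed

end

section \<open>L^2 estimates for the discretised kernels\<close>

context heat
begin

lemma cell_proj_heat:
  assumes N: "0 < N" and r: "0 < r" and [measurable]: "g \<in> borel_measurable borel"
  shows "(\<integral>\<^sup>+x. \<integral>\<^sup>+y. ennreal ((cell_proj N (\<lambda>y'. p r (x - y') * g y') y)\<^sup>2) \<partial>lborel \<partial>lborel) \<le>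
    ennreal (p (2 * r) 0) * (\<integral>\<^sup>+y. ennreal ((g y)\<^sup>2) \<partial>lborel)"
proof -
  have "(\<integral>\<^sup>+x. \<integral>\<^sup>+y. ennreal ((cell_proj N (\<lambda>y'. p r (x - y') * g y') y)\<^sup>2) \<partial>lborel \<partial>lborel) \<le>
    (\<integral>\<^sup>+x. \<integral>\<^sup>+y. ennreal ((p r (x - y))\<^sup>2) * ennreal ((g y)\<^sup>2) \<partial>lborel \<partial>lborel)"
  proof (rule nn_integral_mono)
    fix x
    have "(\<integral>\<^sup>+y. ennreal ((cell_proj N (\<lambda>y'. p r (x - y') * g y') y)\<^sup>2) \<partial>lborel) \<le> (\<integral>\<^sup>+y. ennreal ((p r (x - y) * g y)\<^sup>2) \<partial>lborel)"
      by (rule cell_proj_square[OF N]) measurable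
    also have "\<dots> = (\<integral>\<^sup>+y. ennreal ((p r (x - y))\<^sup>2) * ennreal ((g y)\<^sup>2) \<partial>lborel)"
      by (simp add: power_mult_distrib ennreal_mult)
    finally show "(\<integral>\<^sup>+y. ennreal ((cell_proj N (\<lambda>y'. p r (x - y') * g y') y)\<^sup>2) \<partial>lborel) \<le> (\<integral>\<^sup>+y. ennreal ((p r (x - y))\<^sup>2) * ennreal ((g y)\<^sup>2) \<partial>lborel)" .
  qed
  also have "\<dots> = ennreal (p (2 * r) 0) * (\<integral>\<^sup>+y. ennreal ((g y)\<^sup>2) \<partial>lborel)"
    by (rule space_convolution[OF r]) measurable
  finally show ?thesis .
qed

text \<open>Rounding times to the grid leaves p_r(0) as the available bound instead of p_{2r}(0). By
  \<open>heat_scale\<close> this enlarges the Laplace transform only by sqrt 2.\<close>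

lemma heat_laplace_kernel0:
  assumes "0 < c"
  shows "(\<integral>\<^sup>+r\<in>{0<..}. ennreal (exp (- c * r)) * ennreal (p r 0) \<partial>lborel) = ennreal (sqrt 2 / (2 * sqrt (c * \<theta>)))"
proof -
  have "(\<integral>\<^sup>+r\<in>{0<..}. ennreal (exp (- c * r)) * ennreal (p r 0) \<partial>lborel) =
    (\<integral>\<^sup>+r. ennreal (sqrt 2) * (ennreal (exp (- c * r) * p (2 * r) 0) * indicator {0<..} r) \<partial>lborel)"
  proof (rule nn_integral_cong)
    fix r
    have "ennreal (exp (- c * r)) * ennreal (p r 0) = ennreal (sqrt 2) * ennreal (exp (- c * r) * p (2 * r) 0)" if "0 < r"
      unfolding heat_scale[OF that] using that by (simp add: ennreal_mult[symmetric] heat_nonneg mult_ac)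
    then show "ennreal (exp (- c * r)) * ennreal (p r 0) * indicator {0<..} r = ennreal (sqrt 2) * (ennreal (exp (- c * r) * p (2 * r) 0) * indicator {0<..} r)"
      by (auto simp: indicator_def)
  qed
  also have "\<dots> = ennreal (sqrt 2) * ennreal (1 / (2 * sqrt (c * \<theta>)))"
    by (subst nn_integral_cmult) (auto simp: heat_laplace0[OF assms, simplified])
  also have "\<dots> = ennreal (sqrt 2 / (2 * sqrt (c * \<theta>)))"
    using assms \<theta> by (simp add: ennreal_mult[symmetric])
  finally show ?thesis .
qed

end

context solution
begin

definition discrete_error :: "nat \<Rightarrow> real \<Rightarrow> ennreal" where
  "discrete_error N t = (\<integral>\<^sup>+\<omega>. \<integral>\<^sup>+x. ennreal ((scheme_at N t x \<omega> - ug t x \<omega>)\<^sup>2) \<partial>lborel \<partial>M)"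

definition sigma_energy :: "real \<Rightarrow> ennreal" where
  "sigma_energy s = (\<integral>\<^sup>+\<omega>. \<integral>\<^sup>+y. ennreal ((\<sigma> (ug s y \<omega>))\<^sup>2) \<partial>lborel \<partial>M)"

lemma sigma_energy_measurable[measurable]: "sigma_energy \<in> borel_measurable borel"
  unfolding sigma_energy_def by measurable

lemma discrete_error_measurable: "0 < N \<Longrightarrow> discrete_error N \<in> borel_measurable borel"
proof -
  assume N: "0 < N"
  note [measurable (raw)] = scheme_at_measurable[OF N]
  show ?thesis unfolding discrete_error_def by measurable
qed

lemma ug_space_measurable: "\<omega> \<in> space M \<Longrightarrow> (\<lambda>y. ug s y \<omega>) \<in> borel_measurable borel"
  by measurable

lemma scheme_at_space_measurable: "0 < N \<Longrightarrow> \<omega> \<in> space M \<Longrightarrow> (\<lambda>y. scheme_at N s y \<omega>) \<in> borel_measurable borel"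
  by (rule scheme_at_measurable) auto

text \<open>The path is continuous, and a cell is contained in a compact interval.\<close>

lemma ug_cell_integrable:
  assumes \<omega>: "\<omega> \<in> space M" and s: "0 < s" and r: "0 < r"
  shows "integrable lborel (\<lambda>y. indicator (cell N j) y * (p r (x - y) * \<sigma> (ug s y \<omega>)))"
proof -
  let ?I = "{real j / real N - real N..real (Suc j) / real N - real N}" and ?f = "\<lambda>y. p r (x - y) * \<sigma> (ug s y \<omega>)"
  have \<sigma>: "isCont \<sigma> a" for a using sigma_continuous by (simp add: continuous_on_eq_continuous_at)
  have "isCont (\<lambda>y. p r (x - y)) a" for a
    unfolding heat_kernel_def using \<theta> r by (auto intro!: continuous_intros)
  moreover have "isCont (\<lambda>y. \<sigma> (ug s y \<omega>)) a" for a
    by (rule isCont_o2[OF ug_continuous[OF \<omega> s] \<sigma>])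
  ultimately have "continuous_on ?I ?f"
    by (intro continuous_at_imp_continuous_on ballI isCont_mult) auto
  then have "integrable lborel (\<lambda>y. indicator ?I y *\<^sub>R ?f y)" by (intro borel_integrable_compact) auto
  from integrable_mult_indicator[OF _ this, of "cell N j"]
  have "integrable lborel (\<lambda>y. indicator (cell N j) y *\<^sub>R (indicator ?I y *\<^sub>R ?f y))" by simp
  also have "(\<lambda>y. indicator (cell N j) y *\<^sub>R (indicator ?I y *\<^sub>R ?f y)) = (\<lambda>y. indicator (cell N j) y * ?f y)"
    by (auto simp: fun_eq_iff indicator_def cell_def)
  finally show ?thesis .
qed

lemma scheme_cell_integrable:
  assumes N: "0 < N" and \<omega>: "\<omega> \<in> space M" and r: "0 < r"
  shows "integrable lborel (\<lambda>y. indicator (cell N j) y * (p r (x - y) * \<sigma> (scheme_at N s y \<omega>)))"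
proof -
  have U: "integrable lborel (\<lambda>y. scheme_at N s y \<omega>)" unfolding scheme_at_def by (rule scheme_integrable[OF N \<omega>])
  have [measurable]: "(\<lambda>y. scheme_at N s y \<omega>) \<in> borel_measurable borel" by (rule scheme_at_space_measurable[OF N \<omega>])
  have "integrable lborel (\<lambda>y. \<sigma> (scheme_at N s y \<omega>))"
    by (rule Bochner_Integration.integrable_bound[OF integrable_mult_right[OF integrable_abs[OF U], of L]])
       (use sigma_bound L in \<open>auto simp: abs_mult\<close>)
  from integrable_real_mult_indicator[OF _ heat_op_integrable_kernel[OF r this], of "cell N j" x]
  show ?thesis by (simp add: mult.commute)
qed

lemma discrete_field_pair_measurable:
  assumes "0 < N"
  shows "(\<lambda>w. discrete_field N (scheme_at N) t (fst w) (snd w)) \<in> borel_measurable (borel \<Otimes>\<^sub>M spacetime)"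
    "(\<lambda>w. discrete_field N ug t (fst w) (snd w)) \<in> borel_measurable (borel \<Otimes>\<^sub>M spacetime)"
    "(\<lambda>w. limit_field t (fst w) (snd w)) \<in> borel_measurable (borel \<Otimes>\<^sub>M spacetime)"
proof -
  let ?K = "borel \<Otimes>\<^sub>M spacetime :: (real \<times> 'a \<times> real \<times> real) measure"
  have m: "(\<lambda>w. fst (snd w)) \<in> measurable ?K M" "(\<lambda>w. fst (snd (snd w))) \<in> borel_measurable ?K" "(\<lambda>w. snd (snd (snd w))) \<in> borel_measurable ?K"
    "(\<lambda>w. fst w) \<in> borel_measurable ?K" unfolding spacetime_def by measurable
  note [measurable] = m
  have "(\<lambda>w. discrete_field N v t (fst w) (fst (snd w), fst (snd (snd w)), snd (snd (snd w)))) \<in> borel_measurable ?K"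
    if "\<And>(K :: ((real \<times> 'a \<times> real \<times> real) \<times> real) measure) f g h. f \<in> measurable K M \<Longrightarrow> g \<in> borel_measurable K \<Longrightarrow> h \<in> borel_measurable K \<Longrightarrow> (\<lambda>x. v (g x) (h x) (f x)) \<in> borel_measurable K" for v
    by (rule discrete_field_measurable[OF that]) (use m in auto)
  from this[of "scheme_at N"] this[of ug] scheme_at_measurable[OF assms]
  show "(\<lambda>w. discrete_field N (scheme_at N) t (fst w) (snd w)) \<in> borel_measurable ?K"
    "(\<lambda>w. discrete_field N ug t (fst w) (snd w)) \<in> borel_measurable ?K" by (auto intro: ug_measurable)
  show "(\<lambda>w. limit_field t (fst w) (snd w)) \<in> borel_measurable ?K"
    unfolding limit_field_def split_beta' by measurable
qed

text \<open>The feedback term of the error recursion: the projection is linear and contracting,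
  \<sigma> is Lipschitz, and \<open>grid_diff\<close> replaces the grid difference by t - s.\<close>

lemma discrete_field_diff:
  assumes N: "0 < N" and t: "0 < t"
  shows "(\<integral>\<^sup>+x. \<integral>\<^sup>+z. ennreal ((discrete_field N (scheme_at N) t x z - discrete_field N ug t x z)\<^sup>2) \<partial>spacetime \<partial>lborel) \<le>
    (\<integral>\<^sup>+s\<in>{0<..<t}. ennreal (p (t - s) 0) * (ennreal (L\<^sup>2) * discrete_error N s) \<partial>lborel)"
proof -
  note [measurable] = discrete_field_pair_measurable[OF N, of t]
  have "(\<integral>\<^sup>+x. \<integral>\<^sup>+z. ennreal ((discrete_field N (scheme_at N) t x z - discrete_field N ug t x z)\<^sup>2) \<partial>spacetime \<partial>lborel) =
    (\<integral>\<^sup>+s. \<integral>\<^sup>+\<omega>. \<integral>\<^sup>+x. \<integral>\<^sup>+y. ennreal ((discrete_field N (scheme_at N) t x (\<omega>, s, y) - discrete_field N ug t x (\<omega>, s, y))\<^sup>2) \<partial>lborel \<partial>lborel \<partial>M \<partial>lborel)"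
    by (rule field_space_integral) (unfold split_beta', measurable)
  also have "\<dots> \<le> (\<integral>\<^sup>+s\<in>{0<..<t}. ennreal (p (t - s) 0) * (ennreal (L\<^sup>2) * discrete_error N s) \<partial>lborel)"
  proof (rule nn_integral_mono)
    fix s
    show "(\<integral>\<^sup>+\<omega>. \<integral>\<^sup>+x. \<integral>\<^sup>+y. ennreal ((discrete_field N (scheme_at N) t x (\<omega>, s, y) - discrete_field N ug t x (\<omega>, s, y))\<^sup>2) \<partial>lborel \<partial>lborel \<partial>M) \<le>
      ennreal (p (t - s) 0) * (ennreal (L\<^sup>2) * discrete_error N s) * indicator {0<..<t} s"
    proof (cases "0 < s \<and> slot N s < slot N t")
      case False
      show ?thesis unfolding discrete_field_def prod.case if_not_P[OF False] by simp
    next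
      case True
      then have s: "0 < s" and lt: "slot N s < slot N t" by auto
      note gd = grid_diff[OF N s t lt]
      let ?r = "grid N t - grid N s"
      have "(\<integral>\<^sup>+\<omega>. \<integral>\<^sup>+x. \<integral>\<^sup>+y. ennreal ((discrete_field N (scheme_at N) t x (\<omega>, s, y) - discrete_field N ug t x (\<omega>, s, y))\<^sup>2) \<partial>lborel \<partial>lborel \<partial>M) \<le>
        (\<integral>\<^sup>+\<omega>. ennreal (p (t - s) 0) * (ennreal (L\<^sup>2) * (\<integral>\<^sup>+y. ennreal ((scheme_at N s y \<omega> - ug s y \<omega>)\<^sup>2) \<partial>lborel)) \<partial>M)"
      proof (rule nn_integral_mono)
        fix \<omega> assume \<omega>: "\<omega> \<in> space M"
        note [measurable] = ug_space_measurable[OF \<omega>] scheme_at_space_measurable[OF N \<omega>]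
        let ?g = "\<lambda>y. \<sigma> (scheme_at N s y \<omega>) - \<sigma> (ug s y \<omega>)"
        have "discrete_field N (scheme_at N) t x (\<omega>, s, y) - discrete_field N ug t x (\<omega>, s, y) = cell_proj N (\<lambda>y'. p ?r (x - y') * ?g y') y" for x y
          using True cell_proj_diff[OF scheme_cell_integrable[OF N \<omega> gd(2)] ug_cell_integrable[OF \<omega> s gd(2)]]
          by (simp add: discrete_field_def right_diff_distrib)
        then have "(\<integral>\<^sup>+x. \<integral>\<^sup>+y. ennreal ((discrete_field N (scheme_at N) t x (\<omega>, s, y) - discrete_field N ug t x (\<omega>, s, y))\<^sup>2) \<partial>lborel \<partial>lborel) \<le>
          ennreal (p (2 * ?r) 0) * (\<integral>\<^sup>+y. ennreal ((?g y)\<^sup>2) \<partial>lborel)"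
          using cell_proj_heat[OF N gd(2), of ?g] by simp
        also have "\<dots> \<le> ennreal (p (t - s) 0) * (\<integral>\<^sup>+y. ennreal (L\<^sup>2) * ennreal ((scheme_at N s y \<omega> - ug s y \<omega>)\<^sup>2) \<partial>lborel)"
        proof (intro mult_mono nn_integral_mono)
          show "ennreal (p (2 * ?r) 0) \<le> ennreal (p (t - s) 0)"
            using gd by (intro ennreal_leI heat_antimono) auto
          fix y
          have "(?g y)\<^sup>2 \<le> (L * \<bar>scheme_at N s y \<omega> - ug s y \<omega>\<bar>)\<^sup>2"
            using power_mono[OF Lip[of "scheme_at N s y \<omega>" "ug s y \<omega>"], of 2] by simp
          then show "ennreal ((?g y)\<^sup>2) \<le> ennreal (L\<^sup>2) * ennreal ((scheme_at N s y \<omega> - ug s y \<omega>)\<^sup>2)"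
            by (subst ennreal_mult[symmetric]) (auto simp: power_mult_distrib intro!: ennreal_leI)
        qed auto
        also have "\<dots> = ennreal (p (t - s) 0) * (ennreal (L\<^sup>2) * (\<integral>\<^sup>+y. ennreal ((scheme_at N s y \<omega> - ug s y \<omega>)\<^sup>2) \<partial>lborel))"
          by (subst nn_integral_cmult) auto
        finally show "(\<integral>\<^sup>+x. \<integral>\<^sup>+y. ennreal ((discrete_field N (scheme_at N) t x (\<omega>, s, y) - discrete_field N ug t x (\<omega>, s, y))\<^sup>2) \<partial>lborel \<partial>lborel) \<le>
          ennreal (p (t - s) 0) * (ennreal (L\<^sup>2) * (\<integral>\<^sup>+y. ennreal ((scheme_at N s y \<omega> - ug s y \<omega>)\<^sup>2) \<partial>lborel))" .
      qed
      also have "\<dots> = ennreal (p (t - s) 0) * (ennreal (L\<^sup>2) * discrete_error N s)"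
      proof -
        note [measurable (raw)] = scheme_at_measurable[OF N]
        have [measurable]: "(\<lambda>\<omega>. \<integral>\<^sup>+y. ennreal ((scheme_at N s y \<omega> - ug s y \<omega>)\<^sup>2) \<partial>lborel) \<in> borel_measurable M" by measurable
        show ?thesis unfolding discrete_error_def by (simp add: nn_integral_cmult)
      qed
      finally show ?thesis using s gd(1) by simp
    qed
  qed
  finally show ?thesis .
qed

text \<open>The kernel is kept at the grid times rather than bounded by p (t - s) 0, because these
  bounds must converge to the exact norm of the limit in \<open>limit_field_norm\<close> for
  \<open>square_integrals_tendsto_zero\<close> to apply.\<close>

lemma discrete_field_norm:
  assumes N: "0 < N" and t: "0 < t"
  shows "(\<integral>\<^sup>+x. \<integral>\<^sup>+z. ennreal ((discrete_field N ug t x z)\<^sup>2) \<partial>spacetime \<partial>lborel) \<le>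
    (\<integral>\<^sup>+s. (if 0 < s \<and> slot N s < slot N t then ennreal (p (2 * (grid N t - grid N s)) 0) * sigma_energy s else 0) \<partial>lborel)"
proof -
  note [measurable] = discrete_field_pair_measurable[OF N, of t]
  have "(\<integral>\<^sup>+x. \<integral>\<^sup>+z. ennreal ((discrete_field N ug t x z)\<^sup>2) \<partial>spacetime \<partial>lborel) =
    (\<integral>\<^sup>+s. \<integral>\<^sup>+\<omega>. \<integral>\<^sup>+x. \<integral>\<^sup>+y. ennreal ((discrete_field N ug t x (\<omega>, s, y))\<^sup>2) \<partial>lborel \<partial>lborel \<partial>M \<partial>lborel)"
    by (rule field_space_integral) (unfold split_beta', measurable)
  also have "\<dots> \<le> (\<integral>\<^sup>+s. (if 0 < s \<and> slot N s < slot N t then ennreal (p (2 * (grid N t - grid N s)) 0) * sigma_energy s else 0) \<partial>lborel)"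
  proof (rule nn_integral_mono)
    fix s
    show "(\<integral>\<^sup>+\<omega>. \<integral>\<^sup>+x. \<integral>\<^sup>+y. ennreal ((discrete_field N ug t x (\<omega>, s, y))\<^sup>2) \<partial>lborel \<partial>lborel \<partial>M) \<le>
      (if 0 < s \<and> slot N s < slot N t then ennreal (p (2 * (grid N t - grid N s)) 0) * sigma_energy s else 0)"
    proof (cases "0 < s \<and> slot N s < slot N t")
      case False
      show ?thesis unfolding discrete_field_def prod.case if_not_P[OF False] by simp
    next
      case True
      then have s: "0 < s" and lt: "slot N s < slot N t" by auto
      let ?r = "grid N t - grid N s"
      have "(\<integral>\<^sup>+\<omega>. \<integral>\<^sup>+x. \<integral>\<^sup>+y. ennreal ((discrete_field N ug t x (\<omega>, s, y))\<^sup>2) \<partial>lborel \<partial>lborel \<partial>M) \<le>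
        (\<integral>\<^sup>+\<omega>. ennreal (p (2 * ?r) 0) * (\<integral>\<^sup>+y. ennreal ((\<sigma> (ug s y \<omega>))\<^sup>2) \<partial>lborel) \<partial>M)"
      proof (rule nn_integral_mono)
        fix \<omega> assume \<omega>: "\<omega> \<in> space M"
        note [measurable] = ug_space_measurable[OF \<omega>]
        show "(\<integral>\<^sup>+x. \<integral>\<^sup>+y. ennreal ((discrete_field N ug t x (\<omega>, s, y))\<^sup>2) \<partial>lborel \<partial>lborel) \<le>
          ennreal (p (2 * ?r) 0) * (\<integral>\<^sup>+y. ennreal ((\<sigma> (ug s y \<omega>))\<^sup>2) \<partial>lborel)"
          using True cell_proj_heat[OF N grid_diff(2)[OF N s t lt], of "\<lambda>y. \<sigma> (ug s y \<omega>)"] by (simp add: discrete_field_def)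
      qed
      also have "\<dots> = ennreal (p (2 * ?r) 0) * sigma_energy s"
        unfolding sigma_energy_def by (rule nn_integral_cmult) measurable
      finally show ?thesis using True by simp
    qed
  qed
  finally show ?thesis .
qed

lemma limit_field_norm:
  "(\<integral>\<^sup>+x. \<integral>\<^sup>+z. ennreal ((limit_field t x z)\<^sup>2) \<partial>spacetime \<partial>lborel) =
    (\<integral>\<^sup>+s\<in>{0<..<t}. ennreal (p (2 * (t - s)) 0) * sigma_energy s \<partial>lborel)"
proof -
  note [measurable] = discrete_field_pair_measurable(3)[of 1 t, simplified]
  have "(\<integral>\<^sup>+x. \<integral>\<^sup>+z. ennreal ((limit_field t x z)\<^sup>2) \<partial>spacetime \<partial>lborel) =
    (\<integral>\<^sup>+s. \<integral>\<^sup>+\<omega>. \<integral>\<^sup>+x. \<integral>\<^sup>+y. ennreal ((limit_field t x (\<omega>, s, y))\<^sup>2) \<partial>lborel \<partial>lborel \<partial>M \<partial>lborel)"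
    by (rule field_space_integral) (unfold split_beta', measurable)
  also have "\<dots> = (\<integral>\<^sup>+s\<in>{0<..<t}. ennreal (p (2 * (t - s)) 0) * sigma_energy s \<partial>lborel)"
  proof (rule nn_integral_cong)
    fix s
    show "(\<integral>\<^sup>+\<omega>. \<integral>\<^sup>+x. \<integral>\<^sup>+y. ennreal ((limit_field t x (\<omega>, s, y))\<^sup>2) \<partial>lborel \<partial>lborel \<partial>M) =
      ennreal (p (2 * (t - s)) 0) * sigma_energy s * indicator {0<..<t} s"
    proof (cases "s \<in> {0<..<t}")
      case False
      then show ?thesis by (simp add: limit_field_def)
    next
      case True
      have "(\<integral>\<^sup>+\<omega>. \<integral>\<^sup>+x. \<integral>\<^sup>+y. ennreal ((limit_field t x (\<omega>, s, y))\<^sup>2) \<partial>lborel \<partial>lborel \<partial>M) =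
        (\<integral>\<^sup>+\<omega>. ennreal (p (2 * (t - s)) 0) * (\<integral>\<^sup>+y. ennreal ((\<sigma> (ug s y \<omega>))\<^sup>2) \<partial>lborel) \<partial>M)"
      proof (rule nn_integral_cong)
        fix \<omega> assume \<omega>: "\<omega> \<in> space M"
        note [measurable] = ug_space_measurable[OF \<omega>]
        show "(\<integral>\<^sup>+x. \<integral>\<^sup>+y. ennreal ((limit_field t x (\<omega>, s, y))\<^sup>2) \<partial>lborel \<partial>lborel) =
          ennreal (p (2 * (t - s)) 0) * (\<integral>\<^sup>+y. ennreal ((\<sigma> (ug s y \<omega>))\<^sup>2) \<partial>lborel)"
          using True space_convolution[of "t - s" "\<lambda>y. ennreal ((\<sigma> (ug s y \<omega>))\<^sup>2)"]
          by (simp add: limit_field_def power_mult_distrib ennreal_mult)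
      qed
      also have "\<dots> = ennreal (p (2 * (t - s)) 0) * sigma_energy s"
        unfolding sigma_energy_def by (rule nn_integral_cmult) measurable
      finally show ?thesis using True by simp
    qed
  qed
  finally show ?thesis .
qed

lemma ug_energy_finite: "(\<integral>\<^sup>+t\<in>{0<..<T}. (\<integral>\<^sup>+\<omega>. \<integral>\<^sup>+x. ennreal ((ug t x \<omega>)\<^sup>2) \<partial>lborel \<partial>M) \<partial>lborel) < \<infinity>"
proof -
  interpret P: pair_sigma_finite M "lborel :: real measure" by (rule pair_sigma_finite_lborel)
  have "(\<integral>\<^sup>+\<omega>. \<integral>\<^sup>+x. ennreal ((ug t x \<omega>)\<^sup>2) \<partial>lborel \<partial>M) = (\<integral>\<^sup>+x. \<integral>\<^sup>+\<omega>. ennreal ((uc t x \<omega>)\<^sup>2) \<partial>M \<partial>lborel)" for t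
  proof -
    have "(\<integral>\<^sup>+\<omega>. \<integral>\<^sup>+x. ennreal ((ug t x \<omega>)\<^sup>2) \<partial>lborel \<partial>M) = (\<integral>\<^sup>+\<omega>. \<integral>\<^sup>+x. ennreal ((uc t x \<omega>)\<^sup>2) \<partial>lborel \<partial>M)"
      using AE_ug by (intro nn_integral_cong_AE, eventually_elim) simp
    also have "\<dots> = (\<integral>\<^sup>+x. \<integral>\<^sup>+\<omega>. ennreal ((uc t x \<omega>)\<^sup>2) \<partial>M \<partial>lborel)"
      by (rule P.Fubini'[symmetric]) measurable
    finally show ?thesis .
  qed
  then show ?thesis using energy_finite[of T] by simp
qed

lemma sigma_energy_finite: "(\<integral>\<^sup>+t\<in>{0<..<T}. sigma_energy t \<partial>lborel) < \<infinity>"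
proof -
  have "sigma_energy t \<le> ennreal (L\<^sup>2) * (\<integral>\<^sup>+\<omega>. \<integral>\<^sup>+x. ennreal ((ug t x \<omega>)\<^sup>2) \<partial>lborel \<partial>M)" for t
  proof -
    have "sigma_energy t \<le> (\<integral>\<^sup>+\<omega>. ennreal (L\<^sup>2) * (\<integral>\<^sup>+x. ennreal ((ug t x \<omega>)\<^sup>2) \<partial>lborel) \<partial>M)"
      unfolding sigma_energy_def
    proof (rule nn_integral_mono)
      fix \<omega> assume \<omega>: "\<omega> \<in> space M"
      note [measurable] = ug_space_measurable[OF \<omega>]
      show "(\<integral>\<^sup>+y. ennreal ((\<sigma> (ug t y \<omega>))\<^sup>2) \<partial>lborel) \<le> ennreal (L\<^sup>2) * (\<integral>\<^sup>+x. ennreal ((ug t x \<omega>)\<^sup>2) \<partial>lborel)"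
        using sigma_square_bound
        by (subst nn_integral_cmult[symmetric]) (auto simp: ennreal_mult[symmetric] intro!: nn_integral_mono ennreal_leI)
    qed
    also have "\<dots> = ennreal (L\<^sup>2) * (\<integral>\<^sup>+\<omega>. \<integral>\<^sup>+x. ennreal ((ug t x \<omega>)\<^sup>2) \<partial>lborel \<partial>M)"
      by (rule nn_integral_cmult) measurable
    finally show ?thesis .
  qed
  then have "(\<integral>\<^sup>+t\<in>{0<..<T}. sigma_energy t \<partial>lborel) \<le>
    (\<integral>\<^sup>+t. ennreal (L\<^sup>2) * ((\<integral>\<^sup>+\<omega>. \<integral>\<^sup>+x. ennreal ((ug t x \<omega>)\<^sup>2) \<partial>lborel \<partial>M) * indicator {0<..<T} t) \<partial>lborel)"
    by (intro nn_integral_mono) (auto simp: indicator_def)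
  also have "\<dots> = ennreal (L\<^sup>2) * (\<integral>\<^sup>+t\<in>{0<..<T}. (\<integral>\<^sup>+\<omega>. \<integral>\<^sup>+x. ennreal ((ug t x \<omega>)\<^sup>2) \<partial>lborel \<partial>M) \<partial>lborel)"
    by (rule nn_integral_cmult) measurable
  also have "\<dots> < \<infinity>" using ug_energy_finite[of T] by (simp add: ennreal_mult_less_top)
  finally show ?thesis .
qed

section \<open>Consistency errors of the discretisation\<close>

definition discrete_defect :: "nat \<Rightarrow> real \<Rightarrow> ennreal" where
  "discrete_defect N t = (\<integral>\<^sup>+x. \<integral>\<^sup>+z. ennreal ((discrete_field N ug t x z - limit_field t x z)\<^sup>2) \<partial>spacetime \<partial>lborel)"

text \<open>The error from running the heat flow of the initial value up to the end of the time
  step; \<open>discrete_defect\<close> is the error from discretising the integrand of the true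
  solution.\<close>

definition heat_defect :: "nat \<Rightarrow> real \<Rightarrow> ennreal" where
  "heat_defect N t = (\<integral>\<^sup>+x. ennreal ((heat_op (grid N t + step N) u\<^sub>0 x - heat_op t u\<^sub>0 x)\<^sup>2) \<partial>lborel)"

lemma spacetime_sigma_finite: "sigma_finite_measure spacetime"
proof -
  have sf: "sigma_finite_measure (lborel \<Otimes>\<^sub>M lborel :: (real \<times> real) measure)"
    unfolding lborel_prod by (rule lborel.sigma_finite_measure_axioms)
  interpret Q: pair_sigma_finite M "lborel \<Otimes>\<^sub>M lborel :: (real \<times> real) measure"
    by (intro pair_sigma_finite.intro sf) (rule sigma_finite_measure_axioms)
  show ?thesis unfolding spacetime_def by (rule Q.sigma_finite_measure_axioms)
qed

lemma triple_measurable: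
  assumes N: "0 < N"
  shows "(\<lambda>(t, x, z). discrete_field N ug t x z) \<in> borel_measurable (lborel \<Otimes>\<^sub>M (lborel \<Otimes>\<^sub>M spacetime))"
    "(\<lambda>(t, x, z). limit_field t x z) \<in> borel_measurable (lborel \<Otimes>\<^sub>M (lborel \<Otimes>\<^sub>M spacetime))"
proof -
  let ?K = "lborel \<Otimes>\<^sub>M (lborel \<Otimes>\<^sub>M spacetime) :: (real \<times> real \<times> 'a \<times> real \<times> real) measure"
  have m: "(\<lambda>w. fst (snd (snd w))) \<in> measurable ?K M" "(\<lambda>w. fst (snd (snd (snd w)))) \<in> borel_measurable ?K"
    "(\<lambda>w. snd (snd (snd (snd w)))) \<in> borel_measurable ?K" "(\<lambda>w. fst (snd w)) \<in> borel_measurable ?K" "(\<lambda>w. fst w) \<in> borel_measurable ?K"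
    unfolding spacetime_def by measurable
  note [measurable] = m
  have "(\<lambda>w. discrete_field N ug (fst w) (fst (snd w)) (fst (snd (snd w)), fst (snd (snd (snd w))), snd (snd (snd (snd w))))) \<in> borel_measurable ?K"
    by (rule discrete_field_measurable[OF ug_measurable]) (use m in auto)
  then show "(\<lambda>(t, x, z). discrete_field N ug t x z) \<in> borel_measurable ?K" by (simp add: split_beta')
  show "(\<lambda>(t, x, z). limit_field t x z) \<in> borel_measurable ?K"
    unfolding limit_field_def split_beta' by measurable
qed

text \<open>For s < t the slots eventually differ and the grid difference tends to t - s; continuity
  of the path in space supplies the joint limit for \<open>cell_proj_tendsto\<close>. The index
  \<open>Suc n\<close> avoids N = 0.\<close>

lemma discrete_field_tendsto:
  assumes \<omega>: "\<omega> \<in> space M"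
  shows "(\<lambda>n. discrete_field (Suc n) ug t x (\<omega>, s, y)) \<longlonglongrightarrow> limit_field t x (\<omega>, s, y)"
proof (cases "0 < s \<and> s < t")
  case False
  have "discrete_field (Suc n) ug t x (\<omega>, s, y) = 0" for n
    using False slot_mono[of "Suc n" t s] by (auto simp: discrete_field_def)
  then show ?thesis using False by (auto simp: limit_field_def)
next
  case True
  then have s: "0 < s" "s < t" "0 < t" by auto
  define r where "r n = grid n t - grid n s" for n
  have r: "r \<longlonglongrightarrow> t - s" unfolding r_def using s by (intro tendsto_diff grid_tendsto) auto
  note [measurable] = ug_space_measurable[OF \<omega>]
  have "((\<lambda>(n, y'). p (r n) (x - y') * \<sigma> (ug s y' \<omega>)) \<longlongrightarrow> p (t - s) (x - y) * \<sigma> (ug s y \<omega>)) (sequentially \<times>\<^sub>F nhds y)"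
  proof -
    have f: "((\<lambda>z. r (fst z)) \<longlongrightarrow> t - s) (sequentially \<times>\<^sub>F nhds y)"
      by (rule filterlim_compose[OF r filterlim_fst])
    have g: "((\<lambda>z. snd z) \<longlongrightarrow> y) (sequentially \<times>\<^sub>F nhds y)" by (rule filterlim_snd)
    have u: "((\<lambda>z. ug s (snd z) \<omega>) \<longlongrightarrow> ug s y \<omega>) (sequentially \<times>\<^sub>F nhds y)"
      by (rule isCont_tendsto_compose[OF ug_continuous[OF \<omega> s(1)] g])
    have "isCont \<sigma> (ug s y \<omega>)" using sigma_continuous by (simp add: continuous_on_eq_continuous_at)
    note su = isCont_tendsto_compose[OF this u]
    have "((\<lambda>z. p (r (fst z)) (x - snd z)) \<longlongrightarrow> p (t - s) (x - y)) (sequentially \<times>\<^sub>F nhds y)"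
      unfolding heat_kernel_def using s \<theta> by (intro tendsto_intros f g) auto
    from tendsto_mult[OF this su] show ?thesis by (simp add: split_beta')
  qed
  then have "(\<lambda>n. cell_proj n (\<lambda>y'. p (r n) (x - y') * \<sigma> (ug s y' \<omega>)) y) \<longlonglongrightarrow> p (t - s) (x - y) * \<sigma> (ug s y \<omega>)"
    by (intro cell_proj_tendsto) measurable
  from LIMSEQ_Suc[OF this]
  have "(\<lambda>n. cell_proj (Suc n) (\<lambda>y'. p (r (Suc n)) (x - y') * \<sigma> (ug s y' \<omega>)) y) \<longlonglongrightarrow> limit_field t x (\<omega>, s, y)"
    using s by (simp add: limit_field_def)
  moreover have "\<forall>\<^sub>F n in sequentially. cell_proj (Suc n) (\<lambda>y'. p (r (Suc n)) (x - y') * \<sigma> (ug s y' \<omega>)) y = discrete_field (Suc n) ug t x (\<omega>, s, y)"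
  proof -
    have "\<forall>\<^sub>F n in sequentially. 0 < r (Suc n)"
      by (rule order_tendstoD(1)[OF LIMSEQ_Suc[OF r]]) (use s in simp)
    then show ?thesis
    proof eventually_elim
      case (elim n)
      have "slot (Suc n) s < slot (Suc n) t"
      proof (rule ccontr)
        assume "\<not> slot (Suc n) s < slot (Suc n) t"
        then have "grid (Suc n) t \<le> grid (Suc n) s" using step_pos[of "Suc n"] by (intro mult_right_mono) auto
        then show False using elim by (simp add: r_def)
      qed
      then show ?case unfolding discrete_field_def prod.case r_def using s by simp
    qed
  qed
  ultimately show ?thesis by (rule Lim_transform_eventually)
qed

text \<open>This is the integrable majorant, independent of the grid, for the dominated convergence
  of the norm bounds.\<close>

lemma kernel_energy_finite:
  "(\<integral>\<^sup>+t\<in>{0<..<T}. (\<integral>\<^sup>+s\<in>{0<..<t}. ennreal (p (t - s) 0) * sigma_energy s \<partial>lborel) \<partial>lborel) < \<infinity>"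
proof -
  let ?g = "\<lambda>t. \<integral>\<^sup>+s\<in>{0<..<t}. ennreal (p (t - s) 0) * sigma_energy s \<partial>lborel"
  have "(\<integral>\<^sup>+t\<in>{0<..<T}. ennreal (exp (- 1 * t)) * ?g t \<partial>lborel) \<le>
    ennreal (sqrt 2 / (2 * sqrt (1 * \<theta>))) * (\<integral>\<^sup>+s\<in>{0<..<T}. ennreal (exp (- 1 * s)) * sigma_energy s \<partial>lborel)"
    unfolding heat_laplace_kernel0[of 1, symmetric, OF zero_less_one] by (rule time_convolution_bound) measurable
  also have "\<dots> \<le> ennreal (sqrt 2 / (2 * sqrt (1 * \<theta>))) * (\<integral>\<^sup>+s\<in>{0<..<T}. sigma_energy s \<partial>lborel)"
  proof (intro mult_left_mono nn_integral_mono)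
    fix s
    have "ennreal (exp (- 1 * s)) * sigma_energy s \<le> 1 * sigma_energy s" if "0 < s"
      using that by (intro mult_right_mono) (auto simp: ennreal_le_1)
    then show "ennreal (exp (- 1 * s)) * sigma_energy s * indicator {0<..<T} s \<le> sigma_energy s * indicator {0<..<T} s"
      by (auto simp: indicator_def)
  qed simp
  also have "\<dots> < \<infinity>" using sigma_energy_finite[of T] by (simp add: ennreal_mult_less_top)
  finally have fin: "(\<integral>\<^sup>+t\<in>{0<..<T}. ennreal (exp (- 1 * t)) * ?g t \<partial>lborel) < \<infinity>" .
  have "(\<integral>\<^sup>+t\<in>{0<..<T}. ?g t \<partial>lborel) \<le> (\<integral>\<^sup>+t. ennreal (exp T) * (ennreal (exp (- 1 * t)) * ?g t * indicator {0<..<T} t) \<partial>lborel)"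
  proof (rule nn_integral_mono)
    fix t
    have "1 * ?g t \<le> ennreal (exp T * exp (- 1 * t)) * ?g t" if "t < T"
      using that by (intro mult_right_mono) (auto simp: exp_add[symmetric] ennreal_1[symmetric] simp del: ennreal_1 intro!: ennreal_leI)
    then show "?g t * indicator {0<..<T} t \<le> ennreal (exp T) * (ennreal (exp (- 1 * t)) * ?g t * indicator {0<..<T} t)"
      by (auto simp: indicator_def ennreal_mult mult.assoc)
  qed
  also have "\<dots> = ennreal (exp T) * (\<integral>\<^sup>+t\<in>{0<..<T}. ennreal (exp (- 1 * t)) * ?g t \<partial>lborel)"
    by (rule nn_integral_cmult) measurable
  also have "\<dots> < \<infinity>" using fin by (simp add: ennreal_mult_less_top)
  finally show ?thesis .
qed

text \<open>The fields converge pointwise but come without a pointwise majorant.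
  \<open>square_integrals_tendsto_zero\<close> asks only for convergence of norm bounds, which is a
  dominated convergence in the two time variables alone.\<close>

lemma discrete_defect_tendsto:
  "(\<lambda>n. \<integral>\<^sup>+t\<in>{0<..<T}. discrete_defect (Suc n) t \<partial>lborel) \<longlonglongrightarrow> 0"
proof -
  interpret S: sigma_finite_measure spacetime by (rule spacetime_sigma_finite)
  interpret P: pair_sigma_finite "lborel :: real measure" spacetime
    by (intro pair_sigma_finite.intro lborel.sigma_finite_measure_axioms spacetime_sigma_finite)
  let ?K = "lborel \<Otimes>\<^sub>M (lborel \<Otimes>\<^sub>M spacetime) :: (real \<times> real \<times> 'a \<times> real \<times> real) measure"
  have triple: "(\<integral>\<^sup>+w. (case w of (t, x, z) \<Rightarrow> ennreal ((indicator {0<..<T} t * f t x z)\<^sup>2)) \<partial>?K) =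
      (\<integral>\<^sup>+t\<in>{0<..<T}. (\<integral>\<^sup>+x. \<integral>\<^sup>+z. ennreal ((f t x z)\<^sup>2) \<partial>spacetime \<partial>lborel) \<partial>lborel)"
    if [measurable]: "(\<lambda>(t, x, z). f t x z) \<in> borel_measurable ?K" for f
  proof -
    have [measurable]: "(\<lambda>w. f (fst w) (fst (snd w)) (snd (snd w))) \<in> borel_measurable ?K" using that by (simp add: split_beta')
    have "(\<integral>\<^sup>+w. (case w of (t, x, z) \<Rightarrow> ennreal ((indicator {0<..<T} t * f t x z)\<^sup>2)) \<partial>?K) =
      (\<integral>\<^sup>+t. \<integral>\<^sup>+w. (case w of (x, z) \<Rightarrow> ennreal ((indicator {0<..<T} t * f t x z)\<^sup>2)) \<partial>(lborel \<Otimes>\<^sub>M spacetime) \<partial>lborel)"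
      by (subst P.nn_integral_fst[symmetric]) (auto simp: split_beta')
    also have "\<dots> = (\<integral>\<^sup>+t. \<integral>\<^sup>+x. \<integral>\<^sup>+z. ennreal ((indicator {0<..<T} t * f t x z)\<^sup>2) \<partial>spacetime \<partial>lborel \<partial>lborel)"
    proof (rule nn_integral_cong)
      fix t
      have [measurable]: "(\<lambda>w. f t (fst w) (snd w)) \<in> borel_measurable (lborel \<Otimes>\<^sub>M spacetime)"
        using measurable_compose[OF measurable_Pair1'[of t "lborel :: real measure" "lborel \<Otimes>\<^sub>M spacetime"] that] by (simp add: split_beta')
      show "(\<integral>\<^sup>+w. (case w of (x, z) \<Rightarrow> ennreal ((indicator {0<..<T} t * f t x z)\<^sup>2)) \<partial>(lborel \<Otimes>\<^sub>M spacetime)) =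
        (\<integral>\<^sup>+x. \<integral>\<^sup>+z. ennreal ((indicator {0<..<T} t * f t x z)\<^sup>2) \<partial>spacetime \<partial>lborel)"
        by (subst S.nn_integral_fst[symmetric]) (auto simp: split_beta')
    qed
    also have "\<dots> = (\<integral>\<^sup>+t\<in>{0<..<T}. (\<integral>\<^sup>+x. \<integral>\<^sup>+z. ennreal ((f t x z)\<^sup>2) \<partial>spacetime \<partial>lborel) \<partial>lborel)"
      by (intro nn_integral_cong) (auto simp: indicator_def)
    finally show ?thesis .
  qed
  define F where "F n = (\<lambda>(t, x, z). indicator {0<..<T} t * discrete_field (Suc n) ug t x z)" for n
  define G where "G = (\<lambda>(t, x, z). indicator {0<..<T} t * limit_field t x z)"
  note tm = triple_measurable(1)[OF zero_less_Suc] triple_measurable(2)[OF zero_less_one]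
  note [measurable] = tm
  have FG[measurable]: "F n \<in> borel_measurable ?K" "G \<in> borel_measurable ?K" for n
  proof -
    have [measurable]: "(\<lambda>w. indicator {0<..<T} (fst w) :: real) \<in> borel_measurable ?K" by measurable
    have "F n = (\<lambda>w. indicator {0<..<T} (fst w) * (\<lambda>(t, x, z). discrete_field (Suc n) ug t x z) w)"
      "G = (\<lambda>w. indicator {0<..<T} (fst w) * (\<lambda>(t, x, z). limit_field t x z) w)" by (auto simp: F_def G_def)
    then show "F n \<in> borel_measurable ?K" "G \<in> borel_measurable ?K" by simp_all
  qed
  have Gint: "(\<integral>\<^sup>+w. ennreal ((G w)\<^sup>2) \<partial>?K) = (\<integral>\<^sup>+t\<in>{0<..<T}. (\<integral>\<^sup>+s\<in>{0<..<t}. ennreal (p (2 * (t - s)) 0) * sigma_energy s \<partial>lborel) \<partial>lborel)"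
    using triple[OF tm(2)] by (simp add: G_def split_beta' limit_field_norm)
  \<comment> \<open>\<open>?b\<close> bounds the norm density of the n-th field, \<open>?l\<close>
    is the exact density of the limit, and \<open>?d\<close> dominates every \<open>?b\<close> by
    \<open>grid_diff\<close>.\<close>
  let ?d = "\<lambda>t s. ennreal (p (t - s) 0) * sigma_energy s * (indicator {0<..<t} s * indicator {0<..<T} t)"
  let ?b = "\<lambda>n t s. (if 0 < s \<and> slot (Suc n) s < slot (Suc n) t then ennreal (p (2 * (grid (Suc n) t - grid (Suc n) s)) 0) * sigma_energy s else 0) * indicator {0<..<T} t"
  let ?l = "\<lambda>t s. ennreal (p (2 * (t - s)) 0) * sigma_energy s * (indicator {0<..<t} s * indicator {0<..<T} t)"
  have bd: "?b n t s \<le> ?d t s" for n t s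
  proof (cases "0 < s \<and> slot (Suc n) s < slot (Suc n) t \<and> t \<in> {0<..<T}")
    case True
    note gd = grid_diff[of "Suc n" s t]
    have "ennreal (p (2 * (grid (Suc n) t - grid (Suc n) s)) 0) \<le> ennreal (p (t - s) 0)"
      using True gd by (intro ennreal_leI heat_antimono) auto
    then have "ennreal (p (2 * (grid (Suc n) t - grid (Suc n) s)) 0) * sigma_energy s \<le> ennreal (p (t - s) 0) * sigma_energy s"
      by (rule mult_right_mono) simp
    then show ?thesis using True gd(1) by simp
  qed (auto simp: indicator_def)
  have lim: "(\<lambda>n. ?b n t s) \<longlonglongrightarrow> ?l t s" for t s
  proof (cases "0 < s \<and> s < t \<and> t < T")
    case True
    then have s: "0 < s" "0 < t" "s < t" "t < T" by auto
    have r: "(\<lambda>n. 2 * (grid n t - grid n s)) \<longlonglongrightarrow> 2 * (t - s)" using s by (intro tendsto_intros grid_tendsto) auto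
    have "(\<lambda>n. ennreal (p (2 * (grid n t - grid n s)) 0)) \<longlonglongrightarrow> ennreal (p (2 * (t - s)) 0)"
      using s by (intro tendsto_ennrealI heat_tendsto r tendsto_const) auto
    from LIMSEQ_Suc[OF this]
    have "(\<lambda>n. ennreal (p (2 * (grid (Suc n) t - grid (Suc n) s)) 0) * sigma_energy s) \<longlonglongrightarrow> ennreal (p (2 * (t - s)) 0) * sigma_energy s"
      using s heat_pos[of "2 * (t - s)" 0] by (intro tendsto_mult_ennreal tendsto_const) auto
    moreover have "\<forall>\<^sub>F n in sequentially. ennreal (p (2 * (grid (Suc n) t - grid (Suc n) s)) 0) * sigma_energy s = ?b n t s"
    proof -
      have "\<forall>\<^sub>F n in sequentially. 0 < 2 * (grid (Suc n) t - grid (Suc n) s)"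
        by (rule order_tendstoD(1)[OF LIMSEQ_Suc[OF r]]) (use s in simp)
      then show ?thesis
      proof eventually_elim
        case (elim n)
        have "slot (Suc n) s < slot (Suc n) t"
        proof (rule ccontr)
          assume "\<not> slot (Suc n) s < slot (Suc n) t"
          then have "grid (Suc n) t \<le> grid (Suc n) s" using step_pos[of "Suc n"] by (intro mult_right_mono) auto
          then show False using elim by simp
        qed
        then show ?case using s by simp
      qed
    qed
    ultimately have "(\<lambda>n. ?b n t s) \<longlonglongrightarrow> ennreal (p (2 * (t - s)) 0) * sigma_energy s" by (rule Lim_transform_eventually)
    then show ?thesis using s by simp
  next
    case False
    have "?b n t s = 0" for n using False slot_mono[of "Suc n" t s] by (auto simp: indicator_def)
    then show ?thesis using False by (auto simp: indicator_def)
  qed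
  have pairs: "(\<integral>\<^sup>+w. f (fst w) (snd w) \<partial>(lborel \<Otimes>\<^sub>M lborel)) = (\<integral>\<^sup>+t. \<integral>\<^sup>+s. f t s \<partial>lborel \<partial>lborel)"
    if "case_prod f \<in> borel_measurable (lborel \<Otimes>\<^sub>M lborel)" for f :: "real \<Rightarrow> real \<Rightarrow> ennreal"
    using lborel.nn_integral_fst[OF that] by (simp add: split_beta')
  have m: "case_prod (?b n) \<in> borel_measurable (lborel \<Otimes>\<^sub>M lborel)" "case_prod ?l \<in> borel_measurable (lborel \<Otimes>\<^sub>M lborel)"
    "case_prod ?d \<in> borel_measurable (lborel \<Otimes>\<^sub>M lborel)" for n unfolding split_beta' by measurable
  have out: "(\<integral>\<^sup>+t. \<integral>\<^sup>+s. f t s * (indicator {0<..<t} s * indicator {0<..<T} t) \<partial>lborel \<partial>lborel) =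
    (\<integral>\<^sup>+t\<in>{0<..<T}. (\<integral>\<^sup>+s\<in>{0<..<t}. f t s \<partial>lborel) \<partial>lborel)" for f :: "real \<Rightarrow> real \<Rightarrow> ennreal"
    by (intro nn_integral_cong) (auto simp: indicator_def)
  have blim: "(\<lambda>n. \<integral>\<^sup>+t. \<integral>\<^sup>+s. ?b n t s \<partial>lborel \<partial>lborel) \<longlonglongrightarrow> (\<integral>\<^sup>+w. ennreal ((G w)\<^sup>2) \<partial>?K)"
    unfolding Gint out[symmetric] pairs[OF m(1), symmetric] pairs[OF m(2), symmetric]
  proof (rule nn_integral_dominated_convergence[where w = "\<lambda>w. ?d (fst w) (snd w)"])
    show "(\<lambda>w. ?b n (fst w) (snd w)) \<in> borel_measurable (lborel \<Otimes>\<^sub>M lborel)" "(\<lambda>w. ?l (fst w) (snd w)) \<in> borel_measurable (lborel \<Otimes>\<^sub>M lborel)"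
      "(\<lambda>w. ?d (fst w) (snd w)) \<in> borel_measurable (lborel \<Otimes>\<^sub>M lborel)" for n using m(1)[of n] m(2,3) by (simp_all add: split_beta')
    show "AE w in lborel \<Otimes>\<^sub>M lborel. ?b n (fst w) (snd w) \<le> ?d (fst w) (snd w)" for n by (rule AE_I2) (rule bd)
    show "AE w in lborel \<Otimes>\<^sub>M lborel. (\<lambda>n. ?b n (fst w) (snd w)) \<longlonglongrightarrow> ?l (fst w) (snd w)" by (rule AE_I2) (rule lim)
    show "(\<integral>\<^sup>+w. ?d (fst w) (snd w) \<partial>(lborel \<Otimes>\<^sub>M lborel)) < \<infinity>"
      unfolding pairs[OF m(3)] out by (rule kernel_energy_finite)
  qed
  have "(\<lambda>n. \<integral>\<^sup>+w. ennreal ((F n w - G w)\<^sup>2) \<partial>?K) \<longlonglongrightarrow> 0"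
  proof (rule square_integrals_tendsto_zero[OF FG _ _ blim])
    fix w assume "w \<in> space ?K"
    moreover obtain t x \<omega> s y where w: "w = (t, x, \<omega>, s, y)" by (metis prod_cases5)
    ultimately have "\<omega> \<in> space M" by (simp add: space_pair_measure spacetime_def)
    then show "(\<lambda>n. F n w) \<longlonglongrightarrow> G w"
      unfolding w F_def G_def prod.case by (intro tendsto_mult tendsto_const discrete_field_tendsto)
  next
    fix n
    have "(\<integral>\<^sup>+w. ennreal ((F n w)\<^sup>2) \<partial>?K) = (\<integral>\<^sup>+t\<in>{0<..<T}. (\<integral>\<^sup>+x. \<integral>\<^sup>+z. ennreal ((discrete_field (Suc n) ug t x z)\<^sup>2) \<partial>spacetime \<partial>lborel) \<partial>lborel)"
      using triple[OF tm(1)[of n]] by (simp add: F_def split_beta')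
    also have "\<dots> \<le> (\<integral>\<^sup>+t. \<integral>\<^sup>+s. ?b n t s \<partial>lborel \<partial>lborel)"
    proof (rule nn_integral_mono)
      fix t
      show "(\<integral>\<^sup>+x. \<integral>\<^sup>+z. ennreal ((discrete_field (Suc n) ug t x z)\<^sup>2) \<partial>spacetime \<partial>lborel) * indicator {0<..<T} t \<le> (\<integral>\<^sup>+s. ?b n t s \<partial>lborel)"
        using discrete_field_norm[of "Suc n" t] by (cases "t \<in> {0<..<T}") simp_all
    qed
    finally show "(\<integral>\<^sup>+w. ennreal ((F n w)\<^sup>2) \<partial>?K) \<le> (\<integral>\<^sup>+t. \<integral>\<^sup>+s. ?b n t s \<partial>lborel \<partial>lborel)" .
  next
    have "(\<integral>\<^sup>+w. ennreal ((G w)\<^sup>2) \<partial>?K) \<le> (\<integral>\<^sup>+t\<in>{0<..<T}. (\<integral>\<^sup>+s\<in>{0<..<t}. ennreal (p (t - s) 0) * sigma_energy s \<partial>lborel) \<partial>lborel)"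
      unfolding Gint
    proof (rule nn_integral_mono)
      fix t
      have "(\<integral>\<^sup>+s\<in>{0<..<t}. ennreal (p (2 * (t - s)) 0) * sigma_energy s \<partial>lborel) \<le> (\<integral>\<^sup>+s\<in>{0<..<t}. ennreal (p (t - s) 0) * sigma_energy s \<partial>lborel)"
      proof (rule nn_integral_mono)
        fix s
        show "ennreal (p (2 * (t - s)) 0) * sigma_energy s * indicator {0<..<t} s \<le> ennreal (p (t - s) 0) * sigma_energy s * indicator {0<..<t} s"
          by (cases "s \<in> {0<..<t}") (auto intro!: mult_right_mono ennreal_leI heat_antimono)
      qed
      then show "(\<integral>\<^sup>+s\<in>{0<..<t}. ennreal (p (2 * (t - s)) 0) * sigma_energy s \<partial>lborel) * indicator {0<..<T} t \<le>
        (\<integral>\<^sup>+s\<in>{0<..<t}. ennreal (p (t - s) 0) * sigma_energy s \<partial>lborel) * indicator {0<..<T} t"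
        by (rule mult_right_mono) simp
    qed
    also have "\<dots> < \<infinity>" by (rule kernel_energy_finite)
    finally show "(\<integral>\<^sup>+w. ennreal ((G w)\<^sup>2) \<partial>?K) < \<infinity>" .
  qed
  moreover have "(\<integral>\<^sup>+w. ennreal ((F n w - G w)\<^sup>2) \<partial>?K) = (\<integral>\<^sup>+t\<in>{0<..<T}. discrete_defect (Suc n) t \<partial>lborel)" for n
  proof -
    have "(\<lambda>(t, x, z). discrete_field (Suc n) ug t x z - limit_field t x z) \<in> borel_measurable ?K"
      using borel_measurable_diff[OF tm(1)[of n] tm(2)] by (simp add: split_beta')
    from triple[OF this] show ?thesis by (simp add: F_def G_def split_beta' discrete_defect_def right_diff_distrib)
  qed
  ultimately show ?thesis by simp
qed

text \<open>Here the norm bounds are constant: the grid runs late, and the additional heat flow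
  contracts the L^2 norm.\<close>

lemma heat_defect_tendsto:
  "(\<lambda>n. \<integral>\<^sup>+t\<in>{0<..<T}. heat_defect (Suc n) t \<partial>lborel) \<longlonglongrightarrow> 0"
proof -
  let ?K = "lborel \<Otimes>\<^sub>M lborel :: (real \<times> real) measure"
  have pairs: "(\<integral>\<^sup>+w. ennreal ((indicator {0<..<T} (fst w) * f (fst w) (snd w))\<^sup>2) \<partial>?K) = (\<integral>\<^sup>+t\<in>{0<..<T}. (\<integral>\<^sup>+x. ennreal ((f t x)\<^sup>2) \<partial>lborel) \<partial>lborel)"
    if [measurable]: "case_prod f \<in> borel_measurable (borel \<Otimes>\<^sub>M borel)" for f :: "real \<Rightarrow> real \<Rightarrow> real"
  proof -
    have "(\<integral>\<^sup>+w. ennreal ((indicator {0<..<T} (fst w) * f (fst w) (snd w))\<^sup>2) \<partial>?K) = (\<integral>\<^sup>+t. \<integral>\<^sup>+x. ennreal ((indicator {0<..<T} t * f t x)\<^sup>2) \<partial>lborel \<partial>lborel)"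
      by (subst lborel.nn_integral_fst[symmetric]) auto
    also have "\<dots> = (\<integral>\<^sup>+t\<in>{0<..<T}. (\<integral>\<^sup>+x. ennreal ((f t x)\<^sup>2) \<partial>lborel) \<partial>lborel)"
      by (intro nn_integral_cong) (auto simp: indicator_def)
    finally show ?thesis .
  qed
  define F where "F n w = indicator {0<..<T} (fst w) * heat_op (grid (Suc n) (fst w) + step (Suc n)) u\<^sub>0 (snd w)" for n and w :: "real \<times> real"
  define G where "G w = indicator {0<..<T} (fst w) * heat_op (fst w) u\<^sub>0 (snd w)" for w :: "real \<times> real"
  have gm[measurable]: "(\<lambda>w. grid n (fst w)) \<in> borel_measurable ?K" for n
    by measurable
  have FG[measurable]: "F n \<in> borel_measurable ?K" "G \<in> borel_measurable ?K" for n
    unfolding F_def G_def by measurable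
  have m1: "(\<lambda>(t, x). heat_op (grid (Suc n) t + step (Suc n)) u\<^sub>0 x) \<in> borel_measurable (borel \<Otimes>\<^sub>M borel)" for n
    using gm unfolding split_beta' by (intro heat_op_measurable2) auto
  have m2: "(\<lambda>(t, x). heat_op t u\<^sub>0 x) \<in> borel_measurable (borel \<Otimes>\<^sub>M borel)" by measurable
  note Gint = pairs[OF m2, folded G_def]
  have "(\<lambda>n. \<integral>\<^sup>+w. ennreal ((F n w - G w)\<^sup>2) \<partial>?K) \<longlonglongrightarrow> 0"
  proof (rule square_integrals_tendsto_zero[OF FG, where b = "\<lambda>_. \<integral>\<^sup>+w. ennreal ((G w)\<^sup>2) \<partial>?K"])
    fix w :: "real \<times> real"
    show "(\<lambda>n. F n w) \<longlonglongrightarrow> G w"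
    proof (cases "0 < fst w")
      case True
      have "(\<lambda>n. grid (Suc n) (fst w) + step (Suc n)) \<longlonglongrightarrow> fst w + 0"
        using LIMSEQ_Suc[OF grid_tendsto[OF True]] LIMSEQ_Suc[OF step_tendsto] by (rule tendsto_add)
      then show ?thesis unfolding F_def G_def
        using True grid_bounds(2)[of "Suc _", OF zero_less_Suc True] u\<^sub>0(1) by (intro tendsto_mult tendsto_const heat_op_tendsto) auto
    qed (simp add: F_def G_def)
  next
    fix n
    show "(\<integral>\<^sup>+w. ennreal ((F n w)\<^sup>2) \<partial>?K) \<le> (\<integral>\<^sup>+w. ennreal ((G w)\<^sup>2) \<partial>?K)"
      unfolding Gint F_def pairs[OF m1]
    proof (intro nn_integral_mono)
      fix t
      have "(\<integral>\<^sup>+x. ennreal ((heat_op (grid (Suc n) t + step (Suc n)) u\<^sub>0 x)\<^sup>2) \<partial>lborel) \<le> (\<integral>\<^sup>+x. ennreal ((heat_op t u\<^sub>0 x)\<^sup>2) \<partial>lborel)" if t: "0 < t"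
      proof (cases "t = grid (Suc n) t + step (Suc n)")
        case False
        define r where "r = grid (Suc n) t + step (Suc n) - t"
        have r: "0 < r" using grid_bounds(2)[of "Suc n" t] t False by (simp add: r_def)
        have "heat_op (grid (Suc n) t + step (Suc n)) u\<^sub>0 x = heat_op r (heat_op t u\<^sub>0) x" for x
          using heat_op_semigroup[OF r t u\<^sub>0(1), of x] by (simp add: r_def)
        then show ?thesis using heat_op_L2[OF r, of "heat_op t u\<^sub>0"] by simp
      qed simp
      then show "(\<integral>\<^sup>+x. ennreal ((heat_op (grid (Suc n) t + step (Suc n)) u\<^sub>0 x)\<^sup>2) \<partial>lborel) * indicator {0<..<T} t \<le>
        (\<integral>\<^sup>+x. ennreal ((heat_op t u\<^sub>0 x)\<^sup>2) \<partial>lborel) * indicator {0<..<T} t"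
        by (auto simp: indicator_def)
    qed
  next
    have "(\<integral>\<^sup>+w. ennreal ((G w)\<^sup>2) \<partial>?K) \<le> (\<integral>\<^sup>+t\<in>{0<..<T}. (\<integral>\<^sup>+x. ennreal ((u\<^sub>0 x)\<^sup>2) \<partial>lborel) \<partial>lborel)"
      unfolding Gint using heat_op_L2[OF _ u0_measurable] by (intro nn_integral_mono) (auto simp: indicator_def)
    also have "\<dots> < \<infinity>"
      using u0_square emeasure_bounded_finite[of "{0<..<T}"] by (simp add: nn_integral_cmult ennreal_mult_less_top)
    finally show "(\<integral>\<^sup>+w. ennreal ((G w)\<^sup>2) \<partial>?K) < \<infinity>" .
  qed simp
  moreover have "(\<integral>\<^sup>+w. ennreal ((F n w - G w)\<^sup>2) \<partial>?K) = (\<integral>\<^sup>+t\<in>{0<..<T}. heat_defect (Suc n) t \<partial>lborel)" for n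
  proof -
    have "(\<lambda>(t, x). heat_op (grid (Suc n) t + step (Suc n)) u\<^sub>0 x - heat_op t u\<^sub>0 x) \<in> borel_measurable (borel \<Otimes>\<^sub>M borel)"
      using borel_measurable_diff[OF m1[of n] m2] by (simp add: split_beta')
    from pairs[OF this] show ?thesis by (simp add: F_def G_def heat_defect_def right_diff_distrib)
  qed
  ultimately show ?thesis by simp
qed

section \<open>Error recursion and convergence\<close>

text \<open>The integrands differ in their argument, which gives the feedback term, and in the
  kernel, which gives the consistency error; \<open>discrete_field N ug\<close> lies in between. The
  factors 2 come from the triangle inequality for squares.\<close>

lemma discrete_error_le:
  assumes N: "0 < N" and t: "0 < t"
  shows "discrete_error N t \<le> heat_defect N t +
    2 * (\<integral>\<^sup>+s\<in>{0<..<t}. ennreal (p (t - s) 0) * (ennreal (L\<^sup>2) * discrete_error N s) \<partial>lborel) + 2 * discrete_defect N t"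
proof -
  interpret S: sigma_finite_measure spacetime by (rule spacetime_sigma_finite)
  interpret P: pair_sigma_finite M "lborel :: real measure" by (rule pair_sigma_finite_lborel)
  note [measurable (raw)] = scheme_at_measurable[OF N]
  note m = discrete_field_pair_measurable[OF N, of t]
  let ?a = "discrete_field N (scheme_at N) t" and ?b = "discrete_field N ug t" and ?c = "limit_field t"
  have nm: "(\<lambda>x. \<integral>\<^sup>+z. ennreal ((f x z - g x z)\<^sup>2) \<partial>spacetime) \<in> borel_measurable borel"
    if "(\<lambda>w. f (fst w) (snd w)) \<in> borel_measurable (borel \<Otimes>\<^sub>M spacetime)" "(\<lambda>w. g (fst w) (snd w)) \<in> borel_measurable (borel \<Otimes>\<^sub>M spacetime)" for f g
  proof -
    note [measurable] = that
    show ?thesis by (rule S.borel_measurable_nn_integral) (unfold split_beta', measurable)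
  qed
  note [measurable] = nm[OF m(1,2)] nm[OF m(1,3)] nm[OF m(2,3)]
  have sec: "(\<lambda>z. f x z) \<in> borel_measurable spacetime"
    if "(\<lambda>w. f (fst w) (snd w)) \<in> borel_measurable (borel \<Otimes>\<^sub>M spacetime)" for f :: "real \<Rightarrow> 'a \<times> real \<times> real \<Rightarrow> real" and x
    using measurable_compose[OF measurable_Pair1'[of x borel spacetime] that] by simp
  have "discrete_error N t = (\<integral>\<^sup>+x. \<integral>\<^sup>+\<omega>. ennreal ((scheme_at N t x \<omega> - ug t x \<omega>)\<^sup>2) \<partial>M \<partial>lborel)"
    unfolding discrete_error_def by (rule P.Fubini'[symmetric]) measurable
  also have "\<dots> = heat_defect N t + (\<integral>\<^sup>+x. \<integral>\<^sup>+z. ennreal ((?a x z - ?c x z)\<^sup>2) \<partial>spacetime \<partial>lborel)"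
    unfolding scheme_error[OF N t] heat_defect_def by (rule nn_integral_add) measurable
  finally have err: "discrete_error N t = heat_defect N t + (\<integral>\<^sup>+x. \<integral>\<^sup>+z. ennreal ((?a x z - ?c x z)\<^sup>2) \<partial>spacetime \<partial>lborel)" .
  have "(\<integral>\<^sup>+x. \<integral>\<^sup>+z. ennreal ((?a x z - ?c x z)\<^sup>2) \<partial>spacetime \<partial>lborel) \<le>
    (\<integral>\<^sup>+x. 2 * (\<integral>\<^sup>+z. ennreal ((?a x z - ?b x z)\<^sup>2) \<partial>spacetime) + 2 * (\<integral>\<^sup>+z. ennreal ((?b x z - ?c x z)\<^sup>2) \<partial>spacetime) \<partial>lborel)"
  proof (rule nn_integral_mono)
    fix x
    note [measurable] = sec[OF m(1), of x] sec[OF m(2), of x] sec[OF m(3), of x]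
    show "(\<integral>\<^sup>+z. ennreal ((?a x z - ?c x z)\<^sup>2) \<partial>spacetime) \<le>
      2 * (\<integral>\<^sup>+z. ennreal ((?a x z - ?b x z)\<^sup>2) \<partial>spacetime) + 2 * (\<integral>\<^sup>+z. ennreal ((?b x z - ?c x z)\<^sup>2) \<partial>spacetime)"
      using nn_integral_square_add_le2[of "\<lambda>z. ?a x z - ?b x z" spacetime "\<lambda>z. ?b x z - ?c x z"] by simp
  qed
  also have "\<dots> = 2 * (\<integral>\<^sup>+x. \<integral>\<^sup>+z. ennreal ((?a x z - ?b x z)\<^sup>2) \<partial>spacetime \<partial>lborel) + 2 * discrete_defect N t"
    unfolding discrete_defect_def by (simp add: nn_integral_add nn_integral_cmult)
  also have "\<dots> \<le> 2 * (\<integral>\<^sup>+s\<in>{0<..<t}. ennreal (p (t - s) 0) * (ennreal (L\<^sup>2) * discrete_error N s) \<partial>lborel) + 2 * discrete_defect N t"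
    by (intro add_right_mono mult_left_mono discrete_field_diff[OF N t]) auto
  finally show ?thesis unfolding err by (simp add: add.assoc add_left_mono)
qed

text \<open>Only finitely many slots meet (0, T), so the bounds of \<open>scheme_L2\<close>, one for
  each index, suffice. Finiteness permits the feedback term to be absorbed.\<close>

lemma discrete_error_finite:
  assumes N: "0 < N"
  shows "(\<integral>\<^sup>+t\<in>{0<..<T}. discrete_error N t \<partial>lborel) < \<infinity>"
proof -
  note [measurable (raw)] = scheme_at_measurable[OF N] scheme_measurable(1)[OF N]
  interpret P: pair_sigma_finite M "lborel :: real measure" by (rule pair_sigma_finite_lborel)
  define g where "g k = (\<integral>\<^sup>+\<omega>. \<integral>\<^sup>+x. ennreal ((scheme N k x \<omega>)\<^sup>2) \<partial>lborel \<partial>M)" for k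
  have g: "g k < \<infinity>" for k
  proof -
    have "g k = (\<integral>\<^sup>+x. \<integral>\<^sup>+\<omega>. ennreal ((scheme N k x \<omega>)\<^sup>2) \<partial>M \<partial>lborel)"
      unfolding g_def by (rule P.Fubini'[symmetric]) measurable
    then show ?thesis using scheme_L2[OF N, of k] by simp
  qed
  let ?e = "\<lambda>t. \<integral>\<^sup>+\<omega>. \<integral>\<^sup>+x. ennreal ((ug t x \<omega>)\<^sup>2) \<partial>lborel \<partial>M"
  have "discrete_error N t * indicator {0<..<T} t \<le> 2 * (\<Sum>k\<le>slot N T. g k) * indicator {0<..<T} t + 2 * (?e t * indicator {0<..<T} t)" for t
  proof (cases "t \<in> {0<..<T}")
    case True
    have "discrete_error N t \<le> (\<integral>\<^sup>+\<omega>. 2 * (\<integral>\<^sup>+x. ennreal ((scheme_at N t x \<omega>)\<^sup>2) \<partial>lborel) + 2 * (\<integral>\<^sup>+x. ennreal ((ug t x \<omega>)\<^sup>2) \<partial>lborel) \<partial>M)"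
      unfolding discrete_error_def
    proof (rule nn_integral_mono)
      fix \<omega> assume \<omega>: "\<omega> \<in> space M"
      note [measurable] = ug_space_measurable[OF \<omega>] scheme_at_space_measurable[OF N \<omega>]
      show "(\<integral>\<^sup>+x. ennreal ((scheme_at N t x \<omega> - ug t x \<omega>)\<^sup>2) \<partial>lborel) \<le>
        2 * (\<integral>\<^sup>+x. ennreal ((scheme_at N t x \<omega>)\<^sup>2) \<partial>lborel) + 2 * (\<integral>\<^sup>+x. ennreal ((ug t x \<omega>)\<^sup>2) \<partial>lborel)"
        using nn_integral_square_add_le2[of "\<lambda>x. scheme_at N t x \<omega>" lborel "\<lambda>x. - ug t x \<omega>"] by simp
    qed
    also have "\<dots> = 2 * g (slot N t) + 2 * ?e t"
    proof -
      have [measurable]: "(\<lambda>\<omega>. \<integral>\<^sup>+x. ennreal ((scheme_at N t x \<omega>)\<^sup>2) \<partial>lborel) \<in> borel_measurable M"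
        "(\<lambda>\<omega>. \<integral>\<^sup>+x. ennreal ((ug t x \<omega>)\<^sup>2) \<partial>lborel) \<in> borel_measurable M" by measurable
      show ?thesis by (simp add: nn_integral_add nn_integral_cmult g_def scheme_at_def[symmetric])
    qed
    also have "g (slot N t) \<le> (\<Sum>k\<le>slot N T. g k)"
      using True slot_mono[OF N, of t T] by (intro member_le_sum) auto
    finally show ?thesis using True by (simp add: add_right_mono mult_left_mono)
  qed simp
  then have "(\<integral>\<^sup>+t\<in>{0<..<T}. discrete_error N t \<partial>lborel) \<le>
    (\<integral>\<^sup>+t. 2 * (\<Sum>k\<le>slot N T. g k) * indicator {0<..<T} t + 2 * (?e t * indicator {0<..<T} t) \<partial>lborel)"
    by (intro nn_integral_mono)
  also have "\<dots> = 2 * (\<Sum>k\<le>slot N T. g k) * emeasure lborel {0<..<T} + 2 * (\<integral>\<^sup>+t\<in>{0<..<T}. ?e t \<partial>lborel)"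
    by (simp add: nn_integral_add nn_integral_cmult)
  also have "\<dots> < \<infinity>"
    using g ug_energy_finite[of T] emeasure_bounded_finite[of "{0<..<T}"] by (simp add: ennreal_mult_less_top)
  finally show ?thesis .
qed

text \<open>Finiteness of \<open>W\<close> is essential, since an infinite \<open>W\<close>
  satisfies the second premise for every \<open>X\<close>.\<close>

lemma ennreal_absorb_half:
  fixes W X :: ennreal
  assumes "W < \<infinity>" "W \<le> X + ennreal (1 / 2) * W"
  shows "W \<le> 2 * X"
proof (cases "X < \<infinity>")
  case True
  define w x where "w = enn2real W" and "x = enn2real X"
  have W: "W = ennreal w" "0 \<le> w" and X: "X = ennreal x" "0 \<le> x"
    using assms(1) True by (simp_all add: w_def x_def)
  have "ennreal (1 / 2) * ennreal w = ennreal (w / 2)" using W(2) by (subst ennreal_mult[symmetric]) simp_all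
  then have "ennreal w \<le> ennreal (x + w / 2)"
    using assms(2) W(2) X(2) unfolding W(1) X(1) by (simp only:) (simp add: ennreal_plus)
  then have "w \<le> x + w / 2" using W(2) X(2) by (subst (asm) ennreal_le_iff) auto
  then have "w \<le> 2 * x" by simp
  then have "ennreal w \<le> ennreal (2 * x)" by (rule ennreal_leI)
  then show ?thesis using X(2) unfolding W(1) X(1) by (simp add: ennreal_mult)
next
  case False
  then have "X = \<infinity>" by (simp add: less_top[symmetric])
  then show ?thesis by (simp add: ennreal_mult_top)
qed

lemma discrete_error_tendsto:
  "(\<lambda>n. \<integral>\<^sup>+t\<in>{0<..<T}. discrete_error (Suc n) t \<partial>lborel) \<longlonglongrightarrow> 0"
proof -
  \<comment> \<open>The factor 2 comes from the triangle inequality for squares, L^2 from the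
    Lipschitz bound, and sqrt 2 from having p_r(0) instead of p_{2r}(0).\<close>
  obtain c where c: "0 < c" "2 * L\<^sup>2 * sqrt 2 / (2 * sqrt (c * \<theta>)) \<le> 1 / 2"
    using exists_contraction_rate[of "2 * L\<^sup>2 * sqrt 2"] by auto
  let ?H = "\<lambda>n. \<integral>\<^sup>+t\<in>{0<..<T}. heat_defect (Suc n) t \<partial>lborel" and ?D = "\<lambda>n. \<integral>\<^sup>+t\<in>{0<..<T}. discrete_defect (Suc n) t \<partial>lborel"
  have bound: "(\<integral>\<^sup>+t\<in>{0<..<T}. discrete_error (Suc n) t \<partial>lborel) \<le> ennreal (exp (c * T)) * (2 * (?H n + 2 * ?D n))" for n
  proof -
    let ?E = "discrete_error (Suc n)"
    note [measurable] = discrete_error_measurable[OF zero_less_Suc, of n]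
    have hm[measurable]: "heat_defect (Suc n) \<in> borel_measurable borel"
      unfolding heat_defect_def by measurable
    interpret S: sigma_finite_measure spacetime by (rule spacetime_sigma_finite)
    interpret P: pair_sigma_finite "lborel :: real measure" spacetime
      by (intro pair_sigma_finite.intro lborel.sigma_finite_measure_axioms spacetime_sigma_finite)
    have dm[measurable]: "discrete_defect (Suc n) \<in> borel_measurable borel"
    proof -
      have *: "(\<lambda>(t, x, z). ennreal ((discrete_field (Suc n) ug t x z - limit_field t x z)\<^sup>2)) \<in> borel_measurable (lborel \<Otimes>\<^sub>M (lborel \<Otimes>\<^sub>M spacetime))"
        using borel_measurable_diff[OF triple_measurable(1)[OF zero_less_Suc, of n] triple_measurable(2)[OF zero_less_one]]
        by (auto simp: split_beta' intro!: measurable_compose[OF _ measurable_ennreal] borel_measurable_power)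
      have "discrete_defect (Suc n) = (\<lambda>t. \<integral>\<^sup>+w. (case w of (x, z) \<Rightarrow> ennreal ((discrete_field (Suc n) ug t x z - limit_field t x z)\<^sup>2)) \<partial>(lborel \<Otimes>\<^sub>M spacetime))"
      proof
        fix t
        have "(\<lambda>(x, z). ennreal ((discrete_field (Suc n) ug t x z - limit_field t x z)\<^sup>2)) \<in> borel_measurable (lborel \<Otimes>\<^sub>M spacetime)"
          using measurable_compose[OF measurable_Pair1'[of t "lborel :: real measure" "lborel \<Otimes>\<^sub>M spacetime"] *] by (simp add: split_beta')
        from S.nn_integral_fst[OF this]
        show "discrete_defect (Suc n) t = (\<integral>\<^sup>+w. (case w of (x, z) \<Rightarrow> ennreal ((discrete_field (Suc n) ug t x z - limit_field t x z)\<^sup>2)) \<partial>(lborel \<Otimes>\<^sub>M spacetime))"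
          by (simp add: discrete_defect_def split_beta')
      qed
      moreover have "(\<lambda>t. \<integral>\<^sup>+w. (case w of (x, z) \<Rightarrow> ennreal ((discrete_field (Suc n) ug t x z - limit_field t x z)\<^sup>2)) \<partial>(lborel \<Otimes>\<^sub>M spacetime)) \<in> borel_measurable lborel"
        using * by (intro P.borel_measurable_nn_integral) (simp add: split_beta')
      ultimately show ?thesis by simp
    qed
    define W where "W f = (\<integral>\<^sup>+t\<in>{0<..<T}. ennreal (exp (- c * t)) * f t \<partial>lborel)" for f
    have Wle: "W f \<le> (\<integral>\<^sup>+t\<in>{0<..<T}. f t \<partial>lborel)" for f
      unfolding W_def
    proof (rule nn_integral_mono)
      fix t
      have "ennreal (exp (- c * t)) * f t \<le> 1 * f t" if "0 < t"
        using that c by (intro mult_right_mono) (auto simp: ennreal_le_1)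
      then show "ennreal (exp (- c * t)) * f t * indicator {0<..<T} t \<le> f t * indicator {0<..<T} t" by (auto simp: indicator_def)
    qed
    let ?A = "\<lambda>t. \<integral>\<^sup>+s\<in>{0<..<t}. ennreal (p (t - s) 0) * (ennreal (L\<^sup>2) * ?E s) \<partial>lborel"
    have "W ?E \<le> W (\<lambda>t. heat_defect (Suc n) t + 2 * ?A t + 2 * discrete_defect (Suc n) t)"
      unfolding W_def
    proof (rule nn_integral_mono)
      fix t
      show "ennreal (exp (- c * t)) * ?E t * indicator {0<..<T} t \<le>
        ennreal (exp (- c * t)) * (heat_defect (Suc n) t + 2 * ?A t + 2 * discrete_defect (Suc n) t) * indicator {0<..<T} t"
        using discrete_error_le[of "Suc n" t] by (cases "t \<in> {0<..<T}") (simp_all add: mult_left_mono)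
    qed
    also have "\<dots> = W (heat_defect (Suc n)) + 2 * W ?A + 2 * W (discrete_defect (Suc n))"
    proof -
      have "ennreal (exp (- c * t)) * (heat_defect (Suc n) t + 2 * ?A t + 2 * discrete_defect (Suc n) t) * indicator {0<..<T} t =
        ennreal (exp (- c * t)) * heat_defect (Suc n) t * indicator {0<..<T} t + 2 * (ennreal (exp (- c * t)) * ?A t * indicator {0<..<T} t) +
        2 * (ennreal (exp (- c * t)) * discrete_defect (Suc n) t * indicator {0<..<T} t)" for t
        by (simp add: distrib_left distrib_right mult_ac)
      then show ?thesis unfolding W_def by (simp add: nn_integral_add nn_integral_cmult)
    qed
    also have "W ?A \<le> ennreal (sqrt 2 / (2 * sqrt (c * \<theta>))) * W (\<lambda>s. ennreal (L\<^sup>2) * ?E s)"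
      unfolding W_def heat_laplace_kernel0[OF c(1), symmetric] by (rule time_convolution_bound) measurable
    also have "W (\<lambda>s. ennreal (L\<^sup>2) * ?E s) = ennreal (L\<^sup>2) * W ?E"
    proof -
      have "ennreal (exp (- c * t)) * (ennreal (L\<^sup>2) * ?E t) * indicator {0<..<T} t = ennreal (L\<^sup>2) * (ennreal (exp (- c * t)) * ?E t * indicator {0<..<T} t)" for t
        by (simp add: mult_ac)
      then show ?thesis unfolding W_def by (simp add: nn_integral_cmult)
    qed
    finally have "W ?E \<le> W (heat_defect (Suc n)) + 2 * (ennreal (sqrt 2 / (2 * sqrt (c * \<theta>))) * (ennreal (L\<^sup>2) * W ?E)) + 2 * W (discrete_defect (Suc n))"
      by (simp add: add_left_mono add_right_mono mult_left_mono)
    also have "\<dots> = (W (heat_defect (Suc n)) + 2 * W (discrete_defect (Suc n))) + ennreal (2 * (sqrt 2 / (2 * sqrt (c * \<theta>)) * L\<^sup>2)) * W ?E"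
    proof -
      have "2 * (ennreal a * (ennreal b * w)) = ennreal (2 * (a * b)) * w" if "0 \<le> a" "0 \<le> b" for a b w
        using that by (simp add: ennreal_mult mult.assoc)
      from this[of "sqrt 2 / (2 * sqrt (c * \<theta>))" "L\<^sup>2"] have "2 * (ennreal (sqrt 2 / (2 * sqrt (c * \<theta>))) * (ennreal (L\<^sup>2) * W ?E)) = ennreal (2 * (sqrt 2 / (2 * sqrt (c * \<theta>)) * L\<^sup>2)) * W ?E"
        using c \<theta> by simp
      then show ?thesis by (simp only: add_ac)
    qed
    also have "\<dots> \<le> (W (heat_defect (Suc n)) + 2 * W (discrete_defect (Suc n))) + ennreal (1 / 2) * W ?E"
      using c(2) by (intro add_left_mono mult_right_mono ennreal_leI) (auto simp: mult_ac)
    finally have "W ?E \<le> 2 * (W (heat_defect (Suc n)) + 2 * W (discrete_defect (Suc n)))"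
      using Wle[of ?E] discrete_error_finite[of "Suc n" T] by (intro ennreal_absorb_half) auto
    also have "\<dots> \<le> 2 * (?H n + 2 * ?D n)" by (intro mult_left_mono add_mono Wle) auto
    finally have WE: "W ?E \<le> 2 * (?H n + 2 * ?D n)" .
    have "(\<integral>\<^sup>+t\<in>{0<..<T}. ?E t \<partial>lborel) \<le> (\<integral>\<^sup>+t. ennreal (exp (c * T)) * (ennreal (exp (- c * t)) * ?E t * indicator {0<..<T} t) \<partial>lborel)"
    proof (rule nn_integral_mono)
      fix t
      have "1 * ?E t \<le> ennreal (exp (c * T) * exp (- c * t)) * ?E t" if "t < T"
        using that c by (intro mult_right_mono) (auto simp: exp_add[symmetric] ennreal_1[symmetric] simp del: ennreal_1 intro!: ennreal_leI)
      then show "?E t * indicator {0<..<T} t \<le> ennreal (exp (c * T)) * (ennreal (exp (- c * t)) * ?E t * indicator {0<..<T} t)"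
        by (auto simp: indicator_def ennreal_mult mult.assoc)
    qed
    also have "\<dots> = ennreal (exp (c * T)) * W ?E" unfolding W_def by (rule nn_integral_cmult) measurable
    also have "\<dots> \<le> ennreal (exp (c * T)) * (2 * (?H n + 2 * ?D n))" by (intro mult_left_mono WE) simp
    finally show ?thesis .
  qed
  have "(\<lambda>n. ennreal (exp (c * T)) * (2 * (?H n + 2 * ?D n))) \<longlonglongrightarrow> ennreal (exp (c * T)) * (2 * (0 + 2 * 0))"
    by (intro ennreal_tendsto_cmult tendsto_add heat_defect_tendsto discrete_defect_tendsto) auto
  then have lim: "(\<lambda>n. ennreal (exp (c * T)) * (2 * (?H n + 2 * ?D n))) \<longlonglongrightarrow> 0" by simp
  show ?thesis
    by (rule tendsto_sandwich[OF _ _ tendsto_const lim]) (simp_all only: bound zero_le always_eventually simp_thms)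
qed

section \<open>Positivity\<close>

text \<open>Convergence in L^2 controls the L^1 norm only on a bounded set, hence the restriction to
  [-R, R]. The L^1 bound of the scheme is global and, in the limit, independent of R.\<close>

lemma local_abs_integral_le:
  assumes T: "0 < T" and R: "0 < R"
  shows "(\<integral>\<^sup>+t\<in>{0<..<T}. (\<integral>\<^sup>+\<omega>. (\<integral>\<^sup>+x\<in>{-R..R}. ennreal \<bar>ug t x \<omega>\<bar> \<partial>lborel) \<partial>M) \<partial>lborel) \<le> ennreal T * (\<integral>\<^sup>+x. ennreal \<bar>u\<^sub>0 x\<bar> \<partial>lborel)"
    (is "?L \<le> ennreal T * ?u")
proof (rule ennreal_le_epsilon)
  fix d :: real assume d: "0 < d"
  \<comment> \<open>The inequality z \<le> e + z^2 / e costs \<open>e\<close> per unit of area, and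
    [-R, R] times (0, T) has area 2 R T; the total cost is \<open>d\<close>.\<close>
  define e where "e = d / (2 * R * T)"
  have e: "0 < e" using d R T by (simp add: e_def)
  interpret P: pair_sigma_finite M "lborel :: real measure" by (rule pair_sigma_finite_lborel)
  let ?E = "\<lambda>n. \<integral>\<^sup>+t\<in>{0<..<T}. discrete_error (Suc n) t \<partial>lborel"
  let ?q = "\<lambda>n. exp (6 * L ^ 4 * T / real (Suc n))"
  have b: "?L \<le> ennreal T * (ennreal (?q n) * ?u) + ennreal d + ennreal (1 / e) * ?E n" for n
  proof -
    let ?N = "Suc n"
    note [measurable] = discrete_error_measurable[OF zero_less_Suc, of n]
    note [measurable (raw)] = scheme_at_measurable[OF zero_less_Suc[of n]] scheme_measurable(1)[OF zero_less_Suc[of n]]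
    have "(\<integral>\<^sup>+\<omega>. (\<integral>\<^sup>+x\<in>{-R..R}. ennreal \<bar>ug t x \<omega>\<bar> \<partial>lborel) \<partial>M) \<le> ennreal (?q n) * ?u + ennreal (2 * R * e) + ennreal (1 / e) * discrete_error ?N t"
      if t: "t \<in> {0<..<T}" for t
    proof -
      have "(\<integral>\<^sup>+\<omega>. (\<integral>\<^sup>+x\<in>{-R..R}. ennreal \<bar>ug t x \<omega>\<bar> \<partial>lborel) \<partial>M) \<le>
        (\<integral>\<^sup>+\<omega>. (\<integral>\<^sup>+x. ennreal \<bar>scheme_at ?N t x \<omega>\<bar> \<partial>lborel) + ennreal (2 * R * e) + ennreal (1 / e) * (\<integral>\<^sup>+x. ennreal ((scheme_at ?N t x \<omega> - ug t x \<omega>)\<^sup>2) \<partial>lborel) \<partial>M)"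
      proof (rule nn_integral_mono)
        fix \<omega> assume \<omega>: "\<omega> \<in> space M"
        note [measurable] = ug_space_measurable[OF \<omega>] scheme_at_space_measurable[OF zero_less_Suc \<omega>]
        have "(\<integral>\<^sup>+x\<in>{-R..R}. ennreal \<bar>ug t x \<omega>\<bar> \<partial>lborel) \<le>
          (\<integral>\<^sup>+x. ennreal \<bar>scheme_at ?N t x \<omega>\<bar> + ennreal e * indicator {-R..R} x + ennreal (1 / e) * ennreal ((scheme_at ?N t x \<omega> - ug t x \<omega>)\<^sup>2) \<partial>lborel)"
        proof (rule nn_integral_mono)
          fix x
          let ?a = "scheme_at ?N t x \<omega>" and ?b = "ug t x \<omega>"
          have yo: "z \<le> e + 1 / e * z\<^sup>2" if "0 \<le> z" for z
          proof -
            have "e * z \<le> e\<^sup>2 + z\<^sup>2"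
              using zero_le_power2[of "e - z"] mult_nonneg_nonneg[of e z] e that unfolding power2_diff by linarith
            then show ?thesis using e by (simp add: field_simps power2_eq_square)
          qed
          have "\<bar>?b\<bar> \<le> \<bar>?a\<bar> + e + 1 / e * (?a - ?b)\<^sup>2" using yo[of "\<bar>?a - ?b\<bar>"] by simp
          then have "ennreal \<bar>?b\<bar> \<le> ennreal (\<bar>?a\<bar> + e + 1 / e * (?a - ?b)\<^sup>2)" by (rule ennreal_leI)
          also have "\<dots> = ennreal \<bar>?a\<bar> + ennreal e + ennreal (1 / e) * ennreal ((?a - ?b)\<^sup>2)"
            using e by (simp only: ennreal_plus ennreal_mult zero_le_power2 abs_ge_zero add_nonneg_nonneg mult_nonneg_nonneg less_imp_le divide_nonneg_pos zero_le_one)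
          finally show "ennreal \<bar>?b\<bar> * indicator {-R..R} x \<le> ennreal \<bar>?a\<bar> + ennreal e * indicator {-R..R} x + ennreal (1 / e) * ennreal ((?a - ?b)\<^sup>2)"
            by (auto simp: indicator_def)
        qed
        also have "\<dots> = (\<integral>\<^sup>+x. ennreal \<bar>scheme_at ?N t x \<omega>\<bar> \<partial>lborel) + ennreal e * emeasure lborel {-R..R} + ennreal (1 / e) * (\<integral>\<^sup>+x. ennreal ((scheme_at ?N t x \<omega> - ug t x \<omega>)\<^sup>2) \<partial>lborel)"
          by (simp add: nn_integral_add nn_integral_cmult)
        also have "ennreal e * emeasure lborel {-R..R} = ennreal (2 * R * e)"
          using R e by (simp add: ennreal_mult[symmetric] mult_ac)
        finally show "(\<integral>\<^sup>+x\<in>{-R..R}. ennreal \<bar>ug t x \<omega>\<bar> \<partial>lborel) \<le> (\<integral>\<^sup>+x. ennreal \<bar>scheme_at ?N t x \<omega>\<bar> \<partial>lborel) + ennreal (2 * R * e) +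
          ennreal (1 / e) * (\<integral>\<^sup>+x. ennreal ((scheme_at ?N t x \<omega> - ug t x \<omega>)\<^sup>2) \<partial>lborel)" .
      qed
      also have "\<dots> = (\<integral>\<^sup>+\<omega>. \<integral>\<^sup>+x. ennreal \<bar>scheme_at ?N t x \<omega>\<bar> \<partial>lborel \<partial>M) + ennreal (2 * R * e) + ennreal (1 / e) * discrete_error ?N t"
      proof -
        have [measurable]: "(\<lambda>\<omega>. \<integral>\<^sup>+x. ennreal ((scheme_at ?N t x \<omega> - ug t x \<omega>)\<^sup>2) \<partial>lborel) \<in> borel_measurable M"
          "(\<lambda>\<omega>. \<integral>\<^sup>+x. ennreal \<bar>scheme_at ?N t x \<omega>\<bar> \<partial>lborel) \<in> borel_measurable M" by measurable
        show ?thesis by (simp add: nn_integral_add nn_integral_cmult discrete_error_def emeasure_space_1)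
      qed
      also have "(\<integral>\<^sup>+\<omega>. \<integral>\<^sup>+x. ennreal \<bar>scheme_at ?N t x \<omega>\<bar> \<partial>lborel \<partial>M) = (\<integral>\<^sup>+x. \<integral>\<^sup>+\<omega>. ennreal \<bar>scheme_at ?N t x \<omega>\<bar> \<partial>M \<partial>lborel)"
        by (rule P.Fubini'[symmetric]) measurable
      also have "\<dots> \<le> ennreal ((1 + 6 * L ^ 4 / real ?N ^ 4) ^ slot ?N t) * ?u"
        unfolding scheme_at_def by (rule scheme_L1[OF zero_less_Suc])
      also have "\<dots> \<le> ennreal (?q n) * ?u"
      proof (intro mult_right_mono ennreal_leI)
        \<comment> \<open>At most T N^3 steps are made before time T, so the growth factor is at
          most exp (6 L^4 T / N), which tends to 1.\<close>
        let ?a = "6 * L ^ 4 / real ?N ^ 4"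
        have a: "0 \<le> ?a" using L by simp
        have "grid ?N t < T" using grid_bounds(1)[of ?N t] t by simp
        then have k: "real (slot ?N t) \<le> T * real ?N ^ 3" by (simp add: step_def field_simps)
        have "(1 + ?a) ^ slot ?N t \<le> exp ?a ^ slot ?N t" using a exp_ge_add_one_self[of ?a] by (intro power_mono) auto
        also have "\<dots> = exp (real (slot ?N t) * ?a)" by (simp only: exp_of_nat_mult)
        also have "\<dots> \<le> exp (T * real ?N ^ 3 * ?a)" by (simp only: exp_le_cancel_iff) (intro mult_right_mono k a)
        also have "T * real ?N ^ 3 * ?a = 6 * L ^ 4 * T / real ?N" by (simp add: power4_eq_xxxx power3_eq_cube del: of_nat_Suc)
        finally show "(1 + ?a) ^ slot ?N t \<le> ?q n" .
      qed simp
      finally show ?thesis by (simp add: add_right_mono)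
    qed
    then have "?L \<le> (\<integral>\<^sup>+t. (ennreal (?q n) * ?u + ennreal (2 * R * e)) * indicator {0<..<T} t + ennreal (1 / e) * (discrete_error ?N t * indicator {0<..<T} t) \<partial>lborel)"
      by (intro nn_integral_mono) (auto simp: indicator_def)
    also have "\<dots> = (ennreal (?q n) * ?u + ennreal (2 * R * e)) * ennreal T + ennreal (1 / e) * ?E n"
      using T by (simp add: nn_integral_add nn_integral_cmult)
    also have "\<dots> = ennreal T * (ennreal (?q n) * ?u) + ennreal (2 * R * e * T) + ennreal (1 / e) * ?E n"
    proof -
      have "ennreal (2 * R * e) * ennreal T = ennreal (2 * R * e * T)" using R e T by (intro ennreal_mult[symmetric]) auto
      then show ?thesis by (simp only: distrib_right mult.commute[of "ennreal (?q n) * ?u"])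
    qed
    also have "2 * R * e * T = d" using R T by (simp add: e_def)
    finally show ?thesis .
  qed
  have q: "(\<lambda>n. ?q n) \<longlonglongrightarrow> 1"
  proof -
    have "(\<lambda>n. exp (6 * L ^ 4 * T * (1 / real (Suc n)))) \<longlonglongrightarrow> exp (6 * L ^ 4 * T * 0)"
      by (intro tendsto_intros LIMSEQ_Suc[OF lim_1_over_n])
    then show ?thesis by simp
  qed
  have "(\<lambda>n. ennreal T * (ennreal (?q n) * ?u) + ennreal d + ennreal (1 / e) * ?E n) \<longlonglongrightarrow> ennreal T * (ennreal 1 * ?u) + ennreal d + ennreal (1 / e) * 0"
    by (intro tendsto_add ennreal_tendsto_cmult tendsto_mult_ennreal tendsto_ennrealI q tendsto_const discrete_error_tendsto)
       (use u\<^sub>0(1) in \<open>auto simp: integrable_iff_bounded\<close>)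
  then show "?L \<le> ennreal T * ?u + ennreal d"
    using b by (intro LIMSEQ_le_const) auto
qed

text \<open>The local bound does not depend on R; monotone convergence removes the
  restriction.\<close>

lemma abs_integral_le:
  assumes T: "0 < T"
  shows "(\<integral>\<^sup>+t\<in>{0<..<T}. (\<integral>\<^sup>+\<omega>. \<integral>\<^sup>+x. ennreal \<bar>ug t x \<omega>\<bar> \<partial>lborel \<partial>M) \<partial>lborel) \<le> ennreal T * (\<integral>\<^sup>+x. ennreal \<bar>u\<^sub>0 x\<bar> \<partial>lborel)"
proof -
  let ?I = "\<lambda>n. {- real (Suc n)..real (Suc n)}"
  let ?f = "\<lambda>n t \<omega> x. ennreal \<bar>ug t x \<omega>\<bar> * indicator (?I n) x * indicator {0<..<T} t"
  have inc: "?f n t \<omega> x \<le> ?f (Suc n) t \<omega> x" for n t \<omega> x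
    by (intro mult_right_mono mult_left_mono) (auto simp: indicator_def)
  have sup: "(SUP n. ?f n t \<omega> x) = ennreal \<bar>ug t x \<omega>\<bar> * indicator {0<..<T} t" for t \<omega> x
  proof (rule antisym)
    show "(SUP n. ?f n t \<omega> x) \<le> ennreal \<bar>ug t x \<omega>\<bar> * indicator {0<..<T} t"
      by (intro SUP_least) (auto simp: indicator_def)
    obtain n :: nat where n: "\<bar>x\<bar> < real n" using reals_Archimedean2 by blast
    then have "ennreal \<bar>ug t x \<omega>\<bar> * indicator {0<..<T} t = ?f n t \<omega> x" by (auto simp: indicator_def)
    also have "\<dots> \<le> (SUP n. ?f n t \<omega> x)" by (rule SUP_upper) simp
    finally show "ennreal \<bar>ug t x \<omega>\<bar> * indicator {0<..<T} t \<le> (SUP n. ?f n t \<omega> x)" .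
  qed
  have "(\<integral>\<^sup>+t\<in>{0<..<T}. (\<integral>\<^sup>+\<omega>. \<integral>\<^sup>+x. ennreal \<bar>ug t x \<omega>\<bar> \<partial>lborel \<partial>M) \<partial>lborel) = (\<integral>\<^sup>+t. \<integral>\<^sup>+\<omega>. \<integral>\<^sup>+x. (SUP n. ?f n t \<omega> x) \<partial>lborel \<partial>M \<partial>lborel)"
    unfolding sup by (intro nn_integral_cong) (auto simp: indicator_def)
  also have "\<dots> = (\<integral>\<^sup>+t. \<integral>\<^sup>+\<omega>. (SUP n. \<integral>\<^sup>+x. ?f n t \<omega> x \<partial>lborel) \<partial>M \<partial>lborel)"
    using inc by (intro nn_integral_cong nn_integral_monotone_convergence_SUP incseq_SucI le_funI) measurable
  also have "\<dots> = (\<integral>\<^sup>+t. (SUP n. \<integral>\<^sup>+\<omega>. \<integral>\<^sup>+x. ?f n t \<omega> x \<partial>lborel \<partial>M) \<partial>lborel)"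
    using inc by (intro nn_integral_cong nn_integral_monotone_convergence_SUP incseq_SucI le_funI nn_integral_mono) measurable
  also have "\<dots> = (SUP n. \<integral>\<^sup>+t. \<integral>\<^sup>+\<omega>. \<integral>\<^sup>+x. ?f n t \<omega> x \<partial>lborel \<partial>M \<partial>lborel)"
    using inc by (intro nn_integral_monotone_convergence_SUP incseq_SucI le_funI nn_integral_mono) measurable
  also have "\<dots> \<le> ennreal T * (\<integral>\<^sup>+x. ennreal \<bar>u\<^sub>0 x\<bar> \<partial>lborel)"
  proof (rule SUP_least)
    fix n
    have "(\<integral>\<^sup>+t. \<integral>\<^sup>+\<omega>. \<integral>\<^sup>+x. ?f n t \<omega> x \<partial>lborel \<partial>M \<partial>lborel) = (\<integral>\<^sup>+t\<in>{0<..<T}. (\<integral>\<^sup>+\<omega>. (\<integral>\<^sup>+x\<in>?I n. ennreal \<bar>ug t x \<omega>\<bar> \<partial>lborel) \<partial>M) \<partial>lborel)"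
      by (intro nn_integral_cong) (auto simp: indicator_def)
    also have "\<dots> \<le> ennreal T * (\<integral>\<^sup>+x. ennreal \<bar>u\<^sub>0 x\<bar> \<partial>lborel)" by (rule local_abs_integral_le[OF T]) simp
    finally show "(\<integral>\<^sup>+t. \<integral>\<^sup>+\<omega>. \<integral>\<^sup>+x. ?f n t \<omega> x \<partial>lborel \<partial>M \<partial>lborel) \<le> ennreal T * (\<integral>\<^sup>+x. ennreal \<bar>u\<^sub>0 x\<bar> \<partial>lborel)" .
  qed
  finally show ?thesis .
qed

text \<open>The identity |a| = a + 2 max 0 (-a) is integrated, and the mean of the solution is the
  heat flow because the stochastic integral is centred. Truncation by \<open>ennreal\<close> makes
  \<open>ennreal (- a)\<close> the negative part.\<close>

lemma mean_abs:
  assumes t: "0 < t"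
  shows "(\<integral>\<^sup>+\<omega>. ennreal \<bar>ug t x \<omega>\<bar> \<partial>M) = ennreal (heat_op t u\<^sub>0 x) + 2 * (\<integral>\<^sup>+\<omega>. ennreal (- ug t x \<omega>) \<partial>M)"
proof -
  obtain I where I: "\<And>t x. 0 < t \<Longrightarrow> has_walsh_integral M \<xi> (walsh_kernel t x) (I t x)"
    "AE \<omega> in M. \<forall>t>0. \<forall>x. u t x \<omega> = heat_op t u\<^sub>0 x + I t x \<omega>" by (rule mild_representation) blast
  note w = walsh_isometry[OF I(1)[OF t, of x]]
  have AE: "AE \<omega> in M. ug t x \<omega> = heat_op t u\<^sub>0 x + I t x \<omega>"
    using I(2) AE_ug by eventually_elim (use t in \<open>simp add: uc_eq\<close>)
  have [measurable]: "(\<lambda>\<omega>. ug t x \<omega>) \<in> borel_measurable M" "I t x \<in> borel_measurable M" using w(2) by measurable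
  have "integrable M (\<lambda>\<omega>. heat_op t u\<^sub>0 x + I t x \<omega>)" using w(6) by simp
  then have ui: "integrable M (\<lambda>\<omega>. ug t x \<omega>)" using AE by (subst integrable_cong_AE) auto
  have "(\<integral>\<omega>. ug t x \<omega> \<partial>M) = (\<integral>\<omega>. heat_op t u\<^sub>0 x + I t x \<omega> \<partial>M)" using AE by (intro integral_cong_AE) auto
  then have um: "(\<integral>\<omega>. ug t x \<omega> \<partial>M) = heat_op t u\<^sub>0 x" using w(6,7) by (simp add: prob_space)
  have mi: "integrable M (\<lambda>\<omega>. max 0 (- ug t x \<omega>))" using ui by simp
  have "(\<integral>\<^sup>+\<omega>. ennreal \<bar>ug t x \<omega>\<bar> \<partial>M) = ennreal (\<integral>\<omega>. ug t x \<omega> + 2 * max 0 (- ug t x \<omega>) \<partial>M)"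
  proof -
    have "\<bar>ug t x \<omega>\<bar> = ug t x \<omega> + 2 * max 0 (- ug t x \<omega>)" for \<omega> by (auto simp: max_def)
    then show ?thesis using nn_integral_eq_integral[OF integrable_abs[OF ui]] by simp
  qed
  also have "\<dots> = ennreal (heat_op t u\<^sub>0 x + 2 * (\<integral>\<omega>. max 0 (- ug t x \<omega>) \<partial>M))"
    using ui mi um by simp
  also have "\<dots> = ennreal (heat_op t u\<^sub>0 x) + 2 * ennreal (\<integral>\<omega>. max 0 (- ug t x \<omega>) \<partial>M)"
    using heat_op_nn(2)[OF t u\<^sub>0(1,3)] by (simp add: ennreal_plus ennreal_mult)
  also have "ennreal (\<integral>\<omega>. max 0 (- ug t x \<omega>) \<partial>M) = (\<integral>\<^sup>+\<omega>. ennreal (- ug t x \<omega>) \<partial>M)"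
  proof -
    have "ennreal (max 0 (- a)) = ennreal (- a)" for a :: real by (auto simp: max_def ennreal_neg)
    then show ?thesis using nn_integral_eq_integral[OF mi] by (simp only: max.cobounded1 AE_I2)
  qed
  finally show ?thesis .
qed

lemma AE_interval_witness:
  fixes a b :: real
  assumes "AE x in lborel. P x" "a < b"
  shows "\<exists>x\<in>{a<..<b}. P x"
proof (rule ccontr)
  assume "\<not> (\<exists>x\<in>{a<..<b}. P x)"
  then have "AE x in lborel. x \<notin> {a<..<b}" using assms(1) by (auto elim: eventually_mono)
  then have "emeasure lborel {a<..<b} = 0" by (subst (asm) AE_iff_measurable[OF _ refl]) (auto simp: greaterThanLessThan_def greaterThan_def lessThan_def Collect_conj_eq)
  then show False using assms(2) by simp
qed

text \<open>Integrated over (0, T), the mean L^1 norm equals T times the initial mass plus twice the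
  negative part, and by \<open>abs_integral_le\<close> it is at most T times the initial mass. So
  the negative part vanishes almost everywhere, and continuity of the paths removes the exceptional
  points.\<close>

lemma ug_nonneg_upto:
  assumes T: "0 < T"
  shows "AE \<omega> in M. \<forall>t x. 0 < t \<longrightarrow> t < T \<longrightarrow> 0 \<le> ug t x \<omega>"
proof -
  interpret P: pair_sigma_finite M "lborel :: real measure" by (rule pair_sigma_finite_lborel)
  let ?u = "\<integral>\<^sup>+x. ennreal (u\<^sub>0 x) \<partial>lborel"
  have uabs: "(\<integral>\<^sup>+x. ennreal \<bar>u\<^sub>0 x\<bar> \<partial>lborel) = ?u" using u\<^sub>0(3) by (intro nn_integral_cong_AE) auto
  have ufin: "?u < \<infinity>" using u\<^sub>0(1) unfolding uabs[symmetric] by (simp add: integrable_iff_bounded)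
  let ?n = "\<lambda>t. \<integral>\<^sup>+\<omega>. \<integral>\<^sup>+x. ennreal (- ug t x \<omega>) \<partial>lborel \<partial>M"
  have split: "(\<integral>\<^sup>+\<omega>. \<integral>\<^sup>+x. ennreal \<bar>ug t x \<omega>\<bar> \<partial>lborel \<partial>M) = ?u + 2 * ?n t" if t: "0 < t" for t
  proof -
    have "(\<integral>\<^sup>+\<omega>. \<integral>\<^sup>+x. ennreal \<bar>ug t x \<omega>\<bar> \<partial>lborel \<partial>M) = (\<integral>\<^sup>+x. \<integral>\<^sup>+\<omega>. ennreal \<bar>ug t x \<omega>\<bar> \<partial>M \<partial>lborel)"
      by (rule P.Fubini'[symmetric]) measurable
    also have "\<dots> = (\<integral>\<^sup>+x. ennreal (heat_op t u\<^sub>0 x) \<partial>lborel) + 2 * (\<integral>\<^sup>+x. \<integral>\<^sup>+\<omega>. ennreal (- ug t x \<omega>) \<partial>M \<partial>lborel)"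
      unfolding mean_abs[OF t] by (simp add: nn_integral_add nn_integral_cmult)
    also have "(\<integral>\<^sup>+x. \<integral>\<^sup>+\<omega>. ennreal (- ug t x \<omega>) \<partial>M \<partial>lborel) = ?n t"
      by (rule P.Fubini') measurable
    finally show ?thesis using heat_op_nn(3)[OF t u\<^sub>0(1,3)] by simp
  qed
  have "ennreal T * ?u + 2 * (\<integral>\<^sup>+t\<in>{0<..<T}. ?n t \<partial>lborel) = (\<integral>\<^sup>+t. ?u * indicator {0<..<T} t + 2 * (?n t * indicator {0<..<T} t) \<partial>lborel)"
  proof -
    have "(\<integral>\<^sup>+t. ?u * indicator {0<..<T} t \<partial>lborel) = ennreal T * ?u" using T by (subst nn_integral_cmult) (simp_all add: mult.commute)
    then show ?thesis by (subst nn_integral_add) (simp_all add: nn_integral_cmult)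
  qed
  also have "\<dots> = (\<integral>\<^sup>+t\<in>{0<..<T}. (\<integral>\<^sup>+\<omega>. \<integral>\<^sup>+x. ennreal \<bar>ug t x \<omega>\<bar> \<partial>lborel \<partial>M) \<partial>lborel)"
    using split by (intro nn_integral_cong) (auto simp: indicator_def)
  also have "\<dots> \<le> ennreal T * ?u" using abs_integral_le[OF T] by (simp add: uabs)
  finally have "ennreal T * ?u + 2 * (\<integral>\<^sup>+t\<in>{0<..<T}. ?n t \<partial>lborel) \<le> ennreal T * ?u + 0" by simp
  \<comment> \<open>Cancellation in \<open>ennreal\<close> requires the cancelled term to be
    finite.\<close>
  moreover have "ennreal T * ?u \<noteq> \<top>" using ufin by (auto simp: ennreal_mult_eq_top_iff)
  ultimately have "2 * (\<integral>\<^sup>+t\<in>{0<..<T}. ?n t \<partial>lborel) \<le> 0" by (simp only: ennreal_add_left_cancel_le infinity_ennreal_def simp_thms)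
  then have z: "(\<integral>\<^sup>+t\<in>{0<..<T}. ?n t \<partial>lborel) = 0" by simp
  have "(\<integral>\<^sup>+t\<in>{0<..<T}. ?n t \<partial>lborel) = (\<integral>\<^sup>+t. \<integral>\<^sup>+\<omega>. (\<integral>\<^sup>+x. ennreal (- ug t x \<omega>) \<partial>lborel) * indicator {0<..<T} t \<partial>M \<partial>lborel)"
    by (intro nn_integral_cong nn_integral_multc[symmetric]) measurable
  also have "\<dots> = (\<integral>\<^sup>+\<omega>. \<integral>\<^sup>+t. (\<integral>\<^sup>+x. ennreal (- ug t x \<omega>) \<partial>lborel) * indicator {0<..<T} t \<partial>lborel \<partial>M)"
    by (rule P.Fubini') measurable
  finally have "(\<integral>\<^sup>+\<omega>. \<integral>\<^sup>+t. (\<integral>\<^sup>+x. ennreal (- ug t x \<omega>) \<partial>lborel) * indicator {0<..<T} t \<partial>lborel \<partial>M) = 0" using z by simp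
  then have "AE \<omega> in M. (\<integral>\<^sup>+t. (\<integral>\<^sup>+x. ennreal (- ug t x \<omega>) \<partial>lborel) * indicator {0<..<T} t \<partial>lborel) = 0"
    by (subst (asm) nn_integral_0_iff_AE) measurable
  then show ?thesis using AE_space[of M]
  proof eventually_elim
    case (elim \<omega>)
    note \<omega> = elim(2)
    have um[measurable]: "(\<lambda>z. ug (fst z) (snd z) \<omega>) \<in> borel_measurable (borel \<Otimes>\<^sub>M borel)"
      by (rule ug_measurable) (use \<omega> in auto)
    have m2: "(\<lambda>x. ug t x \<omega>) \<in> borel_measurable borel" for t by (rule ug_space_measurable[OF \<omega>])
    have AEt: "AE t in lborel. (\<integral>\<^sup>+x. ennreal (- ug t x \<omega>) \<partial>lborel) * indicator {0<..<T} t = 0"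
      using elim(1) by (subst (asm) nn_integral_0_iff_AE) measurable
    show ?case
    proof (intro allI impI, rule ccontr)
      fix t x assume t: "0 < t" "t < T" and neg: "\<not> 0 \<le> ug t x \<omega>"
      then have nb: "\<omega> \<notin> bad" by (auto simp: ug_def)
      have cont: "continuous_on ({0<..} \<times> UNIV) (\<lambda>z. ug (fst z) (snd z) \<omega>)"
      proof -
        have "continuous_on ({0<..} \<times> UNIV) (\<lambda>z. u (fst z) (snd z) \<omega>)" using bad(2)[OF \<omega> nb] by (simp add: split_beta')
        then show ?thesis by (rule continuous_on_cong[THEN iffD1, rotated -1]) (use nb in \<open>auto simp: ug_def uc_eq\<close>)
      qed
      \<comment> \<open>A negative value would persist on an open rectangle around (t, x), which
        contains a time, and then a point, from the sets of full measure where the negative part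
        vanishes.\<close>
      have "open ({0<..} \<times> (UNIV :: real set) \<inter> (\<lambda>z. ug (fst z) (snd z) \<omega>) -` {..<0})"
        by (rule continuous_on_open_vimage[THEN iffD1, rule_format, OF _ cont, simplified Int_commute]) (auto intro: open_Times)
      moreover have "(t, x) \<in> {0<..} \<times> UNIV \<inter> (\<lambda>z. ug (fst z) (snd z) \<omega>) -` {..<0}" using t neg by auto
      ultimately obtain A B where AB: "open A" "open B" "t \<in> A" "x \<in> B" and sub: "A \<times> B \<subseteq> {0<..} \<times> UNIV \<inter> (\<lambda>z. ug (fst z) (snd z) \<omega>) -` {..<0}"
        by (rule open_prod_elim) auto
      obtain d where d: "0 < d" "ball t d \<subseteq> A" using AB(1,3) openE by blast
      obtain d' where d': "0 < d'" "ball x d' \<subseteq> B" using AB(2,4) openE by blast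
      have "\<exists>t'\<in>{t<..<min T (t + d)}. (\<integral>\<^sup>+x. ennreal (- ug t' x \<omega>) \<partial>lborel) * indicator {0<..<T} t' = 0"
        by (rule AE_interval_witness[OF AEt]) (use t d in auto)
      then obtain t' where t': "t < t'" "t' < T" "t' < t + d" "(\<integral>\<^sup>+x. ennreal (- ug t' x \<omega>) \<partial>lborel) = 0"
        using t by auto
      note [measurable] = m2[of t']
      have "AE x in lborel. ennreal (- ug t' x \<omega>) = 0" using t'(4) by (subst (asm) nn_integral_0_iff_AE) auto
      then obtain x' where x': "x' \<in> {x<..<x + d'}" "ennreal (- ug t' x' \<omega>) = 0"
        using AE_interval_witness[of "\<lambda>x. ennreal (- ug t' x \<omega>) = 0" x "x + d'"] d' by auto
      have "t' \<in> A" using d t' by (auto simp: dist_real_def subset_iff)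
      moreover have "x' \<in> B" using d' x' by (auto simp: dist_real_def subset_iff)
      ultimately have "(t', x') \<in> A \<times> B" by blast
      then have "ug t' x' \<omega> < 0" using sub by auto
      then show False using x'(2) by (simp add: ennreal_eq_0_iff)
    qed
  qed
qed

lemma solution_nonneg: "AE \<omega> in M. \<forall>t>0. \<forall>x. 0 \<le> u t x \<omega>"
proof -
  have "AE \<omega> in M. \<forall>n::nat. \<forall>t x. 0 < t \<longrightarrow> t < real (Suc n) \<longrightarrow> 0 \<le> ug t x \<omega>"
    by (intro AE_all_countable[THEN iffD2] allI ug_nonneg_upto) simp
  with AE_ug show ?thesis
  proof eventually_elim
    case (elim \<omega>)
    show ?case
    proof (intro allI impI)
      fix t x :: real assume t: "0 < t"
      obtain n :: nat where "t < real n" using reals_Archimedean2 by blast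
      then have "t < real (Suc n)" by simp
      then have "0 \<le> ug t x \<omega>" using elim(2) t by blast
      then show "0 \<le> u t x \<omega>" using elim(1) t by (simp add: uc_eq)
    qed
  qed
qed

section \<open>The total mass of the solution\<close>

lemma uc_space_measurable: "\<omega> \<in> space M \<Longrightarrow> (\<lambda>x. uc t x \<omega>) \<in> borel_measurable borel"
  by (rule uc_measurable) auto

lemma uc_nonneg: "0 < t \<Longrightarrow> AE \<omega> in M. \<forall>x. 0 \<le> uc t x \<omega>"
  using solution_nonneg by eventually_elim (simp add: uc_eq)

lemma mean_mass:
  assumes t: "0 < t"
  shows "(\<integral>\<^sup>+\<omega>. \<integral>\<^sup>+x. ennreal (uc t x \<omega>) \<partial>lborel \<partial>M) = (\<integral>\<^sup>+x. ennreal (u\<^sub>0 x) \<partial>lborel)"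
proof -
  interpret P: pair_sigma_finite M "lborel :: real measure" by (rule pair_sigma_finite_lborel)
  have "(\<integral>\<^sup>+\<omega>. ennreal (uc t x \<omega>) \<partial>M) = ennreal (heat_op t u\<^sub>0 x)" for x
  proof -
    have "(\<integral>\<^sup>+\<omega>. ennreal (uc t x \<omega>) \<partial>M) = (\<integral>\<^sup>+\<omega>. ennreal \<bar>ug t x \<omega>\<bar> \<partial>M)"
      using uc_nonneg[OF t] AE_ug by (intro nn_integral_cong_AE, eventually_elim) (simp)
    moreover have "(\<integral>\<^sup>+\<omega>. ennreal (- ug t x \<omega>) \<partial>M) = (\<integral>\<^sup>+\<omega>. 0 \<partial>M)"
      using uc_nonneg[OF t] AE_ug by (intro nn_integral_cong_AE, eventually_elim) (simp add: ennreal_neg)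
    ultimately show ?thesis using mean_abs[OF t, of x] by simp
  qed
  then have "(\<integral>\<^sup>+x. \<integral>\<^sup>+\<omega>. ennreal (uc t x \<omega>) \<partial>M \<partial>lborel) = (\<integral>\<^sup>+x. ennreal (u\<^sub>0 x) \<partial>lborel)"
    using heat_op_nn(3)[OF t u\<^sub>0(1,3)] by simp
  moreover have "(\<integral>\<^sup>+x. \<integral>\<^sup>+\<omega>. ennreal (uc t x \<omega>) \<partial>M \<partial>lborel) = (\<integral>\<^sup>+\<omega>. \<integral>\<^sup>+x. ennreal (uc t x \<omega>) \<partial>lborel \<partial>M)"
    by (rule P.Fubini') measurable
  ultimately show ?thesis by simp
qed

lemma initial_mass: "(\<integral>\<^sup>+x. ennreal (u\<^sub>0 x) \<partial>lborel) = ennreal (\<integral>x. u\<^sub>0 x \<partial>lborel)" "0 \<le> (\<integral>x. u\<^sub>0 x \<partial>lborel)"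
  using u\<^sub>0 by (auto simp: nn_integral_eq_integral integral_nonneg_AE)

text \<open>The Bochner integral behind \<open>L1_norm\<close> is 0 for a path that is not
  integrable. The extended mass has finite mean, so almost every path is integrable, and there
  \<open>L1_norm\<close> agrees with the extended mass used in the computations.\<close>

lemma solution_mass:
  assumes t: "0 < t"
  shows "AE \<omega> in M. integrable lborel (\<lambda>x. u t x \<omega>) \<and> ennreal (L1_norm (\<lambda>x. u t x \<omega>)) = (\<integral>\<^sup>+x. ennreal (uc t x \<omega>) \<partial>lborel)"
    "integrable M (\<lambda>\<omega>. L1_norm (\<lambda>x. u t x \<omega>))" "(\<integral>\<omega>. L1_norm (\<lambda>x. u t x \<omega>) \<partial>M) = (\<integral>x. u\<^sub>0 x \<partial>lborel)"
proof -
  have m[measurable]: "(\<lambda>\<omega>. \<integral>\<^sup>+x. ennreal (uc t x \<omega>) \<partial>lborel) \<in> borel_measurable M" by measurable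
  have "(\<lambda>\<omega>. L1_norm (\<lambda>x. uc t x \<omega>)) \<in> borel_measurable M" unfolding L1_norm_def by measurable
  then have [measurable]: "(\<lambda>\<omega>. L1_norm (\<lambda>x. u t x \<omega>)) \<in> borel_measurable M" using t by (simp add: uc_eq)
  have "AE \<omega> in M. (\<integral>\<^sup>+x. ennreal (uc t x \<omega>) \<partial>lborel) \<noteq> \<infinity>"
    by (rule nn_integral_PInf_AE[OF m]) (simp add: mean_mass[OF t] initial_mass)
  then show *: "AE \<omega> in M. integrable lborel (\<lambda>x. u t x \<omega>) \<and> ennreal (L1_norm (\<lambda>x. u t x \<omega>)) = (\<integral>\<^sup>+x. ennreal (uc t x \<omega>) \<partial>lborel)"
    using uc_nonneg[OF t] AE_space
  proof eventually_elim
    case (elim \<omega>)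
    note [measurable] = uc_space_measurable[OF elim(3), of t]
    have eq: "u t x \<omega> = uc t x \<omega>" for x using t by (simp add: uc_eq)
    have "integrable lborel (\<lambda>x. uc t x \<omega>)"
      using elim by (intro integrableI_bounded) (auto simp: less_top)
    then show ?case using elim(2) by (simp add: L1_norm_def eq nn_integral_eq_integral)
  qed
  have nn: "0 \<le> L1_norm (\<lambda>x. u t x \<omega>)" for \<omega> by (simp add: L1_norm_def)
  have e: "(\<integral>\<^sup>+\<omega>. ennreal (L1_norm (\<lambda>x. u t x \<omega>)) \<partial>M) = ennreal (\<integral>x. u\<^sub>0 x \<partial>lborel)"
    unfolding initial_mass(1)[symmetric] mean_mass[OF t, symmetric] using * by (intro nn_integral_cong_AE) auto
  then show i: "integrable M (\<lambda>\<omega>. L1_norm (\<lambda>x. u t x \<omega>))"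
    using nn by (intro integrableI_bounded) auto
  show "(\<integral>\<omega>. L1_norm (\<lambda>x. u t x \<omega>) \<partial>M) = (\<integral>x. u\<^sub>0 x \<partial>lborel)"
    using nn e initial_mass(2) by (subst (asm) nn_integral_eq_integral[OF i]) (auto simp: integral_nonneg)
qed

lemma initial_L1_norm:
  assumes \<omega>: "\<omega> \<in> space M"
  shows "integrable lborel (\<lambda>x. u 0 x \<omega>)" "L1_norm (\<lambda>x. u 0 x \<omega>) = L1_norm u\<^sub>0"
proof -
  have m[measurable]: "(\<lambda>x. u 0 x \<omega>) \<in> borel_measurable borel"
    using uc_space_measurable[OF \<omega>, of 0] by (simp add: uc_eq)
  have AE: "AE x in lborel. u 0 x \<omega> = u\<^sub>0 x"
    using mild \<omega> unfolding mild_solution_def by (auto elim: eventually_mono)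
  show "integrable lborel (\<lambda>x. u 0 x \<omega>)" using AE u\<^sub>0(1) by (subst integrable_cong_AE[of _ _ u\<^sub>0]) auto
  show "L1_norm (\<lambda>x. u 0 x \<omega>) = L1_norm u\<^sub>0" unfolding L1_norm_def using AE by (intro integral_cong_AE) auto
qed

end

section \<open>Mutual energy as a Laplace transform of heat flows\<close>

context heat
begin

lemma heat_op_mult:
  assumes t: "0 < t" and f: "integrable lborel f" "AE x in lborel. 0 \<le> f x" and g: "integrable lborel g" "AE x in lborel. 0 \<le> g x"
  shows "(\<integral>\<^sup>+x. ennreal (heat_op t f x) * ennreal (heat_op t g x) \<partial>lborel) =
    (\<integral>\<^sup>+a. \<integral>\<^sup>+b. ennreal (p (2 * t) (a - b)) * (ennreal (f a) * ennreal (g b)) \<partial>lborel \<partial>lborel)"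
proof -
  note [measurable] = borel_measurable_integrable[OF f(1), simplified] borel_measurable_integrable[OF g(1), simplified]
  have pt: "0 \<le> p t a" for a using t by (simp add: heat_nonneg)
  let ?F = "\<lambda>x a b. ennreal (p t (x - a)) * ennreal (p t (x - b)) * (ennreal (f a) * ennreal (g b))"
  have "ennreal (heat_op t f x) * ennreal (heat_op t g x) = (\<integral>\<^sup>+a. \<integral>\<^sup>+b. ?F x a b \<partial>lborel \<partial>lborel)" for x
  proof -
    have "ennreal (heat_op t f x) * ennreal (heat_op t g x) =
      (\<integral>\<^sup>+a. ennreal (p t (x - a)) * ennreal (f a) \<partial>lborel) * (\<integral>\<^sup>+b. ennreal (p t (x - b)) * ennreal (g b) \<partial>lborel)"
      unfolding heat_op_nn(1)[OF t f] heat_op_nn(1)[OF t g] by (simp add: ennreal_mult' pt)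
    also have "\<dots> = (\<integral>\<^sup>+a. ennreal (p t (x - a)) * ennreal (f a) * (\<integral>\<^sup>+b. ennreal (p t (x - b)) * ennreal (g b) \<partial>lborel) \<partial>lborel)"
      by (rule nn_integral_multc[symmetric]) measurable
    also have "\<dots> = (\<integral>\<^sup>+a. \<integral>\<^sup>+b. ?F x a b \<partial>lborel \<partial>lborel)"
      by (simp add: nn_integral_cmult[symmetric] mult_ac)
    finally show ?thesis .
  qed
  then have "(\<integral>\<^sup>+x. ennreal (heat_op t f x) * ennreal (heat_op t g x) \<partial>lborel) = (\<integral>\<^sup>+x. \<integral>\<^sup>+a. \<integral>\<^sup>+b. ?F x a b \<partial>lborel \<partial>lborel \<partial>lborel)"
    by simp
  also have "\<dots> = (\<integral>\<^sup>+a. \<integral>\<^sup>+x. \<integral>\<^sup>+b. ?F x a b \<partial>lborel \<partial>lborel \<partial>lborel)"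
    by (rule lborel_pair.Fubini') measurable
  also have "\<dots> = (\<integral>\<^sup>+a. \<integral>\<^sup>+b. \<integral>\<^sup>+x. ?F x a b \<partial>lborel \<partial>lborel \<partial>lborel)"
    by (intro nn_integral_cong lborel_pair.Fubini') measurable
  also have "\<dots> = (\<integral>\<^sup>+a. \<integral>\<^sup>+b. ennreal (p (2 * t) (a - b)) * (ennreal (f a) * ennreal (g b)) \<partial>lborel \<partial>lborel)"
  proof (intro nn_integral_cong)
    fix a b
    have "(\<integral>\<^sup>+x. ennreal (p t (x - a)) * ennreal (p t (x - b)) \<partial>lborel) = (\<integral>\<^sup>+x. ennreal (p t (a - x) * p t (x - b)) \<partial>lborel)"
      by (simp add: ennreal_mult pt heat_commute[of t _ a])
    then show "(\<integral>\<^sup>+x. ?F x a b \<partial>lborel) = ennreal (p (2 * t) (a - b)) * (ennreal (f a) * ennreal (g b))"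
      using heat_semigroup[OF t t, of a b] by (simp add: nn_integral_multc)
  qed
  finally show ?thesis .
qed

text \<open>Two heat flows at time t overlap through p_{2t}, whose Laplace transform is
  \<open>r_kernel\<close>. So the inhomogeneous term of the renewal equation for the cross moment
  has the mutual energy as its Laplace transform.\<close>

lemma heat_op_energy:
  assumes \<beta>: "0 < \<beta>" and f: "integrable lborel f" "AE x in lborel. 0 \<le> f x" and g: "integrable lborel g" "AE x in lborel. 0 \<le> g x"
  shows "(\<integral>\<^sup>+t\<in>{0<..}. ennreal (exp (- \<beta> * t)) * (\<integral>\<^sup>+x. ennreal (heat_op t f x) * ennreal (heat_op t g x) \<partial>lborel) \<partial>lborel) =
    (\<integral>\<^sup>+a. \<integral>\<^sup>+b. ennreal (r_kernel \<theta> \<beta> (a - b)) * (ennreal (f a) * ennreal (g b)) \<partial>lborel \<partial>lborel)"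
proof -
  note [measurable] = borel_measurable_integrable[OF f(1), simplified] borel_measurable_integrable[OF g(1), simplified]
  let ?F = "\<lambda>t a b. ennreal (exp (- \<beta> * t) * p (2 * t) (a - b)) * indicator {0<..} t * (ennreal (f a) * ennreal (g b))"
  have "(\<integral>\<^sup>+t\<in>{0<..}. ennreal (exp (- \<beta> * t)) * (\<integral>\<^sup>+x. ennreal (heat_op t f x) * ennreal (heat_op t g x) \<partial>lborel) \<partial>lborel) =
    (\<integral>\<^sup>+t. \<integral>\<^sup>+a. \<integral>\<^sup>+b. ?F t a b \<partial>lborel \<partial>lborel \<partial>lborel)"
  proof (rule nn_integral_cong)
    fix t
    show "ennreal (exp (- \<beta> * t)) * (\<integral>\<^sup>+x. ennreal (heat_op t f x) * ennreal (heat_op t g x) \<partial>lborel) * indicator {0<..} t =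
      (\<integral>\<^sup>+a. \<integral>\<^sup>+b. ?F t a b \<partial>lborel \<partial>lborel)"
    proof (cases "0 < t")
      case True
      then show ?thesis
        by (simp add: heat_op_mult[OF True f g] nn_integral_cmult[symmetric] ennreal_mult heat_nonneg mult_ac)
    qed simp
  qed
  also have "\<dots> = (\<integral>\<^sup>+a. \<integral>\<^sup>+t. \<integral>\<^sup>+b. ?F t a b \<partial>lborel \<partial>lborel \<partial>lborel)"
    by (rule lborel_pair.Fubini') measurable
  also have "\<dots> = (\<integral>\<^sup>+a. \<integral>\<^sup>+b. \<integral>\<^sup>+t. ?F t a b \<partial>lborel \<partial>lborel \<partial>lborel)"
    by (intro nn_integral_cong lborel_pair.Fubini') measurable
  also have "\<dots> = (\<integral>\<^sup>+a. \<integral>\<^sup>+b. ennreal (r_kernel \<theta> \<beta> (a - b)) * (ennreal (f a) * ennreal (g b)) \<partial>lborel \<partial>lborel)"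
    by (simp add: nn_integral_multc heat_laplace[OF \<beta>, simplified])
  finally show ?thesis .
qed

text \<open>The kernel is bounded and both functions are integrable, so the energy is a finite
  integral and not a default value.\<close>

lemma mutual_energy_nn:
  assumes \<beta>: "0 < \<beta>" and f: "integrable lborel f" "AE x in lborel. 0 \<le> f x" and g: "integrable lborel g" "AE x in lborel. 0 \<le> g x"
  shows "(\<integral>\<^sup>+a. \<integral>\<^sup>+b. ennreal (r_kernel \<theta> \<beta> (a - b)) * (ennreal (f a) * ennreal (g b)) \<partial>lborel \<partial>lborel) = ennreal (mutual_energy \<theta> \<beta> f g)"
    "0 \<le> mutual_energy \<theta> \<beta> f g"
proof -
  note [measurable] = borel_measurable_integrable[OF f(1), simplified] borel_measurable_integrable[OF g(1), simplified]
  have [measurable]: "r_kernel \<theta> \<beta> \<in> borel_measurable borel" unfolding r_kernel_def by measurable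
  define C where "C = 1 / (2 * sqrt (\<beta> * \<theta>))"
  have C: "0 \<le> C" using \<beta> \<theta> by (simp add: C_def)
  have r: "0 \<le> r_kernel \<theta> \<beta> x" "r_kernel \<theta> \<beta> x \<le> C" for x
    using \<beta> \<theta> by (auto simp: r_kernel_def C_def intro!: divide_right_mono)
  have ir: "integrable lborel (\<lambda>y. r_kernel \<theta> \<beta> (x - y) * g y)" for x
  proof (rule Bochner_Integration.integrable_bound[OF integrable_mult_right[OF g(1), of C]])
    show "AE y in lborel. norm (r_kernel \<theta> \<beta> (x - y) * g y) \<le> norm (C * g y)"
      using r C by (auto simp: abs_mult intro!: mult_right_mono)
  qed measurable
  have rn: "AE y in lborel. 0 \<le> r_kernel \<theta> \<beta> (x - y) * g y" for x
    using g(2) by eventually_elim (simp add: r)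
  let ?R = "R_op \<theta> \<beta> g"
  have Rnn: "0 \<le> ?R x" for x unfolding R_op_def convol_def by (rule integral_nonneg_AE[OF rn])
  have R: "ennreal (?R x) = (\<integral>\<^sup>+y. ennreal (r_kernel \<theta> \<beta> (x - y)) * ennreal (g y) \<partial>lborel)" for x
    unfolding R_op_def convol_def nn_integral_eq_integral[OF ir rn, symmetric] by (simp add: ennreal_mult' r)
  have Rle: "?R x \<le> C * (\<integral>y. g y \<partial>lborel)" for x
  proof -
    have "?R x \<le> (\<integral>y. C * g y \<partial>lborel)" unfolding R_op_def convol_def
      by (intro integral_mono_AE ir integrable_mult_right g(1)) (use g(2) in eventually_elim, auto intro!: mult_right_mono r)
    then show ?thesis by simp
  qed
  have [measurable]: "?R \<in> borel_measurable borel" unfolding R_op_def convol_def by measurable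
  have i: "integrable lborel (\<lambda>x. f x * ?R x)"
  proof (rule Bochner_Integration.integrable_bound[OF integrable_mult_left[OF f(1), of "C * (\<integral>y. g y \<partial>lborel)"]])
    have "\<bar>?R x\<bar> \<le> \<bar>C * (\<integral>y. g y \<partial>lborel)\<bar>" for x using Rle[of x] Rnn[of x] by simp
    then show "AE x in lborel. norm (f x * ?R x) \<le> norm (f x * (C * (\<integral>y. g y \<partial>lborel)))"
      by (auto simp: abs_mult[of "f _"] intro!: mult_left_mono)
  qed measurable
  have nn: "AE x in lborel. 0 \<le> f x * ?R x" using f(2) by eventually_elim (simp add: Rnn)
  show "0 \<le> mutual_energy \<theta> \<beta> f g" unfolding mutual_energy_def by (rule integral_nonneg_AE[OF nn])
  have "ennreal (mutual_energy \<theta> \<beta> f g) = (\<integral>\<^sup>+x. ennreal (f x) * ennreal (?R x) \<partial>lborel)"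
    unfolding mutual_energy_def nn_integral_eq_integral[OF i nn, symmetric] by (simp add: ennreal_mult'' Rnn)
  then show "(\<integral>\<^sup>+a. \<integral>\<^sup>+b. ennreal (r_kernel \<theta> \<beta> (a - b)) * (ennreal (f a) * ennreal (g b)) \<partial>lborel \<partial>lborel) = ennreal (mutual_energy \<theta> \<beta> f g)"
    by (simp add: R nn_integral_cmult[symmetric] mult_ac)
qed

end

section \<open>Two solutions driven by the same noise\<close>

locale solution_pair = noise M \<xi> + heat \<theta> + U: solution M \<xi> \<theta> \<sigma> u\<^sub>0 u L + V: solution M \<xi> \<theta> \<tau> v\<^sub>0 v K
  for M :: "'a measure" and \<xi> :: "(real \<times> real \<Rightarrow> real) \<Rightarrow> 'a \<Rightarrow> real" and \<theta> :: real
    and \<sigma> u\<^sub>0 :: "real \<Rightarrow> real" and u :: "real \<Rightarrow> real \<Rightarrow> 'a \<Rightarrow> real" and L :: real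
    and \<tau> v\<^sub>0 :: "real \<Rightarrow> real" and v :: "real \<Rightarrow> real \<Rightarrow> 'a \<Rightarrow> real" and K :: real +
  assumes \<sigma>: "\<And>a. 0 \<le> \<sigma> a" and \<tau>: "\<And>a. 0 \<le> \<tau> a"
begin

definition cross_source :: "real \<Rightarrow> real \<Rightarrow> ennreal" where
  "cross_source s y = (\<integral>\<^sup>+\<omega>. ennreal (\<sigma> (U.uc s y \<omega>) * \<tau> (V.uc s y \<omega>)) \<partial>M)"

text \<open>This is the unknown \<open>H\<close> of the renewal inequality.\<close>

definition cross_moment :: "real \<Rightarrow> ennreal" where
  "cross_moment t = (\<integral>\<^sup>+x. \<integral>\<^sup>+\<omega>. ennreal (U.uc t x \<omega>) * ennreal (V.uc t x \<omega>) \<partial>M \<partial>lborel)"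

lemma cross_source_measurable[measurable]: "(\<lambda>(s, y). cross_source s y) \<in> borel_measurable (borel \<Otimes>\<^sub>M borel)"
  unfolding cross_source_def by measurable

lemma cross_source_measurable2[measurable (raw)]:
  "f \<in> borel_measurable N \<Longrightarrow> g \<in> borel_measurable N \<Longrightarrow> (\<lambda>x. cross_source (f x) (g x)) \<in> borel_measurable N"
  using measurable_compose[OF measurable_Pair cross_source_measurable, of f N g] by simp

lemma cross_moment_measurable[measurable]: "cross_moment \<in> borel_measurable borel"
  unfolding cross_moment_def by measurable

text \<open>The mixed term of the two centred stochastic integrals is given by
  \<open>walsh_covariance\<close>. Nonnegativity of the solutions and of the coefficients allows the
  identity to be stated with extended integrals, ready for Tonelli.\<close>

lemma product_moment:
  assumes t: "0 < t"
  shows "(\<integral>\<^sup>+\<omega>. ennreal (U.uc t x \<omega>) * ennreal (V.uc t x' \<omega>) \<partial>M) = ennreal (heat_op t u\<^sub>0 x) * ennreal (heat_op t v\<^sub>0 x') +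
    (\<integral>\<^sup>+s\<in>{0<..<t}. (\<integral>\<^sup>+y. ennreal (p (t - s) (x - y) * p (t - s) (x' - y)) * cross_source s y \<partial>lborel) \<partial>lborel)"
    (is "?L = ?R + ?S")
proof -
  obtain I where I: "\<And>t x. 0 < t \<Longrightarrow> has_walsh_integral M \<xi> (U.walsh_kernel t x) (I t x)"
    "AE \<omega> in M. \<forall>t>0. \<forall>x. u t x \<omega> = heat_op t u\<^sub>0 x + I t x \<omega>" by (rule U.mild_representation) blast
  obtain J where J: "\<And>t x. 0 < t \<Longrightarrow> has_walsh_integral M \<xi> (V.walsh_kernel t x) (J t x)"
    "AE \<omega> in M. \<forall>t>0. \<forall>x. v t x \<omega> = heat_op t v\<^sub>0 x + J t x \<omega>" by (rule V.mild_representation) blast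
  note wI = walsh_isometry[OF I(1)[OF t, of x]] and wJ = walsh_isometry[OF J(1)[OF t, of x']]
    and c = walsh_covariance[OF I(1)[OF t, of x] J(1)[OF t, of x']]
  let ?a = "heat_op t u\<^sub>0 x" and ?b = "heat_op t v\<^sub>0 x'"
  have ab: "0 \<le> ?a" "0 \<le> ?b" using heat_op_nn(2)[OF t U.u\<^sub>0(1,3)] heat_op_nn(2)[OF t V.u\<^sub>0(1,3)] by auto
  let ?f = "\<lambda>z. field (U.walsh_kernel t x) z * field (V.walsh_kernel t x') z"
  have AE: "AE \<omega> in M. U.uc t x \<omega> = ?a + I t x \<omega> \<and> V.uc t x' \<omega> = ?b + J t x' \<omega> \<and> 0 \<le> ?a + I t x \<omega> \<and> 0 \<le> ?b + J t x' \<omega>"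
    using I(2) J(2) U.solution_nonneg V.solution_nonneg
  proof eventually_elim
    case (elim \<omega>)
    have "u t x \<omega> = ?a + I t x \<omega>" "v t x' \<omega> = ?b + J t x' \<omega>" "0 \<le> u t x \<omega>" "0 \<le> v t x' \<omega>" using elim t by blast+
    then show ?case using t by (simp add: U.uc_eq V.uc_eq)
  qed
  have f: "?f z = (case z of (\<omega>, s, y) \<Rightarrow> indicator {0<..<t} s * (p (t - s) (x - y) * p (t - s) (x' - y)) * (\<sigma> (U.uc s y \<omega>) * \<tau> (V.uc s y \<omega>)))" for z
    by (auto simp: U.field_walsh_kernel V.field_walsh_kernel indicator_def split: prod.split)
  have fnn: "0 \<le> ?f z" for z
    unfolding f by (auto simp: indicator_def heat_nonneg \<sigma> \<tau> split: prod.split)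
  have exp: "(?a + I t x \<omega>) * (?b + J t x' \<omega>) = ?a * ?b + ?a * J t x' \<omega> + ?b * I t x \<omega> + I t x \<omega> * J t x' \<omega>" for \<omega>
    by (simp add: algebra_simps)
  have int: "integrable M (\<lambda>\<omega>. (?a + I t x \<omega>) * (?b + J t x' \<omega>))"
    unfolding exp using wI(6) wJ(6) c(1) by simp
  have E: "(\<integral>\<omega>. (?a + I t x \<omega>) * (?b + J t x' \<omega>) \<partial>M) = ?a * ?b + (\<integral>z. ?f z \<partial>spacetime)"
    unfolding exp using wI(6,7) wJ(6,7) c by (simp add: prob_space)
  have "?L = (\<integral>\<^sup>+\<omega>. ennreal ((?a + I t x \<omega>) * (?b + J t x' \<omega>)) \<partial>M)"
    using AE by (intro nn_integral_cong_AE, eventually_elim) (simp add: ennreal_mult)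
  also have "\<dots> = ennreal (\<integral>\<omega>. (?a + I t x \<omega>) * (?b + J t x' \<omega>) \<partial>M)"
    using AE by (intro nn_integral_eq_integral int, eventually_elim) (simp)
  also have "\<dots> = ?R + ennreal (\<integral>z. ?f z \<partial>spacetime)"
    unfolding E using ab fnn by (simp add: ennreal_mult integral_nonneg)
  also have "ennreal (\<integral>z. ?f z \<partial>spacetime) = (\<integral>\<^sup>+z. ennreal (?f z) \<partial>spacetime)"
    using fnn by (intro nn_integral_eq_integral[symmetric] c(2)) simp
  also have "\<dots> = (\<integral>\<^sup>+s. \<integral>\<^sup>+y. \<integral>\<^sup>+\<omega>. ennreal (?f (\<omega>, s, y)) \<partial>M \<partial>lborel \<partial>lborel)"
    using wI(1) wJ(1) by (intro U.spacetime_swap) measurable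
  also have "\<dots> = ?S"
  proof (rule nn_integral_cong)
    fix s
    show "(\<integral>\<^sup>+y. \<integral>\<^sup>+\<omega>. ennreal (?f (\<omega>, s, y)) \<partial>M \<partial>lborel) =
      (\<integral>\<^sup>+y. ennreal (p (t - s) (x - y) * p (t - s) (x' - y)) * cross_source s y \<partial>lborel) * indicator {0<..<t} s"
      unfolding f cross_source_def
      by (auto simp: indicator_def ennreal_mult heat_nonneg \<sigma> \<tau> nn_integral_cmult[symmetric])
  qed
  finally show ?thesis .
qed

text \<open>Integration over x and x' removes both heat kernels, each of mass one, so no factor
  depending on t - s remains.\<close>

lemma mass_product:
  assumes t: "0 < t"
  shows "(\<integral>\<^sup>+\<omega>. (\<integral>\<^sup>+x. ennreal (U.uc t x \<omega>) \<partial>lborel) * (\<integral>\<^sup>+x. ennreal (V.uc t x \<omega>) \<partial>lborel) \<partial>M) =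
    (\<integral>\<^sup>+x. ennreal (u\<^sub>0 x) \<partial>lborel) * (\<integral>\<^sup>+x. ennreal (v\<^sub>0 x) \<partial>lborel) + (\<integral>\<^sup>+s\<in>{0<..<t}. (\<integral>\<^sup>+y. cross_source s y \<partial>lborel) \<partial>lborel)"
proof -
  interpret P: pair_sigma_finite M "lborel :: real measure" by (rule pair_sigma_finite_lborel)
  let ?a = "\<lambda>x. ennreal (heat_op t u\<^sub>0 x)" and ?b = "\<lambda>x. ennreal (heat_op t v\<^sub>0 x)"
  let ?k = "\<lambda>s x x' y. ennreal (p (t - s) (x - y) * p (t - s) (x' - y)) * cross_source s y"
  let ?S = "\<lambda>x x'. \<integral>\<^sup>+s\<in>{0<..<t}. (\<integral>\<^sup>+y. ?k s x x' y \<partial>lborel) \<partial>lborel"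
  have "(\<integral>\<^sup>+\<omega>. (\<integral>\<^sup>+x. ennreal (U.uc t x \<omega>) \<partial>lborel) * (\<integral>\<^sup>+x. ennreal (V.uc t x \<omega>) \<partial>lborel) \<partial>M) =
    (\<integral>\<^sup>+\<omega>. \<integral>\<^sup>+x. \<integral>\<^sup>+x'. ennreal (U.uc t x \<omega>) * ennreal (V.uc t x' \<omega>) \<partial>lborel \<partial>lborel \<partial>M)"
  proof (rule nn_integral_cong)
    fix \<omega> assume \<omega>: "\<omega> \<in> space M"
    note [measurable] = U.uc_space_measurable[OF \<omega>] V.uc_space_measurable[OF \<omega>]
    show "(\<integral>\<^sup>+x. ennreal (U.uc t x \<omega>) \<partial>lborel) * (\<integral>\<^sup>+x. ennreal (V.uc t x \<omega>) \<partial>lborel) =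
      (\<integral>\<^sup>+x. \<integral>\<^sup>+x'. ennreal (U.uc t x \<omega>) * ennreal (V.uc t x' \<omega>) \<partial>lborel \<partial>lborel)"
      by (simp add: nn_integral_cmult nn_integral_multc)
  qed
  also have "\<dots> = (\<integral>\<^sup>+x. \<integral>\<^sup>+\<omega>. \<integral>\<^sup>+x'. ennreal (U.uc t x \<omega>) * ennreal (V.uc t x' \<omega>) \<partial>lborel \<partial>M \<partial>lborel)"
    by (rule P.Fubini'[symmetric]) measurable
  also have "\<dots> = (\<integral>\<^sup>+x. \<integral>\<^sup>+x'. \<integral>\<^sup>+\<omega>. ennreal (U.uc t x \<omega>) * ennreal (V.uc t x' \<omega>) \<partial>M \<partial>lborel \<partial>lborel)"
    by (intro nn_integral_cong P.Fubini'[symmetric]) measurable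
  also have "\<dots> = (\<integral>\<^sup>+x. \<integral>\<^sup>+x'. ?a x * ?b x' \<partial>lborel \<partial>lborel) + (\<integral>\<^sup>+x. \<integral>\<^sup>+x'. ?S x x' \<partial>lborel \<partial>lborel)"
    unfolding product_moment[OF t] by (subst nn_integral_add[symmetric]) (measurable, simp add: nn_integral_add)
  also have "(\<integral>\<^sup>+x. \<integral>\<^sup>+x'. ?a x * ?b x' \<partial>lborel \<partial>lborel) = (\<integral>\<^sup>+x. ennreal (u\<^sub>0 x) \<partial>lborel) * (\<integral>\<^sup>+x. ennreal (v\<^sub>0 x) \<partial>lborel)"
    using heat_op_nn(3)[OF t U.u\<^sub>0(1,3)] heat_op_nn(3)[OF t V.u\<^sub>0(1,3)] by (simp add: nn_integral_cmult nn_integral_multc)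
  also have "(\<integral>\<^sup>+x. \<integral>\<^sup>+x'. ?S x x' \<partial>lborel \<partial>lborel) = (\<integral>\<^sup>+x. \<integral>\<^sup>+s. \<integral>\<^sup>+x'. (\<integral>\<^sup>+y. ?k s x x' y \<partial>lborel) * indicator {0<..<t} s \<partial>lborel \<partial>lborel \<partial>lborel)"
    by (intro nn_integral_cong lborel_pair.Fubini') measurable
  also have "\<dots> = (\<integral>\<^sup>+s. \<integral>\<^sup>+x. \<integral>\<^sup>+x'. (\<integral>\<^sup>+y. ?k s x x' y \<partial>lborel) * indicator {0<..<t} s \<partial>lborel \<partial>lborel \<partial>lborel)"
    by (rule lborel_pair.Fubini') measurable
  also have "\<dots> = (\<integral>\<^sup>+s\<in>{0<..<t}. (\<integral>\<^sup>+y. cross_source s y \<partial>lborel) \<partial>lborel)"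
  proof (rule nn_integral_cong)
    fix s
    show "(\<integral>\<^sup>+x. \<integral>\<^sup>+x'. (\<integral>\<^sup>+y. ?k s x x' y \<partial>lborel) * indicator {0<..<t} s \<partial>lborel \<partial>lborel) = (\<integral>\<^sup>+y. cross_source s y \<partial>lborel) * indicator {0<..<t} s"
    proof (cases "s \<in> {0<..<t}")
      case True
      have r: "0 < t - s" using True by simp
      have "(\<integral>\<^sup>+x. \<integral>\<^sup>+x'. \<integral>\<^sup>+y. ?k s x x' y \<partial>lborel \<partial>lborel \<partial>lborel) = (\<integral>\<^sup>+x. \<integral>\<^sup>+y. \<integral>\<^sup>+x'. ?k s x x' y \<partial>lborel \<partial>lborel \<partial>lborel)"
        by (intro nn_integral_cong lborel_pair.Fubini') measurable
      also have "\<dots> = (\<integral>\<^sup>+x. \<integral>\<^sup>+y. ennreal (p (t - s) (x - y)) * cross_source s y \<partial>lborel \<partial>lborel)"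
        using r by (simp add: ennreal_mult heat_nonneg nn_integral_multc nn_integral_cmult heat_mass)
      also have "\<dots> = (\<integral>\<^sup>+y. \<integral>\<^sup>+x. ennreal (p (t - s) (x - y)) * cross_source s y \<partial>lborel \<partial>lborel)"
        by (rule lborel_pair.Fubini') measurable
      also have "\<dots> = (\<integral>\<^sup>+y. cross_source s y \<partial>lborel)"
        using r by (simp add: nn_integral_multc heat_mass)
      finally show ?thesis using True by simp
    qed simp
  qed
  finally show ?thesis .
qed

text \<open>On the diagonal the product of the two kernels is a square, which
  \<open>square_conv_space\<close> integrates to p_{2(t-s)}(0).\<close>

lemma cross_moment_renewal:
  assumes t: "0 < t"
  shows "cross_moment t = (\<integral>\<^sup>+x. ennreal (heat_op t u\<^sub>0 x) * ennreal (heat_op t v\<^sub>0 x) \<partial>lborel) +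
    (\<integral>\<^sup>+s\<in>{0<..<t}. ennreal (p (2 * (t - s)) 0) * (\<integral>\<^sup>+y. cross_source s y \<partial>lborel) \<partial>lborel)"
proof -
  have "cross_moment t = (\<integral>\<^sup>+x. ennreal (heat_op t u\<^sub>0 x) * ennreal (heat_op t v\<^sub>0 x) + square_conv cross_source t x \<partial>lborel)"
    unfolding cross_moment_def product_moment[OF t] square_conv_def by (simp add: power2_eq_square)
  also have "\<dots> = (\<integral>\<^sup>+x. ennreal (heat_op t u\<^sub>0 x) * ennreal (heat_op t v\<^sub>0 x) \<partial>lborel) + (\<integral>\<^sup>+x. square_conv cross_source t x \<partial>lborel)"
    unfolding square_conv_def by (rule nn_integral_add) measurable
  finally show ?thesis by (simp add: square_conv_space)
qed

lemma cross_source_le: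
  assumes s: "0 < s"
  shows "(\<integral>\<^sup>+y. cross_source s y \<partial>lborel) \<le> ennreal (L * K) * cross_moment s"
proof -
  have "cross_source s y \<le> (\<integral>\<^sup>+\<omega>. ennreal (L * K) * (ennreal (U.uc s y \<omega>) * ennreal (V.uc s y \<omega>)) \<partial>M)" for y
    unfolding cross_source_def
    using U.uc_nonneg[OF s] V.uc_nonneg[OF s]
  proof (intro nn_integral_mono_AE, eventually_elim)
    case (elim \<omega>)
    have "\<sigma> (U.uc s y \<omega>) * \<tau> (V.uc s y \<omega>) \<le> (L * U.uc s y \<omega>) * (K * V.uc s y \<omega>)"
      using U.sigma_bound[of "U.uc s y \<omega>"] V.sigma_bound[of "V.uc s y \<omega>"] elim U.L
      by (intro mult_mono \<tau>) (auto simp: \<sigma> \<tau>)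
    then have "ennreal (\<sigma> (U.uc s y \<omega>) * \<tau> (V.uc s y \<omega>)) \<le> ennreal ((L * K) * (U.uc s y \<omega> * V.uc s y \<omega>))"
      by (intro ennreal_leI) (simp add: mult_ac)
    then show ?case using elim U.L V.L by (simp add: ennreal_mult)
  qed
  then have "(\<integral>\<^sup>+y. cross_source s y \<partial>lborel) \<le> (\<integral>\<^sup>+y. \<integral>\<^sup>+\<omega>. ennreal (L * K) * (ennreal (U.uc s y \<omega>) * ennreal (V.uc s y \<omega>)) \<partial>M \<partial>lborel)"
    by (rule nn_integral_mono)
  also have "\<dots> = ennreal (L * K) * cross_moment s"
    unfolding cross_moment_def by (simp add: nn_integral_cmult)
  finally show ?thesis .
qed

text \<open>The two energies dominate the cross moment. This finiteness lets the weighted moment be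
  moved to the other side in \<open>weighted_cross_moment\<close>.\<close>

lemma cross_moment_finite: "(\<integral>\<^sup>+t\<in>{0<..<T}. cross_moment t \<partial>lborel) < \<infinity>"
proof -
  let ?U = "\<lambda>t. \<integral>\<^sup>+x. \<integral>\<^sup>+\<omega>. ennreal ((U.uc t x \<omega>)\<^sup>2) \<partial>M \<partial>lborel" and ?V = "\<lambda>t. \<integral>\<^sup>+x. \<integral>\<^sup>+\<omega>. ennreal ((V.uc t x \<omega>)\<^sup>2) \<partial>M \<partial>lborel"
  have le: "ennreal a * ennreal b \<le> ennreal (a\<^sup>2) + ennreal (b\<^sup>2)" for a b :: real
  proof (cases "0 \<le> a \<and> 0 \<le> b")
    case True
    have "a * b \<le> a\<^sup>2 + b\<^sup>2" using zero_le_power2[of "a - b"] mult_nonneg_nonneg[of a b] True unfolding power2_diff by linarith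
    then show ?thesis using True by (simp add: ennreal_mult[symmetric] ennreal_plus[symmetric] ennreal_leI del: ennreal_plus)
  qed (auto simp: ennreal_neg)
  have "cross_moment t \<le> ?U t + ?V t" for t
  proof -
    have "cross_moment t \<le> (\<integral>\<^sup>+x. \<integral>\<^sup>+\<omega>. ennreal ((U.uc t x \<omega>)\<^sup>2) + ennreal ((V.uc t x \<omega>)\<^sup>2) \<partial>M \<partial>lborel)"
      unfolding cross_moment_def by (intro nn_integral_mono le)
    then show ?thesis by (simp add: nn_integral_add)
  qed
  then have "(\<integral>\<^sup>+t\<in>{0<..<T}. cross_moment t \<partial>lborel) \<le> (\<integral>\<^sup>+t. ?U t * indicator {0<..<T} t + ?V t * indicator {0<..<T} t \<partial>lborel)"
    by (intro nn_integral_mono) (simp add: distrib_right[symmetric] mult_right_mono)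
  also have "\<dots> = (\<integral>\<^sup>+t\<in>{0<..<T}. ?U t \<partial>lborel) + (\<integral>\<^sup>+t\<in>{0<..<T}. ?V t \<partial>lborel)"
    by (rule nn_integral_add) measurable
  also have "\<dots> < \<infinity>" using U.energy_finite[of T] V.energy_finite[of T] by simp
  finally show ?thesis .
qed

text \<open>Write W for the left side and E for the mutual energy. The inhomogeneous term, extended
  to all times, contributes E, and the kernel contributes its Laplace transform 1 / q, so W \<le> E
  + (L K / q) W. As W is finite, W \<le> q / (q - L K) E.\<close>

lemma weighted_cross_moment:
  assumes \<beta>: "0 < \<beta>" "L * K < 2 * sqrt (\<beta> * \<theta>)"
  shows "(\<integral>\<^sup>+t\<in>{0<..<T}. ennreal (exp (- \<beta> * t)) * cross_moment t \<partial>lborel) \<le>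
    ennreal (2 * sqrt (\<beta> * \<theta>) / (2 * sqrt (\<beta> * \<theta>) - L * K) * mutual_energy \<theta> \<beta> u\<^sub>0 v\<^sub>0)"
    (is "?W \<le> _")
proof -
  define q where "q = 2 * sqrt (\<beta> * \<theta>)"
  have q: "0 < q" "L * K < q" using \<beta> \<theta> by (simp_all add: q_def)
  have LK: "0 \<le> L * K" using U.L V.L by simp
  let ?e = "mutual_energy \<theta> \<beta> u\<^sub>0 v\<^sub>0" and ?A = "\<lambda>t. \<integral>\<^sup>+x. ennreal (heat_op t u\<^sub>0 x) * ennreal (heat_op t v\<^sub>0 x) \<partial>lborel"
  let ?B = "\<lambda>t. \<integral>\<^sup>+s\<in>{0<..<t}. ennreal (p (2 * (t - s)) 0) * (ennreal (L * K) * cross_moment s) \<partial>lborel"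
  note e = mutual_energy_nn[OF \<beta>(1) U.u\<^sub>0(1,3) V.u\<^sub>0(1,3)]
  have Wfin: "?W < \<infinity>"
  proof (rule le_less_trans[OF nn_integral_mono cross_moment_finite[of T]])
    fix t
    have "ennreal (exp (- \<beta> * t)) * cross_moment t \<le> 1 * cross_moment t" if "0 < t"
      using that \<beta> by (intro mult_right_mono) (auto simp: ennreal_le_1)
    then show "ennreal (exp (- \<beta> * t)) * cross_moment t * indicator {0<..<T} t \<le> cross_moment t * indicator {0<..<T} t"
      by (auto simp: indicator_def)
  qed
  have "?W \<le> (\<integral>\<^sup>+t. ennreal (exp (- \<beta> * t)) * ?A t * indicator {0<..} t + ennreal (exp (- \<beta> * t)) * ?B t * indicator {0<..<T} t \<partial>lborel)"
  proof (rule nn_integral_mono)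
    fix t
    have "cross_moment t \<le> ?A t + ?B t" if "0 < t"
      unfolding cross_moment_renewal[OF that]
    proof (intro add_left_mono nn_integral_mono)
      fix s
      show "ennreal (p (2 * (t - s)) 0) * (\<integral>\<^sup>+y. cross_source s y \<partial>lborel) * indicator {0<..<t} s \<le>
        ennreal (p (2 * (t - s)) 0) * (ennreal (L * K) * cross_moment s) * indicator {0<..<t} s"
        using cross_source_le[of s] by (auto simp: indicator_def intro!: mult_left_mono)
    qed
    then show "ennreal (exp (- \<beta> * t)) * cross_moment t * indicator {0<..<T} t \<le>
      ennreal (exp (- \<beta> * t)) * ?A t * indicator {0<..} t + ennreal (exp (- \<beta> * t)) * ?B t * indicator {0<..<T} t"
      by (auto simp: indicator_def distrib_left[symmetric] intro!: mult_left_mono)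
  qed
  also have "\<dots> = (\<integral>\<^sup>+t\<in>{0<..}. ennreal (exp (- \<beta> * t)) * ?A t \<partial>lborel) + (\<integral>\<^sup>+t\<in>{0<..<T}. ennreal (exp (- \<beta> * t)) * ?B t \<partial>lborel)"
    by (rule nn_integral_add) measurable
  also have "(\<integral>\<^sup>+t\<in>{0<..}. ennreal (exp (- \<beta> * t)) * ?A t \<partial>lborel) = ennreal ?e"
    unfolding heat_op_energy[OF \<beta>(1) U.u\<^sub>0(1,3) V.u\<^sub>0(1,3)] e(1) ..
  finally have W: "?W \<le> ennreal ?e + (\<integral>\<^sup>+t\<in>{0<..<T}. ennreal (exp (- \<beta> * t)) * ?B t \<partial>lborel)" .
  have "(\<integral>\<^sup>+t\<in>{0<..<T}. ennreal (exp (- \<beta> * t)) * ?B t \<partial>lborel) \<le>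
    (\<integral>\<^sup>+r\<in>{0<..}. ennreal (exp (- \<beta> * r)) * ennreal (p (2 * r) 0) \<partial>lborel) * (\<integral>\<^sup>+s\<in>{0<..<T}. ennreal (exp (- \<beta> * s)) * (ennreal (L * K) * cross_moment s) \<partial>lborel)"
    by (rule time_convolution_bound) measurable
  also have "(\<integral>\<^sup>+r\<in>{0<..}. ennreal (exp (- \<beta> * r)) * ennreal (p (2 * r) 0) \<partial>lborel) = ennreal (1 / q)"
    unfolding q_def heat_laplace0[OF \<beta>(1), symmetric] by (intro nn_integral_cong) (auto simp: indicator_def ennreal_mult' )
  also have "(\<integral>\<^sup>+s\<in>{0<..<T}. ennreal (exp (- \<beta> * s)) * (ennreal (L * K) * cross_moment s) \<partial>lborel) = ennreal (L * K) * ?W"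
    by (subst nn_integral_cmult[symmetric]) (auto intro!: nn_integral_cong simp: mult_ac)
  finally have W2: "?W \<le> ennreal ?e + ennreal (1 / q) * (ennreal (L * K) * ?W)"
    using W by (meson add_left_mono order_trans)
  define w where "w = enn2real ?W"
  have w: "?W = ennreal w" "0 \<le> w" using Wfin by (simp_all add: w_def)
  have "ennreal (1 / q) * (ennreal (L * K) * ennreal w) = ennreal (1 / q * (L * K * w))"
    using w(2) q LK by (simp only: ennreal_mult[symmetric] mult_nonneg_nonneg less_imp_le divide_nonneg_pos zero_le_one)
  moreover have "0 \<le> 1 / q * (L * K * w)" using w(2) q(1) LK by simp
  ultimately have "ennreal w \<le> ennreal (?e + 1 / q * (L * K * w))"
    using W2 e(2) unfolding w(1) by (simp only: ennreal_plus)
  then have "w \<le> ?e + 1 / q * (L * K * w)"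
    using e(2) w(2) q LK by (subst (asm) ennreal_le_iff) auto
  then have "w \<le> q / (q - L * K) * ?e" using q by (simp add: field_simps)
  then show ?thesis unfolding w(1) q_def by (rule ennreal_leI)
qed

text \<open>The product of the initial masses in \<open>mass_product\<close> is the product of the
  means and cancels in the covariance; only the integrated source remains. Its bound by the cross
  moment gives the factor \<open>L * K\<close> in the numerator, the renewal inequality the one in
  the denominator.\<close>

lemma covariance_bound:
  assumes t: "0 < t" and \<beta>: "0 < \<beta>" "L * K < 2 * sqrt (\<beta> * \<theta>)"
  shows "integrable M (\<lambda>\<omega>. L1_norm (\<lambda>x. u t x \<omega>) * L1_norm (\<lambda>x. v t x \<omega>))"
    "covariance M (\<lambda>\<omega>. L1_norm (\<lambda>x. u t x \<omega>)) (\<lambda>\<omega>. L1_norm (\<lambda>x. v t x \<omega>))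
      \<le> 2 * sqrt (\<beta> * \<theta>) * L * K / (2 * sqrt (\<beta> * \<theta>) - L * K) * exp (\<beta> * t) * mutual_energy \<theta> \<beta> u\<^sub>0 v\<^sub>0"
proof -
  define X Y where "X = (\<lambda>\<omega>. L1_norm (\<lambda>x. u t x \<omega>))" and "Y = (\<lambda>\<omega>. L1_norm (\<lambda>x. v t x \<omega>))"
  let ?a = "\<integral>x. u\<^sub>0 x \<partial>lborel" and ?b = "\<integral>x. v\<^sub>0 x \<partial>lborel" and ?e = "mutual_energy \<theta> \<beta> u\<^sub>0 v\<^sub>0"
  note mU = U.solution_mass[OF t, folded X_def] and mV = V.solution_mass[OF t, folded Y_def]
  have XY: "0 \<le> X \<omega>" "0 \<le> Y \<omega>" for \<omega> by (simp_all add: X_def Y_def L1_norm_def)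
  have LK: "0 \<le> L * K" using U.L V.L by simp
  let ?B = "2 * sqrt (\<beta> * \<theta>) / (2 * sqrt (\<beta> * \<theta>) - L * K) * ?e" and ?D = "\<integral>\<^sup>+s\<in>{0<..<t}. (\<integral>\<^sup>+y. cross_source s y \<partial>lborel) \<partial>lborel"
  have B: "0 \<le> ?B" using \<beta> \<theta> mutual_energy_nn(2)[OF \<beta>(1) U.u\<^sub>0(1,3) V.u\<^sub>0(1,3)] by simp
  have "?D \<le> (\<integral>\<^sup>+s. ennreal (L * K * exp (\<beta> * t)) * (ennreal (exp (- \<beta> * s)) * cross_moment s * indicator {0<..<t} s) \<partial>lborel)"
  proof (rule nn_integral_mono)
    fix s
    have "(\<integral>\<^sup>+y. cross_source s y \<partial>lborel) \<le> ennreal (L * K * exp (\<beta> * t)) * (ennreal (exp (- \<beta> * s)) * cross_moment s)" if s: "0 < s" "s < t"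
    proof -
      have "(\<integral>\<^sup>+y. cross_source s y \<partial>lborel) \<le> ennreal (L * K) * cross_moment s" by (rule cross_source_le[OF s(1)])
      \<comment> \<open>For s < t the missing weight is supplied by 1 \<le> exp (\<beta> (t - s));
        this is the origin of the factor exp (\<beta> t).\<close>
      also have "\<dots> \<le> ennreal (L * K * exp (\<beta> * t) * exp (- \<beta> * s)) * cross_moment s"
      proof (intro mult_right_mono ennreal_leI)
        have "L * K * 1 \<le> L * K * exp (\<beta> * t + - \<beta> * s)" using LK s \<beta> by (intro mult_left_mono) auto
        then show "L * K \<le> L * K * exp (\<beta> * t) * exp (- \<beta> * s)" by (simp only: exp_add mult.assoc mult_1_right)
      qed simp
      also have "\<dots> = ennreal (L * K * exp (\<beta> * t)) * (ennreal (exp (- \<beta> * s)) * cross_moment s)"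
        using LK by (subst ennreal_mult) (simp_all add: mult.assoc[of _ _ "cross_moment s"] del: mult.assoc)
      finally show ?thesis .
    qed
    then show "(\<integral>\<^sup>+y. cross_source s y \<partial>lborel) * indicator {0<..<t} s \<le>
      ennreal (L * K * exp (\<beta> * t)) * (ennreal (exp (- \<beta> * s)) * cross_moment s * indicator {0<..<t} s)"
      by (auto simp: indicator_def)
  qed
  also have "\<dots> = ennreal (L * K * exp (\<beta> * t)) * (\<integral>\<^sup>+s\<in>{0<..<t}. ennreal (exp (- \<beta> * s)) * cross_moment s \<partial>lborel)"
    by (rule nn_integral_cmult) measurable
  also have "\<dots> \<le> ennreal (L * K * exp (\<beta> * t)) * ennreal ?B"
    by (intro mult_left_mono weighted_cross_moment \<beta>) simp
  also have "\<dots> = ennreal (L * K * exp (\<beta> * t) * ?B)" using LK B by (simp only: ennreal_mult exp_ge_zero mult_nonneg_nonneg)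
  finally have D: "?D \<le> ennreal (L * K * exp (\<beta> * t) * ?B)" .
  have "(\<integral>\<^sup>+\<omega>. ennreal (X \<omega> * Y \<omega>) \<partial>M) = (\<integral>\<^sup>+\<omega>. (\<integral>\<^sup>+x. ennreal (U.uc t x \<omega>) \<partial>lborel) * (\<integral>\<^sup>+x. ennreal (V.uc t x \<omega>) \<partial>lborel) \<partial>M)"
    using mU(1) mV(1) by (intro nn_integral_cong_AE, eventually_elim) (simp add: X_def Y_def ennreal_mult XY[unfolded X_def Y_def])
  also have "\<dots> = ennreal (?a * ?b) + ?D"
    unfolding mass_product[OF t] U.initial_mass(1) V.initial_mass(1) using U.initial_mass(2) V.initial_mass(2) by (simp add: ennreal_mult)
  also have "\<dots> \<le> ennreal (?a * ?b) + ennreal (L * K * exp (\<beta> * t) * ?B)" by (intro add_left_mono D)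
  also have "\<dots> = ennreal (?a * ?b + L * K * exp (\<beta> * t) * ?B)"
    using U.initial_mass(2) V.initial_mass(2) by (intro ennreal_plus[symmetric] mult_nonneg_nonneg LK B) auto
  finally have P: "(\<integral>\<^sup>+\<omega>. ennreal (X \<omega> * Y \<omega>) \<partial>M) \<le> ennreal (?a * ?b + L * K * exp (\<beta> * t) * ?B)" .
  have [measurable]: "X \<in> borel_measurable M" "Y \<in> borel_measurable M" using mU(2) mV(2) by auto
  have i: "integrable M (\<lambda>\<omega>. X \<omega> * Y \<omega>)"
    using le_less_trans[OF P ennreal_less_top] XY by (intro integrableI_bounded) (auto simp: abs_mult)
  then show "integrable M (\<lambda>\<omega>. L1_norm (\<lambda>x. u t x \<omega>) * L1_norm (\<lambda>x. v t x \<omega>))" by (simp add: X_def Y_def)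
  have "(\<integral>\<omega>. X \<omega> * Y \<omega> \<partial>M) \<le> ?a * ?b + L * K * exp (\<beta> * t) * ?B"
  proof -
    have "0 \<le> ?a * ?b + L * K * exp (\<beta> * t) * ?B"
      using U.initial_mass(2) V.initial_mass(2) by (intro add_nonneg_nonneg mult_nonneg_nonneg LK B) auto
    then show ?thesis using P XY by (subst (asm) nn_integral_eq_integral[OF i]) (simp_all del: ennreal_plus)
  qed
  moreover have "covariance M X Y = (\<integral>\<omega>. X \<omega> * Y \<omega> \<partial>M) - ?a * ?b"
  proof -
    have "(X \<omega> - ?a) * (Y \<omega> - ?b) = X \<omega> * Y \<omega> - ?b * X \<omega> - ?a * Y \<omega> + ?a * ?b" for \<omega> by (simp add: algebra_simps)
    then show ?thesis unfolding covariance_def mU(3) mV(3) using i mU(2,3) mV(2,3) by (simp add: prob_space)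
  qed
  ultimately have "covariance M X Y \<le> L * K * exp (\<beta> * t) * ?B" by simp
  then show "covariance M (\<lambda>\<omega>. L1_norm (\<lambda>x. u t x \<omega>)) (\<lambda>\<omega>. L1_norm (\<lambda>x. v t x \<omega>))
      \<le> 2 * sqrt (\<beta> * \<theta>) * L * K / (2 * sqrt (\<beta> * \<theta>) - L * K) * exp (\<beta> * t) * ?e"
    by (simp add: X_def Y_def mult_ac)
qed

end

section \<open>Lipschitz constants and the covariance inequality\<close>

lemma Lip_properties:
  assumes "\<exists>C. C-lipschitz_on UNIV \<phi>"
  shows "\<bar>\<phi> a - \<phi> b\<bar> \<le> Lip \<phi> * \<bar>a - b\<bar>" "0 \<le> Lip \<phi>"
proof -
  obtain C where C: "C-lipschitz_on UNIV \<phi>" using assms by blast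
  have "\<bar>(\<phi> a - \<phi> b) / (a - b)\<bar> \<le> C" if "a < b" for a b
    using lipschitz_onD[OF C, of a b] that by (simp add: dist_real_def abs_divide pos_divide_le_eq)
  \<comment> \<open>Boundedness makes the supremum in \<open>Lip\<close> an actual upper bound of
    the difference quotients rather than an unspecified real.\<close>
  then have bdd: "bdd_above ((\<lambda>(a, b). \<bar>(\<phi> a - \<phi> b) / (a - b)\<bar>) ` {(a, b). a < b})" by (intro bdd_aboveI[of _ C]) auto
  have q: "\<bar>(\<phi> a - \<phi> b) / (a - b)\<bar> \<le> Lip \<phi>" if "a < b" for a b
    using cSUP_upper[OF _ bdd, of "(a, b)"] that by (simp add: Lip_def)
  then have *: "\<bar>\<phi> a - \<phi> b\<bar> \<le> Lip \<phi> * \<bar>a - b\<bar>" if "a < b" for a b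
    using q[OF that] that by (simp add: abs_divide pos_divide_le_eq)
  show "\<bar>\<phi> a - \<phi> b\<bar> \<le> Lip \<phi> * \<bar>a - b\<bar>"
    using *[of a b] *[of b a] by (cases a b rule: linorder_cases) (simp_all add: abs_minus_commute)
  show "0 \<le> Lip \<phi>" using order_trans[OF abs_ge_zero q[of 0 1]] by simp
qed

text \<open>The integrability clauses give the covariance its meaning, because a Bochner integral of
  a function that is not integrable is 0 by convention.\<close>

theorem theorem2p3:
  fixes M :: "'a measure"
    and \<xi> :: "(real \<times> real \<Rightarrow> real) \<Rightarrow> 'a \<Rightarrow> real"
    and \<theta> \<beta> t :: real
    and \<sigma>\<^sub>1 \<sigma>\<^sub>2 u\<^sub>0 v\<^sub>0 :: "real \<Rightarrow> real"
    and u v :: "real \<Rightarrow> real \<Rightarrow> 'a \<Rightarrow> real"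
  assumes "0 < \<theta>"
    and "\<exists>C. C-lipschitz_on UNIV \<sigma>\<^sub>1" and "\<exists>C. C-lipschitz_on UNIV \<sigma>\<^sub>2"
    and "\<And>a. 0 \<le> \<sigma>\<^sub>1 a" and "\<And>a. 0 \<le> \<sigma>\<^sub>2 a"
    and "\<sigma>\<^sub>1 0 = 0" and "\<sigma>\<^sub>2 0 = 0"
    and "integrable lborel u\<^sub>0" and "\<exists>C. AE x in lborel. \<bar>u\<^sub>0 x\<bar> \<le> C" and "AE x in lborel. 0 \<le> u\<^sub>0 x"
    and "integrable lborel v\<^sub>0" and "\<exists>C. AE x in lborel. \<bar>v\<^sub>0 x\<bar> \<le> C" and "AE x in lborel. 0 \<le> v\<^sub>0 x"
    and "prob_space M" and "white_noise M \<xi>"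
    and "mild_solution M \<xi> \<theta> \<sigma>\<^sub>1 u\<^sub>0 u" and "mild_solution M \<xi> \<theta> \<sigma>\<^sub>2 v\<^sub>0 v"
    and "0 \<le> t" and "(Lip \<sigma>\<^sub>1 * Lip \<sigma>\<^sub>2)\<^sup>2 / (4 * \<theta>) < \<beta>"
  shows "(AE \<omega> in M. integrable lborel (\<lambda>x. u t x \<omega>)) \<and>
    (AE \<omega> in M. integrable lborel (\<lambda>x. v t x \<omega>)) \<and>
    integrable M (\<lambda>\<omega>. L1_norm (\<lambda>x. u t x \<omega>)) \<and>
    integrable M (\<lambda>\<omega>. L1_norm (\<lambda>x. v t x \<omega>)) \<and>
    integrable M (\<lambda>\<omega>. L1_norm (\<lambda>x. u t x \<omega>) * L1_norm (\<lambda>x. v t x \<omega>)) \<and>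
    covariance M (\<lambda>\<omega>. L1_norm (\<lambda>x. u t x \<omega>)) (\<lambda>\<omega>. L1_norm (\<lambda>x. v t x \<omega>))
      \<le> 2 * sqrt (\<beta> * \<theta>) * Lip \<sigma>\<^sub>1 * Lip \<sigma>\<^sub>2 / (2 * sqrt (\<beta> * \<theta>) - Lip \<sigma>\<^sub>1 * Lip \<sigma>\<^sub>2)
        * exp (\<beta> * t) * mutual_energy \<theta> \<beta> u\<^sub>0 v\<^sub>0"
proof -
  have prob: "prob_space M" and white: "white_noise M \<xi>" by fact+
  note L1 = Lip_properties[OF assms(2)] and L2 = Lip_properties[OF assms(3)]
  have noise: "noise M \<xi>" by (intro noise.intro noise_axioms.intro prob white)
  have heat: "heat \<theta>" by (rule heat.intro) fact
  interpret solution_pair M \<xi> \<theta> \<sigma>\<^sub>1 u\<^sub>0 u "Lip \<sigma>\<^sub>1" \<sigma>\<^sub>2 v\<^sub>0 v "Lip \<sigma>\<^sub>2"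
    by (intro solution_pair.intro solution_pair_axioms.intro solution.intro solution_axioms.intro noise heat)
       (use assms L1 L2 in auto)
  let ?l = "Lip \<sigma>\<^sub>1 * Lip \<sigma>\<^sub>2"
  have l: "0 \<le> ?l" using L1(2) L2(2) by simp
  have "0 \<le> ?l\<^sup>2 / (4 * \<theta>)" using \<theta> by simp
  then have \<beta>: "0 < \<beta>" using assms(19) by linarith
  \<comment> \<open>The threshold on \<beta> says precisely that \<open>?l\<close> times the Laplace
    transform 1 / (2 sqrt (\<beta> \<theta>)) is less than 1.\<close>
  have "?l\<^sup>2 < 4 * (\<beta> * \<theta>)" using assms(19) \<theta> by (simp add: field_simps)
  then have "sqrt (?l\<^sup>2) < sqrt (4 * (\<beta> * \<theta>))" by (rule real_sqrt_less_mono)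
  then have lb: "?l < 2 * sqrt (\<beta> * \<theta>)" using l by (simp add: real_sqrt_mult)
  note e = mutual_energy_nn(2)[OF \<beta> U.u\<^sub>0(1,3) V.u\<^sub>0(1,3)]
  show ?thesis
  proof (cases "t = 0")
    \<comment> \<open>At time 0 the masses are deterministic, so the covariance is 0, and it remains
      to see that the right-hand side is nonnegative.\<close>
    case True
    have "(\<integral>\<omega>. L1_norm (\<lambda>x. u 0 x \<omega>) \<partial>M) = (\<integral>\<omega>. L1_norm u\<^sub>0 \<partial>M)"
      "(\<integral>\<omega>. L1_norm (\<lambda>x. v 0 x \<omega>) \<partial>M) = (\<integral>\<omega>. L1_norm v\<^sub>0 \<partial>M)"
      by (intro Bochner_Integration.integral_cong refl U.initial_L1_norm V.initial_L1_norm; assumption)+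
    then have "covariance M (\<lambda>\<omega>. L1_norm (\<lambda>x. u 0 x \<omega>)) (\<lambda>\<omega>. L1_norm (\<lambda>x. v 0 x \<omega>)) = (\<integral>\<omega>. 0 \<partial>M)"
      unfolding covariance_def by (intro Bochner_Integration.integral_cong) (simp_all add: U.initial_L1_norm prob_space)
    moreover have "0 \<le> 2 * sqrt (\<beta> * \<theta>) * Lip \<sigma>\<^sub>1 * Lip \<sigma>\<^sub>2 / (2 * sqrt (\<beta> * \<theta>) - ?l) * exp (\<beta> * t) * mutual_energy \<theta> \<beta> u\<^sub>0 v\<^sub>0"
      using L1(2) L2(2) lb e \<beta> \<theta> by simp
    moreover have "integrable M (\<lambda>\<omega>. L1_norm (\<lambda>x. u 0 x \<omega>))" "integrable M (\<lambda>\<omega>. L1_norm (\<lambda>x. v 0 x \<omega>))"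
      "integrable M (\<lambda>\<omega>. L1_norm (\<lambda>x. u 0 x \<omega>) * L1_norm (\<lambda>x. v 0 x \<omega>))"
      by (simp_all add: U.initial_L1_norm V.initial_L1_norm cong: Bochner_Integration.integrable_cong)
    ultimately show ?thesis using True U.initial_L1_norm(1) V.initial_L1_norm(1) by simp
  next
    case False
    then have t: "0 < t" using assms(18) by simp
    have "AE \<omega> in M. integrable lborel (\<lambda>x. u t x \<omega>)" "AE \<omega> in M. integrable lborel (\<lambda>x. v t x \<omega>)"
      using U.solution_mass(1)[OF t] V.solution_mass(1)[OF t] by (auto elim: eventually_mono)
    then show ?thesis using U.solution_mass(2)[OF t] V.solution_mass(2)[OF t] covariance_bound[OF t \<beta> lb] by blast
  qed
qed

end
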